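(* Suppose that $(X,f)$ and $(Y,g)$ satisfy all six Axioms 0--5, and that $(\overline X,\overline f)$ is topologically conjugate to $(\overline Y,\overline g)$ by a conjugacy map $\phi$. If $\overline{\mathcal O}$ is a finite union of periodic orbits of $\overline f$ and $\overline{\mathcal O'}=\phi(\overline{\mathcal O})$, then there is a unique conjugacy $\tilde\phi\colon(\Sigma_{\mathcal O},\sigma_{\mathcal O})\to(\Sigma_{\mathcal O'},\sigma_{\mathcal O'})$ such that $$\phi\circ\overline\rho_{\mathcal O}\circ p_{\mathcal O}=\overline\rho_{\mathcal O'}\circ p_{\mathcal O'}\circ\tilde\phi ,$$ where $\mathcal O=\pi(\overline{\mathcal O})\subset X$ and $\mathcal O'=\pi(\overline{\mathcal O'})\subset Y$ are the projections to the zeroth coordinate, $(\Sigma_{\mathcal O},\sigma_{\mathcal O})$ and $(\Sigma_{\mathcal O'},\sigma_{\mathcal O'})$ are the two-sided shifts of finite type associated with the new presentations $(X_{\mathcal O},f_{\mathcal O})$ and $(Y_{\mathcal O'},g_{\mathcal O'})$, $p_{\mathcal O}\colon\Sigma_{\mathcal O}\to\overline X_{\mathcal O}$ and $p_{\mathcal O'}\colon\Sigma_{\mathcal O'}\to\overline Y_{\mathcal O'}$ are the associated semiconjugacies, and $\overline\rho_{\mathcal O}\colon\overline X_{\mathcal O}\to\overline X$, $\overline\rho_{\mathcal O'}\colon\overline Y_{\mathcal O'}\to\overline Y$ are the conjugacies induced by the natural projections.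
   Context: **Graphs and axioms.** $X$ is a (finite) directed graph, regarded as a topological space, with vertex set $\mathcal V$ and edge set $\mathcal E$, and $f\colon X\to X$ is continuous (similarly $(Y,g)$). Axiom 0 (Indecomposability): $X$ cannot be split into two nonempty, closed, $f$-invariant subsets. Axiom 1 (Nonwandering): all points of $X$ are nonwandering under $f$. Axiom 2 (Flattening): there is $k\ge1$ such that every $x\in X$ has an open neighborhood $U$ with $f^k(U)$ homeomorphic to $(-\epsilon,\epsilon)$. Axiom 3 (Expansion): there are a metric $d$ compatible with the topology and constants $C>0$, $\lambda>1$ such that for all $n>0$ and all points $x,y$ on a common edge of $X$, if $f^n$ maps the interval $[x,y]$ into an edge, then $d(f^nx,f^ny)\ge C\lambda^n d(x,y)$. Axiom 4 (Nonfolding): $f^n|_{X-\mathcal V}$ is locally one-to-one for every positive integer $n$. Axiom 5 (Markov): $f(\mathcal V)\subseteq\mathcal V$. **Inverse limit.** $\overline X=\{(x_0,x_1,\dots): x_i\in X,\ f(x_{i+1})=x_i\}$, $\overline f(x_0,x_1,\dots)=(f(x_0),x_0,x_1,\dots)$, and $\pi(x_0,x_1,\dots)=x_0$. **New presentation $(X_{\mathcal O},f_{\mathcal O})$** for a finite set $\mathcal O\subset X$ with $f(\mathcal O)=\mathcal O$. A path is a class of locally one-to-one continuous maps $\gamma\colon[0,1]\to X$ up to order-preserving reparametrization; $l^{-1}$ is the reversal of $l$. $\mathcal P$ is the set of paths whose endpoints lie in $\mathcal O$ and whose interior contains no point of $\mathcal O$. $\mathcal I_m$ is the set of paths whose endpoints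 lie in $f^{-m}(\mathcal O)$ and whose interior contains no point of $f^{-m}(\mathcal O)$. Let $n$ be a positive integer with $f^n(e)\supseteq X$ for every edge $e$. Fix $N\ge n$ such that the interior of each edge contains at least one point of $f^{-N}(\mathcal O)$ and, for each vertex $v$: (1) if $v\notin f^{-N}(\mathcal O)$, there is a path $l_v\in\mathcal P$, unique up to direction, such that for every $I\in\mathcal I_N$ containing $v$ as an interior point, either $f^N(I)\notin\mathcal P$ or $f^N(I)=l_v^{\pm1}$; (2) if $v\in f^{-N}(\mathcal O)$, there are paths $l_i,l_t\in\mathcal P$, unique up to direction, such that if $J_1,J_2\in\mathcal I_N$ and $v$ is the terminal point of $J_1$ and the initial point of $J_2$, then $f^N(J_1J_2)=(l_il_t)^{\pm1}$. Let $\mathcal I=\{I\in\mathcal I_N: f^N(I)\in\mathcal P\}$, let $\mathcal I_{or}$ consist of one chosen path from each pair $\{I,I^{-1}\}\subset\mathcal I$, and let $\mathcal P_{\mathcal O}=\{f^N(I): I\in\mathcal I_{or}\}$ (paths being taken up to direction). The graph $X_{\mathcal O}$ has vertex set $\mathcal O$ and one directed edge $e_l$ for each $l\in\mathcal P_{\mathcal O}$, from the initial to the terminal point of $l$; the reversed path $l^{-1}$ corresponds to $e_l^{-1}$. The natural projection $\rho_{\mathcal O}\colon X_{\mathcal O}\to X$ is the identity on $\mathcal O$ and maps $e_l$ along $l$. For $l\in\mathcal P_{\mathcal O}$, cutting $f(l)$ at its visits to $\mathcal O$ writes it as $l_1^{s_1}\cdots l_m^{s_m}$ with $l_j\in\mathcal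 P_{\mathcal O}$, $s_j=\pm1$; the graph map $f_{\mathcal O}\colon X_{\mathcal O}\to X_{\mathcal O}$ is induced by $f$: it maps $e_l$ along $e_{l_1}^{s_1}\cdots e_{l_m}^{s_m}$ and satisfies $\rho_{\mathcal O}\circ f_{\mathcal O}=f\circ\rho_{\mathcal O}$. $(\overline X_{\mathcal O},\overline f_{\mathcal O})$ is the inverse limit system of $(X_{\mathcal O},f_{\mathcal O})$, and $\overline\rho_{\mathcal O}(x_0,x_1,\dots)=(\rho_{\mathcal O}(x_0),\rho_{\mathcal O}(x_1),\dots)$. The same construction is applied to $(Y,g)$ and $\mathcal O'$. **SFT cover of a graph with map $(Z,h)$** (applied to $(X_{\mathcal O},f_{\mathcal O})$ and $(Y_{\mathcal O'},g_{\mathcal O'})$). Each edge $e_i$ of $Z$ is partitioned into consecutive subintervals $I_{i,1},\dots,I_{i,j(i)}$ such that $h$ is injective on the interior of $I_{i,j}$ and $h(I_{i,j})$ is an edge (up to direction). Let $\mathcal A=\{I_{i,j}\}$. $\Sigma_Z\subset\mathcal A^{\mathbb Z}$ is the set of sequences $(I_{a(k)})_{k\in\mathbb Z}$ with $I_{a(k+1)}\subseteq h(I_{a(k)})$ for all $k$, and $\sigma_Z$ is the shift map. The semiconjugacy $p\colon\Sigma_Z\to\overline Z$ sends $w=(I_{a(k)})$ to the unique corresponding point $x_w=(x_0,x_1,\dots)=\bigcap_{j=-\infty}^{\infty}\overline{\overline h^{-j}(\pi^{-1}(I_{a(j)}))}$, for which $x_i\in I_{a(-i)}$ and $h^i(x_0)\in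 I_{a(i)}$ for $i\ge0$.
   Formalization: The point x_w is the intersection over n of closures of finite intersections (|j| ≤ n) with interval interiors, as the displayed intersection need not be one point; condition (2) on N is required only for J_1J_2 whose image under f^N is a path, as it fails for J_2 = J_1^{-1}. *)

theory Defs
  imports "HOL-Analysis.Analysis"
begin

section \<open>Finite directed graphs as topological spaces\<close>

text \<open>
  The edge with label \<open>e\<close> is given by its characteristic map \<open>echar G e\<close> on \<open>[0,1]\<close>,
  which runs from the initial to the terminal vertex; its values off \<open>[0,1]\<close> are irrelevant.
\<close>

record ('a, 'e) digraph =
  gtop :: "'a topology"
  verts :: "'a set"
  edges :: "'e set"
  echar :: "'e \<Rightarrow> real \<Rightarrow> 'a"

abbreviation pts :: "('a, 'e, 'm) digraph_scheme \<Rightarrow> 'a set" where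
  "pts G \<equiv> topspace (gtop G)"

text \<open>
  Since there are finitely many closed cells and the space is Hausdorff, its topology is
  the quotient topology of the disjoint union of the cells, so these conditions describe
  exactly the finite one-dimensional CW complexes with oriented edges.
  Loops and multiple edges are allowed.
\<close>

definition finite_digraph :: "('a, 'e, 'm) digraph_scheme \<Rightarrow> bool" where
  "finite_digraph G \<longleftrightarrow>
     Hausdorff_space (gtop G) \<and> finite (verts G) \<and> finite (edges G) \<and>
     pts G = verts G \<union> (\<Union>e\<in>edges G. echar G e ` {0..1}) \<and>
     (\<forall>e\<in>edges G.
        continuous_map (top_of_set {0..1}) (gtop G) (echar G e) \<and>
        inj_on (echar G e) {0<..<1} \<and>
        echar G e 0 \<in> verts G \<and> echar G e 1 \<in> verts G \<and>
        echar G e ` {0<..<1} \<inter> verts G = {}) \<and>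
     (\<forall>e\<in>edges G. \<forall>e'\<in>edges G. e \<noteq> e' \<longrightarrow>
        echar G e ` {0<..<1} \<inter> echar G e' ` {0<..<1} = {})"

abbreviation edge_set :: "('a, 'e, 'm) digraph_scheme \<Rightarrow> 'e \<Rightarrow> 'a set" where
  "edge_set G e \<equiv> echar G e ` {0..1}"


section \<open>The axioms\<close>

definition locally_one_to_one :: "'a topology \<Rightarrow> ('a \<Rightarrow> 'b) \<Rightarrow> bool" where
  "locally_one_to_one T f \<longleftrightarrow> (\<forall>x\<in>topspace T. \<exists>U. openin T U \<and> x \<in> U \<and> inj_on f U)"

definition indecomposable :: "('a, 'e, 'm) digraph_scheme \<Rightarrow> ('a \<Rightarrow> 'a) \<Rightarrow> bool" where
  "indecomposable G f \<longleftrightarrow>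
     \<not> (\<exists>A B. closedin (gtop G) A \<and> closedin (gtop G) B \<and> A \<noteq> {} \<and> B \<noteq> {} \<and>
           A \<inter> B = {} \<and> A \<union> B = pts G \<and> f ` A \<subseteq> A \<and> f ` B \<subseteq> B)"

definition nonwandering :: "('a, 'e, 'm) digraph_scheme \<Rightarrow> ('a \<Rightarrow> 'a) \<Rightarrow> bool" where
  "nonwandering G f \<longleftrightarrow>
     (\<forall>x\<in>pts G. \<forall>U. openin (gtop G) U \<and> x \<in> U \<longrightarrow> (\<exists>n>0. (f ^^ n) ` U \<inter> U \<noteq> {}))"

definition flattening :: "('a, 'e, 'm) digraph_scheme \<Rightarrow> ('a \<Rightarrow> 'a) \<Rightarrow> bool" where
  "flattening G f \<longleftrightarrow>
     (\<exists>k\<ge>1. \<forall>x\<in>pts G. \<exists>U. openin (gtop G) U \<and> x \<in> U \<and>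
        (\<exists>\<epsilon>>0. subtopology (gtop G) ((f ^^ k) ` U)
           homeomorphic_space top_of_set {-\<epsilon><..<\<epsilon>::real}))"

definition expansion :: "('a, 'e, 'm) digraph_scheme \<Rightarrow> ('a \<Rightarrow> 'a) \<Rightarrow> bool" where
  "expansion G f \<longleftrightarrow>
     (\<exists>d C \<Lambda>. Metric_space (pts G) d \<and> Metric_space.mtopology (pts G) d = gtop G \<and>
        C > 0 \<and> \<Lambda> > 1 \<and>
        (\<forall>n>0. \<forall>e\<in>edges G. \<forall>s t. 0 \<le> s \<and> s \<le> t \<and> t \<le> 1 \<and>
           (\<exists>e'\<in>edges G. (f ^^ n) ` echar G e ` {s..t} \<subseteq> edge_set G e') \<longrightarrow>
           d ((f ^^ n) (echar G e s)) ((f ^^ n) (echar G e t))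
             \<ge> C * \<Lambda> ^ n * d (echar G e s) (echar G e t)))"

definition nonfolding :: "('a, 'e, 'm) digraph_scheme \<Rightarrow> ('a \<Rightarrow> 'a) \<Rightarrow> bool" where
  "nonfolding G f \<longleftrightarrow>
     (\<forall>n>0. locally_one_to_one (subtopology (gtop G) (pts G - verts G)) (f ^^ n))"

definition markov :: "('a, 'e, 'm) digraph_scheme \<Rightarrow> ('a \<Rightarrow> 'a) \<Rightarrow> bool" where
  "markov G f \<longleftrightarrow> f ` verts G \<subseteq> verts G"

definition graph_presentation :: "('a, 'e, 'm) digraph_scheme \<Rightarrow> ('a \<Rightarrow> 'a) \<Rightarrow> bool" where
  "graph_presentation G f \<longleftrightarrow>
     finite_digraph G \<and> continuous_map (gtop G) (gtop G) f \<and>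
     indecomposable G f \<and> nonwandering G f \<and> flattening G f \<and>
     expansion G f \<and> nonfolding G f \<and> markov G f"


section \<open>Dynamical systems and inverse limits\<close>

definition conjugacy ::
  "'a topology \<Rightarrow> ('a \<Rightarrow> 'a) \<Rightarrow> 'b topology \<Rightarrow> ('b \<Rightarrow> 'b) \<Rightarrow> ('a \<Rightarrow> 'b) \<Rightarrow> bool" where
  "conjugacy S s T t \<phi> \<longleftrightarrow>
     homeomorphic_map S T \<phi> \<and> (\<forall>x\<in>topspace S. \<phi> (s x) = t (\<phi> x))"

definition invlim :: "'a topology \<Rightarrow> ('a \<Rightarrow> 'a) \<Rightarrow> (nat \<Rightarrow> 'a) topology" where
  "invlim T f = subtopology (product_topology (\<lambda>_. T) UNIV) {x. \<forall>i. f (x (Suc i)) = x i}"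

definition invlim_map :: "('a \<Rightarrow> 'a) \<Rightarrow> (nat \<Rightarrow> 'a) \<Rightarrow> nat \<Rightarrow> 'a" where
  "invlim_map f x = case_nat (f (x 0)) x"

definition proj0 :: "(nat \<Rightarrow> 'a) \<Rightarrow> 'a" where
  "proj0 x = x 0"

definition finite_union_of_periodic_orbits ::
  "'a topology \<Rightarrow> ('a \<Rightarrow> 'a) \<Rightarrow> 'a set \<Rightarrow> bool" where
  "finite_union_of_periodic_orbits T s A \<longleftrightarrow>
     (\<exists>B. finite B \<and> B \<subseteq> topspace T \<and> (\<forall>x\<in>B. \<exists>n>0. (s ^^ n) x = x) \<and>
          A = (\<Union>x\<in>B. range (\<lambda>n. (s ^^ n) x)))"


section \<open>Paths\<close>

text \<open>
  A path is an equivalence class of maps on \<open>[0,1]\<close>.  The class of a map contains all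
  functions that agree on \<open>[0,1]\<close> with a reparametrization of it.
  The class \<open>pclass \<gamma>\<close> makes sense for every \<open>\<gamma>\<close>; it is a path only if \<open>\<gamma>\<close> is
  continuous and locally one-to-one.
\<close>

type_synonym 'a pathclass = "(real \<Rightarrow> 'a) set"

definition reparam :: "(real \<Rightarrow> real) \<Rightarrow> bool" where
  "reparam h \<longleftrightarrow> continuous_on {0..1} h \<and> strict_mono_on {0..1} h \<and> h ` {0..1} = {0..1}"

definition pclass :: "(real \<Rightarrow> 'a) \<Rightarrow> 'a pathclass" where
  "pclass \<gamma> = {\<delta>. \<exists>h. reparam h \<and> (\<forall>t\<in>{0..1}. \<delta> t = \<gamma> (h t))}"

definition path_map :: "'a topology \<Rightarrow> (real \<Rightarrow> 'a) \<Rightarrow> bool" where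
  "path_map T \<gamma> \<longleftrightarrow> pathin T \<gamma> \<and> locally_one_to_one (top_of_set {0..1}) \<gamma>"

definition paths :: "'a topology \<Rightarrow> 'a pathclass set" where
  "paths T = {pclass \<gamma> |\<gamma>. path_map T \<gamma>}"

definition prep :: "'a pathclass \<Rightarrow> real \<Rightarrow> 'a" where
  "prep l = (SOME \<gamma>. \<gamma> \<in> l)"

definition pinit :: "'a pathclass \<Rightarrow> 'a" where
  "pinit l = prep l 0"

definition pterm :: "'a pathclass \<Rightarrow> 'a" where
  "pterm l = prep l 1"

definition pinterior :: "'a pathclass \<Rightarrow> 'a set" where
  "pinterior l = prep l ` {0<..<1}"

definition prev :: "'a pathclass \<Rightarrow> 'a pathclass" where
  "prev l = (\<Union>\<gamma>\<in>l. pclass (\<lambda>t. \<gamma> (1 - t)))"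

definition pjoin :: "'a pathclass \<Rightarrow> 'a pathclass \<Rightarrow> 'a pathclass" where
  "pjoin l m = (\<Union>\<gamma>\<in>l. \<Union>\<delta>\<in>m. pclass (\<lambda>t. if t \<le> 1/2 then \<gamma> (2 * t) else \<delta> (2 * t - 1)))"

fun pconcat :: "'a pathclass list \<Rightarrow> 'a pathclass" where
  "pconcat [] = {}"
| "pconcat [l] = l"
| "pconcat (l # m # ls) = pjoin l (pconcat (m # ls))"

text \<open>The image of a path need not be a path, because it may fail to be locally one-to-one.\<close>

definition pimage :: "('a \<Rightarrow> 'b) \<Rightarrow> 'a pathclass \<Rightarrow> 'b pathclass" where
  "pimage F l = (\<Union>\<gamma>\<in>l. pclass (F \<circ> \<gamma>))"

definition ppow :: "'a pathclass \<Rightarrow> bool \<Rightarrow> 'a pathclass" where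
  "ppow l s = (if s then l else prev l)"

definition paths_between :: "'a topology \<Rightarrow> 'a set \<Rightarrow> 'a pathclass set" where
  "paths_between T A = {l \<in> paths T. pinit l \<in> A \<and> pterm l \<in> A \<and> pinterior l \<inter> A = {}}"


section \<open>The new presentation\<close>

definition preimg :: "'a topology \<Rightarrow> ('a \<Rightarrow> 'a) \<Rightarrow> nat \<Rightarrow> 'a set \<Rightarrow> 'a set" where
  "preimg T f m A = {x \<in> topspace T. (f ^^ m) x \<in> A}"

definition crossing ::
  "('a, 'e, 'm) digraph_scheme \<Rightarrow> ('a \<Rightarrow> 'a) \<Rightarrow> 'a set \<Rightarrow> nat \<Rightarrow> 'a \<Rightarrow> 'a pathclass \<Rightarrow> bool" where
  "crossing G f \<O> N v l \<longleftrightarrow>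
     (\<forall>I\<in>paths_between (gtop G) (preimg (gtop G) f N \<O>). v \<in> pinterior I \<longrightarrow>
        pimage (f ^^ N) I \<notin> paths_between (gtop G) \<O> \<or>
        pimage (f ^^ N) I \<in> {l, prev l})"

text \<open>
  The image of \<open>J\<^sub>1J\<^sub>2\<close> folds at \<open>v\<close> when, for example, \<open>J\<^sub>2\<close> is the reversal of \<open>J\<^sub>1\<close>;
  the condition concerns the concatenations whose image is a path.
\<close>

definition through ::
  "('a, 'e, 'm) digraph_scheme \<Rightarrow> ('a \<Rightarrow> 'a) \<Rightarrow> 'a set \<Rightarrow> nat \<Rightarrow> 'a
     \<Rightarrow> 'a pathclass \<Rightarrow> 'a pathclass \<Rightarrow> bool" where
  "through G f \<O> N v li lt \<longleftrightarrow>
     (\<forall>J1\<in>paths_between (gtop G) (preimg (gtop G) f N \<O>).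
      \<forall>J2\<in>paths_between (gtop G) (preimg (gtop G) f N \<O>).
        pterm J1 = v \<and> pinit J2 = v \<and> pimage (f ^^ N) (pjoin J1 J2) \<in> paths (gtop G) \<longrightarrow>
        pimage (f ^^ N) (pjoin J1 J2) \<in> {pjoin li lt, prev (pjoin li lt)})"

definition admissible_level ::
  "('a, 'e, 'm) digraph_scheme \<Rightarrow> ('a \<Rightarrow> 'a) \<Rightarrow> 'a set \<Rightarrow> nat \<Rightarrow> nat \<Rightarrow> bool" where
  "admissible_level G f \<O> n N \<longleftrightarrow>
     n > 0 \<and> (\<forall>e\<in>edges G. pts G \<subseteq> (f ^^ n) ` edge_set G e) \<and> n \<le> N \<and>
     (\<forall>e\<in>edges G. echar G e ` {0<..<1} \<inter> preimg (gtop G) f N \<O> \<noteq> {}) \<and>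
     (\<forall>v\<in>verts G. v \<notin> preimg (gtop G) f N \<O> \<longrightarrow>
        (\<exists>l\<in>paths_between (gtop G) \<O>. crossing G f \<O> N v l \<and>
           (\<forall>l'\<in>paths_between (gtop G) \<O>. crossing G f \<O> N v l' \<longrightarrow> l' = l \<or> l' = prev l))) \<and>
     (\<forall>v\<in>verts G. v \<in> preimg (gtop G) f N \<O> \<longrightarrow>
        (\<exists>li\<in>paths_between (gtop G) \<O>. \<exists>lt\<in>paths_between (gtop G) \<O>. through G f \<O> N v li lt \<and>
           (\<forall>li'\<in>paths_between (gtop G) \<O>. \<forall>lt'\<in>paths_between (gtop G) \<O>.
              through G f \<O> N v li' lt' \<longrightarrow>
              (li', lt') = (li, lt) \<or> (li', lt') = (prev lt, prev li))))"

definition orientation_of :: "'a pathclass set \<Rightarrow> 'a pathclass set \<Rightarrow> bool" where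
  "orientation_of \<L> L \<longleftrightarrow> L \<subseteq> \<L> \<and> (\<forall>l\<in>\<L>. \<exists>!m. m \<in> {l, prev l} \<and> m \<in> L)"

text \<open>
  \<open>L\<close> is a possible set of edge paths of the new presentation.  Distinct members of \<open>Ior\<close>
  may have images that are reversals of each other; as paths are taken up to direction,
  \<open>L\<close> retains one of the two.
\<close>

definition new_edge_paths ::
  "('a, 'e, 'm) digraph_scheme \<Rightarrow> ('a \<Rightarrow> 'a) \<Rightarrow> 'a set \<Rightarrow> nat \<Rightarrow> 'a pathclass set \<Rightarrow> bool" where
  "new_edge_paths G f \<O> N L \<longleftrightarrow>
     (\<exists>Ior. orientation_of
              {I \<in> paths_between (gtop G) (preimg (gtop G) f N \<O>).
                 pimage (f ^^ N) I \<in> paths_between (gtop G) \<O>} Ior \<and>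
            orientation_of (pimage (f ^^ N) ` Ior) L)"

datatype ('v, 'l) gpoint = Vtx 'v | Inn 'l real

definition edge_point :: "'a pathclass \<Rightarrow> real \<Rightarrow> ('a, 'a pathclass) gpoint" where
  "edge_point l t =
     (if t \<le> 0 then Vtx (pinit l) else if t \<ge> 1 then Vtx (pterm l) else Inn l t)"

definition new_open :: "'a set \<Rightarrow> 'a pathclass set \<Rightarrow> ('a, 'a pathclass) gpoint set \<Rightarrow> bool" where
  "new_open \<O> L U \<longleftrightarrow>
     U \<subseteq> Vtx ` \<O> \<union> {Inn l t |l t. l \<in> L \<and> 0 < t \<and> t < 1} \<and>
     (\<forall>l\<in>L. openin (top_of_set {0..1}) {t\<in>{0..1}. edge_point l t \<in> U})"

definition new_graph ::
  "'a set \<Rightarrow> 'a pathclass set \<Rightarrow> (('a, 'a pathclass) gpoint, 'a pathclass) digraph" where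
  "new_graph \<O> L =
     \<lparr>gtop = topology (new_open \<O> L), verts = Vtx ` \<O>, edges = L, echar = edge_point\<rparr>"

lemma istopology_new_open: "istopology (new_open \<O> L)"
proof -
  have "new_open \<O> L (U \<inter> V)" if "new_open \<O> L U" "new_open \<O> L V" for U V
  proof -
    have "{t\<in>{0..1}. edge_point l t \<in> U \<inter> V} =
        {t\<in>{0..1}. edge_point l t \<in> U} \<inter> {t\<in>{0..1}. edge_point l t \<in> V}" for l :: "'a pathclass"
      by auto
    with that show ?thesis
      unfolding new_open_def by (auto simp del: Int_iff intro: openin_Int)
  qed
  moreover have "new_open \<O> L (\<Union>\<U>)" if "\<forall>U\<in>\<U>. new_open \<O> L U" for \<U>
  proof -
    have "{t\<in>{0..1}. edge_point l t \<in> \<Union>\<U>} = \<Union>((\<lambda>U. {t\<in>{0..1}. edge_point l t \<in> U}) ` \<U>)"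
      for l :: "'a pathclass"
      by auto
    moreover have "openin (top_of_set {0..1})
        (\<Union>((\<lambda>U. {t\<in>{0..1}. edge_point l t \<in> U}) ` \<U>))" if "l \<in> L" for l
      using \<open>\<forall>U\<in>\<U>. new_open \<O> L U\<close> that unfolding new_open_def by (intro openin_Union) blast
    ultimately show ?thesis
      using that unfolding new_open_def by auto
  qed
  ultimately show ?thesis
    unfolding istopology_def by blast
qed

lemma openin_new_graph: "openin (gtop (new_graph \<O> L)) = new_open \<O> L"
  by (simp add: new_graph_def istopology_new_open topology_inverse')

text \<open>\<open>prep l\<close> fixes the parametrization in which the projection runs along \<open>l\<close>.\<close>

fun rho :: "('a, 'a pathclass) gpoint \<Rightarrow> 'a" where
  "rho (Vtx x) = x"
| "rho (Inn l t) = prep l t"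

definition rho_bar :: "(nat \<Rightarrow> ('a, 'a pathclass) gpoint) \<Rightarrow> nat \<Rightarrow> 'a" where
  "rho_bar x = (\<lambda>i. rho (x i))"

text \<open>
  The list \<open>ws\<close> is the word \<open>l\<^sub>1\<^sup>s\<^sup>1 \<dots> l\<^sub>m\<^sup>s\<^sup>m\<close>, with \<open>True\<close> for exponent \<open>1\<close> and \<open>False\<close> for
  exponent \<open>-1\<close>; the members of \<open>L\<close> do not meet \<open>\<O>\<close> in their interiors, so the
  factorization of the image of \<open>l\<close> is the one cut at the visits to \<open>\<O>\<close>.
\<close>

definition induced_map ::
  "('a \<Rightarrow> 'a) \<Rightarrow> 'a set \<Rightarrow> 'a pathclass set
     \<Rightarrow> (('a, 'a pathclass) gpoint \<Rightarrow> ('a, 'a pathclass) gpoint) \<Rightarrow> bool" where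
  "induced_map f \<O> L h \<longleftrightarrow>
     continuous_map (gtop (new_graph \<O> L)) (gtop (new_graph \<O> L)) h \<and>
     (\<forall>z\<in>pts (new_graph \<O> L). rho (h z) = f (rho z)) \<and>
     (\<forall>l\<in>L. \<exists>ws. ws \<noteq> [] \<and> fst ` set ws \<subseteq> L \<and>
        pimage f l = pconcat (map (\<lambda>(l', s). ppow l' s) ws) \<and>
        pimage h (pclass (edge_point l)) =
          pconcat (map (\<lambda>(l', s). ppow (pclass (edge_point l')) s) ws))"

definition new_presentation ::
  "('a, 'e, 'm) digraph_scheme \<Rightarrow> ('a \<Rightarrow> 'a) \<Rightarrow> 'a set
     \<Rightarrow> (('a, 'a pathclass) gpoint, 'a pathclass) digraph
     \<Rightarrow> (('a, 'a pathclass) gpoint \<Rightarrow> ('a, 'a pathclass) gpoint) \<Rightarrow> bool" where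
  "new_presentation G f \<O> Z h \<longleftrightarrow>
     (\<exists>n N L. admissible_level G f \<O> n N \<and> new_edge_paths G f \<O> N L \<and>
        Z = new_graph \<O> L \<and> induced_map f \<O> L h)"


section \<open>The shift of finite type of a graph with a map\<close>

text \<open>The triple \<open>(e, a, b)\<close> stands for the subinterval \<open>[a, b]\<close> of the edge \<open>e\<close>.\<close>

type_synonym 'e subinterval = "'e \<times> real \<times> real"

fun closed_arc :: "('a, 'e, 'm) digraph_scheme \<Rightarrow> 'e subinterval \<Rightarrow> 'a set" where
  "closed_arc G (e, a, b) = echar G e ` {a..b}"

fun open_arc :: "('a, 'e, 'm) digraph_scheme \<Rightarrow> 'e subinterval \<Rightarrow> 'a set" where
  "open_arc G (e, a, b) = echar G e ` {a<..<b}"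

definition markov_partition ::
  "('a, 'e, 'm) digraph_scheme \<Rightarrow> ('a \<Rightarrow> 'a) \<Rightarrow> 'e subinterval set \<Rightarrow> bool" where
  "markov_partition G h \<A> \<longleftrightarrow>
     (\<exists>ts. (\<forall>e\<in>edges G. ts e \<noteq> [] \<and> hd (ts e) = 0 \<and> last (ts e) = 1 \<and> sorted_wrt (<) (ts e)) \<and>
        \<A> = {(e, ts e ! j, ts e ! Suc j) |e j. e \<in> edges G \<and> Suc j < length (ts e)}) \<and>
     (\<forall>I\<in>\<A>. inj_on h (open_arc G I) \<and> (\<exists>e\<in>edges G. h ` closed_arc G I = edge_set G e))"

definition sft ::
  "('a, 'e, 'm) digraph_scheme \<Rightarrow> ('a \<Rightarrow> 'a) \<Rightarrow> 'e subinterval set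
     \<Rightarrow> (int \<Rightarrow> 'e subinterval) topology" where
  "sft G h \<A> =
     subtopology (product_topology (\<lambda>_. discrete_topology \<A>) UNIV)
       {w. \<forall>k. closed_arc G (w (k + 1)) \<subseteq> h ` closed_arc G (w k)}"

definition shift :: "(int \<Rightarrow> 'b) \<Rightarrow> int \<Rightarrow> 'b" where
  "shift w = (\<lambda>k. w (k + 1))"

text \<open>
  \<open>cylinder G h w n\<close> is the intersection over \<open>|j| \<le> n\<close> of the preimages under the \<open>j\<close>-th
  power of \<open>invlim_map h\<close> of the points whose zeroth coordinate is interior to \<open>w j\<close>.
  The closure is taken after this finite intersection, with open intervals:
  the closures of the individual preimages may have several common points when edges share
  both endpoints or are loops.  For the doubling map on the circle with one vertex,
  the fixed point lies in the closure of every individual preimage.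
\<close>

definition cylinder ::
  "('a, 'e, 'm) digraph_scheme \<Rightarrow> ('a \<Rightarrow> 'a) \<Rightarrow> (int \<Rightarrow> 'e subinterval) \<Rightarrow> nat \<Rightarrow> (nat \<Rightarrow> 'a) set" where
  "cylinder G h w n =
     {x \<in> topspace (invlim (gtop G) h).
        \<forall>i\<le>n. x i \<in> open_arc G (w (- int i)) \<and> (h ^^ i) (x 0) \<in> open_arc G (w (int i))}"

definition cover_map ::
  "('a, 'e, 'm) digraph_scheme \<Rightarrow> ('a \<Rightarrow> 'a) \<Rightarrow> (int \<Rightarrow> 'e subinterval) \<Rightarrow> nat \<Rightarrow> 'a" where
  "cover_map G h w = (THE x. (\<Inter>n. invlim (gtop G) h closure_of cylinder G h w n) = {x})"

end

theory Submission
  imports Defs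
begin

text \<open>
  \<^emph>\<open>The proof.\<close>  The map \<open>rho_bar\<close> is a conjugacy: expansion makes \<open>f\<close> eventually onto on every arc,
  which gives surjectivity, and flattening gives injectivity.  Hence \<open>\<phi>\<close> lifts to a conjugacy \<open>\<Phi>\<close> of
  the inverse limits of the new presentations which matches the finite invariant sets \<open>\<Theta>\<close>, \<open>\<Theta>'\<close>
  lying over \<open>\<O>bar\<close>, \<open>\<O>bar'\<close>.  The points whose zeroth coordinate is eventually mapped to a vertex
  are those forward asymptotic to \<open>\<Theta>\<close>, so \<open>\<Phi>\<close> preserves them, with a uniform time \<open>K\<close> by
  compactness.  An arc of points with a common backward itinerary that meets no vertices up to
  time \<open>K\<close> is therefore mapped by \<open>\<Phi>\<close> into a connected set whose zeroth coordinates avoid the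
  partition points, that is, into a single interval of the second partition.  Reading off these intervals
  at all times gives a sliding block code, and the code of \<open>\<Phi>\<inverse>\<close> inverts it.  Uniqueness
  holds because the sequences whose point never hits a vertex are dense and are determined by
  their point.
\<close>

section \<open>Locally injective maps of intervals\<close>

text \<open>The coding is not injective: a point whose orbit meets a vertex may have several
  codings, so a conjugacy of the inverse limits does not act on sequences point by point. Hence
  whole arcs with prescribed past and finite future are transported, on which no choice arises, and
  ambiguous points are reached only as limits of such arcs. This succeeds only if a point with
  ambiguous image is itself ambiguous, up to a bounded delay. Hitting a vertex depends on the
  presentation, whereas being asymptotic to a finite invariant set does not; this is why the
  periodic orbits of the two sides have to correspond under the conjugacy. On the new graph a
  density statement takes the place of an expanding metric: points that eventually hit a vertex are
  dense in every edge. The open image of an inverse branch of order n contains no point that hits a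
  vertex before time n, so branches of high order have short images, uniformly over all
  words.\<close>

lemma no_interior_maximum:
  fixes u :: "real \<Rightarrow> real"
  assumes u: "continuous_on S u" and loc: "locally_one_to_one (top_of_set S) u"
    and sub: "{x..y} \<subseteq> S" and m: "x < m" "m < y" and le: "\<And>z. z \<in> {x..y} \<Longrightarrow> u z \<le> u m"
  shows False
proof -
  have "m \<in> S" using sub m by auto
  with loc obtain U where U: "openin (top_of_set S) U" "m \<in> U" "inj_on u U"
    unfolding locally_one_to_one_def by auto
  then obtain e where e: "e > 0" "ball m e \<inter> S \<subseteq> U"
    unfolding openin_contains_ball by blast
  define d where "d = Min {e/2, m - x, y - m}"
  have d: "d > 0" "d < e" "d \<le> m - x" "d \<le> y - m" using e m by (auto simp: d_def)
  have "{m-d..m+d} \<subseteq> ball m e" using d by (auto simp: dist_real_def)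
  moreover have "{m-d..m+d} \<subseteq> {x..y}" using d by auto
  ultimately have pq: "{m-d..m+d} \<subseteq> U" "{m-d..m+d} \<subseteq> S" using e(2) sub by blast+
  \<comment> \<open>Injectivity on a short interval around \<open>m\<close> forces strict
    monotonicity, so one of the two neighbours lies above \<open>u m\<close>.\<close>
  have "(u (m-d) < u m \<and> u m < u (m+d)) \<or> (u (m+d) < u m \<and> u m < u (m-d))"
    using d by (intro continuous_inj_imp_mono continuous_on_subset[OF u pq(2)] inj_on_subset[OF U(3) pq(1)]) auto
  moreover have "u (m-d) \<le> u m" "u (m+d) \<le> u m" using d by (auto intro!: le)
  ultimately show False by linarith
qed

text \<open>If two values agree, the extrema over the interval between them cannot lie inside it.
  They are then attained at the ends, the function is constant in between, and a constant function
  does have an interior maximum.\<close>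

lemma locally_injective_imp_injective:
  fixes u :: "real \<Rightarrow> real"
  assumes S: "is_interval S" and u: "continuous_on S u"
    and loc: "locally_one_to_one (top_of_set S) u"
  shows "inj_on u S"
proof -
  have loc': "locally_one_to_one (top_of_set S) (\<lambda>x. - u x)"
    using loc unfolding locally_one_to_one_def inj_on_def by simp
  have u': "continuous_on S (\<lambda>x. - u x)" by (intro continuous_on_minus u)
  have "u x \<noteq> u y" if xy: "x \<in> S" "y \<in> S" "x < y" for x y
  proof
    assume eq: "u x = u y"
    have sub: "{x..y} \<subseteq> S" using S xy unfolding is_interval_1 by (meson atLeastAtMost_iff subsetI)
    have cont: "continuous_on {x..y} u" using u sub continuous_on_subset by blast
    obtain m where m: "m \<in> {x..y}" "\<And>z. z \<in> {x..y} \<Longrightarrow> u z \<le> u m"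
      using continuous_attains_sup[OF _ _ cont] xy by auto
    obtain n where n: "n \<in> {x..y}" "\<And>z. z \<in> {x..y} \<Longrightarrow> u n \<le> u z"
      using continuous_attains_inf[OF _ _ cont] xy by auto
    have "m = x \<or> m = y" using no_interior_maximum[OF u loc sub, of m] m by force
    moreover have "n = x \<or> n = y" using no_interior_maximum[OF u' loc' sub, of n] n by force
    ultimately have "u m = u x" "u n = u x" using eq by metis+
    then have const: "u z = u x" if "z \<in> {x..y}" for z
      using m(2)[OF that] n(2)[OF that] by simp
    have mid: "x < (x+y)/2" "(x+y)/2 < y" using xy(3) by auto
    then have "u z \<le> u ((x+y)/2)" if "z \<in> {x..y}" for z
      using const[OF that] const[of "(x+y)/2"] by simp
    then show False
      using no_interior_maximum[OF u loc sub mid] by blast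
  qed
  then show ?thesis by (metis inj_onI linorder_less_linear)
qed

text \<open>On the open interval the function is strictly monotone, and continuity extends weak
  inequalities to the ends. Two auxiliary points strictly between \<open>r\<close> and
  \<open>s\<close> make them strict again.\<close>

lemma inj_on_closure_interval:
  fixes u :: "real \<Rightarrow> real"
  assumes u: "continuous_on {a..b} u" and inj: "inj_on u {a<..<b}"
  shows "inj_on u {a..b}"
proof (cases "a < b")
  case True
  have str: "strict_mono_on {a..b} v" if v: "continuous_on {a..b} v" "strict_mono_on {a<..<b} v" for v :: "real \<Rightarrow> real"
  proof -
    have le: "v x \<le> v y" if "x \<in> {a..b}" "y \<in> {a<..<b}" "x < y" for x y
    proof -
      have "(v \<longlongrightarrow> v x) (at_right x)"
      proof -
        have "(v \<longlongrightarrow> v x) (at x within {a..b})" using v(1) that by (auto simp: continuous_on_def)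
        then have "(v \<longlongrightarrow> v x) (at x within {x..b})" by (rule tendsto_within_subset) (use that in auto)
        moreover have "at x within {x..b} = at_right x" using that by (intro at_within_Icc_at_right) auto
        ultimately show ?thesis by simp
      qed
      moreover have "eventually (\<lambda>z. v z \<le> v y) (at_right x)"
        unfolding eventually_at_right_field using that v(2)
        by (intro exI[of _ y]) (auto intro!: less_imp_le strict_mono_onD[OF v(2)])
      ultimately show ?thesis by (intro tendsto_upperbound) auto
    qed
    have ge: "v y \<le> v x" if "x \<in> {a..b}" "y \<in> {a<..<b}" "y < x" for x y
    proof -
      have "(v \<longlongrightarrow> v x) (at_left x)"
      proof -
        have "(v \<longlongrightarrow> v x) (at x within {a..b})" using v(1) that by (auto simp: continuous_on_def)
        then have "(v \<longlongrightarrow> v x) (at x within {a..x})" by (rule tendsto_within_subset) (use that in auto)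
        moreover have "at x within {a..x} = at_left x" using that by (intro at_within_Icc_at_left) auto
        ultimately show ?thesis by simp
      qed
      moreover have "eventually (\<lambda>z. v y \<le> v z) (at_left x)"
        unfolding eventually_at_left_field using that v(2)
        by (intro exI[of _ y]) (auto intro!: less_imp_le strict_mono_onD[OF v(2)])
      ultimately show ?thesis by (intro tendsto_lowerbound) auto
    qed
    show ?thesis
    proof (intro strict_mono_onI)
      fix r s assume rs: "r \<in> {a..b}" "s \<in> {a..b}" "r < s"
      define p q where "p = r + (s-r)/3" and "q = r + (s-r)*2/3"
      have "r < p" "p < q" "q < s" "p \<in> {a<..<b}" "q \<in> {a<..<b}"
        using rs by (auto simp: p_def q_def field_simps)
      then show "v r < v s"
        using le[of r p] ge[of s q] strict_mono_onD[OF v(2), of p q] rs by auto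
    qed
  qed
  have "continuous_on {a<..<b} u" by (rule continuous_on_subset[OF u]) auto
  then consider "strict_mono_on {a<..<b} u" | "strict_antimono_on {a<..<b} u"
    using inj injective_eq_monotone_map[of "{a<..<b}" u] by (auto simp: is_interval_oo)
  then show ?thesis
  proof cases
    case 1
    then show ?thesis using str[OF u] strict_mono_on_imp_inj_on by blast
  next
    case 2
    then have "strict_mono_on {a<..<b} (\<lambda>x. - u x)"
      by (auto simp: monotone_on_def)
    from str[OF continuous_on_minus[OF u] this] show ?thesis
      using strict_mono_on_imp_inj_on by (fastforce simp: inj_on_def)
  qed
qed (auto simp: inj_on_def)

lemma limit_at_left_of_mono:
  fixes u :: "real \<Rightarrow> real"
  assumes "a < b" and mono: "mono_on {a<..<b} u" and bd: "u ` {a<..<b} \<subseteq> {c..d}"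
  shows "\<exists>L\<in>{c..d}. (u \<longlongrightarrow> L) (at_left b)"
proof (intro bexI)
  let ?A = "u ` {a<..<b}"
  have ne: "?A \<noteq> {}" using assms(1) dense by auto
  have bdd: "bdd_above ?A" using bd by (meson bdd_above_Icc bdd_above_mono)
  show "(u \<longlongrightarrow> Sup ?A) (at_left b)"
  proof (rule order_tendstoI)
    fix x assume "x < Sup ?A"
    then obtain t where t: "t \<in> {a<..<b}" "x < u t" using less_cSup_iff[OF ne bdd] by auto
    show "eventually (\<lambda>z. x < u z) (at_left b)"
      unfolding eventually_at_left_field
    proof (intro exI[of _ t] conjI allI impI)
      fix y assume "t < y" "y < b"
      then have "u t \<le> u y" using t by (intro mono_onD[OF mono]) auto
      then show "x < u y" using t by simp
    qed (use t in auto)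
  next
    fix x assume x: "Sup ?A < x"
    show "eventually (\<lambda>z. u z < x) (at_left b)"
      unfolding eventually_at_left_field
      using x cSup_upper[OF _ bdd] assms(1) by (intro exI[of _ a]) force
  qed
  obtain z where "z \<in> ?A" using ne by blast
  then show "Sup ?A \<in> {c..d}"
    using cSup_upper[OF _ bdd, of z] bd by (auto intro!: cSup_least[OF ne])
qed

lemma limit_at_right_of_mono:
  fixes u :: "real \<Rightarrow> real"
  assumes "a < b" and mono: "mono_on {a<..<b} u" and bd: "u ` {a<..<b} \<subseteq> {c..d}"
  shows "\<exists>L\<in>{c..d}. (u \<longlongrightarrow> L) (at_right a)"
proof -
  have "\<exists>L\<in>{-d..-c}. ((\<lambda>x. - u (- x)) \<longlongrightarrow> L) (at_left (-a))"
    using assms(1) bd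
    by (intro limit_at_left_of_mono[of "-b"]) (auto intro!: mono_onI mono_onD[OF mono] simp: image_subset_iff)
  then obtain L where L: "L \<in> {-d..-c}" "((\<lambda>x. - u (- x)) \<longlongrightarrow> L) (at_left (-a))" by blast
  have "((\<lambda>x. u (- x)) \<longlongrightarrow> - L) (at_left (-a))" using tendsto_minus[OF L(2)] by simp
  then have "(u \<longlongrightarrow> - L) (at_right a)"
    by (subst at_right_minus) (simp add: filterlim_filtermap)
  then show ?thesis using L(1) by (intro bexI[of _ "-L"]) auto
qed

text \<open>Charts of an edge are at first available only on an open interval. Monotonicity and
  boundedness supply the one-sided limits that close them up.\<close>

lemma continuous_injective_extension:
  fixes u :: "real \<Rightarrow> real"
  assumes "a < b" and u: "continuous_on {a<..<b} u" and inj: "inj_on u {a<..<b}"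
    and bd: "u ` {a<..<b} \<subseteq> {c..d}"
  obtains v where "continuous_on {a..b} v" "inj_on v {a..b}" "v ` {a..b} \<subseteq> {c..d}"
    "\<And>t. t \<in> {a<..<b} \<Longrightarrow> v t = u t"
proof -
  have lims: "\<exists>L\<in>{c..d}. \<exists>R\<in>{c..d}. (u \<longlongrightarrow> L) (at_left b) \<and> (u \<longlongrightarrow> R) (at_right a)"
  proof -
    consider "strict_mono_on {a<..<b} u" | "strict_antimono_on {a<..<b} u"
      using u inj injective_eq_monotone_map[of "{a<..<b}" u] by (auto simp: is_interval_oo)
    then show ?thesis
    proof cases
      case 1
      then have "mono_on {a<..<b} u" using strict_mono_on_imp_mono_on by blast
      then show ?thesis
        using limit_at_left_of_mono[OF assms(1) _ bd] limit_at_right_of_mono[OF assms(1) _ bd] by blast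
    next
      case 2
      then have m: "mono_on {a<..<b} (\<lambda>x. - u x)"
        by (auto simp: monotone_on_def order_le_less)
      have b: "(\<lambda>x. - u x) ` {a<..<b} \<subseteq> {-d..-c}" using bd by auto
      obtain L R where "L \<in> {-d..-c}" "((\<lambda>x. - u x) \<longlongrightarrow> L) (at_left b)"
        "R \<in> {-d..-c}" "((\<lambda>x. - u x) \<longlongrightarrow> R) (at_right a)"
        using limit_at_left_of_mono[OF assms(1) m b] limit_at_right_of_mono[OF assms(1) m b] by blast
      moreover from this have "(u \<longlongrightarrow> - L) (at_left b)" "(u \<longlongrightarrow> - R) (at_right a)"
        using tendsto_minus by fastforce+
      ultimately show ?thesis
        by (intro bexI[of _ "-L"] bexI[of _ "-R"] conjI) auto
    qed
  qed
  then obtain L R where LR: "L \<in> {c..d}" "R \<in> {c..d}" "(u \<longlongrightarrow> L) (at_left b)" "(u \<longlongrightarrow> R) (at_right a)"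
    by blast
  define v where "v = (\<lambda>x. if x = a then R else if x = b then L else u x)"
  have v: "continuous_on {a..b} v"
  proof (rule continuous_on_IccI)
    show "(v \<longlongrightarrow> v a) (at_right a)"
      by (rule Lim_transform_eventually[of u])
        (use LR(4) assms(1) in \<open>auto simp: v_def eventually_at_right_field intro!: exI[of _ b]\<close>)
    show "(v \<longlongrightarrow> v b) (at_left b)"
      by (rule Lim_transform_eventually[of u])
        (use LR(3) assms(1) in \<open>auto simp: v_def eventually_at_left_field intro!: exI[of _ a]\<close>)
    fix x assume x: "a < x" "x < b"
    then have "u \<midarrow>x\<rightarrow> u x"
      using u by (simp add: continuous_on_eq_continuous_at isCont_def)
    moreover have "eventually (\<lambda>z. u z = v z) (at x)"
      using eventually_at_in_open'[of "{a<..<b}" x] x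
      by (auto simp: v_def elim!: eventually_mono)
    ultimately show "v \<midarrow>x\<rightarrow> v x"
      using Lim_transform_eventually x by (auto simp: v_def)
  qed (rule assms(1))
  show ?thesis
  proof
    show "continuous_on {a..b} v" by fact
    have "inj_on v {a<..<b}" using inj by (auto simp: v_def inj_on_def)
    then show "inj_on v {a..b}" using inj_on_closure_interval v by blast
    show "v ` {a..b} \<subseteq> {c..d}" using LR bd by (auto simp: v_def image_subset_iff)
  qed (auto simp: v_def)
qed

section \<open>Local injectivity under restriction and composition, and finiteness of level
  sets\<close>

lemma locally_one_to_one_subset:
  assumes "locally_one_to_one (top_of_set S) f" "S' \<subseteq> S"
  shows "locally_one_to_one (top_of_set S') f"
  unfolding locally_one_to_one_def
proof
  fix x assume "x \<in> topspace (top_of_set S')"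
  then obtain U where U: "openin (top_of_set S) U" "x \<in> U" "inj_on f U" "x \<in> S'"
    using assms unfolding locally_one_to_one_def by auto
  then have "openin (top_of_set S') (S' \<inter> U)"
  proof -
    obtain W where "open W" "U = S \<inter> W" using U(1) by (auto simp: openin_open)
    then have "S' \<inter> U = S' \<inter> W" using assms(2) by blast
    with \<open>open W\<close> show ?thesis by (auto simp: openin_open)
  qed
  with U show "\<exists>U. openin (top_of_set S') U \<and> x \<in> U \<and> inj_on f U"
    by (intro exI[of _ "S' \<inter> U"]) (auto intro: inj_on_subset)
qed

lemma locally_one_to_one_compose_inj:
  fixes u :: "'b::topological_space \<Rightarrow> 'c::topological_space"
  assumes f: "locally_one_to_one (top_of_set S) f" and u: "continuous_on T u" "u ` T \<subseteq> S"
    and inj: "inj_on u T" and eq: "\<And>t. t \<in> T \<Longrightarrow> g t = f (u t)"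
  shows "locally_one_to_one (top_of_set T) g"
  unfolding locally_one_to_one_def
proof
  fix x assume "x \<in> topspace (top_of_set T)"
  then have x: "x \<in> T" "u x \<in> S" using u by auto
  then obtain U where U: "openin (top_of_set S) U" "u x \<in> U" "inj_on f U"
    using f unfolding locally_one_to_one_def by auto
  have "openin (top_of_set T) (T \<inter> u -` U)"
    using continuous_openin_preimage[OF u(1) _ U(1)] u(2) by blast
  moreover have "inj_on g (T \<inter> u -` U)"
    using U(3) inj eq by (auto simp: inj_on_def)
  ultimately show "\<exists>U. openin (top_of_set T) U \<and> x \<in> U \<and> inj_on g U"
    using x U(2) by (intro exI[of _ "T \<inter> u -` U"]) auto
qed

lemma locally_one_to_one_of_compose:
  assumes f: "locally_one_to_one (top_of_set S) g" and eq: "\<And>t. t \<in> S \<Longrightarrow> g t = f (u t)"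
  shows "locally_one_to_one (top_of_set S) u"
  unfolding locally_one_to_one_def
proof
  fix x assume "x \<in> topspace (top_of_set S)"
  then obtain U where U: "openin (top_of_set S) U" "x \<in> U" "inj_on g U"
    using f unfolding locally_one_to_one_def by auto
  then have "U \<subseteq> S" using openin_imp_subset by blast
  then have "inj_on u U" using U(3) eq unfolding inj_on_def by (metis subsetD)
  with U show "\<exists>U. openin (top_of_set S) U \<and> x \<in> U \<and> inj_on u U" by blast
qed

text \<open>At an accumulation point of a level set the map would fail to be injective on every
  neighbourhood.\<close>

lemma finite_level_sets:
  fixes \<gamma> :: "real \<Rightarrow> 'a"
  assumes loc: "locally_one_to_one (top_of_set S) \<gamma>" and K: "compact K" "K \<subseteq> S" and F: "finite F"
  shows "finite {t \<in> K. \<gamma> t \<in> F}"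
proof -
  have "finite {t \<in> K. \<gamma> t = p}" for p
  proof (rule ccontr)
    assume "infinite {t \<in> K. \<gamma> t = p}"
    then obtain x where x: "x \<in> K" "x islimpt {t \<in> K. \<gamma> t = p}"
      using Heine_Borel_imp_Bolzano_Weierstrass[OF K(1), of "{t \<in> K. \<gamma> t = p}"] by auto
    then obtain U where U: "openin (top_of_set S) U" "x \<in> U" "inj_on \<gamma> U"
      using loc K unfolding locally_one_to_one_def by (auto dest: subsetD)
    then obtain e where e: "e > 0" "ball x e \<inter> S \<subseteq> U"
      unfolding openin_contains_ball by blast
    have "infinite ({t \<in> K. \<gamma> t = p} \<inter> ball x e)"
      using x(2) e(1) islimpt_eq_infinite_ball by blast
    moreover have "{t \<in> K. \<gamma> t = p} \<inter> ball x e \<subseteq> U" using e K by auto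
    moreover have "inj_on \<gamma> ({t \<in> K. \<gamma> t = p} \<inter> ball x e)"
      using calculation(2) U(3) inj_on_subset by blast
    moreover have "finite (\<gamma> ` ({t \<in> K. \<gamma> t = p} \<inter> ball x e))"
      by (rule finite_subset[of _ "{p}"]) auto
    ultimately show False using finite_imageD by blast
  qed
  then have "finite (\<Union>p\<in>F. {t \<in> K. \<gamma> t = p})" using F by blast
  then show ?thesis by (rule rev_finite_subset) auto
qed

lemma continuous_map_interval_subset:
  assumes "continuous_map (top_of_set {a..b::real}) T \<gamma>" "S \<subseteq> {a..b}"
  shows "continuous_map (top_of_set S) T \<gamma>"
  by (rule continuous_map_from_subtopology_mono[OF assms])

section \<open>Finite graphs\<close>

locale finite_graph =
  fixes G :: "('a, 'e, 'm) digraph_scheme"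
  assumes digraph: "finite_digraph G"
begin

lemma Hausdorff: "Hausdorff_space (gtop G)"
  by (rule digraph[unfolded finite_digraph_def, THEN conjunct1])

lemma finite_verts: "finite (verts G)"
  by (rule digraph[unfolded finite_digraph_def, THEN conjunct2, THEN conjunct1])

lemma finite_edges: "finite (edges G)"
  by (rule digraph[unfolded finite_digraph_def, THEN conjunct2, THEN conjunct2, THEN conjunct1])

lemma pts_eq: "pts G = verts G \<union> (\<Union>e\<in>edges G. edge_set G e)"
  by (rule digraph[unfolded finite_digraph_def, THEN conjunct2, THEN conjunct2, THEN conjunct2, THEN conjunct1])

lemma edge_properties:
  assumes "e \<in> edges G"
  shows "continuous_map (top_of_set {0..1}) (gtop G) (echar G e) \<and> inj_on (echar G e) {0<..<1} \<and>
    echar G e 0 \<in> verts G \<and> echar G e 1 \<in> verts G \<and> echar G e ` {0<..<1} \<inter> verts G = {}"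
proof -
  have "\<forall>e\<in>edges G. continuous_map (top_of_set {0..1}) (gtop G) (echar G e) \<and>
    inj_on (echar G e) {0<..<1} \<and>
    echar G e 0 \<in> verts G \<and> echar G e 1 \<in> verts G \<and> echar G e ` {0<..<1} \<inter> verts G = {}"
    using digraph unfolding finite_digraph_def by (elim conjE) assumption
  with assms show ?thesis by (rule bspec[rotated])
qed

lemma edge_cont: "e \<in> edges G \<Longrightarrow> continuous_map (top_of_set {0..1}) (gtop G) (echar G e)"
  by (rule edge_properties[THEN conjunct1])

lemma edge_inj: "e \<in> edges G \<Longrightarrow> inj_on (echar G e) {0<..<1}"
  by (rule edge_properties[THEN conjunct2, THEN conjunct1])

lemma edge_0: "e \<in> edges G \<Longrightarrow> echar G e 0 \<in> verts G"
  by (rule edge_properties[THEN conjunct2, THEN conjunct2, THEN conjunct1])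

lemma edge_1: "e \<in> edges G \<Longrightarrow> echar G e 1 \<in> verts G"
  by (rule edge_properties[THEN conjunct2, THEN conjunct2, THEN conjunct2, THEN conjunct1])

lemma edge_interior:
  assumes "e \<in> edges G" "0 < t" "t < 1"
  shows "echar G e t \<notin> verts G"
proof -
  have "echar G e t \<in> echar G e ` {0<..<1}" using assms by (intro imageI) simp
  then show ?thesis using edge_properties[OF assms(1)] by blast
qed

lemma edge_disjoint:
  assumes "e \<in> edges G" "e' \<in> edges G" "e \<noteq> e'" "0 < s" "s < 1" "0 < t" "t < 1"
  shows "echar G e s \<noteq> echar G e' t"
proof -
  have "\<forall>e\<in>edges G. \<forall>e'\<in>edges G. e \<noteq> e' \<longrightarrow> echar G e ` {0<..<1} \<inter> echar G e' ` {0<..<1} = {}"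
    using digraph unfolding finite_digraph_def by (elim conjE) assumption
  then have "echar G e ` {0<..<1} \<inter> echar G e' ` {0<..<1} = {}" using assms by blast
  moreover have "echar G e s \<in> echar G e ` {0<..<1}" "echar G e' t \<in> echar G e' ` {0<..<1}"
    using assms by auto
  ultimately show ?thesis by (metis IntI emptyE)
qed

lemma edge_in_verts_iff:
  assumes "e \<in> edges G" "0 \<le> t" "t \<le> 1"
  shows "echar G e t \<in> verts G \<longleftrightarrow> t = 0 \<or> t = 1"
proof
  assume "echar G e t \<in> verts G"
  then have "\<not> (0 < t \<and> t < 1)" using edge_interior[OF assms(1)] by blast
  then show "t = 0 \<or> t = 1" using assms(2,3) by linarith
next
  assume "t = 0 \<or> t = 1"
  then show "echar G e t \<in> verts G" using edge_0[OF assms(1)] edge_1[OF assms(1)] by metis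
qed

text \<open>The second parameter may be an end of its edge: ends are vertices and interior points
  are not, so equality itself forces it into the interior.\<close>

lemma edge_eq:
  assumes "e \<in> edges G" "e' \<in> edges G" "0 < s" "s < 1" "0 \<le> t" "t \<le> 1" "echar G e s = echar G e' t"
  shows "e = e'" "s = t"
proof -
  have "echar G e' t \<notin> verts G" using edge_interior assms by metis
  then have t: "0 < t" "t < 1" using edge_in_verts_iff assms by force+
  show "e = e'" using edge_disjoint assms t by metis
  then show "s = t" using edge_inj[OF assms(1)] assms t by (auto dest: inj_onD)
qed

lemma edge_in_pts:
  assumes "e \<in> edges G" "0 \<le> t" "t \<le> 1"
  shows "echar G e t \<in> pts G"
proof -
  have "echar G e t \<in> edge_set G e" using assms by (intro imageI) simp
  then show ?thesis unfolding pts_eq using assms(1) by blast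
qed

lemma verts_in_pts: "verts G \<subseteq> pts G"
  unfolding pts_eq by (rule Un_upper1)

lemma pts_cases:
  assumes "x \<in> pts G" "x \<notin> verts G"
  obtains e t where "e \<in> edges G" "0 < t" "t < 1" "x = echar G e t"
proof -
  obtain e t where e: "e \<in> edges G" "0 \<le> t" "t \<le> 1" "x = echar G e t"
    using assms unfolding pts_eq by auto
  then have "0 < t" "t < 1" using assms edge_0 edge_1 by (auto simp: less_le)
  with e that show ?thesis by blast
qed

lemma compactin_edge_image:
  assumes "e \<in> edges G" "compact C" "C \<subseteq> {0..1}"
  shows "compactin (gtop G) (echar G e ` C)"
  by (rule image_compactin[OF _ edge_cont[OF assms(1)]]) (simp add: compactin_subtopology assms)

lemma closedin_edge_image:
  assumes "e \<in> edges G" "closed C" "C \<subseteq> {0..1}"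
  shows "closedin (gtop G) (echar G e ` C)"
proof -
  have "compact C"
    using assms(2) bounded_subset[OF bounded_closed_interval assms(3)] by (simp add: compact_eq_bounded_closed)
  then show ?thesis
    using compactin_imp_closedin[OF Hausdorff compactin_edge_image[OF assms(1) _ assms(3)]] by blast
qed

lemma closedin_finite: "finite A \<Longrightarrow> A \<subseteq> pts G \<Longrightarrow> closedin (gtop G) A"
  by (rule closedin_Hausdorff_finite[OF Hausdorff])

lemma compact_graph: "compact_space (gtop G)"
proof -
  have "compactin (gtop G) (verts G \<union> \<Union>((\<lambda>e. edge_set G e) ` edges G))"
  proof (intro compactin_Un compactin_Union)
    show "compactin (gtop G) (verts G)" using finite_verts verts_in_pts by (rule finite_imp_compactin[rotated])
    show "finite ((\<lambda>e. edge_set G e) ` edges G)" using finite_edges by blast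
    show "compactin (gtop G) S" if S: "S \<in> (\<lambda>e. edge_set G e) ` edges G" for S
    proof -
      obtain e where "e \<in> edges G" "S = edge_set G e" using S by blast
      then show ?thesis using compactin_edge_image[of e "{0..1}"] by simp
    qed
  qed
  then show ?thesis unfolding compact_space_def pts_eq[symmetric] .
qed

text \<open>The complement is a finite union of compact, hence closed, sets: the vertices, the other
  closed edges and the rest of this edge. In this way finiteness and the Hausdorff property give the
  open edges their real topology.\<close>

lemma openin_edge_image:
  assumes e: "e \<in> edges G" and U: "open U" "U \<subseteq> {0<..<1}"
  shows "openin (gtop G) (echar G e ` U)"
proof -
  let ?C = "verts G \<union> \<Union>((\<lambda>e'. edge_set G e') ` (edges G - {e})) \<union> echar G e ` ({0..1} - U)"
  have "closedin (gtop G) ?C"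
  proof (intro closedin_Un closedin_Union)
    show "closedin (gtop G) (verts G)" using finite_verts verts_in_pts by (rule closedin_finite)
    show "finite ((\<lambda>e'. edge_set G e') ` (edges G - {e}))" using finite_edges by blast
    show "closedin (gtop G) S" if S: "S \<in> (\<lambda>e'. edge_set G e') ` (edges G - {e})" for S
    proof -
      obtain e' where "e' \<in> edges G" "S = edge_set G e'" using S by blast
      then show ?thesis using closedin_edge_image[of e' "{0..1}"] by simp
    qed
    have "closed ({0..1} - U)" using U(1) by (intro closed_Diff) auto
    then show "closedin (gtop G) (echar G e ` ({0..1} - U))" using e closedin_edge_image by blast
  qed
  moreover have "echar G e ` U = pts G - ?C"
  proof (intro equalityI subsetI)
    fix x assume "x \<in> echar G e ` U"
    then obtain t where t: "t \<in> U" "x = echar G e t" by auto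
    then have t': "0 < t" "t < 1" using U by auto
    have "x \<in> pts G" using edge_in_pts e t t' by auto
    moreover have "x \<notin> verts G" using edge_interior e t t' by auto
    moreover have "x \<notin> echar G e' ` {0..1}" if "e' \<in> edges G - {e}" for e'
      using edge_eq(1)[OF e _ t'] that t by auto
    moreover have "x \<notin> echar G e ` ({0..1} - U)"
      using edge_eq(2)[OF e e t'] t by auto
    ultimately show "x \<in> pts G - ?C" by blast
  next
    fix x assume "x \<in> pts G - ?C"
    then show "x \<in> echar G e ` U" unfolding pts_eq using e by blast
  qed
  ultimately show ?thesis by (simp add: openin_diff)
qed

text \<open>The open edges are open and pairwise disjoint, so a connected set off the vertices
  cannot meet two of them.\<close>

lemma connected_in_edge:
  assumes S: "connectedin (gtop G) S" and V: "S \<inter> verts G = {}" and "S \<noteq> {}"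
  obtains e where "e \<in> edges G" "S \<subseteq> echar G e ` {0<..<1}"
proof -
  obtain x where x: "x \<in> S" using assms by blast
  have sub: "S \<subseteq> pts G" using S connectedin_subset_topspace by blast
  then obtain e t where e: "e \<in> edges G" "0 < t" "t < 1" "x = echar G e t"
    using pts_cases x V by blast
  let ?A = "echar G e ` {0<..<1}" and ?B = "\<Union>((\<lambda>e'. echar G e' ` {0<..<1}) ` (edges G - {e}))"
  have "openin (gtop G) ?A" "openin (gtop G) ?B"
    using e by (auto intro!: openin_edge_image openin_Union)
  moreover have "S \<subseteq> ?A \<union> ?B"
  proof
    fix y assume "y \<in> S"
    then obtain e' t' where "e' \<in> edges G" "0 < t'" "t' < 1" "y = echar G e' t'"
      using pts_cases sub V by blast
    then have "y \<in> echar G e' ` {0<..<1}" "e' \<in> edges G" by auto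
    then show "y \<in> ?A \<union> ?B" by (cases "e' = e") blast+
  qed
  moreover have "?A \<inter> ?B \<inter> S = {}" using edge_disjoint[OF e(1)] by (auto; metis)
  moreover have "x \<in> ?A" unfolding e(4) using e(2,3) by (intro imageI) auto
  then have "?A \<inter> S \<noteq> {}" using x by blast
  ultimately have "?B \<inter> S = {}" using S unfolding connectedin by (metis (no_types, lifting) inf_commute)
  then show ?thesis using that[OF e(1)] \<open>S \<subseteq> ?A \<union> ?B\<close> by blast
qed

text \<open>Off the vertices the path stays in one open edge and has a continuous real parameter,
  which local injectivity makes monotone. Its extension to the ends still represents
  \<open>\<gamma>\<close> because the graph is Hausdorff; the ends themselves may be
  vertices.\<close>

lemma edge_chart:
  fixes a b :: real
  assumes ab: "a < b" and \<gamma>: "continuous_map (top_of_set {a..b}) (gtop G) \<gamma>"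
    and loc: "locally_one_to_one (top_of_set {a<..<b}) \<gamma>"
    and avoid: "\<And>t. a < t \<Longrightarrow> t < b \<Longrightarrow> \<gamma> t \<notin> verts G"
  obtains e \<xi> where "e \<in> edges G" "continuous_on {a..b} \<xi>" "inj_on \<xi> {a..b}" "\<xi> ` {a..b} \<subseteq> {0..1}"
    "\<forall>t\<in>{a..b}. \<gamma> t = echar G e (\<xi> t)" "\<xi> ` {a<..<b} \<subseteq> {0<..<1}"
proof -
  have \<gamma>o: "continuous_map (top_of_set {a<..<b}) (gtop G) \<gamma>"
    by (rule continuous_map_interval_subset[OF \<gamma>]) auto
  have "connectedin (gtop G) (\<gamma> ` {a<..<b})"
    by (rule connectedin_continuous_map_image[OF \<gamma>o]) (simp add: connectedin_subtopology)
  moreover have "\<gamma> ` {a<..<b} \<inter> verts G = {}" "\<gamma> ` {a<..<b} \<noteq> {}" using avoid ab by auto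
  ultimately obtain e where e: "e \<in> edges G" "\<gamma> ` {a<..<b} \<subseteq> echar G e ` {0<..<1}"
    using connected_in_edge by blast
  have "\<exists>s. t \<in> {a<..<b} \<longrightarrow> s \<in> {0<..<1} \<and> \<gamma> t = echar G e s" for t
    using e(2) by blast
  then obtain u where u: "\<And>t. t \<in> {a<..<b} \<Longrightarrow> u t \<in> {0<..<1} \<and> \<gamma> t = echar G e (u t)" by metis
  \<comment> \<open>Continuity of the parameter amounts to the characteristic map being open on the
    open edge.\<close>
  have ucont: "continuous_on {a<..<b} u"
    unfolding continuous_openin_preimage_eq
  proof (intro allI impI)
    fix W :: "real set" assume "open W"
    then have "openin (gtop G) (echar G e ` (W \<inter> {0<..<1}))" by (intro openin_edge_image e) auto
    then have "openin (top_of_set {a<..<b}) {t \<in> topspace (top_of_set {a<..<b}). \<gamma> t \<in> echar G e ` (W \<inter> {0<..<1})}"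
      by (rule openin_continuous_map_preimage[OF \<gamma>o])
    moreover have "{t \<in> topspace (top_of_set {a<..<b}). \<gamma> t \<in> echar G e ` (W \<inter> {0<..<1})} = {a<..<b} \<inter> u -` W"
    proof -
      have "\<gamma> t \<in> echar G e ` (W \<inter> {0<..<1}) \<longleftrightarrow> u t \<in> W" if "t \<in> {a<..<b}" for t
        using inj_on_image_mem_iff[OF edge_inj[OF e(1)], of "u t" "W \<inter> {0<..<1}"] u[OF that] by auto
      then show ?thesis by auto
    qed
    ultimately show "openin (top_of_set {a<..<b}) ({a<..<b} \<inter> u -` W)" by simp
  qed
  have "locally_one_to_one (top_of_set {a<..<b}) u"
    by (rule locally_one_to_one_of_compose[OF loc, of "echar G e"]) (use u in blast)
  then have uinj: "inj_on u {a<..<b}"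
    by (intro locally_injective_imp_injective ucont) (auto simp: is_interval_oo)
  have ubd: "u ` {a<..<b} \<subseteq> {0..1}" using u by fastforce
  obtain v where v: "continuous_on {a..b} v" "inj_on v {a..b}" "v ` {a..b} \<subseteq> {0..1}"
    "\<And>t. t \<in> {a<..<b} \<Longrightarrow> v t = u t"
    using continuous_injective_extension[OF ab ucont uinj ubd] by blast
  have ev: "continuous_map (top_of_set {a..b}) (gtop G) (\<lambda>t. echar G e (v t))"
    using v by (intro continuous_map_compose[OF _ edge_cont[OF e(1)], unfolded o_def]) (auto simp: continuous_map_in_subtopology)
  have "\<gamma> t = echar G e (v t)" if "t \<in> {a..b}" for t
  proof (rule forall_in_closure_of_eq[OF _ Hausdorff \<gamma> ev])
    show "t \<in> top_of_set {a..b} closure_of {a<..<b}"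
      using that ab by (simp add: closure_of_subtopology Int_absorb1 greaterThanLessThan_subseteq_atLeastAtMost_iff)
  qed (use u v in auto)
  moreover have "v ` {a<..<b} \<subseteq> {0<..<1}" using v(4) u by auto
  ultimately show ?thesis using that[OF e(1) v(1-3)] by blast
qed

text \<open>The edge parameter is injective, so it cannot return to the end of the edge where it
  started; both 0 and 1 are attained.\<close>

lemma full_edge:
  fixes a b :: real
  assumes ab: "a < b" and \<gamma>: "continuous_map (top_of_set {a..b}) (gtop G) \<gamma>"
    and loc: "locally_one_to_one (top_of_set {a<..<b}) \<gamma>"
    and avoid: "\<And>t. a < t \<Longrightarrow> t < b \<Longrightarrow> \<gamma> t \<notin> verts G"
    and ends: "\<gamma> a \<in> verts G" "\<gamma> b \<in> verts G"
  obtains e where "e \<in> edges G" "\<gamma> ` {a..b} = edge_set G e"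
proof -
  obtain e \<xi> where e: "e \<in> edges G" "continuous_on {a..b} \<xi>" "inj_on \<xi> {a..b}" "\<xi> ` {a..b} \<subseteq> {0..1}"
    "\<forall>t\<in>{a..b}. \<gamma> t = echar G e (\<xi> t)"
    by (rule edge_chart[OF ab \<gamma> loc avoid])
  have ends01: "\<xi> t \<in> {0,1}" if t: "t \<in> {a..b}" "\<gamma> t \<in> verts G" for t
  proof -
    have "\<xi> t \<in> {0..1}" using e(4) t(1) by blast
    moreover have "echar G e (\<xi> t) \<in> verts G" using e(5) t by simp
    ultimately show ?thesis using edge_in_verts_iff[OF e(1), of "\<xi> t"] by auto
  qed
  have "\<xi> a \<in> {0,1}" "\<xi> b \<in> {0,1}" using ends01 ends ab by auto
  moreover have "\<xi> a \<noteq> \<xi> b" using inj_onD[OF e(3), of a b] ab by auto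
  moreover have "connected (\<xi> ` {a..b})" by (intro connected_continuous_image e) auto
  then have "{\<xi> a..\<xi> b} \<subseteq> \<xi> ` {a..b}" "{\<xi> b..\<xi> a} \<subseteq> \<xi> ` {a..b}"
    using ab by (intro connected_contains_Icc imageI; simp)+
  ultimately have "{0..1} \<subseteq> \<xi> ` {a..b}" by auto
  then have "\<xi> ` {a..b} = {0..1}" using e(4) by blast
  moreover have "\<gamma> ` {a..b} = echar G e ` \<xi> ` {a..b}" unfolding image_image using e(5) by (intro image_cong) auto
  ultimately show ?thesis using that e(1) by metis
qed

text \<open>Visits to vertices are finite in number, so there is a next visit after
  \<open>s\<close>; up to it the path traverses one full edge.\<close>

lemma covers_edge:
  fixes a b :: real
  assumes \<gamma>: "continuous_map (top_of_set {a..b}) (gtop G) \<gamma>"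
    and loc: "locally_one_to_one (top_of_set {a<..<b}) \<gamma>"
    and st: "a < s" "s < t" "t < b" and V: "\<gamma> s \<in> verts G" "\<gamma> t \<in> verts G"
  obtains e where "e \<in> edges G" "edge_set G e \<subseteq> \<gamma> ` {s..t}"
proof -
  define H where "H = {r \<in> {s..t}. \<gamma> r \<in> verts G} - {s}"
  have H: "finite H" "t \<in> H"
  proof -
    have "{s..t} \<subseteq> {a<..<b}" using st by auto
    then have "finite {r \<in> {s..t}. \<gamma> r \<in> verts G}"
      by (intro finite_level_sets[OF loc] finite_verts) auto
    then show "finite H" unfolding H_def by blast
    show "t \<in> H" using st V by (simp add: H_def)
  qed
  define r where "r = Min H"
  have r: "r \<in> H" "\<And>x. x \<in> H \<Longrightarrow> r \<le> x" unfolding r_def using H Min_in[of H] Min_le[of H] by blast+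
  then have "s < r" "r \<le> t" "\<gamma> r \<in> verts G" by (auto simp: H_def)
  moreover have "\<gamma> x \<notin> verts G" if "s < x" "x < r" for x
    using r(2)[of x] that calculation by (auto simp: H_def)
  moreover have "continuous_map (top_of_set {s..r}) (gtop G) \<gamma>"
    using calculation st by (intro continuous_map_interval_subset[OF \<gamma>]) auto
  moreover have "locally_one_to_one (top_of_set {s<..<r}) \<gamma>"
    using calculation st by (intro locally_one_to_one_subset[OF loc]) auto
  ultimately obtain e where "e \<in> edges G" "\<gamma> ` {s..r} = edge_set G e"
    using full_edge[of s r \<gamma>] V(1) by blast
  then show ?thesis using that \<open>r \<le> t\<close> image_mono[of "{s..r}" "{s..t}" \<gamma>] by auto
qed

text \<open>Local injectivity is assumed only on the open interval, so visits to vertices might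
  accumulate at \<open>a\<close>. Any two visits would enclose a whole edge together with a marked
  point on it different from \<open>\<gamma> a\<close>, which continuity excludes near
  \<open>a\<close>.\<close>

lemma initially_injective:
  fixes a b :: real
  assumes ab: "a < b" and \<gamma>: "continuous_map (top_of_set {a..b}) (gtop G) \<gamma>"
    and loc: "locally_one_to_one (top_of_set {a<..<b}) \<gamma>"
  obtains c where "a < c" "c \<le> b" "inj_on \<gamma> {a..c}"
proof -
  have "\<exists>t. 0 < t \<and> t < 1 \<and> echar G e t \<noteq> \<gamma> a" if "e \<in> edges G" for e
  proof -
    \<comment> \<open>Of two distinct interior points at most one equals \<open>\<gamma> a\<close>,
      so one of them can serve as the marked point.\<close>
    have "echar G e (1/2) \<noteq> echar G e (1/3)" using edge_eq(2)[OF that that, of "1/2" "1/3"] by auto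
    then consider "echar G e (1/2) \<noteq> \<gamma> a" | "echar G e (1/3) \<noteq> \<gamma> a" by metis
    then show ?thesis
    proof cases
      case 1
      then show ?thesis by (intro exI[of _ "1/2"]) simp
    next
      case 2
      then show ?thesis by (intro exI[of _ "1/3"]) simp
    qed
  qed
  then obtain m where m: "\<And>e. e \<in> edges G \<Longrightarrow> 0 < m e \<and> m e < 1 \<and> echar G e (m e) \<noteq> \<gamma> a" by metis
  define W where "W = pts G - (\<lambda>e. echar G e (m e)) ` edges G"
  have W: "openin (gtop G) W"
  proof -
    have "(\<lambda>e. echar G e (m e)) ` edges G \<subseteq> pts G"
      using m by (intro image_subsetI edge_in_pts) (auto simp: less_imp_le)
    then show ?thesis unfolding W_def using finite_edges by (intro openin_diff closedin_finite) auto
  qed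
  have "\<gamma> a \<in> pts G" using \<gamma> ab by (auto simp: continuous_map_def)
  moreover have "\<gamma> a \<notin> (\<lambda>e. echar G e (m e)) ` edges G"
  proof
    assume "\<gamma> a \<in> (\<lambda>e. echar G e (m e)) ` edges G"
    then obtain e where "\<gamma> a = echar G e (m e)" "e \<in> edges G" by (rule imageE)
    then show False using m[of e] by simp
  qed
  ultimately have "\<gamma> a \<in> W" unfolding W_def by (rule DiffI)
  have opn: "openin (top_of_set {a..b}) {t \<in> topspace (top_of_set {a..b}). \<gamma> t \<in> W}"
    using openin_continuous_map_preimage[OF \<gamma> W] .
  obtain d where d: "d > 0" "\<And>t. t \<in> {a..b} \<Longrightarrow> dist a t < d \<Longrightarrow> \<gamma> t \<in> W"
  proof -
    have "\<exists>d>0. ball a d \<inter> {a..b} \<subseteq> {t \<in> topspace (top_of_set {a..b}). \<gamma> t \<in> W}"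
      using opn \<open>\<gamma> a \<in> W\<close> ab unfolding openin_contains_ball by simp
    then show ?thesis using that by (auto simp: subset_iff)
  qed
  define c0 where "c0 = min b (a + d/2)"
  have c0: "a < c0" "c0 \<le> b" using d(1) ab by (auto simp: c0_def)
  have c0W: "\<gamma> t \<in> W" if "t \<in> {a..c0}" for t
    using that d(1) by (intro d(2)) (auto simp: c0_def dist_real_def)
  have le1: "s = t" if st: "s \<in> {a<..<c0}" "t \<in> {a<..<c0}" "\<gamma> s \<in> verts G" "\<gamma> t \<in> verts G" for s t
  proof -
    have "False" if st: "s \<in> {a<..<c0}" "t \<in> {a<..<c0}" "\<gamma> s \<in> verts G" "\<gamma> t \<in> verts G" "s < t" for s t
    proof -
      obtain e where e: "e \<in> edges G" "edge_set G e \<subseteq> \<gamma> ` {s..t}"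
        by (rule covers_edge[OF \<gamma> loc, of s t]) (use st c0 in auto)
      have "echar G e (m e) \<in> edge_set G e" using m[OF e(1)] by (intro imageI) auto
      then obtain x where x: "x \<in> {s..t}" "echar G e (m e) = \<gamma> x" using e(2) by blast
      then have "\<gamma> x \<in> W" using st by (intro c0W) auto
      then show False using e(1) x(2)[symmetric] unfolding W_def by blast
    qed
    then show ?thesis using st by (metis linorder_less_linear)
  qed
  obtain c where c: "a < c" "c \<le> c0" "\<And>t. t \<in> {a<..<c} \<Longrightarrow> \<gamma> t \<notin> verts G"
  proof (cases "\<exists>s\<in>{a<..<c0}. \<gamma> s \<in> verts G")
    case True
    then obtain s where s: "s \<in> {a<..<c0}" "\<gamma> s \<in> verts G" by blast
    have "\<gamma> t \<notin> verts G" if t: "t \<in> {a<..<s}" for t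
    proof
      assume "\<gamma> t \<in> verts G"
      moreover have "t \<in> {a<..<c0}" using s t by simp
      ultimately have "s = t" using le1[of s t] s by blast
      then show False using t by simp
    qed
    then show ?thesis using s by (intro that[of s]) auto
  next
    case False
    then show ?thesis using c0 by (intro that[of c0]) auto
  qed
  have \<gamma>c: "continuous_map (top_of_set {a..c}) (gtop G) \<gamma>"
    using c c0 by (intro continuous_map_interval_subset[OF \<gamma>]) auto
  have locc: "locally_one_to_one (top_of_set {a<..<c}) \<gamma>"
    using c c0 by (intro locally_one_to_one_subset[OF loc]) auto
  obtain e \<xi> where e: "e \<in> edges G" "inj_on \<xi> {a..c}" "\<xi> ` {a..c} \<subseteq> {0..1}"
    "\<forall>t\<in>{a..c}. \<gamma> t = echar G e (\<xi> t)" "\<xi> ` {a<..<c} \<subseteq> {0<..<1}"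
    by (rule edge_chart[OF c(1) \<gamma>c locc]) (use c(3) in auto)
  \<comment> \<open>Stopping before \<open>c\<close> keeps every parameter except that of
    \<open>a\<close> interior to the edge. At \<open>c\<close> the path could be back at its
    starting vertex, if the edge is a loop.\<close>
  define c' where "c' = (a+c)/2"
  have c': "a < c'" "c' < c" using c by (auto simp: c'_def)
  have "inj_on \<gamma> {a..c'}"
  proof (rule linorder_inj_onI)
    fix s t assume st: "s < t" "s \<in> {a..c'}" "t \<in> {a..c'}"
    then have "t \<in> {a<..<c}" "s \<in> {a..c}" using c' by auto
    then have "\<xi> t \<in> {0<..<1}" "\<xi> s \<in> {0..1}" "\<xi> s \<noteq> \<xi> t"
      using e(3,5) inj_onD[OF e(2), of s t] st by (auto simp: image_subset_iff)
    then have "echar G e (\<xi> t) \<noteq> echar G e (\<xi> s)"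
      using edge_eq(2)[OF e(1) e(1), of "\<xi> t" "\<xi> s"] by auto
    then show "\<gamma> s \<noteq> \<gamma> t" using e(4) \<open>t \<in> {a<..<c}\<close> \<open>s \<in> {a..c}\<close> by auto
  qed auto
  then show ?thesis using that[of c'] c c0 c' by auto
qed

text \<open>Both ends have neighbourhoods on which the path is injective, the right one by reversing
  time; the compact part in between is covered by \<open>finite_level_sets\<close>.\<close>

lemma finite_path_level_sets:
  fixes a b :: real
  assumes \<gamma>: "continuous_map (top_of_set {a..b}) (gtop G) \<gamma>"
    and loc: "locally_one_to_one (top_of_set {a<..<b}) \<gamma>" and F: "finite F"
  shows "finite {t \<in> {a..b}. \<gamma> t \<in> F}"
proof (cases "a < b")
  case True
  have inj: "finite {t \<in> S. \<gamma>' t \<in> F}" if "inj_on \<gamma>' S" for \<gamma>' S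
  proof -
    have "{t \<in> S. \<gamma>' t \<in> F} = \<gamma>' -` F \<inter> S" by auto
    then show ?thesis using finite_vimage_IntI[OF F that] by simp
  qed
  obtain c where c: "a < c" "c \<le> b" "inj_on \<gamma> {a..c}" using initially_injective[OF True \<gamma> loc] .
  define \<delta> where "\<delta> t = \<gamma> (- t)" for t
  have "continuous_map (top_of_set {-b..-a}) (gtop G) \<delta>"
    unfolding \<delta>_def by (rule continuous_map_compose[OF _ \<gamma>, unfolded o_def])
      (auto simp: continuous_map_in_subtopology intro!: continuous_intros)
  moreover have "locally_one_to_one (top_of_set {-b<..<-a}) \<delta>"
    by (rule locally_one_to_one_compose_inj[OF loc, of _ uminus]) (auto simp: \<delta>_def intro!: continuous_intros)
  ultimately obtain d where d: "-b < d" "d \<le> -a" "inj_on \<delta> {-b..d}" using initially_injective[of "-b" "-a" \<delta>] True by auto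
  have "inj_on \<gamma> {-d..b}"
  proof (rule inj_onI)
    fix x y assume "x \<in> {-d..b}" "y \<in> {-d..b}" "\<gamma> x = \<gamma> y"
    then show "x = y" using inj_onD[OF d(3), of "-x" "-y"] by (auto simp: \<delta>_def)
  qed
  moreover have "finite {t \<in> {c..-d}. \<gamma> t \<in> F}"
    by (rule finite_level_sets[OF loc _ _ F]) (use c d in auto)
  ultimately have "finite ({t \<in> {a..c}. \<gamma> t \<in> F} \<union> {t \<in> {-d..b}. \<gamma> t \<in> F} \<union> {t \<in> {c..-d}. \<gamma> t \<in> F})"
    using inj c by blast
  then show ?thesis by (rule rev_finite_subset) auto
next
  case False
  then have "{t \<in> {a..b}. \<gamma> t \<in> F} \<subseteq> {a}" by auto
  then show ?thesis using finite_subset by blast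
qed

end

section \<open>Path classes\<close>

lemma reparam_maps: "reparam h \<Longrightarrow> t \<in> {0..1} \<Longrightarrow> h t \<in> {0..1}"
  unfolding reparam_def by blast

lemma reparamD:
  assumes "reparam h"
  shows "continuous_on {0..1} h" "strict_mono_on {0..1} h" "h ` {0..1} = {0..1}" "inj_on h {0..1}"
  using assms strict_mono_on_imp_inj_on[of "{0..1}" h] unfolding reparam_def by (elim conjE; assumption?; simp)+

lemma reparam_id: "reparam (\<lambda>t. t)"
  unfolding reparam_def by (intro conjI continuous_on_id strict_mono_onI) simp_all

lemma reparam_comp:
  assumes "reparam h" "reparam k"
  shows "reparam (\<lambda>t. h (k t))"
proof -
  note h = reparamD[OF assms(1)] and k = reparamD[OF assms(2)]
  have "continuous_on {0..1} (\<lambda>t. h (k t))"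
    by (rule continuous_on_compose2[OF h(1) k(1)]) (simp add: k(3))
  moreover have "strict_mono_on {0..1} (\<lambda>t. h (k t))"
    using reparam_maps[OF assms(2)]
    by (intro strict_mono_onI) (blast intro: strict_mono_onD[OF h(2)] strict_mono_onD[OF k(2)])
  moreover have "(\<lambda>t. h (k t)) ` {0..1} = {0..1}"
    unfolding image_image[of h k, symmetric] k(3) h(3) ..
  ultimately show ?thesis unfolding reparam_def by blast
qed

lemma reparam_ends:
  assumes "reparam h"
  shows "h 0 = 0" "h 1 = 1"
proof -
  note h = reparamD(2,3)[OF assms]
  have le: "h s \<le> h t" if "s \<in> {0..1}" "t \<in> {0..1}" "s \<le> t" for s t
    using strict_mono_onD[OF h(1) that(1,2)] that(3) by (cases "s = t") auto
  obtain s t where "s \<in> {0..1}" "h s = 0" "t \<in> {0..1}" "h t = 1"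
    using h(2) by (metis (no_types, lifting) atLeastAtMost_iff imageE order_refl zero_le_one)
  then have "h 0 \<le> 0" "1 \<le> h 1" using le[of 0 s] le[of t 1] by auto
  moreover have "h 0 \<in> {0..1}" "h 1 \<in> {0..1}" using reparam_maps[OF assms] by auto
  ultimately show "h 0 = 0" "h 1 = 1" by auto
qed

lemma reparam_inverse:
  assumes "reparam h"
  obtains k where "reparam k" "\<forall>t\<in>{0..1}. h (k t) = t"
proof -
  note h = reparamD(1-3)[OF assms]
  have inj: "inj_on h {0..1}" using h(2) strict_mono_on_imp_inj_on by blast
  define k where "k = inv_into {0..1} h"
  have kk: "k t \<in> {0..1}" "h (k t) = t" if "t \<in> {0..1}" for t
    using that h(3) inv_into_into[of t h "{0..1}"] f_inv_into_f[of t h "{0..1}"] by (auto simp: k_def)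
  have kh: "k (h t) = t" if "t \<in> {0..1}" for t
    using that inj by (simp add: k_def)
  have "continuous_on {0..1} k"
    using continuous_on_inv[OF h(1), of k] kh h(3) by simp
  moreover have "strict_mono_on {0..1} k"
  proof (intro strict_mono_onI)
    fix r s :: real assume rs: "r \<in> {0..1}" "s \<in> {0..1}" "r < s"
    show "k r < k s"
    proof (rule ccontr)
      assume "\<not> k r < k s"
      then consider "k s < k r" | "k s = k r" by linarith
      then show False
        using strict_mono_onD[OF h(2) kk(1)[OF rs(2)] kk(1)[OF rs(1)]] kk(2)[OF rs(1)] kk(2)[OF rs(2)] rs(3)
        by cases auto
    qed
  qed
  moreover have "k ` {0..1} = {0..1}"
  proof
    show "k ` {0..1} \<subseteq> {0..1}" using kk(1) by blast
    show "{0..1} \<subseteq> k ` {0..1}" using kh reparam_maps[OF assms] by (metis imageI subsetI)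
  qed
  ultimately have "reparam k" unfolding reparam_def by blast
  then show ?thesis using that[of k] kk(2) by blast
qed

lemma pclass_self: "\<gamma> \<in> pclass \<gamma>"
  unfolding pclass_def using reparam_id by blast

lemma pclassI: "reparam h \<Longrightarrow> (\<And>t. t \<in> {0..1} \<Longrightarrow> \<delta> t = \<gamma> (h t)) \<Longrightarrow> \<delta> \<in> pclass \<gamma>"
  unfolding pclass_def by blast

lemma pclassE:
  assumes "\<delta> \<in> pclass \<gamma>"
  obtains h where "reparam h" "\<forall>t\<in>{0..1}. \<delta> t = \<gamma> (h t)"
  using assms unfolding pclass_def by blast

lemma pclass_trans:
  assumes "\<delta> \<in> pclass \<gamma>" "\<eta> \<in> pclass \<delta>"
  shows "\<eta> \<in> pclass \<gamma>"
proof -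
  obtain h where h: "reparam h" "\<forall>t\<in>{0..1}. \<delta> t = \<gamma> (h t)" by (rule pclassE[OF assms(1)])
  obtain k where k: "reparam k" "\<forall>t\<in>{0..1}. \<eta> t = \<delta> (k t)" by (rule pclassE[OF assms(2)])
  show ?thesis
    by (rule pclassI[OF reparam_comp[OF h(1) k(1)]]) (use h(2) k(2) reparam_maps[OF k(1)] in simp)
qed

lemma pclass_sym:
  assumes "\<delta> \<in> pclass \<gamma>"
  shows "\<gamma> \<in> pclass \<delta>"
proof -
  obtain h where h: "reparam h" "\<forall>t\<in>{0..1}. \<delta> t = \<gamma> (h t)" by (rule pclassE[OF assms])
  obtain k where k: "reparam k" "\<forall>t\<in>{0..1}. h (k t) = t" by (rule reparam_inverse[OF h(1)])
  show ?thesis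
    by (rule pclassI[OF k(1)]) (use h(2) k(2) reparam_maps[OF k(1)] in simp)
qed

lemma pclass_eqI: "\<delta> \<in> pclass \<gamma> \<Longrightarrow> pclass \<delta> = pclass \<gamma>"
  using pclass_trans pclass_sym by blast

lemma prep_in: "l = pclass \<gamma> \<Longrightarrow> prep l \<in> pclass \<gamma>"
  unfolding prep_def using pclass_self[of \<gamma>] by (metis someI)

lemma prep_reparam:
  obtains h where "reparam h" "\<forall>t\<in>{0..1}. prep (pclass \<gamma>) t = \<gamma> (h t)"
  by (rule pclassE[OF prep_in[OF refl]])

lemma pinit_pclass: "pinit (pclass \<gamma>) = \<gamma> 0"
  unfolding pinit_def by (rule prep_reparam[of \<gamma>]) (auto simp: reparam_ends)

lemma pterm_pclass: "pterm (pclass \<gamma>) = \<gamma> 1"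
  unfolding pterm_def by (rule prep_reparam[of \<gamma>]) (auto simp: reparam_ends)

lemma reparam_open_interval:
  assumes "reparam h"
  shows "h ` {0<..<1} = {0<..<1}"
proof -
  note h = reparamD(2,3)[OF assms]
  have inj: "inj_on h {0..1}" using h(1) strict_mono_on_imp_inj_on by blast
  have I: "{0<..<1::real} = {0..1} - {0,1}" by auto
  have "h ` ({0..1} - {0,1}) = h ` {0..1} - h ` {0,1}"
    using inj by (intro inj_on_image_set_diff[of _ "{0..1}"]) auto
  then show ?thesis unfolding I h(2) using reparam_ends[OF assms] by simp
qed

lemma pinterior_pclass: "pinterior (pclass \<gamma>) = \<gamma> ` {0<..<1}"
proof -
  obtain h where h: "reparam h" "\<forall>t\<in>{0..1}. prep (pclass \<gamma>) t = \<gamma> (h t)" by (rule prep_reparam[of \<gamma>])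
  have "prep (pclass \<gamma>) ` {0<..<1} = \<gamma> ` h ` {0<..<1}"
    unfolding image_image using h(2) by (intro image_cong) auto
  then show ?thesis unfolding pinterior_def reparam_open_interval[OF h(1)] .
qed

lemma reparam_reverse:
  assumes "reparam h"
  shows "reparam (\<lambda>t. 1 - h (1 - t))"
proof -
  note h = reparamD(1-3)[OF assms]
  have "continuous_on {0..1} (\<lambda>t. 1 - h (1 - t))"
    by (intro continuous_on_diff continuous_on_const continuous_on_compose2[OF h(1)] continuous_on_id) auto
  moreover have "strict_mono_on {0..1} (\<lambda>t. 1 - h (1 - t))"
    by (intro strict_mono_onI) (auto intro!: strict_mono_onD[OF h(2)])
  moreover have "(\<lambda>t. 1 - h (1 - t)) ` {0..1} = {0..1}"
  proof -
    have I: "(\<lambda>t. 1 - t) ` {0..1} = {0..1::real}"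
      by simp
    have "(\<lambda>t. 1 - h (1 - t)) ` {0..1} = (\<lambda>t. 1 - t) ` h ` (\<lambda>t. 1 - t) ` {0..1}"
      unfolding image_image ..
    then show ?thesis unfolding I h(3) .
  qed
  ultimately show ?thesis unfolding reparam_def by blast
qed

lemma prev_pclass: "prev (pclass \<gamma>) = pclass (\<lambda>t. \<gamma> (1 - t))"
proof
  show "pclass (\<lambda>t. \<gamma> (1 - t)) \<subseteq> prev (pclass \<gamma>)"
    unfolding prev_def using pclass_self[of \<gamma>] by blast
  show "prev (pclass \<gamma>) \<subseteq> pclass (\<lambda>t. \<gamma> (1 - t))"
  proof
    fix \<eta> assume "\<eta> \<in> prev (pclass \<gamma>)"
    then obtain \<delta> where d: "\<delta> \<in> pclass \<gamma>" "\<eta> \<in> pclass (\<lambda>t. \<delta> (1 - t))" unfolding prev_def by blast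
    obtain h where h: "reparam h" "\<forall>t\<in>{0..1}. \<delta> t = \<gamma> (h t)" by (rule pclassE[OF d(1)])
    have "(\<lambda>t. \<delta> (1 - t)) \<in> pclass (\<lambda>t. \<gamma> (1 - t))"
      using h(2) by (intro pclassI[OF reparam_reverse[OF h(1)]]) auto
    then show "\<eta> \<in> pclass (\<lambda>t. \<gamma> (1 - t))" using d(2) pclass_trans by blast
  qed
qed

lemma pimage_pclass: "pimage F (pclass \<gamma>) = pclass (F \<circ> \<gamma>)"
proof
  show "pclass (F \<circ> \<gamma>) \<subseteq> pimage F (pclass \<gamma>)"
    unfolding pimage_def using pclass_self[of \<gamma>] by blast
  show "pimage F (pclass \<gamma>) \<subseteq> pclass (F \<circ> \<gamma>)"
  proof
    fix \<eta> assume "\<eta> \<in> pimage F (pclass \<gamma>)"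
    then obtain \<delta> where d: "\<delta> \<in> pclass \<gamma>" "\<eta> \<in> pclass (F \<circ> \<delta>)" unfolding pimage_def by blast
    obtain h where h: "reparam h" "\<forall>t\<in>{0..1}. \<delta> t = \<gamma> (h t)" by (rule pclassE[OF d(1)])
    have "F \<circ> \<delta> \<in> pclass (F \<circ> \<gamma>)" using h(2) by (intro pclassI[OF h(1)]) simp
    then show "\<eta> \<in> pclass (F \<circ> \<gamma>)" using d(2) pclass_trans by blast
  qed
qed

lemma path_map_reparam:
  assumes \<gamma>: "path_map T \<gamma>" and h: "reparam h" "\<And>t. t \<in> {0..1} \<Longrightarrow> \<delta> t = \<gamma> (h t)"
  shows "path_map T \<delta>"
proof -
  have hh: "continuous_on {0..1} h" "inj_on h {0..1}" "h ` {0..1} \<subseteq> {0..1}"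
    using reparamD[OF h(1)] by simp_all
  have "continuous_map (top_of_set {0..1}) T (\<gamma> \<circ> h)"
    using \<gamma> hh unfolding path_map_def pathin_def
    by (intro continuous_map_compose[of _ "top_of_set {0..1}"]) (auto simp: continuous_map_in_subtopology)
  then have "pathin T \<delta>"
    unfolding pathin_def by (rule continuous_map_eq) (use h(2) in auto)
  moreover have "locally_one_to_one (top_of_set {0..1}) \<delta>"
    using \<gamma> unfolding path_map_def
    by (intro locally_one_to_one_compose_inj[of "{0..1}" \<gamma> "{0..1}" h \<delta>]) (use hh h(2) in auto)
  ultimately show ?thesis unfolding path_map_def by blast
qed

lemma prep_path:
  assumes "l \<in> paths T"
  shows "path_map T (prep l)" "pclass (prep l) = l"
proof -
  obtain \<gamma> where g: "l = pclass \<gamma>" "path_map T \<gamma>" using assms unfolding paths_def by blast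
  have p: "prep l \<in> pclass \<gamma>" using prep_in[OF g(1)] .
  show "pclass (prep l) = l" using pclass_eqI[OF p] g(1) by simp
  obtain h where "reparam h" "\<forall>t\<in>{0..1}. prep l t = \<gamma> (h t)" by (rule pclassE[OF p])
  then show "path_map T (prep l)" using path_map_reparam[OF g(2), of h "prep l"] by blast
qed

lemma pclass_paths_between:
  assumes "path_map T \<gamma>" "\<gamma> 0 \<in> A" "\<gamma> 1 \<in> A" "\<And>t. 0 < t \<Longrightarrow> t < 1 \<Longrightarrow> \<gamma> t \<notin> A"
  shows "pclass \<gamma> \<in> paths_between T A"
  using assms unfolding paths_between_def paths_def
  by (auto simp: pinit_pclass pterm_pclass pinterior_pclass)

lemma prep_paths_between:
  assumes "l \<in> paths_between T A"
  shows "path_map T (prep l)" "pclass (prep l) = l" "prep l 0 \<in> A" "prep l 1 \<in> A"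
    "\<And>t. 0 < t \<Longrightarrow> t < 1 \<Longrightarrow> prep l t \<notin> A"
proof -
  have l: "l \<in> paths T" "pinit l \<in> A" "pterm l \<in> A" "pinterior l \<inter> A = {}"
    using assms unfolding paths_between_def by auto
  show "path_map T (prep l)" "pclass (prep l) = l" using prep_path[OF l(1)] .
  show "prep l 0 \<in> A" "prep l 1 \<in> A" using l by (auto simp: pinit_def pterm_def)
  show "prep l t \<notin> A" if "0 < t" "t < 1" for t
  proof
    assume "prep l t \<in> A"
    moreover have "prep l t \<in> prep l ` {0<..<1}" using that by (intro imageI) simp
    ultimately show False using l(4) unfolding pinterior_def by blast
  qed
qed

text \<open>The fixed points of \<open>k\<close> form a nonempty clopen set; this also rules out reversing \<open>k\<close>.\<close>

lemma locally_injective_rigid: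
  fixes k :: "real \<Rightarrow> real"
  assumes \<gamma>: "locally_one_to_one (top_of_set {0..1}) \<gamma>"
    and k: "continuous_on {0..1} k" "k ` {0..1} \<subseteq> {0..1}"
    and eq: "\<And>t. t \<in> {0..1} \<Longrightarrow> \<gamma> (k t) = \<gamma> t" and t: "t \<in> {0..1}"
  shows "k t = t"
proof -
  let ?A = "{t \<in> {0..1}. k t = t}"
  have "\<exists>x\<ge>0. x \<le> 1 \<and> k x - x = 0"
  proof (intro IVT2')
    have "k x \<in> {0..1}" if "x \<in> {0..1}" for x using k(2) that by blast
    from this[of 0] this[of 1] show "0 \<le> k 0 - 0" "k 1 - 1 \<le> 0" by auto
  qed (auto intro!: continuous_intros k(1))
  then have ne: "?A \<noteq> {}" by auto
  have "closedin (top_of_set {0..1}) {t \<in> {0..1}. k t - t = 0}"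
    by (rule continuous_closedin_preimage_constant) (intro continuous_on_diff k(1) continuous_on_id)
  then have cl: "closedin (top_of_set {0..1}) ?A" by simp
  have op: "openin (top_of_set {0..1}) ?A"
    unfolding openin_subopen[of _ ?A]
  proof
    fix x assume x: "x \<in> ?A"
    then have "x \<in> topspace (top_of_set {0..1})" by simp
    then obtain U where U: "openin (top_of_set {0..1}) U" "x \<in> U" "inj_on \<gamma> U"
      using \<gamma> unfolding locally_one_to_one_def by blast
    have "openin (top_of_set {0..1}) ({0..1} \<inter> k -` U)"
      using continuous_openin_preimage[OF k(1) _ U(1)] k(2) by blast
    then have W: "openin (top_of_set {0..1}) (U \<inter> ({0..1} \<inter> k -` U))" using U(1) by blast
    moreover have "U \<inter> ({0..1} \<inter> k -` U) \<subseteq> ?A"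
      using eq inj_onD[OF U(3)] by blast
    ultimately show "\<exists>T. openin (top_of_set {0..1}) T \<and> x \<in> T \<and> T \<subseteq> ?A"
      using x U(2) by (intro exI[of _ "U \<inter> ({0..1} \<inter> k -` U)"]) auto
  qed
  have "?A = {0..1}"
    using connected_clopen[of "{0..1::real}"] cl op ne by auto
  then show ?thesis using t by blast
qed

text \<open>A continuous bijection of the unit interval is increasing or decreasing; in the second
  case its composition with the reversal is a reparametrization.\<close>

lemma pclass_eq_up_to_direction:
  assumes k: "continuous_on {0..1} k" "inj_on k {0..1}" "k ` {0..1} = {0..1}"
    and eq: "\<And>t. t \<in> {0..1} \<Longrightarrow> \<gamma> t = \<delta> (k t)"
  shows "pclass \<gamma> \<in> {pclass \<delta>, prev (pclass \<delta>)}"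
proof -
  consider "strict_mono_on {0..1} k" | "strict_antimono_on {0..1} k"
    using k injective_eq_monotone_map[of "{0..1}" k] by (auto simp: is_interval_cc)
  then show ?thesis
  proof cases
    case 1
    then have "reparam k" using k unfolding reparam_def by blast
    then have "\<gamma> \<in> pclass \<delta>" using eq by (rule pclassI)
    then show ?thesis using pclass_eqI by blast
  next
    case 2
    have I: "(\<lambda>t. 1 - t) ` {0..1} = {0..1::real}"
      by simp
    have "(\<lambda>t. 1 - k t) ` {0..1} = (\<lambda>t. 1 - t) ` k ` {0..1}" by (simp add: image_image)
    then have "(\<lambda>t. 1 - k t) ` {0..1} = {0..1}" unfolding k(3) I .
    moreover have "strict_mono_on {0..1} (\<lambda>t. 1 - k t)"
      using 2 by (intro strict_mono_onI) (auto simp: monotone_on_def)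
    moreover have "continuous_on {0..1} (\<lambda>t. 1 - k t)" by (intro continuous_intros k)
    ultimately have "reparam (\<lambda>t. 1 - k t)" unfolding reparam_def by blast
    then have "\<gamma> \<in> pclass (\<lambda>t. \<delta> (1 - t))" by (rule pclassI) (use eq in auto)
    then show ?thesis unfolding prev_pclass using pclass_eqI by blast
  qed
qed

section \<open>Coding by a Markov partition\<close>

lemma injective_interval_image:
  fixes f :: "real \<Rightarrow> real"
  assumes ab: "a < b" and f: "continuous_on {a..b} f" "inj_on f {a..b}" "f ` {a..b} = {c..d}"
  shows "{f a, f b} = {c, d}" "f ` {a<..<b} = {c<..<d}"
proof -
  have in_cd: "f a \<in> {c..d}" "f b \<in> {c..d}" using f(3) ab by (metis atLeastAtMost_iff imageI less_imp_le order_refl)+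
  then have cd: "c \<le> d" by auto
  obtain s t where s: "s \<in> {a..b}" "f s = c" and t: "t \<in> {a..b}" "f t = d"
    using f(3) cd by (metis (no_types, lifting) atLeastAtMost_iff imageE order_refl)
  consider "strict_mono_on {a..b} f" | "strict_antimono_on {a..b} f"
    using f injective_eq_monotone_map[of "{a..b}" f] by (auto simp: is_interval_cc)
  then show ends: "{f a, f b} = {c, d}"
  proof cases
    case 1
    have "f a \<le> f s" using strict_mono_onD[OF 1, of a s] s ab by (cases "a = s") auto
    moreover have "f t \<le> f b" using strict_mono_onD[OF 1, of t b] t ab by (cases "t = b") auto
    ultimately have "f a = c" "f b = d" using s t in_cd by auto
    then show ?thesis by simp
  next
    case 2
    have "f b \<le> f s" using s ab 2 by (cases "s = b") (auto simp: monotone_on_def less_imp_le)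
    moreover have "f t \<le> f a" using t ab 2 by (cases "t = a") (auto simp: monotone_on_def less_imp_le)
    ultimately have "f b = c" "f a = d" using s t in_cd by auto
    then show ?thesis by auto
  qed
  have I: "{x<..<y} = {x..y} - {x,y}" for x y :: real by auto
  have "f ` ({a..b} - {a,b}) = f ` {a..b} - f ` {a,b}"
    using ab by (intro inj_on_image_set_diff[OF f(2)]) auto
  then show "f ` {a<..<b} = {c<..<d}" unfolding I f(3) using ends by simp
qed

lemma inj_on_imp_locally_one_to_one:
  assumes "inj_on f S"
  shows "locally_one_to_one (top_of_set S) f"
  unfolding locally_one_to_one_def
proof
  fix x assume "x \<in> topspace (top_of_set S)"
  moreover have "openin (top_of_set S) S" by simp
  ultimately show "\<exists>U. openin (top_of_set S) U \<and> x \<in> U \<and> inj_on f U"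
    using assms by (intro exI[of _ S]) simp
qed

lemma sorted_partition_step:
  fixes xs :: "real list"
  assumes "xs \<noteq> []" "hd xs = 0" "last xs = 1" "sorted_wrt (<) xs" "0 \<le> t" "t \<le> 1"
  obtains j where "Suc j < length xs" "xs ! j \<le> t" "t \<le> xs ! Suc j"
proof -
  have nth0: "xs ! 0 = 0" using assms by (simp add: hd_conv_nth)
  have last: "xs ! (length xs - 1) = 1" using assms by (simp add: last_conv_nth)
  have len: "1 < length xs"
  proof (rule ccontr)
    assume "\<not> 1 < length xs"
    then have "length xs - 1 = 0" by simp
    then show False using nth0 last by simp
  qed
  let ?J = "{j. Suc j < length xs \<and> xs ! j \<le> t}"
  have fin: "finite ?J" by (rule finite_subset[of _ "{..<length xs}"]) auto
  have ne: "0 \<in> ?J" using len nth0 assms by simp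
  define j where "j = Max ?J"
  have j: "j \<in> ?J" unfolding j_def using Max_in[OF fin] ne by blast
  have "t \<le> xs ! Suc j"
  proof (cases "Suc (Suc j) < length xs")
    case True
    have "Suc j \<notin> ?J" using Max_ge[OF fin, of "Suc j"] unfolding j_def by auto
    then show ?thesis using True by simp
  next
    case False
    then have "Suc j = length xs - 1" using j by auto
    then show ?thesis using last assms by simp
  qed
  then show ?thesis using that j by blast
qed

abbreviation lo :: "'e subinterval \<Rightarrow> real" where "lo I \<equiv> fst (snd I)"
abbreviation hi :: "'e subinterval \<Rightarrow> real" where "hi I \<equiv> snd (snd I)"

text \<open>The hypothesis \<open>escape\<close> is all that is left of expansion: every arc contains a point that hits a vertex.\<close>

locale markov_system = finite_graph Z for Z :: "('z, 'e, 'm) digraph_scheme" +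
  fixes h :: "'z \<Rightarrow> 'z" and \<A> :: "'e subinterval set"
  assumes h_cont: "continuous_map (gtop Z) (gtop Z) h"
    and h_verts: "\<And>v. v \<in> verts Z \<Longrightarrow> h v \<in> verts Z"
    and partition: "markov_partition Z h \<A>"
    and escape: "\<And>e s t. e \<in> edges Z \<Longrightarrow> 0 \<le> s \<Longrightarrow> s < t \<Longrightarrow> t \<le> 1 \<Longrightarrow>
      \<exists>r m. s < r \<and> r < t \<and> (h ^^ m) (echar Z e r) \<in> verts Z"
begin

text \<open>If a vertex were hit inside the piece, the part up to the first hit would already cover
  the edge \<open>e'\<close>, and a later point would repeat a value, against injectivity. So the
  piece runs exactly once along \<open>e'\<close>.\<close>

lemma piece_chart:
  assumes e: "e \<in> edges Z" "0 \<le> a" "a < b" "b \<le> 1" and inj: "inj_on h (open_arc Z (e, a, b))"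
    and img: "h ` closed_arc Z (e, a, b) = edge_set Z e'" "e' \<in> edges Z"
    and ha: "h (echar Z e a) \<in> verts Z"
  obtains \<xi> where "continuous_on {a..b} \<xi>" "inj_on \<xi> {a..b}" "\<xi> ` {a..b} = {0..1}"
    "\<forall>t\<in>{a..b}. h (echar Z e t) = echar Z e' (\<xi> t)"
proof -
  define \<gamma> where "\<gamma> t = h (echar Z e t)" for t
  have echar_inj: "inj_on (echar Z e) {a<..<b}"
    by (rule inj_on_subset[OF edge_inj[OF e(1)]]) (use e in auto)
  have \<gamma>inj: "inj_on \<gamma> {a<..<b}"
    using comp_inj_on[OF echar_inj, of h] inj unfolding \<gamma>_def[abs_def] by (simp add: o_def)
  have \<gamma>: "continuous_map (top_of_set {a..b}) (gtop Z) \<gamma>"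
    unfolding \<gamma>_def using e
    by (intro continuous_map_compose[OF _ h_cont, unfolded o_def] continuous_map_interval_subset[OF edge_cont[OF e(1)]]) auto
  have loc: "locally_one_to_one (top_of_set {a<..<b}) \<gamma>" by (rule inj_on_imp_locally_one_to_one[OF \<gamma>inj])
  have img': "\<gamma> ` {a..b} = edge_set Z e'" using img(1) unfolding \<gamma>_def by (simp add: image_image)
  let ?H = "{t \<in> {a..b}. \<gamma> t \<in> verts Z}"
  have finH: "finite ?H" by (rule finite_path_level_sets[OF \<gamma> loc finite_verts])
  have nohit: "\<gamma> t \<notin> verts Z" if t: "a < t" "t < b" for t
  proof
    assume hit: "\<gamma> t \<in> verts Z"
    let ?I = "?H \<inter> {a<..<b}"
    have finI: "finite ?I" and tI: "t \<in> ?I" using finH t hit by auto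
    define t1 where "t1 = Min ?I"
    have t1: "t1 \<in> ?I" unfolding t1_def using Min_in[OF finI] tI by blast
    have min: "t1 \<le> x" if "x \<in> ?I" for x unfolding t1_def using Min_le[OF finI that] .
    have t1': "a < t1" "t1 < b" "\<gamma> t1 \<in> verts Z" using t1 by auto
    obtain e1 where e1: "e1 \<in> edges Z" "\<gamma> ` {a..t1} = edge_set Z e1"
    proof (rule full_edge[OF t1'(1)])
      show "continuous_map (top_of_set {a..t1}) (gtop Z) \<gamma>"
        by (rule continuous_map_interval_subset[OF \<gamma>]) (use t1' in auto)
      show "locally_one_to_one (top_of_set {a<..<t1}) \<gamma>"
        by (rule locally_one_to_one_subset[OF loc]) (use t1' in auto)
      show "\<gamma> x \<notin> verts Z" if "a < x" "x < t1" for x using min[of x] that t1' by auto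
      show "\<gamma> a \<in> verts Z" using ha unfolding \<gamma>_def .
      show "\<gamma> t1 \<in> verts Z" by (rule t1'(3))
    qed
    have "echar Z e1 (1/2) \<in> edge_set Z e1" by (intro imageI) simp
    also have "\<dots> \<subseteq> \<gamma> ` {a..b}" unfolding e1(2)[symmetric] using t1' by (intro image_mono) auto
    finally obtain s where s: "s \<in> {0..1}" "echar Z e1 (1/2) = echar Z e' s" unfolding img' by blast
    then have "e1 = e'" using edge_eq(1)[OF e1(1) img(2), of "1/2" s] by simp
    \<comment> \<open>Only finitely many parameters are mapped to vertices, so a later point with a
      nonvertex image exists. Its image is taken a second time on \<open>{a..t1}\<close>.\<close>
    have "infinite {t1<..<b}" using t1' infinite_Ioo by blast
    then obtain x where x: "x \<in> {t1<..<b}" "x \<notin> ?H" using finH by (meson finite_subset subsetI)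
    then have "\<gamma> x \<notin> verts Z" using t1' by auto
    moreover have "\<gamma> x \<in> \<gamma> ` {a..b}" using x t1' by (intro imageI) auto
    then have "\<gamma> x \<in> \<gamma> ` {a..t1}" unfolding img' e1(2) \<open>e1 = e'\<close> .
    then obtain y where y: "y \<in> {a..t1}" "\<gamma> x = \<gamma> y" by blast
    ultimately have "y \<noteq> a" using ha unfolding \<gamma>_def by metis
    then have "x = y" using inj_onD[OF \<gamma>inj y(2)] x(1) y(1) t1' by auto
    then show False using x(1) y(1) by auto
  qed
  obtain e1 \<xi> where c: "e1 \<in> edges Z" "continuous_on {a..b} \<xi>" "inj_on \<xi> {a..b}" "\<xi> ` {a..b} \<subseteq> {0..1}"
    "\<forall>t\<in>{a..b}. \<gamma> t = echar Z e1 (\<xi> t)" "\<xi> ` {a<..<b} \<subseteq> {0<..<1}"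
    by (rule edge_chart[OF e(3) \<gamma> loc nohit])
  have mid: "(a+b)/2 \<in> {a<..<b}" using e(3) by auto
  have "\<xi> ((a+b)/2) \<in> {0<..<1}" using c(6) mid by blast
  moreover have "\<gamma> ((a+b)/2) \<in> edge_set Z e'" unfolding img'[symmetric] using mid by (intro imageI) auto
  then obtain s where "s \<in> {0..1}" "\<gamma> ((a+b)/2) = echar Z e' s" by blast
  moreover have "\<gamma> ((a+b)/2) = echar Z e1 (\<xi> ((a+b)/2))" using c(5) mid by auto
  ultimately have "e1 = e'" using edge_eq(1)[OF c(1) img(2), of "\<xi> ((a+b)/2)" s] by auto
  \<comment> \<open>Only interior parameters can be compared, since a loop identifies 0 and 1; the
    ends follow by closure.\<close>
  have "{0<..<1} \<subseteq> \<xi> ` {a..b}"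
  proof
    fix s :: real assume s: "s \<in> {0<..<1}"
    then have "echar Z e' s \<in> \<gamma> ` {a..b}" unfolding img' by (intro imageI) auto
    then obtain t where t: "t \<in> {a..b}" "echar Z e' s = \<gamma> t" by blast
    then have "echar Z e' s = echar Z e' (\<xi> t)" using c(5) \<open>e1 = e'\<close> by metis
    moreover have "\<xi> t \<in> {0..1}" using c(4) t(1) by blast
    ultimately have "s = \<xi> t" using edge_eq(2)[OF img(2) img(2), of s "\<xi> t"] s by auto
    then show "s \<in> \<xi> ` {a..b}" using t(1) by blast
  qed
  then have "closure {0<..<1} \<subseteq> \<xi> ` {a..b}"
    by (intro closure_minimal compact_imp_closed compact_continuous_image c(2)) auto
  then have "\<xi> ` {a..b} = {0..1}" using c(4) by auto
  then show ?thesis using that[OF c(2,3)] c(5) unfolding \<gamma>_def \<open>e1 = e'\<close> by blast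
qed

text \<open>\<open>br I\<close> is the inverse branch of \<open>h\<close> from the edge \<open>tgt I\<close> onto \<open>I\<close>, in edge parameters.\<close>

definition is_branch :: "'e subinterval \<Rightarrow> 'e \<Rightarrow> (real \<Rightarrow> real) \<Rightarrow> bool" where
  "is_branch I e' \<beta> \<longleftrightarrow> e' \<in> edges Z \<and> continuous_on {0..1} \<beta> \<and> inj_on \<beta> {0..1} \<and>
     \<beta> ` {0..1} = {lo I..hi I} \<and> h ` closed_arc Z I = edge_set Z e' \<and>
     (\<forall>s\<in>{0..1}. h (echar Z (fst I) (\<beta> s)) = echar Z e' s)"

definition tgt :: "'e subinterval \<Rightarrow> 'e" where
  "tgt I = fst (SOME p. is_branch I (fst p) (snd p))"

definition br :: "'e subinterval \<Rightarrow> real \<Rightarrow> real" where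
  "br I = snd (SOME p. is_branch I (fst p) (snd p))"

lemma partition_lists:
  obtains ts where "\<forall>e\<in>edges Z. ts e \<noteq> [] \<and> hd (ts e) = 0 \<and> last (ts e) = 1 \<and> sorted_wrt (<) (ts e)"
    "\<A> = {(e, ts e ! j, ts e ! Suc j) |e j. e \<in> edges Z \<and> Suc j < length (ts e)}"
  using partition unfolding markov_partition_def by blast

lemma arc_image:
  assumes "I \<in> \<A>"
  shows "inj_on h (open_arc Z I)" "\<exists>e\<in>edges Z. h ` closed_arc Z I = edge_set Z e"
  using partition assms unfolding markov_partition_def by blast+

lemma sorted_partition_bounds:
  fixes xs :: "real list"
  assumes "xs \<noteq> []" "hd xs = 0" "last xs = 1" "sorted_wrt (<) xs" "Suc j < length xs"
  shows "0 \<le> xs ! j" "xs ! j < xs ! Suc j" "xs ! Suc j \<le> 1"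
proof -
  have nth: "xs ! i \<le> xs ! k" if "i \<le> k" "k < length xs" for i k
    using sorted_wrt_nth_less[OF assms(4), of i k] that by (cases "i = k") auto
  have "xs ! 0 = 0" "xs ! (length xs - 1) = 1" using assms by (simp_all add: hd_conv_nth last_conv_nth)
  then show "0 \<le> xs ! j" "xs ! Suc j \<le> 1" using nth[of 0 j] nth[of "Suc j" "length xs - 1"] assms(5) by auto
  show "xs ! j < xs ! Suc j" using sorted_wrt_nth_less[OF assms(4), of j "Suc j"] assms(5) by simp
qed

lemma arc_bounds:
  assumes "I \<in> \<A>"
  shows "fst I \<in> edges Z" "0 \<le> lo I" "lo I < hi I" "hi I \<le> 1"
proof -
  obtain ts where ts: "\<forall>e\<in>edges Z. ts e \<noteq> [] \<and> hd (ts e) = 0 \<and> last (ts e) = 1 \<and> sorted_wrt (<) (ts e)"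
    "\<A> = {(e, ts e ! j, ts e ! Suc j) |e j. e \<in> edges Z \<and> Suc j < length (ts e)}" by (rule partition_lists)
  then obtain e j where I: "I = (e, ts e ! j, ts e ! Suc j)" "e \<in> edges Z" "Suc j < length (ts e)"
    using assms by blast
  then have "ts e \<noteq> []" "hd (ts e) = 0" "last (ts e) = 1" "sorted_wrt (<) (ts e)" using ts(1) by blast+
  note sorted_partition_bounds[OF this I(3)]
  then show "fst I \<in> edges Z" "0 \<le> lo I" "lo I < hi I" "hi I \<le> 1" using I by simp_all
qed

text \<open>\<open>markov_partition\<close> says nothing about images of cut points. The property
  travels along the edge from its initial vertex: each piece ends over a vertex, which is what
  \<open>piece_chart\<close> asks of the next one.\<close>

lemma arc_left_vertex:
  assumes "I \<in> \<A>"
  shows "h (echar Z (fst I) (lo I)) \<in> verts Z"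
proof -
  obtain ts where ts: "\<forall>e\<in>edges Z. ts e \<noteq> [] \<and> hd (ts e) = 0 \<and> last (ts e) = 1 \<and> sorted_wrt (<) (ts e)"
    "\<A> = {(e, ts e ! j, ts e ! Suc j) |e j. e \<in> edges Z \<and> Suc j < length (ts e)}" by (rule partition_lists)
  have "Suc j < length (ts e) \<Longrightarrow> h (echar Z e (ts e ! j)) \<in> verts Z" if e: "e \<in> edges Z" for e j
  proof (induction j)
    case 0
    have "ts e ! 0 = 0" using ts(1) e by (metis hd_conv_nth)
    then show ?case using h_verts[OF edge_0[OF e]] by simp
  next
    case (Suc j)
    define I where "I = (e, ts e ! j, ts e ! Suc j)"
    have I: "I \<in> \<A>" unfolding I_def ts(2) using e Suc.prems by auto
    obtain e' where e': "e' \<in> edges Z" "h ` closed_arc Z I = edge_set Z e'" using arc_image(2)[OF I] by blast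
    note b = arc_bounds[OF I, unfolded I_def, simplified]
    obtain \<xi> where x: "continuous_on {ts e ! j..ts e ! Suc j} \<xi>" "inj_on \<xi> {ts e ! j..ts e ! Suc j}"
      "\<xi> ` {ts e ! j..ts e ! Suc j} = {0..1}"
      "\<forall>t\<in>{ts e ! j..ts e ! Suc j}. h (echar Z e t) = echar Z e' (\<xi> t)"
    proof (rule piece_chart[OF b(1-4) _ _ e'(1)])
      show "inj_on h (open_arc Z (e, ts e ! j, ts e ! Suc j))" using arc_image(1)[OF I] unfolding I_def .
      show "h ` closed_arc Z (e, ts e ! j, ts e ! Suc j) = edge_set Z e'" using e'(2) unfolding I_def .
      show "h (echar Z e (ts e ! j)) \<in> verts Z" using Suc by simp
    qed
    have "\<xi> (ts e ! Suc j) \<in> {0, 1}" using injective_interval_image(1)[OF b(3) x(1-3)] by blast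
    moreover have "h (echar Z e (ts e ! Suc j)) = echar Z e' (\<xi> (ts e ! Suc j))" using x(4) b(3) by simp
    ultimately show ?case using edge_0[OF e'(1)] edge_1[OF e'(1)] by auto
  qed
  moreover obtain e j where "I = (e, ts e ! j, ts e ! Suc j)" "e \<in> edges Z" "Suc j < length (ts e)"
    using assms ts(2) by blast
  ultimately show ?thesis by simp
qed

lemma branch_exists:
  assumes I: "I \<in> \<A>"
  shows "is_branch I (tgt I) (br I)"
proof -
  obtain e a b where Ieq: "I = (e, a, b)" by (cases I) auto
  note bd = arc_bounds[OF I, unfolded Ieq, simplified]
  obtain e' where e': "e' \<in> edges Z" "h ` closed_arc Z I = edge_set Z e'" using arc_image(2)[OF I] by blast
  obtain \<xi> where x: "continuous_on {a..b} \<xi>" "inj_on \<xi> {a..b}" "\<xi> ` {a..b} = {0..1}"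
    "\<forall>t\<in>{a..b}. h (echar Z e t) = echar Z e' (\<xi> t)"
  proof (rule piece_chart[OF bd(1-4) _ _ e'(1)])
    show "inj_on h (open_arc Z (e, a, b))" using arc_image(1)[OF I] unfolding Ieq .
    show "h ` closed_arc Z (e, a, b) = edge_set Z e'" using e'(2) unfolding Ieq .
    show "h (echar Z e a) \<in> verts Z" using arc_left_vertex[OF I] unfolding Ieq by simp
  qed
  define \<beta> where "\<beta> = inv_into {a..b} \<xi>"
  have \<beta>1: "\<beta> s \<in> {a..b}" "\<xi> (\<beta> s) = s" if "s \<in> {0..1}" for s
    using that x(3) inv_into_into[of s \<xi> "{a..b}"] f_inv_into_f[of s \<xi> "{a..b}"] unfolding \<beta>_def by auto
  have \<beta>2: "\<beta> (\<xi> t) = t" if "t \<in> {a..b}" for t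
    unfolding \<beta>_def using inv_into_f_f[OF x(2) that] .
  have "continuous_on (\<xi> ` {a..b}) \<beta>"
    by (rule continuous_on_inv[OF x(1)]) (use \<beta>2 in auto)
  then have "continuous_on {0..1} \<beta>" unfolding x(3) .
  moreover have "inj_on \<beta> {0..1}" using \<beta>1(2) by (metis inj_onI)
  moreover have "\<beta> ` {0..1} = {a..b}"
  proof
    show "\<beta> ` {0..1} \<subseteq> {a..b}" using \<beta>1(1) by blast
    show "{a..b} \<subseteq> \<beta> ` {0..1}"
    proof
      fix t assume t: "t \<in> {a..b}"
      then have "\<xi> t \<in> {0..1}" using x(3) by blast
      then show "t \<in> \<beta> ` {0..1}" using \<beta>2[OF t] by (metis imageI)
    qed
  qed
  moreover have "\<forall>s\<in>{0..1}. h (echar Z e (\<beta> s)) = echar Z e' s"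
    using x(4) \<beta>1 by metis
  ultimately have "is_branch I e' \<beta>"
    unfolding is_branch_def using e' unfolding Ieq by simp
  then have "is_branch I (fst (e', \<beta>)) (snd (e', \<beta>))" by simp
  then show ?thesis unfolding tgt_def br_def by (rule someI)
qed

lemma branch:
  assumes "I \<in> \<A>"
  shows "tgt I \<in> edges Z" "continuous_on {0..1} (br I)" "inj_on (br I) {0..1}"
    "br I ` {0..1} = {lo I..hi I}" "h ` closed_arc Z I = edge_set Z (tgt I)"
    "\<And>s. s \<in> {0..1} \<Longrightarrow> h (echar Z (fst I) (br I s)) = echar Z (tgt I) s"
  using branch_exists[OF assms] unfolding is_branch_def by simp_all

lemma branch_open:
  assumes "I \<in> \<A>"
  shows "br I ` {0<..<1} = {lo I<..<hi I}" "{br I 0, br I 1} = {lo I, hi I}"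
  using injective_interval_image[OF _ branch(2,3,4)[OF assms]] by simp_all

lemma branch_mem: "I \<in> \<A> \<Longrightarrow> s \<in> {0..1} \<Longrightarrow> br I s \<in> {lo I..hi I}"
  using branch(4)[of I] by blast

lemma branch_mem_open: "I \<in> \<A> \<Longrightarrow> s \<in> {0<..<1} \<Longrightarrow> br I s \<in> {lo I<..<hi I}"
  using branch_open(1)[of I] by blast

lemma arc_end_vertex:
  assumes "I \<in> \<A>" "t \<in> {lo I, hi I}"
  shows "h (echar Z (fst I) t) \<in> verts Z"
proof -
  have "t \<in> {br I 0, br I 1}" using branch_open(2)[OF assms(1)] assms(2) by simp
  then show ?thesis
    using branch(6)[OF assms(1), of 0] branch(6)[OF assms(1), of 1] branch(1)[OF assms(1)] edge_0 edge_1 by auto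
qed

lemma arc_exists:
  assumes e: "e \<in> edges Z" and t: "0 \<le> t" "t \<le> 1"
  obtains I where "I \<in> \<A>" "fst I = e" "t \<in> {lo I..hi I}"
proof -
  obtain ts where ts: "\<forall>e\<in>edges Z. ts e \<noteq> [] \<and> hd (ts e) = 0 \<and> last (ts e) = 1 \<and> sorted_wrt (<) (ts e)"
    "\<A> = {(e, ts e ! j, ts e ! Suc j) |e j. e \<in> edges Z \<and> Suc j < length (ts e)}" by (rule partition_lists)
  have "ts e \<noteq> []" "hd (ts e) = 0" "last (ts e) = 1" "sorted_wrt (<) (ts e)" using ts(1) e by blast+
  then obtain j where j: "Suc j < length (ts e)" "ts e ! j \<le> t" "t \<le> ts e ! Suc j"
    by (rule sorted_partition_step[OF _ _ _ _ t])
  have "(e, ts e ! j, ts e ! Suc j) \<in> \<A>" unfolding ts(2) using e j(1) by blast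
  then show ?thesis using that[of "(e, ts e ! j, ts e ! Suc j)"] j by simp
qed

lemma arc_exists_open:
  assumes e: "e \<in> edges Z" and t: "0 \<le> t" "t \<le> 1" and ht: "h (echar Z e t) \<notin> verts Z"
  obtains I where "I \<in> \<A>" "fst I = e" "t \<in> {lo I<..<hi I}"
proof -
  obtain I where I: "I \<in> \<A>" "fst I = e" "t \<in> {lo I..hi I}" by (rule arc_exists[OF e t])
  have "t \<noteq> lo I" "t \<noteq> hi I" using arc_end_vertex[OF I(1), of t] I(2) ht by auto
  then show ?thesis using that[OF I(1,2)] I(3) by auto
qed

lemma arc_unique:
  assumes I: "I \<in> \<A>" and J: "J \<in> \<A>" and eq: "fst I = fst J" and t: "t \<in> {lo I..hi I}" "t \<in> {lo J<..<hi J}"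
  shows "I = J"
proof -
  obtain ts where ts: "\<forall>e\<in>edges Z. ts e \<noteq> [] \<and> hd (ts e) = 0 \<and> last (ts e) = 1 \<and> sorted_wrt (<) (ts e)"
    "\<A> = {(e, ts e ! j, ts e ! Suc j) |e j. e \<in> edges Z \<and> Suc j < length (ts e)}" by (rule partition_lists)
  obtain e i where i: "I = (e, ts e ! i, ts e ! Suc i)" "e \<in> edges Z" "Suc i < length (ts e)"
    using I ts(2) by blast
  obtain e2 j where j: "J = (e2, ts e2 ! j, ts e2 ! Suc j)" "e2 \<in> edges Z" "Suc j < length (ts e2)"
    using J ts(2) by blast
  have e2: "e2 = e" using i j eq by simp
  have srt: "sorted_wrt (<) (ts e)" using ts(1) i(2) by blast
  have nth: "ts e ! k \<le> ts e ! m" if "k \<le> m" "m < length (ts e)" for k m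
    using sorted_wrt_nth_less[OF srt, of k m] that by (cases "k = m") auto
  have "\<not> i < j" using nth[of "Suc i" j] i j t e2 by auto
  moreover have "\<not> j < i" using nth[of "Suc j" i] i j t e2 by auto
  ultimately show ?thesis using i j e2 by auto
qed

lemma finite_arcs: "finite \<A>"
proof -
  obtain ts where ts: "\<forall>e\<in>edges Z. ts e \<noteq> [] \<and> hd (ts e) = 0 \<and> last (ts e) = 1 \<and> sorted_wrt (<) (ts e)"
    "\<A> = {(e, ts e ! j, ts e ! Suc j) |e j. e \<in> edges Z \<and> Suc j < length (ts e)}" by (rule partition_lists)
  have "\<A> \<subseteq> (\<lambda>(e, j). (e, ts e ! j, ts e ! Suc j)) ` (SIGMA e:edges Z. {..<length (ts e)})"
    unfolding ts(2) by force
  then show ?thesis by (rule finite_subset) (intro finite_imageI finite_SigmaI finite_edges finite_lessThan)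
qed

end

section \<open>Inverse limits: coordinates, continuity and basic neighbourhoods\<close>

lemma topspace_invlim:
  "topspace (invlim T f) = {x. \<forall>i. x i \<in> topspace T \<and> f (x (Suc i)) = x i}"
  unfolding invlim_def by (auto simp: PiE_UNIV_domain)

lemma invlim_D:
  assumes "x \<in> topspace (invlim T f)"
  shows "x i \<in> topspace T" "f (x (Suc i)) = x i"
  using assms unfolding topspace_invlim by auto

lemma invlim_funpow:
  assumes "x \<in> topspace (invlim T f)"
  shows "(f ^^ m) (x (i + m)) = x i"
proof (induction m)
  case (Suc m)
  have "(f ^^ Suc m) (x (i + Suc m)) = (f ^^ m) (f (x (Suc (i + m))))"
    by (simp add: funpow_swap1)
  then show ?case using Suc invlim_D(2)[OF assms, of "i + m"] by simp
qed simp

lemma continuous_map_invlim_coord: "continuous_map (invlim T f) T (\<lambda>x. x i)"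
  unfolding invlim_def by (intro continuous_map_from_subtopology continuous_map_product_projection) simp

lemma continuous_map_into_invlim:
  assumes "\<And>i. continuous_map S T (\<lambda>s. F s i)" "\<And>s. s \<in> topspace S \<Longrightarrow> F s \<in> topspace (invlim T f)"
  shows "continuous_map S (invlim T f) F"
  unfolding invlim_def continuous_map_in_subtopology continuous_map_componentwise_UNIV
  using assms by (auto simp: topspace_invlim)

text \<open>A basic open set constrains finitely many coordinates. Exact agreement in these replaces
  closeness, so that neighbourhoods are later entered without any estimate.\<close>

lemma openin_invlim_basic:
  assumes U: "openin (invlim T f) U" and x: "x \<in> U"
  obtains n where "\<And>y. y \<in> topspace (invlim T f) \<Longrightarrow> (\<forall>i\<le>n. y i = x i) \<Longrightarrow> y \<in> U"
proof -
  obtain W where W: "openin (product_topology (\<lambda>_. T) UNIV) W" "U = W \<inter> {x. \<forall>i. f (x (Suc i)) = x i}"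
    using U unfolding invlim_def openin_subtopology by blast
  then have "x \<in> W" using x by blast
  then obtain B where B: "finite {i \<in> UNIV. B i \<noteq> topspace T}" "\<forall>i\<in>UNIV. openin T (B i)"
    "x \<in> Pi\<^sub>E UNIV B" "Pi\<^sub>E UNIV B \<subseteq> W"
    using W(1) unfolding openin_product_topology_alt by blast
  obtain n where n: "\<forall>i\<in>{i \<in> UNIV. B i \<noteq> topspace T}. i \<le> n"
    using B(1) finite_nat_set_iff_bounded_le by blast
  show ?thesis
  proof (rule that)
    fix y assume y: "y \<in> topspace (invlim T f)" "\<forall>i\<le>n. y i = x i"
    have "y i \<in> B i" for i
    proof (cases "B i = topspace T")
      case True
      then show ?thesis using invlim_D(1)[OF y(1)] by simp
    next
      case False
      then have "i \<le> n" using n by blast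
      then show ?thesis using y(2) B(3) by (auto simp: PiE_UNIV_domain)
    qed
    then have "y \<in> W" using B(4) by (auto simp: PiE_UNIV_domain)
    then show "y \<in> U" using W(2) y(1) unfolding topspace_invlim by auto
  qed
qed

section \<open>Composed inverse branches, their shrinking, and the point coded by a sequence\<close>

context markov_system
begin

abbreviation Zbar :: "(nat \<Rightarrow> 'z) topology" where "Zbar \<equiv> invlim (gtop Z) h"
abbreviation words :: "(int \<Rightarrow> 'e subinterval) set" where "words \<equiv> topspace (sft Z h \<A>)"

text \<open>The inverse branch of \<open>h ^^ n\<close> prescribed by the symbols at the times
  \<open>i\<close> to \<open>i + n - 1\<close>, in edge parameters.\<close>

fun comp_br :: "(int \<Rightarrow> 'e subinterval) \<Rightarrow> int \<Rightarrow> nat \<Rightarrow> real \<Rightarrow> real" where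
  "comp_br w i 0 s = s"
| "comp_br w i (Suc n) s = br (w i) (comp_br w (i + 1) n s)"

text \<open>Admissibility of a finite stretch of symbols. At time \<open>i + n\<close> only the edge
  of the symbol matters, as the domain of the composed branch, so placeholder symbols may stand
  there.\<close>

definition adm :: "(int \<Rightarrow> 'e subinterval) \<Rightarrow> int \<Rightarrow> nat \<Rightarrow> bool" where
  "adm w i n \<longleftrightarrow> (\<forall>j<n. w (i + int j) \<in> \<A> \<and> fst (w (i + int j + 1)) = tgt (w (i + int j)))"

lemma adm_Suc: "adm w i (Suc n) \<longleftrightarrow> w i \<in> \<A> \<and> fst (w (i + 1)) = tgt (w i) \<and> adm w (i + 1) n"
proof
  assume a: "adm w i (Suc n)"
  have "w (i + 1 + int j) \<in> \<A> \<and> fst (w (i + 1 + int j + 1)) = tgt (w (i + 1 + int j))" if "j < n" for j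
  proof -
    have "w (i + int (Suc j)) \<in> \<A> \<and> fst (w (i + int (Suc j) + 1)) = tgt (w (i + int (Suc j)))"
      using a that unfolding adm_def by (metis Suc_less_eq)
    then show ?thesis by (simp add: algebra_simps)
  qed
  moreover have "w (i + int 0) \<in> \<A> \<and> fst (w (i + int 0 + 1)) = tgt (w (i + int 0))"
    using a unfolding adm_def by (metis zero_less_Suc)
  ultimately show "w i \<in> \<A> \<and> fst (w (i + 1)) = tgt (w i) \<and> adm w (i + 1) n"
    unfolding adm_def by simp
next
  assume a: "w i \<in> \<A> \<and> fst (w (i + 1)) = tgt (w i) \<and> adm w (i + 1) n"
  show "adm w i (Suc n)" unfolding adm_def
  proof (intro allI impI)
    fix j assume "j < Suc n"
    show "w (i + int j) \<in> \<A> \<and> fst (w (i + int j + 1)) = tgt (w (i + int j))"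
    proof (cases j)
      case 0
      then show ?thesis using a by simp
    next
      case (Suc k)
      then have "w (i + 1 + int k) \<in> \<A> \<and> fst (w (i + 1 + int k + 1)) = tgt (w (i + 1 + int k))"
        using a \<open>j < Suc n\<close> unfolding adm_def by simp
      then show ?thesis using Suc by (simp add: algebra_simps)
    qed
  qed
qed

lemma adm_drop: "adm w i (m + n) \<Longrightarrow> adm w (i + int m) n"
proof (induction m arbitrary: i)
  case (Suc m)
  then have "adm w (i + 1) (m + n)" by (simp add: adm_Suc)
  then have "adm w (i + 1 + int m) n" by (rule Suc.IH)
  then show ?case by (simp add: add.assoc)
qed simp

lemma comp_br_cong:
  "(\<And>j. j < n \<Longrightarrow> w (i + int j) = w' (i' + int j)) \<Longrightarrow> comp_br w i n s = comp_br w' i' n s"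
proof (induction n arbitrary: i i')
  case (Suc n)
  have "w (i + 1 + int j) = w' (i' + 1 + int j)" if "j < n" for j
    using Suc.prems[of "Suc j"] that by (simp add: algebra_simps)
  then have "comp_br w (i + 1) n s = comp_br w' (i' + 1) n s" by (rule Suc.IH)
  then show ?case using Suc.prems[of 0] by simp
qed simp

lemma comp_br_append: "comp_br w i (m + n) s = comp_br w i m (comp_br w (i + int m) n s)"
  by (induction m arbitrary: i) (simp_all add: algebra_simps)

lemma comp_br_mem: "adm w i n \<Longrightarrow> s \<in> {0..1} \<Longrightarrow> comp_br w i n s \<in> {0..1}"
proof (induction n arbitrary: i)
  case (Suc n)
  then have "w i \<in> \<A>" "comp_br w (i + 1) n s \<in> {0..1}" unfolding adm_Suc by blast+
  then show ?case using branch_mem[of "w i"] arc_bounds[of "w i"] by fastforce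
qed simp

lemma comp_br_mem_open: "adm w i n \<Longrightarrow> s \<in> {0<..<1} \<Longrightarrow> comp_br w i n s \<in> {0<..<1}"
proof (induction n arbitrary: i)
  case (Suc n)
  then have "w i \<in> \<A>" "comp_br w (i + 1) n s \<in> {0<..<1}" unfolding adm_Suc by blast+
  then show ?case using branch_mem_open[of "w i"] arc_bounds[of "w i"] by fastforce
qed simp

lemma comp_br_cont: "adm w i n \<Longrightarrow> continuous_on {0..1} (comp_br w i n)"
proof (induction n arbitrary: i)
  case 0
  have "comp_br w i 0 = (\<lambda>s. s)" by (rule ext) simp
  then show ?case by (simp add: continuous_on_id)
next
  case (Suc n)
  then have a: "w i \<in> \<A>" "adm w (i + 1) n" unfolding adm_Suc by blast+
  have "comp_br w i (Suc n) = (\<lambda>s. br (w i) (comp_br w (i + 1) n s))" by (rule ext) simp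
  moreover have "continuous_on {0..1} (\<lambda>s. br (w i) (comp_br w (i + 1) n s))"
    using comp_br_mem[OF a(2)]
    by (intro continuous_on_compose2[OF branch(2)[OF a(1)] Suc.IH[OF a(2)]]) blast
  ultimately show ?case by simp
qed

lemma comp_br_inj: "adm w i n \<Longrightarrow> inj_on (comp_br w i n) {0..1}"
proof (induction n arbitrary: i)
  case (Suc n)
  then have a: "w i \<in> \<A>" "adm w (i + 1) n" unfolding adm_Suc by blast+
  show ?case
  proof (rule inj_onI)
    fix x y :: real assume xy: "x \<in> {0..1}" "y \<in> {0..1}" "comp_br w i (Suc n) x = comp_br w i (Suc n) y"
    then have "comp_br w (i + 1) n x = comp_br w (i + 1) n y"
      using inj_onD[OF branch(3)[OF a(1)]] comp_br_mem[OF a(2)] by simp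
    then show "x = y" using inj_onD[OF Suc.IH[OF a(2)]] xy by blast
  qed
qed (simp add: inj_on_def)

lemma h_comp_br:
  assumes "adm w i (Suc n)" "s \<in> {0..1}"
  shows "h (echar Z (fst (w i)) (comp_br w i (Suc n) s)) = echar Z (fst (w (i + 1))) (comp_br w (i + 1) n s)"
proof -
  have a: "w i \<in> \<A>" "fst (w (i + 1)) = tgt (w i)" "adm w (i + 1) n" using assms(1) unfolding adm_Suc by blast+
  show ?thesis using branch(6)[OF a(1) comp_br_mem[OF a(3) assms(2)]] a(2) by simp
qed

lemma funpow_comp_br:
  "adm w i (m + n) \<Longrightarrow> s \<in> {0..1} \<Longrightarrow>
    (h ^^ m) (echar Z (fst (w i)) (comp_br w i (m + n) s)) = echar Z (fst (w (i + int m))) (comp_br w (i + int m) n s)"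
proof (induction m arbitrary: i)
  case (Suc m)
  have a: "adm w i (Suc (m + n))" using Suc.prems by simp
  have "(h ^^ Suc m) (echar Z (fst (w i)) (comp_br w i (Suc m + n) s)) =
    (h ^^ m) (h (echar Z (fst (w i)) (comp_br w i (Suc (m + n)) s)))"
    by (simp add: funpow_swap1)
  also have "\<dots> = (h ^^ m) (echar Z (fst (w (i + 1))) (comp_br w (i + 1) (m + n) s))"
    unfolding h_comp_br[OF a Suc.prems(2)] ..
  also have "\<dots> = echar Z (fst (w (i + 1 + int m))) (comp_br w (i + 1 + int m) n s)"
    using a Suc.prems(2) unfolding adm_Suc by (intro Suc.IH) blast+
  finally show ?case by (simp add: algebra_simps)
qed simp

lemma adm_edge: "adm w i (Suc n) \<Longrightarrow> fst (w i) \<in> edges Z"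
  unfolding adm_Suc using arc_bounds(1) by blast

lemma h_funpow_verts: "v \<in> verts Z \<Longrightarrow> (h ^^ m) v \<in> verts Z"
  by (induction m) (simp_all add: h_verts)

lemma h_pts: "z \<in> pts Z \<Longrightarrow> h z \<in> pts Z"
  using continuous_map_image_subset_topspace[OF h_cont] by blast

lemma h_funpow_pts: "z \<in> pts Z \<Longrightarrow> (h ^^ m) z \<in> pts Z"
  by (induction m) (simp_all add: h_pts)

lemma comp_br_interval:
  assumes "adm w i n" "x \<in> comp_br w i n ` {0..1}" "y \<in> comp_br w i n ` {0..1}" "x < r" "r < y"
  obtains s where "s \<in> {0<..<1}" "r = comp_br w i n s"
proof -
  obtain c d where cd: "comp_br w i n ` {0..1} = {c..d}"
    using continuous_image_closed_interval[OF zero_le_one comp_br_cont[OF assms(1)]] by blast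
  have "r \<in> {c<..<d}" using assms(2-5) unfolding cd by auto
  also have "{c<..<d} = comp_br w i n ` {0<..<1}"
    using injective_interval_image(2)[OF zero_less_one comp_br_cont[OF assms(1)] comp_br_inj[OF assms(1)] cd] ..
  finally show ?thesis using that by blast
qed

text \<open>Each image before time \<open>n\<close> is a shorter branch applied to the same interior
  parameter, hence an interior point of an edge.\<close>

lemma vertex_free_comp_br:
  assumes "adm w i n" "s \<in> {0<..<1}" "m < n"
  shows "(h ^^ m) (echar Z (fst (w i)) (comp_br w i n s)) \<notin> verts Z"
proof -
  define k where "k = n - m"
  have n: "n = m + k" "0 < k" using assms(3) by (auto simp: k_def)
  have a: "adm w i (m + k)" using assms(1) n by simp
  have ak: "adm w (i + int m) k" by (rule adm_drop[OF a])
  obtain k' where k': "k = Suc k'" using n(2) by (cases k) auto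
  have "comp_br w (i + int m) k s \<in> {0<..<1}" by (rule comp_br_mem_open[OF ak assms(2)])
  moreover have "fst (w (i + int m)) \<in> edges Z" using adm_edge ak unfolding k' by blast
  ultimately have "echar Z (fst (w (i + int m))) (comp_br w (i + int m) k s) \<notin> verts Z"
    using edge_interior by auto
  then show ?thesis using funpow_comp_br[OF a, of s] assms(2) n(1) by auto
qed

text \<open>Cut every edge into \<open>Q\<close> cells. By \<open>escape\<close> each contains a
  point that hits a vertex, and \<open>M0\<close> bounds the finitely many hitting times. A longer
  branch whose image contains a whole cell would contain such a point as the image of an interior
  parameter, against \<open>vertex_free_comp_br\<close>.\<close>

lemma uniform_shrink:
  assumes "\<delta> > 0"
  shows "\<exists>M. \<forall>w i n x y. M \<le> n \<longrightarrow> adm w i n \<longrightarrow> x \<in> comp_br w i n ` {0..1} \<longrightarrow>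
    y \<in> comp_br w i n ` {0..1} \<longrightarrow> y - x < \<delta>"
proof -
  \<comment> \<open>The factor 2 makes every interval of length at least \<open>\<delta>\<close> in
    an edge contain a whole cell, wherever it starts.\<close>
  obtain Q :: nat where Q: "2 / \<delta> < real Q" using reals_Archimedean2 by blast
  have "0 < 2 / \<delta>" using assms by simp
  then have Q0: "0 < real Q" using Q by linarith
  have Q2: "2 / real Q < \<delta>" using Q assms Q0 by (simp add: field_simps)
  have "\<exists>m. \<exists>r. real q / real Q < r \<and> r < (real q + 1) / real Q \<and> (h ^^ m) (echar Z e r) \<in> verts Z"
    if "e \<in> edges Z" "q < Q" for e q
  proof -
    have "0 \<le> real q / real Q" "real q / real Q < (real q + 1) / real Q" "(real q + 1) / real Q \<le> 1"
      using that Q0 by (auto simp: divide_strict_right_mono)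
    from escape[OF that(1) this] show ?thesis by blast
  qed
  then have "\<forall>p\<in>edges Z \<times> {..<Q}. \<exists>m. \<exists>r. real (snd p) / real Q < r \<and> r < (real (snd p) + 1) / real Q \<and>
    (h ^^ m) (echar Z (fst p) r) \<in> verts Z" by auto
  from bchoice[OF this] obtain \<mu> where \<mu>: "\<forall>p\<in>edges Z \<times> {..<Q}. \<exists>r. real (snd p) / real Q < r \<and>
    r < (real (snd p) + 1) / real Q \<and> (h ^^ \<mu> p) (echar Z (fst p) r) \<in> verts Z" by blast
  have fin: "finite (\<mu> ` (edges Z \<times> {..<Q}))" using finite_edges by blast
  then obtain M0 where M0: "\<forall>m\<in>\<mu> ` (edges Z \<times> {..<Q}). m \<le> M0"
    using finite_nat_set_iff_bounded_le by blast
  show ?thesis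
  proof (intro exI[of _ "Suc M0"] allI impI, rule ccontr)
    fix w i n x y
    assume n: "Suc M0 \<le> n" and a: "adm w i n" and x: "x \<in> comp_br w i n ` {0..1}"
      and y: "y \<in> comp_br w i n ` {0..1}" and "\<not> y - x < \<delta>"
    then have yx: "x + 2 / real Q \<le> y" using Q2 by linarith
    have x01: "0 \<le> x" and y01: "y \<le> 1" using x y comp_br_mem[OF a] by auto
    \<comment> \<open>The first cell that starts at \<open>x\<close> or to the right of it.\<close>
    define q where "q = nat \<lceil>x * real Q\<rceil>"
    have "0 \<le> x * real Q" using x01 Q0 by simp
    then have q: "x * real Q \<le> real q" "real q < x * real Q + 1" unfolding q_def by linarith+
    have q1: "x \<le> real q / real Q" using q(1) Q0 by (simp add: field_simps)
    have "x * real Q + 2 \<le> y * real Q" using yx Q0 by (simp add: field_simps)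
    then have "real q + 1 \<le> y * real Q" using q(2) by linarith
    then have q2: "(real q + 1) / real Q \<le> y" using Q0 by (simp add: field_simps)
    have "(real q + 1) / real Q \<le> 1" using q2 y01 by linarith
    then have "q < Q" using Q0 by (simp add: field_simps)
    obtain n' where n': "n = Suc n'" using n by (cases n) auto
    have e: "fst (w i) \<in> edges Z" using adm_edge a unfolding n' by blast
    have p: "(fst (w i), q) \<in> edges Z \<times> {..<Q}" using e \<open>q < Q\<close> by simp
    obtain r where r: "real q / real Q < r" "r < (real q + 1) / real Q"
      "(h ^^ \<mu> (fst (w i), q)) (echar Z (fst (w i)) r) \<in> verts Z"
      using bspec[OF \<mu> p] by auto
    have "x < r" "r < y" using q1 q2 r by linarith+
    then obtain s where s: "s \<in> {0<..<1}" "r = comp_br w i n s" by (rule comp_br_interval[OF a x y])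
    have "\<mu> (fst (w i), q) \<le> M0" using M0 p by blast
    then have "\<mu> (fst (w i), q) < n" using n by linarith
    then show False using vertex_free_comp_br[OF a s(1)] r(3) s(2) by blast
  qed
qed

lemma shrink_unique:
  assumes a: "\<And>n. adm w i n" and x: "\<And>n. x \<in> comp_br w i n ` {0..1}" and y: "\<And>n. y \<in> comp_br w i n ` {0..1}"
  shows "x = y"
proof -
  have "\<not> x < y" if x: "\<And>n. x \<in> comp_br w i n ` {0..1}" and y: "\<And>n. y \<in> comp_br w i n ` {0..1}" for x y
  proof
    assume "x < y"
    then obtain M where M: "\<forall>w i n x' y'. M \<le> n \<longrightarrow> adm w i n \<longrightarrow> x' \<in> comp_br w i n ` {0..1} \<longrightarrow>
      y' \<in> comp_br w i n ` {0..1} \<longrightarrow> y' - x' < y - x" using uniform_shrink[of "y - x"] by auto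
    have "y - x < y - x" using M[rule_format, OF order_refl a x y] .
    then show False by simp
  qed
  from this[OF x y] this[OF y x] show ?thesis by linarith
qed

text \<open>The image of an arc is a whole edge, so the next arc lies in it as soon as its midpoint
  does; an interior point belongs to one edge only.\<close>

lemma words_iff: "w \<in> words \<longleftrightarrow> (\<forall>k. w k \<in> \<A> \<and> fst (w (k + 1)) = tgt (w k))"
proof -
  have "closed_arc Z (w (k + 1)) \<subseteq> h ` closed_arc Z (w k) \<longleftrightarrow> fst (w (k + 1)) = tgt (w k)"
    if w: "\<forall>k. w k \<in> \<A>" for k
  proof -
    obtain e a b where I: "w (k + 1) = (e, a, b)" by (cases "w (k + 1)") auto
    have "w (k + 1) \<in> \<A>" using w by blast
    note bd = arc_bounds[OF this, unfolded I, simplified]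
    have img: "h ` closed_arc Z (w k) = edge_set Z (tgt (w k))" and t: "tgt (w k) \<in> edges Z"
      using branch(5,1)[of "w k"] w by blast+
    show ?thesis unfolding img I
    proof
      assume sub: "closed_arc Z (e, a, b) \<subseteq> edge_set Z (tgt (w k))"
      have "echar Z e ((a + b) / 2) \<in> closed_arc Z (e, a, b)" using bd by auto
      then obtain s where s: "s \<in> {0..1}" "echar Z e ((a + b) / 2) = echar Z (tgt (w k)) s" using sub by blast
      then have "e = tgt (w k)" using edge_eq(1)[OF bd(1) t, of "(a + b) / 2" s] bd by auto
      then show "fst (e, a, b) = tgt (w k)" by simp
    next
      assume "fst (e, a, b) = tgt (w k)"
      then have "e = tgt (w k)" by simp
      then show "closed_arc Z (e, a, b) \<subseteq> edge_set Z (tgt (w k))" using bd by (auto intro!: image_mono)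
    qed
  qed
  moreover have "w \<in> words \<longleftrightarrow> (\<forall>k. w k \<in> \<A>) \<and> (\<forall>k. closed_arc Z (w (k + 1)) \<subseteq> h ` closed_arc Z (w k))"
    unfolding sft_def by (simp add: PiE_UNIV_domain Pi_iff)
  ultimately show ?thesis by blast
qed

lemma words_adm: "w \<in> words \<Longrightarrow> adm w i n"
  unfolding words_iff adm_def by blast

lemma shift_word: "w \<in> words \<Longrightarrow> shift w \<in> words"
  unfolding words_iff shift_def by blast

text \<open>The intervals \<open>comp_br w i n ` {0..1}\<close> shrink to a point by \<open>escape\<close>.\<close>

definition position :: "(int \<Rightarrow> 'e subinterval) \<Rightarrow> int \<Rightarrow> real" where
  "position w i = (SOME x. \<forall>n. x \<in> comp_br w i n ` {0..1})"

lemma position_in: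
  assumes w: "w \<in> words"
  shows "position w i \<in> comp_br w i n ` {0..1}"
proof -
  have dec: "comp_br w i (m + k) ` {0..1} \<subseteq> comp_br w i m ` {0..1}" for m k
    unfolding comp_br_append using comp_br_mem[OF words_adm[OF w]] by blast
  have "\<Inter>(range (\<lambda>n. comp_br w i n ` {0..1})) \<noteq> {}"
  proof (rule compact_nest)
    show "compact (comp_br w i n ` {0..1})" for n
      by (intro compact_continuous_image comp_br_cont words_adm w) simp
    show "comp_br w i n ` {0..1} \<noteq> {}" for n by simp
    show "comp_br w i n ` {0..1} \<subseteq> comp_br w i m ` {0..1}" if "m \<le> n" for m n
      using dec[of m "n - m"] that by simp
  qed
  then have "\<exists>x. \<forall>n. x \<in> comp_br w i n ` {0..1}" by blast
  then have "\<forall>n. position w i \<in> comp_br w i n ` {0..1}" unfolding position_def by (rule someI_ex)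
  then show ?thesis by blast
qed

lemma position_mem: "w \<in> words \<Longrightarrow> position w i \<in> {0..1}"
  using position_in[of w i 0] by simp

lemma position_step:
  assumes w: "w \<in> words"
  shows "position w i = br (w i) (position w (i + 1))"
proof -
  have "\<forall>n. \<exists>s. s \<in> {0..1} \<and> position w i = br (w i) (comp_br w (i + 1) n s)"
    using position_in[OF w, of i "Suc _"] by force
  then obtain \<sigma> where \<sigma>: "\<And>n. \<sigma> n \<in> {0..1} \<and> position w i = br (w i) (comp_br w (i + 1) n (\<sigma> n))" by metis
  have I: "w i \<in> \<A>" using w unfolding words_iff by blast
  \<comment> \<open>The parameters chosen at the different depths describe the same point, because
    \<open>br (w i)\<close> is injective; at depth 0 that point is
    \<open>\<sigma> 0\<close>.\<close>
  have "comp_br w (i + 1) n (\<sigma> n) = \<sigma> 0" for n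
    using \<sigma>[of n] \<sigma>[of 0] inj_onD[OF branch(3)[OF I], of "comp_br w (i + 1) n (\<sigma> n)" "\<sigma> 0"]
      comp_br_mem[OF words_adm[OF w]] by simp
  then have "\<sigma> 0 \<in> comp_br w (i + 1) n ` {0..1}" for n using \<sigma>[of n] by (metis imageI)
  then have "\<sigma> 0 = position w (i + 1)" using shrink_unique[OF words_adm[OF w]] position_in[OF w] by blast
  then show ?thesis using \<sigma>[of 0] by simp
qed

lemma position_comp_br:
  assumes w: "w \<in> words"
  shows "position w i = comp_br w i n (position w (i + int n))"
proof (induction n arbitrary: i)
  case (Suc n)
  have "position w i = br (w i) (position w (i + 1))" by (rule position_step[OF w])
  also have "position w (i + 1) = comp_br w (i + 1) n (position w (i + 1 + int n))" by (rule Suc.IH)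
  also have "i + 1 + int n = i + int (Suc n)" by simp
  finally show ?case by simp
qed simp

text \<open>
  For fixed \<open>w\<close> and \<open>j\<close>, the points \<open>leaf w j s\<close> form the arc of the points of the inverse limit whose
  itinerary agrees with \<open>w\<close> at all times up to \<open>j\<close>.
\<close>

definition leaf :: "(int \<Rightarrow> 'e subinterval) \<Rightarrow> nat \<Rightarrow> real \<Rightarrow> nat \<Rightarrow> 'z" where
  "leaf w j s = (\<lambda>i. echar Z (fst (w (- int i))) (comp_br w (- int i) (i + j + 1) s))"

lemma word_edge: "w \<in> words \<Longrightarrow> fst (w i) \<in> edges Z"
  unfolding words_iff using arc_bounds(1) by blast

lemma leaf_in:
  assumes w: "w \<in> words" and s: "s \<in> {0..1}"
  shows "leaf w j s \<in> topspace Zbar"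
  unfolding topspace_invlim
proof (intro CollectI allI conjI)
  fix i
  have "comp_br w (- int i) (i + j + 1) s \<in> {0..1}" by (rule comp_br_mem[OF words_adm[OF w] s])
  then show "leaf w j s i \<in> pts Z"
    unfolding leaf_def using edge_in_pts[OF word_edge[OF w]] by auto
  have "h (leaf w j s (Suc i)) = h (echar Z (fst (w (- int (Suc i)))) (comp_br w (- int (Suc i)) (Suc (i + j + 1)) s))"
    unfolding leaf_def by (simp only: add_Suc)
  also have "\<dots> = echar Z (fst (w (- int (Suc i) + 1))) (comp_br w (- int (Suc i) + 1) (i + j + 1) s)"
    by (rule h_comp_br[OF words_adm[OF w] s])
  also have "- int (Suc i) + 1 = - int i" by simp
  finally show "h (leaf w j s (Suc i)) = leaf w j s i" unfolding leaf_def .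
qed

lemma leaf_cont:
  assumes w: "w \<in> words"
  shows "continuous_map (top_of_set {0..1}) Zbar (leaf w j)"
proof (rule continuous_map_into_invlim)
  fix i
  have "continuous_map (top_of_set {0..1}) (top_of_set {0..1}) (comp_br w (- int i) (i + j + 1))"
    unfolding continuous_map_in_subtopology
  proof (intro conjI)
    show "continuous_map (top_of_set {0..1}) euclideanreal (comp_br w (- int i) (i + j + 1))"
      using comp_br_cont[OF words_adm[OF w]] by (simp only: continuous_map_iff_continuous)
    show "comp_br w (- int i) (i + j + 1) \<in> topspace (top_of_set {0..1}) \<rightarrow> {0..1}"
      using comp_br_mem[OF words_adm[OF w]] unfolding Pi_iff topspace_euclidean_subtopology by blast
  qed
  from continuous_map_compose[OF this edge_cont[OF word_edge[OF w]]]
  show "continuous_map (top_of_set {0..1}) (gtop Z) (\<lambda>s. leaf w j s i)"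
    unfolding leaf_def o_def .
next
  fix s :: real assume "s \<in> topspace (top_of_set {0..1})"
  then show "leaf w j s \<in> topspace Zbar" using leaf_in[OF w] by simp
qed

lemma leaf_0_funpow:
  assumes w: "w \<in> words" and s: "s \<in> {0..1}" and m: "m \<le> j + 1"
  shows "(h ^^ m) (leaf w j s 0) = echar Z (fst (w (int m))) (comp_br w (int m) (j + 1 - m) s)"
proof -
  have "m + (j + 1 - m) = j + 1" using m by simp
  then show ?thesis
    using funpow_comp_br[OF words_adm[OF w] s, of m 0 "j + 1 - m"] unfolding leaf_def by simp
qed

lemma leaf_shift:
  assumes w: "w \<in> words" and s: "s \<in> {0..1}"
  shows "invlim_map h (leaf w (Suc j) s) = leaf (shift w) j s"
proof
  fix i
  have sh: "comp_br (shift w) k n s = comp_br w (k + 1) n s" for k n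
    by (rule comp_br_cong) (simp add: shift_def algebra_simps)
  show "invlim_map h (leaf w (Suc j) s) i = leaf (shift w) j s i"
  proof (cases i)
    case 0
    have "h (leaf w (Suc j) s 0) = echar Z (fst (w 1)) (comp_br w 1 (j + 1) s)"
      using leaf_0_funpow[OF w s, of 1 "Suc j"] by simp
    moreover have "leaf (shift w) j s 0 = echar Z (fst (w 1)) (comp_br w 1 (j + 1) s)"
      unfolding leaf_def sh by (simp add: shift_def)
    ultimately show ?thesis using 0 unfolding invlim_map_def by simp
  next
    case (Suc i')
    have "- int i + 1 = - int i'" using Suc by simp
    then show ?thesis
      unfolding invlim_map_def leaf_def sh using Suc by (simp add: shift_def)
  qed
qed

text \<open>Prescribing one more future symbol replaces the arc by a subarc, parametrized through
  the corresponding branch.\<close>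

lemma leaf_Suc: "leaf w (Suc j) s = leaf w j (br (w (int j + 1)) s)"
proof
  fix i
  have "comp_br w (- int i) ((i + j + 1) + 1) s = comp_br w (- int i) (i + j + 1) (comp_br w (- int i + int (i + j + 1)) 1 s)"
    by (rule comp_br_append)
  then show "leaf w (Suc j) s i = leaf w j (br (w (int j + 1)) s) i"
    unfolding leaf_def by (simp add: algebra_simps)
qed

lemma leaf_Suc_subset:
  assumes w: "w \<in> words"
  shows "leaf w (j + m) ` {0<..<1} \<subseteq> leaf w j ` {0<..<1}"
proof (induction m)
  case (Suc m)
  have "w (int (j + m) + 1) \<in> \<A>" using w unfolding words_iff by blast
  from branch_mem_open[OF this] arc_bounds[OF this]
  have "br (w (int (j + m) + 1)) s \<in> {0<..<1}" if "s \<in> {0<..<1}" for s using that by fastforce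
  then have "leaf w (Suc (j + m)) ` {0<..<1} \<subseteq> leaf w (j + m) ` {0<..<1}" unfolding leaf_Suc by blast
  then show ?case using Suc by simp
qed simp

lemma leaf_cong:
  assumes "\<And>k. - int i \<le> k \<Longrightarrow> k \<le> int j \<Longrightarrow> w k = w' k"
  shows "leaf w j s i = leaf w' j s i"
proof -
  have "comp_br w (- int i) (i + j + 1) s = comp_br w' (- int i) (i + j + 1) s"
    by (rule comp_br_cong) (rule assms, simp_all)
  then show ?thesis unfolding leaf_def using assms[of "- int i"] by simp
qed

lemma open_arc_eq: "open_arc Z I = echar Z (fst I) ` {lo I<..<hi I}"
  by (cases I) simp

lemma comp_br_Suc_open:
  assumes "adm w i (Suc n)" "s \<in> {0<..<1}"
  shows "echar Z (fst (w i)) (comp_br w i (Suc n) s) \<in> open_arc Z (w i)"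
proof -
  have a: "w i \<in> \<A>" "adm w (i + 1) n" using assms(1) unfolding adm_Suc by blast+
  show ?thesis
    unfolding open_arc_eq using branch_mem_open[OF a(1) comp_br_mem_open[OF a(2) assms(2)]]
    by (intro imageI) simp
qed

lemma leaf_cylinder:
  assumes w: "w \<in> words" and s: "s \<in> {0<..<1}" and n: "n \<le> j"
  shows "leaf w j s \<in> cylinder Z h w n"
proof -
  have s': "s \<in> {0..1}" using s by auto
  have "leaf w j s i \<in> open_arc Z (w (- int i))" for i
    unfolding leaf_def using comp_br_Suc_open[OF words_adm[OF w] s, of "- int i" "i + j"] by simp
  moreover have "(h ^^ i) (leaf w j s 0) \<in> open_arc Z (w (int i))" if "i \<le> n" for i
  proof -
    have "j + 1 - i = Suc (j - i)" using that n by simp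
    then show ?thesis
      using leaf_0_funpow[OF w s', of i j] comp_br_Suc_open[OF words_adm[OF w] s, of "int i" "j - i"] that n by simp
  qed
  ultimately show ?thesis unfolding cylinder_def using leaf_in[OF w s'] by blast
qed

text \<open>The point is recovered from its itinerary by pulling back one branch at a time. Interior
  points have a single edge parameter, so the two parameters found for \<open>h y\<close>
  agree.\<close>

lemma itinerary_comp_br:
  assumes w: "w \<in> words"
  shows "(\<And>m. m \<le> M \<Longrightarrow> (h ^^ m) y \<in> open_arc Z (w (k + int m))) \<Longrightarrow>
    \<exists>s\<in>{0<..<1}. y = echar Z (fst (w k)) (comp_br w k (Suc M) s)"
proof (induction M arbitrary: y k)
  case 0
  have I: "w k \<in> \<A>" using w unfolding words_iff by blast
  have "y \<in> open_arc Z (w k)" using 0[of 0] by simp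
  then obtain t where "t \<in> {lo (w k)<..<hi (w k)}" "y = echar Z (fst (w k)) t" unfolding open_arc_eq by blast
  moreover from this obtain s where "s \<in> {0<..<1}" "t = br (w k) s" using branch_open(1)[OF I] by blast
  ultimately show ?case by auto
next
  case (Suc M)
  have I: "w k \<in> \<A>" and tg: "fst (w (k + 1)) = tgt (w k)" using w unfolding words_iff by blast+
  have "y \<in> open_arc Z (w k)" using Suc.prems[of 0] by simp
  then obtain t where t: "t \<in> {lo (w k)<..<hi (w k)}" "y = echar Z (fst (w k)) t" unfolding open_arc_eq by blast
  then obtain s' where s': "s' \<in> {0<..<1}" "t = br (w k) s'" using branch_open(1)[OF I] by blast
  have hy: "h y = echar Z (tgt (w k)) s'" using branch(6)[OF I, of s'] s' t(2) by simp
  have "(h ^^ m) (h y) \<in> open_arc Z (w (k + 1 + int m))" if "m \<le> M" for m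
    using Suc.prems[of "Suc m"] that by (simp add: funpow_swap1 algebra_simps)
  then obtain s where s: "s \<in> {0<..<1}" "h y = echar Z (fst (w (k + 1))) (comp_br w (k + 1) (Suc M) s)"
    using Suc.IH[of "h y" "k + 1"] by blast
  have "comp_br w (k + 1) (Suc M) s \<in> {0<..<1}" by (rule comp_br_mem_open[OF words_adm[OF w] s(1)])
  then have "s' = comp_br w (k + 1) (Suc M) s"
    using edge_eq(2)[OF branch(1)[OF I] branch(1)[OF I], of s' "comp_br w (k + 1) (Suc M) s"] s' s(2) hy tg by auto
  then show ?case using s(1) t(2) s'(2) by auto
qed

lemma cylinder_coord:
  assumes w: "w \<in> words" and x: "x \<in> cylinder Z h w n" and i: "i \<le> n"
  shows "x i \<in> echar Z (fst (w (- int i))) ` comp_br w (- int i) (i + n + 1) ` {0..1}"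
proof -
  have xZ: "x \<in> topspace Zbar" and
    c: "\<And>i. i \<le> n \<Longrightarrow> x i \<in> open_arc Z (w (- int i)) \<and> (h ^^ i) (x 0) \<in> open_arc Z (w (int i))"
    using x unfolding cylinder_def by auto
  \<comment> \<open>The forward orbit of \<open>x i\<close> first runs through the earlier
    coordinates \<open>x (i - m)\<close> and after time \<open>i\<close> through the iterates of
    \<open>x 0\<close>; the cylinder controls both.\<close>
  have "(h ^^ m) (x i) \<in> open_arc Z (w (- int i + int m))" if m: "m \<le> i + n" for m
  proof (cases "m \<le> i")
    case True
    then have "(h ^^ m) (x i) = x (i - m)" using invlim_funpow[OF xZ, of m "i - m"] by simp
    moreover have "- int i + int m = - int (i - m)" using True by simp
    moreover have "x (i - m) \<in> open_arc Z (w (- int (i - m)))"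
      by (rule c[THEN conjunct1]) (use i in simp)
    ultimately show ?thesis by (simp only:)
  next
    case False
    then have "m = (m - i) + i" by simp
    then have "(h ^^ m) (x i) = (h ^^ (m - i)) ((h ^^ i) (x i))" by (metis funpow_add o_apply)
    also have "(h ^^ i) (x i) = x 0" using invlim_funpow[OF xZ, of i 0] by simp
    finally have "(h ^^ m) (x i) = (h ^^ (m - i)) (x 0)" .
    moreover have "- int i + int m = int (m - i)" using False by simp
    moreover have "(h ^^ (m - i)) (x 0) \<in> open_arc Z (w (int (m - i)))"
      by (rule c[THEN conjunct2]) (use m in simp)
    ultimately show ?thesis by (simp only:)
  qed
  then obtain s where "s \<in> {0<..<1}" "x i = echar Z (fst (w (- int i))) (comp_br w (- int i) (Suc (i + n)) s)"
    using itinerary_comp_br[OF w, of "i + n" "x i" "- int i"] by blast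
  then have "s \<in> {0..1}" "x i = echar Z (fst (w (- int i))) (comp_br w (- int i) (i + n + 1) s)" by simp_all
  then show ?thesis by blast
qed

text \<open>An explicit form of \<open>cover_map\<close>: each coordinate depends only on the
  symbols from its own time onwards.\<close>

definition pt :: "(int \<Rightarrow> 'e subinterval) \<Rightarrow> nat \<Rightarrow> 'z" where
  "pt w = (\<lambda>i. echar Z (fst (w (- int i))) (position w (- int i)))"

lemma pt_leaf:
  assumes w: "w \<in> words"
  shows "pt w = leaf w j (position w (int j + 1))"
proof
  fix i
  show "pt w i = leaf w j (position w (int j + 1)) i"
    unfolding pt_def leaf_def using position_comp_br[OF w, of "- int i" "i + j + 1"] by (simp add: algebra_simps)
qed

lemma pt_in: "w \<in> words \<Longrightarrow> pt w \<in> topspace Zbar"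
  using pt_leaf[of w 0] leaf_in[OF _ position_mem] by metis

text \<open>The position may be an end of the parameter interval, so \<open>pt w\<close> need not
  lie on the open arc itself.\<close>

lemma pt_closure:
  assumes w: "w \<in> words"
  shows "pt w \<in> Zbar closure_of (leaf w j ` {0<..<1})"
proof -
  have "position w (int j + 1) \<in> top_of_set {0..1} closure_of {0<..<1}"
    using position_mem[OF w] by (simp add: closure_of_subtopology Int_absorb1 greaterThanLessThan_subseteq_atLeastAtMost_iff)
  then have "leaf w j (position w (int j + 1)) \<in> leaf w j ` (top_of_set {0..1} closure_of {0<..<1})" by (rule imageI)
  also have "\<dots> \<subseteq> Zbar closure_of (leaf w j ` {0<..<1})"
    by (rule continuous_map_image_closure_subset[OF leaf_cont[OF w]])
  finally show ?thesis unfolding pt_leaf[OF w, of j] .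
qed

text \<open>In each coordinate a point of all the closures lies in the compact images of branches of
  growing order. By \<open>uniform_shrink\<close> these images shrink to the image of the
  position.\<close>

lemma cylinder_closure_unique:
  assumes w: "w \<in> words" and x: "\<And>n. x \<in> Zbar closure_of cylinder Z h w n"
  shows "x = pt w"
proof
  fix i
  define e where "e = fst (w (- int i))"
  have e: "e \<in> edges Z" unfolding e_def by (rule word_edge[OF w])
  let ?K = "\<lambda>n. comp_br w (- int i) (i + n + 1) ` {0..1}"
  have xi: "x i \<in> echar Z e ` ?K n" if n: "i \<le> n" for n
  proof -
    have "(\<lambda>x. x i) ` (Zbar closure_of cylinder Z h w n) \<subseteq> gtop Z closure_of ((\<lambda>x. x i) ` cylinder Z h w n)"
      by (rule continuous_map_image_closure_subset[OF continuous_map_invlim_coord])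
    then have "x i \<in> gtop Z closure_of ((\<lambda>x. x i) ` cylinder Z h w n)" using x by blast
    also have "\<dots> \<subseteq> echar Z e ` ?K n"
    proof (rule closure_of_minimal)
      show "(\<lambda>x. x i) ` cylinder Z h w n \<subseteq> echar Z e ` ?K n"
        using cylinder_coord[OF w _ n] unfolding e_def by blast
      show "closedin (gtop Z) (echar Z e ` ?K n)"
      proof (intro closedin_edge_image[OF e] compact_imp_closed compact_continuous_image comp_br_cont words_adm w)
        show "?K n \<subseteq> {0..1}" using comp_br_mem[OF words_adm[OF w]] by blast
      qed simp
    qed
    finally show ?thesis .
  qed
  let ?k = "position w (- int i)"
  have k01: "?k \<in> {0..1}" by (rule position_mem[OF w])
  have "echar Z e ?k = x i"
  proof (rule ccontr)
    assume ne: "echar Z e ?k \<noteq> x i"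
    have "x i \<in> pts Z" using x[of 0] closure_of_subset_topspace[of Zbar] invlim_D(1) by blast
    then have op: "openin (gtop Z) (pts Z - {x i})" by (intro openin_diff closedin_finite) auto
    have "openin (top_of_set {0..1}) {t \<in> topspace (top_of_set {0..1}). echar Z e t \<in> pts Z - {x i}}"
      by (rule openin_continuous_map_preimage[OF edge_cont[OF e] op])
    moreover have "?k \<in> {t \<in> topspace (top_of_set {0..1}). echar Z e t \<in> pts Z - {x i}}"
      using k01 ne edge_in_pts[OF e] by auto
    ultimately obtain \<delta> where \<delta>: "\<delta> > 0"
      "ball ?k \<delta> \<inter> {0..1} \<subseteq> {t \<in> topspace (top_of_set {0..1}). echar Z e t \<in> pts Z - {x i}}"
      unfolding openin_contains_ball by blast
    obtain M where M: "\<forall>w i n x y. M \<le> n \<longrightarrow> adm w i n \<longrightarrow> x \<in> comp_br w i n ` {0..1} \<longrightarrow>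
      y \<in> comp_br w i n ` {0..1} \<longrightarrow> y - x < \<delta>" using uniform_shrink[OF \<delta>(1)] by blast
    define n where "n = M + i"
    obtain t where t: "t \<in> ?K n" "x i = echar Z e t" using xi[of n] unfolding n_def by auto
    have k: "?k \<in> ?K n" by (rule position_in[OF w])
    have "M \<le> i + n + 1" unfolding n_def by simp
    note M' = M[rule_format, OF this words_adm[OF w]]
    have "t - ?k < \<delta>" "?k - t < \<delta>" using M'[OF k t(1)] M'[OF t(1) k] by blast+
    moreover have "t \<in> {0..1}" using t(1) comp_br_mem[OF words_adm[OF w]] by blast
    ultimately have "t \<in> ball ?k \<delta> \<inter> {0..1}" by (auto simp: dist_real_def)
    then have "echar Z e t \<notin> {x i}" using \<delta>(2) by blast
    then show False using t(2) by simp
  qed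
  then show "x i = pt w i" unfolding pt_def e_def by simp
qed

lemma cover_map_eq_pt:
  assumes w: "w \<in> words"
  shows "cover_map Z h w = pt w"
proof -
  have "pt w \<in> Zbar closure_of cylinder Z h w n" for n
  proof -
    have "leaf w n ` {0<..<1} \<subseteq> cylinder Z h w n" using leaf_cylinder[OF w] by blast
    then show ?thesis using pt_closure[OF w, of n] closure_of_mono by blast
  qed
  then have "(\<Inter>n. Zbar closure_of cylinder Z h w n) = {pt w}"
    using cylinder_closure_unique[OF w] by blast
  then show ?thesis unfolding cover_map_def by (intro the_equality) auto
qed

end

lemma uniform_radius:
  fixes P :: "'a \<Rightarrow> real \<Rightarrow> bool"
  assumes "finite A" and "\<And>a. a \<in> A \<Longrightarrow> \<exists>d>0. P a d"
    and mono: "\<And>a d d'. P a d \<Longrightarrow> 0 < d' \<Longrightarrow> d' \<le> d \<Longrightarrow> P a d'"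
  shows "\<exists>d>0. \<forall>a\<in>A. P a d"
  using assms(1,2)
proof (induction A)
  case empty
  then show ?case by (intro exI[of _ 1]) simp
next
  case (insert a A)
  obtain d where d: "d > 0" "\<forall>a\<in>A. P a d" using insert by blast
  obtain d' where d': "d' > 0" "P a d'" using insert by blast
  have "min d d' > 0" using d d' by simp
  moreover have "P b (min d d')" if "b \<in> insert a A" for b
    using that d d' mono[of b d "min d d'"] mono[of b d' "min d d'"] by auto
  ultimately show ?case by blast
qed

section \<open>Expansivity at the vertices, and the sequences whose point never hits a
  vertex\<close>

context markov_system
begin

lemma adm_cong:
  assumes "\<And>j. j \<le> n \<Longrightarrow> w (i + int j) = w' (i' + int j)"
  shows "adm w i n = adm w' i' n"
proof -
  have "w (i + int j + 1) = w' (i' + int j + 1)" if "j < n" for j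
    using assms[of "Suc j"] that by (simp add: algebra_simps)
  then show ?thesis unfolding adm_def using assms by (metis less_imp_le)
qed

text \<open>The radius for \<open>vertices_expansive\<close>. A point closer than
  \<open>\<delta>\<close> to an end of its edge lies in the outermost piece at that end, and the
  parameter of its image is within 1/2 of the image of that end, so the image cannot be near the
  opposite end.\<close>

lemma corner_radius:
  "\<exists>\<delta>>0. \<delta> \<le> 1/2 \<and> (\<forall>I\<in>\<A>. \<delta> \<le> hi I - lo I \<and>
    (\<forall>s\<in>{0..1}. \<forall>c\<in>{0,1}. \<bar>br I s - br I c\<bar> < \<delta> \<longrightarrow> \<bar>s - c\<bar> < 1/2))"
proof -
  let ?P = "\<lambda>I \<delta>. \<delta> \<le> 1/2 \<and> \<delta> \<le> hi I - lo I \<and>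
    (\<forall>s\<in>{0..1}. \<forall>c\<in>{0,1}. \<bar>br I s - br I c\<bar> < \<delta> \<longrightarrow> \<bar>s - c\<bar> < 1/2)"
  have one: "\<exists>d>0. \<forall>s\<in>{0..1}. \<bar>br I s - br I c\<bar> < d \<longrightarrow> \<bar>s - c\<bar> < 1/2"
    if I: "I \<in> \<A>" and c: "c \<in> {0,1::real}" for I c
  proof -
    \<comment> \<open>On the compact set of parameters far from \<open>c\<close>, the distance of
      the branch from its value at \<open>c\<close> attains a minimum, which is positive by
      injectivity and serves as the radius.\<close>
    let ?S = "{0..1} \<inter> {s. 1/2 \<le> \<bar>s - c\<bar>}"
    have S: "compact ?S"
      by (intro compact_Int_closed closed_Collect_le continuous_intros) simp
    have ne: "1 - c \<in> ?S" using c by auto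
    have "continuous_on ?S (\<lambda>s. \<bar>br I s - br I c\<bar>)"
      by (intro continuous_intros continuous_on_subset[OF branch(2)[OF I]]) auto
    then obtain m where m: "m \<in> ?S" "\<forall>s\<in>?S. \<bar>br I m - br I c\<bar> \<le> \<bar>br I s - br I c\<bar>"
      using continuous_attains_inf[OF S] ne by blast
    have "m \<noteq> c" "m \<in> {0..1}" "c \<in> {0..1}" using m(1) c by auto
    then have "br I m \<noteq> br I c" using inj_onD[OF branch(3)[OF I]] by blast
    moreover have "\<bar>s - c\<bar> < 1/2" if "s \<in> {0..1}" "\<bar>br I s - br I c\<bar> < \<bar>br I m - br I c\<bar>" for s
    proof (rule ccontr)
      assume "\<not> \<bar>s - c\<bar> < 1/2"
      then have "s \<in> ?S" using that(1) by simp
      then have "\<bar>br I m - br I c\<bar> \<le> \<bar>br I s - br I c\<bar>" using m(2) by blast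
      then show False using that(2) by linarith
    qed
    ultimately show ?thesis by (intro exI[of _ "\<bar>br I m - br I c\<bar>"]) auto
  qed
  have "\<exists>d>0. ?P I d" if I: "I \<in> \<A>" for I
  proof -
    obtain d0 where d0: "d0 > 0" "\<forall>s\<in>{0..1}. \<bar>br I s - br I 0\<bar> < d0 \<longrightarrow> \<bar>s - 0\<bar> < 1/2"
      using one[OF I, of 0] by blast
    obtain d1 where d1: "d1 > 0" "\<forall>s\<in>{0..1}. \<bar>br I s - br I 1\<bar> < d1 \<longrightarrow> \<bar>s - 1\<bar> < 1/2"
      using one[OF I, of 1] by blast
    let ?d = "min (min d0 d1) (min (1/2) (hi I - lo I))"
    have "0 < ?d" using d0(1) d1(1) arc_bounds[OF I] by simp
    moreover have "?P I ?d"
    proof (intro conjI ballI impI)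
      fix s c assume s: "s \<in> {0..1}" and c: "c \<in> {0,1::real}" and lt: "\<bar>br I s - br I c\<bar> < ?d"
      show "\<bar>s - c\<bar> < 1/2"
      proof (cases "c = 0")
        case True
        then show ?thesis using d0(2) s lt by simp
      next
        case False
        then have "c = 1" using c by simp
        then show ?thesis using d1(2) s lt by simp
      qed
    qed linarith+
    ultimately show ?thesis by blast
  qed
  moreover have "?P I d'" if "?P I d" "0 < d'" "d' \<le> d" for I d d'
  proof (intro conjI ballI impI)
    show "d' \<le> 1/2" "d' \<le> hi I - lo I" using that by linarith+
    fix s c assume s: "s \<in> {0..1}" and c: "c \<in> {0,1::real}" and lt: "\<bar>br I s - br I c\<bar> < d'"
    have "\<bar>br I s - br I c\<bar> < d" using lt that(3) by linarith
    then show "\<bar>s - c\<bar> < 1/2" using that(1) s c by blast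
  qed
  ultimately have "\<exists>d>0. \<forall>I\<in>\<A>. ?P I d" using uniform_radius[OF finite_arcs, of ?P] by blast
  then obtain d where d: "d > 0" "\<forall>I\<in>\<A>. ?P I d" by blast
  show ?thesis
  proof (intro exI[of _ "min d (1/2)"] conjI ballI impI)
    fix I s c assume *: "I \<in> \<A>" "s \<in> {0..1}" "c \<in> {0,1::real}" "\<bar>br I s - br I c\<bar> < min d (1/2)"
    then have "\<bar>br I s - br I c\<bar> < d" by simp
    then show "\<bar>s - c\<bar> < 1/2" using d(2) *(1-3) by blast
  next
    fix I assume "I \<in> \<A>"
    then have "d \<le> hi I - lo I" using d(2) by blast
    then show "min d (1/2) \<le> hi I - lo I" by simp
  qed (use d(1) in auto)
qed

text \<open>Suppose that the orbit of an interior point stays near the vertices. Then the point and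
  the nearby end of its edge lie in the image of one common branch of every order, so
  \<open>uniform_shrink\<close> makes their distance smaller than itself.\<close>

lemma vertices_expansive:
  obtains W where "openin (gtop Z) W" "verts Z \<subseteq> W"
    "\<And>z. z \<in> pts Z \<Longrightarrow> (\<forall>j. (h ^^ j) z \<in> W) \<Longrightarrow> z \<in> verts Z"
proof -
  obtain \<delta> where \<delta>: "\<delta> > 0" "\<delta> \<le> 1/2" "\<forall>I\<in>\<A>. \<delta> \<le> hi I - lo I \<and>
    (\<forall>s\<in>{0..1}. \<forall>c\<in>{0,1}. \<bar>br I s - br I c\<bar> < \<delta> \<longrightarrow> \<bar>s - c\<bar> < 1/2)"
    using corner_radius by blast
  let ?C = "\<Union>((\<lambda>e. echar Z e ` {\<delta>..1-\<delta>}) ` edges Z)"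
  define W where "W = pts Z - ?C"
  have sub01: "{\<delta>..1-\<delta>} \<subseteq> {0..1}" using \<delta> by auto
  have "closedin (gtop Z) ?C"
  proof (rule closedin_Union)
    show "finite ((\<lambda>e. echar Z e ` {\<delta>..1-\<delta>}) ` edges Z)" using finite_edges by blast
    fix S assume "S \<in> (\<lambda>e. echar Z e ` {\<delta>..1-\<delta>}) ` edges Z"
    then obtain e where "e \<in> edges Z" "S = echar Z e ` {\<delta>..1-\<delta>}" by blast
    then show "closedin (gtop Z) S" using closedin_edge_image[OF _ _ sub01, of e] by simp
  qed
  then have W: "openin (gtop Z) W" unfolding W_def by (intro openin_diff) auto
  have VW: "verts Z \<subseteq> W"
  proof
    fix v assume v: "v \<in> verts Z"
    have "v \<notin> echar Z e ` {\<delta>..1-\<delta>}" if "e \<in> edges Z" for e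
      using edge_interior[OF that] v \<delta> by auto
    then show "v \<in> W" unfolding W_def using v verts_in_pts by blast
  qed
  have near: "\<exists>c\<in>{0,1}. \<bar>t - c\<bar> < \<delta>" if "e \<in> edges Z" "t \<in> {0<..<1}" "echar Z e t \<in> W" for e t
  proof -
    have "t \<notin> {\<delta>..1-\<delta>}" using that unfolding W_def by blast
    then have "t < \<delta> \<or> 1 - \<delta> < t" by auto
    then show ?thesis using that(2) by auto
  qed
  \<comment> \<open>The word may depend on \<open>n\<close>: it is built backwards, prefixing the
    piece containing \<open>t\<close> to a word found for its image.\<close>
  have corner: "\<exists>w. adm w 0 n \<and> fst (w 0) = e \<and> t \<in> comp_br w 0 n ` {0..1} \<and> c \<in> comp_br w 0 n ` {0..1}"
    if "e \<in> edges Z" "c \<in> {0,1}" "t \<in> {0<..<1}" "\<bar>t - c\<bar> < \<delta>" "\<forall>j. (h ^^ j) (echar Z e t) \<in> W" for n e c t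
    using that
  proof (induction n arbitrary: e c t)
    case 0
    have "t \<in> {0..1}" "c \<in> {0..1}" using 0 by auto
    \<comment> \<open>At order 0 only the edge of the symbol matters; the interval bounds are
      placeholders.\<close>
    then have "t \<in> comp_br (\<lambda>_. (e, 0, 0)) 0 0 ` {0..1}" "c \<in> comp_br (\<lambda>_. (e, 0, 0)) 0 0 ` {0..1}" by auto
    then show ?case by (intro exI[of _ "\<lambda>_. (e, 0, 0)"]) (simp add: adm_def)
  next
    case (Suc n)
    have c01: "0 \<le> c" "c \<le> 1" using Suc.prems(2) by auto
    obtain I where I: "I \<in> \<A>" "fst I = e" "c \<in> {lo I..hi I}" by (rule arc_exists[OF Suc.prems(1) c01])
    note bd = arc_bounds[OF I(1)]
    have dI: "\<delta> \<le> hi I - lo I" using \<delta>(3) I(1) by blast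
    have "c \<in> {lo I, hi I} \<and> t \<in> {lo I<..<hi I}"
    proof (cases "c = 0")
      case True
      then show ?thesis using I(3) bd dI Suc.prems(3,4) by auto
    next
      case False
      then have "c = 1" using Suc.prems(2) by auto
      then show ?thesis using I(3) bd dI Suc.prems(3,4) by auto
    qed
    then have "c \<in> {br I 0, br I 1}" "t \<in> br I ` {0<..<1}" using branch_open[OF I(1)] by blast+
    then obtain c' s where c': "c' \<in> {0,1}" "c = br I c'" and s: "s \<in> {0<..<1}" "t = br I s" by blast
    have s01: "s \<in> {0..1}" using s(1) by auto
    have "\<bar>br I s - br I c'\<bar> < \<delta>" using Suc.prems(4) c' s by simp
    then have half: "\<bar>s - c'\<bar> < 1/2" using \<delta>(3) I(1) s01 c'(1) by blast
    have hz: "h (echar Z e t) = echar Z (tgt I) s" using branch(6)[OF I(1) s01] I(2) s(2) by simp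
    have orb: "\<forall>j. (h ^^ j) (echar Z (tgt I) s) \<in> W"
    proof
      fix j
      have "(h ^^ Suc j) (echar Z e t) \<in> W" using Suc.prems(5) by blast
      then show "(h ^^ j) (echar Z (tgt I) s) \<in> W" by (simp only: funpow_Suc_right o_apply hz)
    qed
    have "echar Z (tgt I) s \<in> W" using spec[OF orb, of 0] by simp
    then obtain c'' where c'': "c'' \<in> {0,1}" "\<bar>s - c''\<bar> < \<delta>" using near[OF branch(1)[OF I(1)] s(1)] by blast
    \<comment> \<open>Both ends are closer than 1/2 to \<open>s\<close>, whereas distinct ends are
      at distance 1.\<close>
    have "c'' = c'" using c''(1,2) c'(1) half \<delta>(2) by auto
    then obtain w' where w': "adm w' 0 n" "fst (w' 0) = tgt I" "s \<in> comp_br w' 0 n ` {0..1}" "c' \<in> comp_br w' 0 n ` {0..1}"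
      using Suc.IH[OF branch(1)[OF I(1)] c'(1) s(1) _ orb] c''(2) by blast
    define w where "w = (\<lambda>k. if k = 0 then I else w' (k - 1))"
    have "adm w (0 + 1) n = adm w' 0 n" by (rule adm_cong) (simp add: w_def)
    then have "adm w 0 (Suc n)" unfolding adm_Suc using w' I(1) by (simp add: w_def)
    moreover have "comp_br w (0 + 1) n x = comp_br w' 0 n x" for x by (rule comp_br_cong) (simp add: w_def)
    then have "comp_br w 0 (Suc n) ` {0..1} = br I ` comp_br w' 0 n ` {0..1}"
      by (simp add: image_image w_def)
    ultimately show ?case using w' s(2) c'(2) I(2) by (intro exI[of _ w]) (auto simp: w_def)
  qed
  have "z \<in> verts Z" if z: "z \<in> pts Z" and orb: "\<forall>j. (h ^^ j) z \<in> W" for z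
  proof (rule ccontr)
    assume "z \<notin> verts Z"
    then obtain e t where e: "e \<in> edges Z" "0 < t" "t < 1" "z = echar Z e t" by (rule pts_cases[OF z])
    then have t: "t \<in> {0<..<1}" by simp
    have "echar Z e t \<in> W" using spec[OF orb, of 0] e(4) by simp
    then obtain c where c: "c \<in> {0,1}" "\<bar>t - c\<bar> < \<delta>" using near[OF e(1) t] by blast
    define d where "d = \<bar>t - c\<bar>"
    have "d > 0" using c(1) t unfolding d_def by auto
    then obtain M where M: "\<forall>w i n x y. M \<le> n \<longrightarrow> adm w i n \<longrightarrow> x \<in> comp_br w i n ` {0..1} \<longrightarrow>
      y \<in> comp_br w i n ` {0..1} \<longrightarrow> y - x < d" using uniform_shrink[of d] by blast
    obtain w where w: "adm w 0 M" "t \<in> comp_br w 0 M ` {0..1}" "c \<in> comp_br w 0 M ` {0..1}"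
      using corner[OF e(1) c(1) t c(2), of M] orb e(4) by blast
    have "t - c < d" using M[rule_format, OF order_refl w(1,3,2)] .
    moreover have "c - t < d" using M[rule_format, OF order_refl w] .
    ultimately show False unfolding d_def by linarith
  qed
  then show ?thesis using that[OF W VW] by blast
qed

lemma finite_hits: "e \<in> edges Z \<Longrightarrow> finite {t \<in> {0..1}. (h ^^ j) (echar Z e t) \<in> verts Z}"
proof (induction j arbitrary: e)
  case 0
  have "{t \<in> {0..1}. (h ^^ 0) (echar Z e t) \<in> verts Z} \<subseteq> {0, 1}"
    using edge_in_verts_iff[OF 0] by auto
  then show ?case by (rule finite_subset) simp
next
  case (Suc j)
  let ?H = "\<lambda>e. {t \<in> {0..1}. (h ^^ j) (echar Z e t) \<in> verts Z}"
  have "{t \<in> {0..1}. (h ^^ Suc j) (echar Z e t) \<in> verts Z} \<subseteq> (\<Union>I\<in>\<A>. br I ` ?H (tgt I))"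
  proof
    fix t assume t: "t \<in> {t \<in> {0..1}. (h ^^ Suc j) (echar Z e t) \<in> verts Z}"
    then have t01: "0 \<le> t" "t \<le> 1" by auto
    obtain I where I: "I \<in> \<A>" "fst I = e" "t \<in> {lo I..hi I}" by (rule arc_exists[OF Suc.prems t01])
    then obtain s where s: "s \<in> {0..1}" "t = br I s" using branch(4)[OF I(1)] by blast
    then have "h (echar Z e t) = echar Z (tgt I) s" using branch(6)[OF I(1)] I(2) by blast
    then have "(h ^^ j) (echar Z (tgt I) s) \<in> verts Z" using t by (simp add: funpow_swap1)
    then show "t \<in> (\<Union>I\<in>\<A>. br I ` ?H (tgt I))" using I(1) s by blast
  qed
  moreover have "finite (\<Union>I\<in>\<A>. br I ` ?H (tgt I))"
    using finite_arcs Suc.IH[OF branch(1)] by blast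
  ultimately show ?case by (rule finite_subset)
qed

text \<open>There are finitely many hits at each of countably many times, and an interval is
  uncountable.\<close>

lemma vertex_free_point:
  assumes "e \<in> edges Z"
  obtains s where "s \<in> {0<..<1}" "\<And>j. (h ^^ j) (echar Z e s) \<notin> verts Z"
proof -
  have "countable (\<Union>j. {t \<in> {0..1}. (h ^^ j) (echar Z e t) \<in> verts Z})"
    by (rule countable_UN[OF countableI_type]) (rule countable_finite[OF finite_hits[OF assms]])
  moreover have "uncountable {0<..<1::real}" using uncountable_open_interval[of 0 "1::real"] by simp
  ultimately have "\<not> {0<..<1} \<subseteq> (\<Union>j. {t \<in> {0..1}. (h ^^ j) (echar Z e t) \<in> verts Z})"
    using countable_subset by blast
  then show ?thesis using that by fastforce
qed

text \<open>The two-sided orbit behind a sequence: the coordinates of \<open>pt w\<close> at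
  nonpositive times, the forward orbit of \<open>pt w 0\<close> at positive times.\<close>

definition coding_pt :: "(int \<Rightarrow> 'e subinterval) \<Rightarrow> int \<Rightarrow> 'z" where
  "coding_pt w k = echar Z (fst (w k)) (position w k)"

lemma coding_pt_step:
  assumes w: "w \<in> words"
  shows "h (coding_pt w k) = coding_pt w (k + 1)"
proof -
  have I: "w k \<in> \<A>" "fst (w (k + 1)) = tgt (w k)" using w unfolding words_iff by blast+
  have "position w k = br (w k) (position w (k + 1))" by (rule position_step[OF w])
  then show ?thesis unfolding coding_pt_def using branch(6)[OF I(1) position_mem[OF w]] I(2) by simp
qed

lemma coding_pt_funpow:
  assumes w: "w \<in> words"
  shows "(h ^^ j) (coding_pt w k) = coding_pt w (k + int j)"
proof (induction j)
  case (Suc j)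
  then show ?case using coding_pt_step[OF w, of "k + int j"] by (simp add: algebra_simps)
qed simp

lemma pt_coding: "pt w i = coding_pt w (- int i)"
  unfolding pt_def coding_pt_def ..

lemma open_arc_disjoint:
  assumes I: "I \<in> \<A>" and J: "J \<in> \<A>" and y: "y \<in> open_arc Z I" "y \<in> open_arc Z J"
  shows "I = J"
proof -
  obtain s t where st: "s \<in> {lo I<..<hi I}" "y = echar Z (fst I) s" "t \<in> {lo J<..<hi J}" "y = echar Z (fst J) t"
    using y unfolding open_arc_eq by blast
  note bI = arc_bounds[OF I] and bJ = arc_bounds[OF J]
  have "0 < s" "s < 1" "0 \<le> t" "t \<le> 1" using st bI bJ by auto
  then have "fst I = fst J" "s = t" using edge_eq[OF bI(1) bJ(1), of s t] st by auto
  moreover from this have "t \<in> {lo I..hi I}" using st(1) by auto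
  ultimately show ?thesis using arc_unique[OF I J _ _ st(3)] by blast
qed

lemma open_arc_exists:
  assumes y: "y \<in> pts Z" "h y \<notin> verts Z"
  obtains I where "I \<in> \<A>" "y \<in> open_arc Z I"
proof -
  have "y \<notin> verts Z" using h_verts y(2) by blast
  then obtain e t where e: "e \<in> edges Z" "0 < t" "t < 1" "y = echar Z e t" by (rule pts_cases[OF y(1)])
  have t01: "0 \<le> t" "t \<le> 1" using e by auto
  obtain I where I: "I \<in> \<A>" "fst I = e" "t \<in> {lo I<..<hi I}"
    by (rule arc_exists_open[OF e(1) t01]) (use y(2) e(4) in auto)
  then show ?thesis using that[OF I(1)] e(4) unfolding open_arc_eq by blast
qed

lemma openin_open_arc: "I \<in> \<A> \<Longrightarrow> openin (gtop Z) (open_arc Z I)"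
  unfolding open_arc_eq using arc_bounds[of I] by (intro openin_edge_image) auto

lemma open_arc_image:
  assumes I: "I \<in> \<A>" and y: "y \<in> open_arc Z I"
  obtains s where "s \<in> {0<..<1}" "h y = echar Z (tgt I) s"
proof -
  obtain t where t: "t \<in> {lo I<..<hi I}" "y = echar Z (fst I) t" using y unfolding open_arc_eq by blast
  then obtain s where s: "s \<in> {0<..<1}" "t = br I s" using branch_open(1)[OF I] by blast
  then have "h y = echar Z (tgt I) s" using branch(6)[OF I, of s] t(2) by simp
  then show ?thesis using that s(1) by blast
qed

lemma transition_edge:
  assumes I: "I \<in> \<A>" and J: "J \<in> \<A>" and y: "y \<in> open_arc Z I" "h y \<in> open_arc Z J"
  shows "fst J = tgt I"
proof -
  obtain s where s: "s \<in> {0<..<1}" "h y = echar Z (tgt I) s" by (rule open_arc_image[OF I y(1)])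
  obtain t where t: "t \<in> {lo J<..<hi J}" "h y = echar Z (fst J) t" using y(2) unfolding open_arc_eq by blast
  have "0 < t" "t < 1" using t(1) arc_bounds[OF J] by auto
  then show ?thesis using edge_eq(1)[OF arc_bounds(1)[OF J] branch(1)[OF I], of t s] s t by auto
qed

lemma coding_pt_arc:
  assumes w: "w \<in> words" and v: "h (coding_pt w k) \<notin> verts Z"
  shows "coding_pt w k \<in> open_arc Z (w k)"
proof -
  have I: "w k \<in> \<A>" using w unfolding words_iff by blast
  have "position w k \<in> {lo (w k)..hi (w k)}"
    using position_step[OF w, of k] branch_mem[OF I position_mem[OF w, of "k + 1"]] by simp
  moreover have "position w k \<notin> {lo (w k), hi (w k)}" using arc_end_vertex[OF I] v unfolding coding_pt_def by blast
  ultimately show ?thesis unfolding coding_pt_def open_arc_eq by (intro imageI) auto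
qed

text \<open>Excluding forward hits is enough, because a vertex at an earlier time would be mapped to
  vertices at all later times.\<close>

definition generic :: "(int \<Rightarrow> 'e subinterval) \<Rightarrow> bool" where
  "generic w \<longleftrightarrow> (\<forall>j. (h ^^ j) (pt w 0) \<notin> verts Z)"

lemma generic_coding:
  assumes w: "w \<in> words" "generic w"
  shows "coding_pt w k \<notin> verts Z"
proof
  assume v: "coding_pt w k \<in> verts Z"
  define j where "j = nat (- k)"
  have "(h ^^ j) (coding_pt w k) = coding_pt w (k + int j)" by (rule coding_pt_funpow[OF w(1)])
  then have v': "coding_pt w (k + int j) \<in> verts Z" using h_funpow_verts[OF v, of j] by simp
  have "k + int j = int (nat k)" unfolding j_def by simp
  then have "coding_pt w (k + int j) = (h ^^ nat k) (pt w 0)"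
    using coding_pt_funpow[OF w(1), of "nat k" 0] pt_coding[of w 0] by simp
  then show False using w(2) v' unfolding generic_def by simp
qed

text \<open>When no orbit point is a vertex, every orbit point lies in the interior of its arc.
  Interiors of distinct arcs are disjoint, so all symbols can be read off from the point.\<close>

lemma generic_determined:
  assumes w: "w \<in> words" "generic w" and w': "w' \<in> words" and eq: "pt w = pt w'"
  shows "w = w'"
proof
  fix k
  have gen': "generic w'" using w(2) eq unfolding generic_def by simp
  have same: "coding_pt w k = coding_pt w' k"
  proof (cases "k \<le> 0")
    case True
    then show ?thesis using fun_cong[OF eq, of "nat (- k)"] by (simp add: pt_coding)
  next
    case False
    then have k: "k = 0 + int (nat k)" by simp
    have "coding_pt w 0 = coding_pt w' 0" using fun_cong[OF eq, of 0] by (simp add: pt_coding)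
    then show ?thesis
      using coding_pt_funpow[OF w(1), of "nat k" 0] coding_pt_funpow[OF w', of "nat k" 0] k by simp
  qed
  have "h (coding_pt w k) \<notin> verts Z" "h (coding_pt w' k) \<notin> verts Z"
    using generic_coding[OF w] generic_coding[OF w' gen'] coding_pt_step[OF w(1)] coding_pt_step[OF w'] by simp_all
  then have "coding_pt w k \<in> open_arc Z (w k)" "coding_pt w k \<in> open_arc Z (w' k)"
    using coding_pt_arc[OF w(1), of k] coding_pt_arc[OF w', of k] same by simp_all
  moreover have "w k \<in> \<A>" "w' k \<in> \<A>" using w(1) w' unfolding words_iff by blast+
  ultimately show "w k = w' k" using open_arc_disjoint by blast
qed

text \<open>Keep all symbols up to time \<open>m\<close> and continue with the itinerary of a point
  of the next edge that never hits a vertex.\<close>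

lemma generic_dense:
  assumes w: "w \<in> words"
  obtains u where "u \<in> words" "generic u" "\<And>k. k \<le> int m \<Longrightarrow> u k = w k"
proof -
  define e where "e = fst (w (int m + 1))"
  have e: "e \<in> edges Z" unfolding e_def by (rule word_edge[OF w])
  obtain s where s: "s \<in> {0<..<1}" "\<And>j. (h ^^ j) (echar Z e s) \<notin> verts Z"
    by (rule vertex_free_point[OF e]) blast
  define y where "y j = (h ^^ j) (echar Z e s)" for j
  have y0: "echar Z e s \<in> pts Z" using edge_in_pts[OF e] s(1) by auto
  have ystep: "h (y j) = y (Suc j)" for j unfolding y_def by simp
  have yp: "y j \<in> pts Z" and yv: "y j \<notin> verts Z" for j unfolding y_def using h_funpow_pts[OF y0] s(2) by blast+
  have "\<exists>I. I \<in> \<A> \<and> y j \<in> open_arc Z I" for j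
    using open_arc_exists[OF yp, of j] ystep yv by metis
  then obtain A where A: "\<And>j. A j \<in> \<A> \<and> y j \<in> open_arc Z (A j)" by metis
  have tr: "fst (A (Suc j)) = tgt (A j)" for j
    using transition_edge[of "A j" "A (Suc j)" "y j"] A ystep by metis
  have "fst (A 0) = e"
  proof -
    obtain t where t: "t \<in> {lo (A 0)<..<hi (A 0)}" "echar Z e s = echar Z (fst (A 0)) t"
      using A[of 0] unfolding open_arc_eq y_def by auto
    have "A 0 \<in> \<A>" using A by blast
    then show ?thesis using edge_eq(1)[OF e arc_bounds(1), of "A 0" s t] t s(1) arc_bounds[of "A 0"] by auto
  qed
  define u where "u k = (if k \<le> int m then w k else A (nat (k - int m - 1)))" for k
  have u_tail: "u (int m + 1 + int j) = A j" for j unfolding u_def by simp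
  have "u k \<in> \<A> \<and> fst (u (k + 1)) = tgt (u k)" for k
  proof -
    consider "k < int m" | "k = int m" | "int m < k" by linarith
    then show ?thesis
    proof cases
      case 1
      then show ?thesis using w unfolding words_iff u_def by simp
    next
      case 2
      have "w (int m) \<in> \<A>" "fst (w (int m + 1)) = tgt (w (int m))" using w unfolding words_iff by blast+
      then show ?thesis using 2 u_tail[of 0] \<open>fst (A 0) = e\<close> e_def by (simp add: u_def)
    next
      case 3
      then obtain j where j: "k = int m + 1 + int j" by (metis zless_iff_Suc_zadd add.assoc add.commute of_nat_Suc)
      have "k + 1 = int m + 1 + int (Suc j)" using j by simp
      then show ?thesis using u_tail[of j] u_tail[of "Suc j"] A[of j] tr[of j] j by metis
    qed
  qed
  then have u: "u \<in> words" unfolding words_iff by blast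
  have fu: "fst (u (int m + 1)) = e" using u_tail[of 0] \<open>fst (A 0) = e\<close> by simp
  \<comment> \<open>The prescribed itinerary puts \<open>s\<close> into all branch intervals at time
    \<open>m + 1\<close>, hence it is the position there.\<close>
  have "s \<in> comp_br u (int m + 1) n ` {0..1}" for n
  proof (cases n)
    case 0
    then show ?thesis using s(1) by auto
  next
    case (Suc M)
    have "(h ^^ j) (echar Z e s) \<in> open_arc Z (u (int m + 1 + int j))" if "j \<le> M" for j
      using A[of j] unfolding u_tail y_def by blast
    from itinerary_comp_br[OF u this] obtain s' where s': "s' \<in> {0<..<1}"
      "echar Z e s = echar Z e (comp_br u (int m + 1) (Suc M) s')" unfolding fu by blast
    have "comp_br u (int m + 1) (Suc M) s' \<in> {0<..<1}" by (rule comp_br_mem_open[OF words_adm[OF u] s'(1)])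
    then have "s = comp_br u (int m + 1) (Suc M) s'"
      using edge_eq(2)[OF e e _ _ _ _ s'(2)] s(1) by simp
    then show ?thesis unfolding Suc by (rule image_eqI) (use s'(1) in auto)
  qed
  then have "s = position u (int m + 1)" using shrink_unique[OF words_adm[OF u]] position_in[OF u] by blast
  then have c: "coding_pt u (int m + 1) = echar Z e s" unfolding coding_pt_def fu by simp
  have "generic u" unfolding generic_def
  proof (intro allI notI)
    fix j assume "(h ^^ j) (pt u 0) \<in> verts Z"
    \<comment> \<open>A vertex on the orbit of \<open>pt u 0\<close> stays a vertex for another
      \<open>m + 1\<close> steps, and by then the orbit has become that of the chosen point.\<close>
    then have "(h ^^ (m + 1)) ((h ^^ j) (pt u 0)) \<in> verts Z" by (rule h_funpow_verts)
    moreover have "(h ^^ (m + 1)) ((h ^^ j) (pt u 0)) = (h ^^ j) ((h ^^ (m + 1)) (pt u 0))"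
      by (metis add.commute funpow_add o_apply)
    moreover have "(h ^^ (m + 1)) (pt u 0) = echar Z e s"
      using coding_pt_funpow[OF u, of "m + 1" 0] c by (simp add: pt_coding add.commute del: funpow.simps)
    ultimately show False using s(2)[of j] by (simp del: funpow.simps)
  qed
  then show ?thesis using that[OF u] by (simp add: u_def)
qed

end

section \<open>Iterates of the map on the inverse limit, and the topology of the sequence
  space\<close>

lemma invlim_map_in:
  assumes "f ` topspace T \<subseteq> topspace T" "x \<in> topspace (invlim T f)"
  shows "invlim_map f x \<in> topspace (invlim T f)"
proof -
  have "invlim_map f x i \<in> topspace T \<and> f (invlim_map f x (Suc i)) = invlim_map f x i" for i
    using assms invlim_D[OF assms(2)] unfolding invlim_map_def by (cases i) auto
  then show ?thesis unfolding topspace_invlim by blast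
qed

lemma invlim_map_funpow_0: "(invlim_map f ^^ j) x 0 = (f ^^ j) (x 0)"
  by (induction j) (simp_all add: invlim_map_def)

lemma invlim_map_funpow_shift: "(invlim_map f ^^ j) x (j + k) = x k"
  by (induction j) (simp_all add: invlim_map_def)

text \<open>After \<open>j\<close> steps the coordinates 0 to \<open>j\<close> consist of the
  forward orbit of the old zeroth coordinate, read backwards; the past only enters beyond
  \<open>j\<close>.\<close>

lemma invlim_map_funpow_agree:
  assumes "x 0 = y 0"
  shows "i \<le> j \<Longrightarrow> (invlim_map f ^^ j) x i = (invlim_map f ^^ j) y i"
proof (induction j arbitrary: i)
  case 0
  then show ?case using assms by simp
next
  case (Suc j)
  then show ?case by (cases i) (simp_all add: invlim_map_def)
qed

lemma openin_sft_agree: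
  assumes "finite F"
  shows "openin (sft G h \<A>) {u \<in> topspace (sft G h \<A>). \<forall>k\<in>F. u k = w k}"
  using assms
proof (induction F)
  case (insert k F)
  have "continuous_map (sft G h \<A>) (discrete_topology \<A>) (\<lambda>u. u k)"
    unfolding sft_def by (intro continuous_map_from_subtopology continuous_map_product_projection) simp
  then have "openin (sft G h \<A>) {u \<in> topspace (sft G h \<A>). u k \<in> {w k} \<inter> \<A>}"
    by (rule openin_continuous_map_preimage) simp
  then have "openin (sft G h \<A>) ({u \<in> topspace (sft G h \<A>). u k \<in> {w k} \<inter> \<A>} \<inter>
    {u \<in> topspace (sft G h \<A>). \<forall>k\<in>F. u k = w k})" using insert.IH by (rule openin_Int)
  moreover have "u k \<in> \<A>" if "u \<in> topspace (sft G h \<A>)" for u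
    using that unfolding sft_def by (auto simp: PiE_UNIV_domain)
  then have "{u \<in> topspace (sft G h \<A>). u k \<in> {w k} \<inter> \<A>} \<inter>
    {u \<in> topspace (sft G h \<A>). \<forall>k\<in>F. u k = w k} = {u \<in> topspace (sft G h \<A>). \<forall>k\<in>insert k F. u k = w k}"
    by auto
  ultimately show ?case by simp
qed simp

text \<open>Finitely many times are constrained. They are bounded from above only, since
  \<open>generic_dense\<close> preserves the entire past.\<close>

lemma openin_sft_basic:
  assumes U: "openin (sft G h \<A>) U" and w: "w \<in> U"
  obtains m :: nat where "\<And>u. u \<in> topspace (sft G h \<A>) \<Longrightarrow> (\<forall>k\<le>int m. u k = w k) \<Longrightarrow> u \<in> U"
proof -
  obtain W where W: "openin (product_topology (\<lambda>_. discrete_topology \<A>) UNIV) W"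
    "U = W \<inter> {w. \<forall>k. closed_arc G (w (k + 1)) \<subseteq> h ` closed_arc G (w k)}"
    using U unfolding sft_def openin_subtopology by blast
  then have "w \<in> W" using w by blast
  then obtain B where B: "finite {i \<in> UNIV. B i \<noteq> topspace (discrete_topology \<A>)}"
    "w \<in> Pi\<^sub>E UNIV B" "Pi\<^sub>E UNIV B \<subseteq> W"
    using W(1) unfolding openin_product_topology_alt by blast
  obtain m where m: "\<forall>i\<in>nat ` {i \<in> UNIV. B i \<noteq> topspace (discrete_topology \<A>)}. i \<le> m"
    using B(1) finite_nat_set_iff_bounded_le by blast
  show ?thesis
  proof (rule that)
    fix u assume u: "u \<in> topspace (sft G h \<A>)" "\<forall>k\<le>int m. u k = w k"
    have uA: "u i \<in> \<A>" for i using u(1) unfolding sft_def by (auto simp: PiE_UNIV_domain)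
    have "u i \<in> B i" for i
    proof (cases "B i = topspace (discrete_topology \<A>)")
      case True
      then show ?thesis using uA by simp
    next
      case False
      then have "nat i \<le> m" using m by blast
      then have "i \<le> int m" by simp
      then show ?thesis using u(2) B(2) by (auto simp: PiE_UNIV_domain)
    qed
    then have "u \<in> W" using B(3) by (auto simp: PiE_UNIV_domain)
    then show "u \<in> U" using W(2) u(1) unfolding sft_def by auto
  qed
qed

lemma Hausdorff_sft: "Hausdorff_space (sft G h \<A>)"
  unfolding sft_def
  by (intro Hausdorff_space_subtopology) (simp add: Hausdorff_space_product_topology)

definition shift_by :: "int \<Rightarrow> (int \<Rightarrow> 'b) \<Rightarrow> int \<Rightarrow> 'b" where
  "shift_by i w = (\<lambda>k. w (k + i))"

context markov_system
begin

lemma shift_by_word: "w \<in> words \<Longrightarrow> shift_by i w \<in> words"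
  unfolding words_iff shift_by_def by (metis add.assoc add.commute)

lemma shift_shift_by: "shift (shift_by i w) = shift_by (i + 1) w"
  unfolding shift_def shift_by_def by (simp add: algebra_simps)

lemma leaf_funpow:
  assumes w: "w \<in> words" and s: "s \<in> {0..1}"
  shows "(invlim_map h ^^ i) (leaf w (j + i) s) = leaf (shift_by (int i) w) j s"
proof (induction i arbitrary: j)
  case 0
  then show ?case by (simp add: shift_by_def)
next
  case (Suc i)
  have "(invlim_map h ^^ Suc i) (leaf w (j + Suc i) s) = invlim_map h ((invlim_map h ^^ i) (leaf w (Suc j + i) s))"
    by simp
  also have "\<dots> = invlim_map h (leaf (shift_by (int i) w) (Suc j) s)" unfolding Suc ..
  also have "\<dots> = leaf (shift_by (int i + 1) w) j s"
    unfolding leaf_shift[OF shift_by_word[OF w] s] shift_shift_by ..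
  finally show ?case by (simp add: add.commute)
qed

lemma invlim_map_closed: "x \<in> topspace Zbar \<Longrightarrow> invlim_map h x \<in> topspace Zbar"
  by (rule invlim_map_in) (use h_pts in auto)

lemma invlim_map_funpow_closed: "x \<in> topspace Zbar \<Longrightarrow> (invlim_map h ^^ j) x \<in> topspace Zbar"
  by (induction j) (simp_all add: invlim_map_closed)

lemma generic_closure:
  assumes w: "w \<in> words"
  shows "w \<in> sft Z h \<A> closure_of {u \<in> words. generic u}"
  unfolding in_closure_of
proof (intro conjI w allI impI)
  fix U assume U: "w \<in> U \<and> openin (sft Z h \<A>) U"
  obtain m where m: "\<And>u. u \<in> words \<Longrightarrow> (\<forall>k\<le>int m. u k = w k) \<Longrightarrow> u \<in> U"
    by (rule openin_sft_basic[OF conjunct2[OF U] conjunct1[OF U]]) blast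
  obtain u where u: "u \<in> words" "generic u" "\<And>k. k \<le> int m \<Longrightarrow> u k = w k"
    by (rule generic_dense[OF w, of m]) blast
  then show "\<exists>y. y \<in> {u \<in> words. generic u} \<and> y \<in> U" using m[of u] by blast
qed

end

section \<open>Conjugacies that respect the vertices\<close>

text \<open>The conditions on the two sets are one-sided: \<open>\<Theta>\<close> lies over
  vertices, while \<open>\<Theta>'\<close> is finite, invariant and reaches every vertex. Using the
  locale for a conjugacy and for its inverse gives all of them for both sets.\<close>

locale markov_pair = A: markov_system Z h \<A> + B: markov_system Z' h' \<B>
  for Z :: "('z, 'e, 'm) digraph_scheme" and h \<A>
    and Z' :: "('y, 'd, 'k) digraph_scheme" and h' \<B> +
  fixes \<Phi> :: "(nat \<Rightarrow> 'z) \<Rightarrow> nat \<Rightarrow> 'y" and \<Theta> \<Theta>'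
  assumes homeo: "homeomorphic_map A.Zbar B.Zbar \<Phi>"
    and comm: "\<And>x. x \<in> topspace A.Zbar \<Longrightarrow> \<Phi> (invlim_map h x) = invlim_map h' (\<Phi> x)"
    and \<Theta>_sub: "\<Theta> \<subseteq> topspace A.Zbar" and \<Theta>_verts: "\<And>\<theta>. \<theta> \<in> \<Theta> \<Longrightarrow> \<theta> 0 \<in> verts Z"
    and \<Theta>_image: "\<Phi> ` \<Theta> = \<Theta>'" and \<Theta>'_fin: "finite \<Theta>'"
    and \<Theta>'_inv: "\<And>\<theta>. \<theta> \<in> \<Theta>' \<Longrightarrow> invlim_map h' \<theta> \<in> \<Theta>'"
    and \<Theta>'_verts: "verts Z' \<subseteq> (\<lambda>\<theta>. \<theta> 0) ` \<Theta>'"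
begin

lemma \<Phi>_in: "x \<in> topspace A.Zbar \<Longrightarrow> \<Phi> x \<in> topspace B.Zbar"
  using homeomorphic_imp_surjective_map[OF homeo] by blast

lemma comm_funpow:
  assumes "x \<in> topspace A.Zbar"
  shows "\<Phi> ((invlim_map h ^^ j) x) = (invlim_map h' ^^ j) (\<Phi> x)"
  by (induction j) (simp_all add: comm A.invlim_map_funpow_closed[OF assms])

text \<open>
  Points of \<open>B.Zbar\<close> with the same zeroth coordinate are forward asymptotic, uniformly.  Hence the
  forward orbit of \<open>x\<close> eventually stays near the vertices, and it can do so only on them.
\<close>

lemma hit_time: "\<exists>k. \<forall>x\<in>topspace A.Zbar. \<Phi> x 0 \<in> verts Z' \<longrightarrow> (h ^^ k) (x 0) \<in> verts Z"
proof -
  obtain W where W: "openin (gtop Z) W" "verts Z \<subseteq> W"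
    "\<And>z. z \<in> pts Z \<Longrightarrow> (\<forall>j. (h ^^ j) z \<in> W) \<Longrightarrow> z \<in> verts Z"
    by (rule A.vertices_expansive) blast
  define Wb where "Wb = {x \<in> topspace A.Zbar. x 0 \<in> W}"
  have "openin A.Zbar Wb"
    unfolding Wb_def by (rule openin_continuous_map_preimage[OF continuous_map_invlim_coord W(1)])
  then have op: "openin B.Zbar (\<Phi> ` Wb)"
    using homeomorphic_imp_open_map[OF homeo] unfolding open_map_def by blast
  have near: "\<theta> \<in> \<Phi> ` Wb" if "\<theta> \<in> \<Theta>'" for \<theta>
    using that \<Theta>_sub \<Theta>_verts W(2) unfolding \<Theta>_image[symmetric] Wb_def by blast
  have "\<exists>n. \<forall>y. y \<in> topspace B.Zbar \<longrightarrow> (\<forall>i\<le>n. y i = \<theta> i) \<longrightarrow> y \<in> \<Phi> ` Wb" if "\<theta> \<in> \<Theta>'" for \<theta>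
    by (rule openin_invlim_basic[OF op near[OF that]]) blast
  then obtain \<nu> where \<nu>: "\<forall>\<theta>\<in>\<Theta>'. \<forall>y. y \<in> topspace B.Zbar \<longrightarrow> (\<forall>i\<le>\<nu> \<theta>. y i = \<theta> i) \<longrightarrow> y \<in> \<Phi> ` Wb"
    by metis
  \<comment> \<open>As \<open>\<Theta>'\<close> is finite, one number of coordinates works at all of
    its points; this makes the hitting time independent of \<open>x\<close>.\<close>
  obtain n where n: "\<forall>m\<in>\<nu> ` \<Theta>'. m \<le> n"
    using finite_nat_set_iff_bounded_le[of "\<nu> ` \<Theta>'"] \<Theta>'_fin by blast
  have "(h ^^ n) (x 0) \<in> verts Z" if x: "x \<in> topspace A.Zbar" and v: "\<Phi> x 0 \<in> verts Z'" for x
  proof (rule W(3))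
    have x0: "x 0 \<in> pts Z" using invlim_D(1)[OF x] .
    then show "(h ^^ n) (x 0) \<in> pts Z" by (rule A.h_funpow_pts)
    obtain \<theta> where \<theta>: "\<theta> \<in> \<Theta>'" "\<Phi> x 0 = \<theta> 0" using v \<Theta>'_verts by blast
    show "\<forall>j. (h ^^ j) ((h ^^ n) (x 0)) \<in> W"
    proof
      fix j
      \<comment> \<open>At time \<open>j + n\<close> the image point agrees in more than
        \<open>n\<close> coordinates with an iterate of \<open>\<theta>\<close>, which again belongs
        to \<open>\<Theta>'\<close>.\<close>
      define m where "m = j + n"
      let ?x = "(invlim_map h ^^ m) x"
      have xm: "?x \<in> topspace A.Zbar" by (rule A.invlim_map_funpow_closed[OF x])
      have \<theta>m: "(invlim_map h' ^^ m) \<theta> \<in> \<Theta>'" by (induction m) (simp_all add: \<theta>(1) \<Theta>'_inv)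
      then have "\<nu> ((invlim_map h' ^^ m) \<theta>) \<le> m" using n unfolding m_def by fastforce
      moreover have "\<Phi> ?x i = (invlim_map h' ^^ m) \<theta> i" if "i \<le> m" for i
        unfolding comm_funpow[OF x] using invlim_map_funpow_agree[where x = "\<Phi> x" and y = \<theta>, OF \<theta>(2) that] .
      ultimately have "\<Phi> ?x \<in> \<Phi> ` Wb" using \<nu> \<theta>m \<Phi>_in[OF xm] by (meson le_trans)
      then obtain x' where x': "x' \<in> Wb" "\<Phi> ?x = \<Phi> x'" by blast
      have "?x = x'"
        using inj_onD[OF homeomorphic_imp_injective_map[OF homeo] x'(2) xm] x'(1) unfolding Wb_def by blast
      then have "?x 0 \<in> W" using x'(1) unfolding Wb_def by blast
      then show "(h ^^ j) ((h ^^ n) (x 0)) \<in> W" unfolding invlim_map_funpow_0 m_def by (simp add: funpow_add)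
    qed
  qed
  then show ?thesis by blast
qed

definition K :: nat where
  "K = (SOME k. \<forall>x\<in>topspace A.Zbar. \<Phi> x 0 \<in> verts Z' \<longrightarrow> (h ^^ k) (x 0) \<in> verts Z)"

lemma K: "x \<in> topspace A.Zbar \<Longrightarrow> \<Phi> x 0 \<in> verts Z' \<Longrightarrow> (h ^^ K) (x 0) \<in> verts Z"
  using someI_ex[OF hit_time] unfolding K_def by blast

text \<open>At the positive times up to \<open>K\<close> an open leaf avoids the vertices, so \<open>\<Phi>\<close> keeps it in one partition interval.\<close>

definition code0 :: "(int \<Rightarrow> 'e subinterval) \<Rightarrow> 'd subinterval" where
  "code0 w = (SOME I. I \<in> \<B> \<and> (\<forall>s\<in>{0<..<1}. \<Phi> (A.leaf w K s) 0 \<in> open_arc Z' I))"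

lemma code0:
  assumes w: "w \<in> A.words"
  shows "code0 w \<in> \<B>" "\<And>s. s \<in> {0<..<1} \<Longrightarrow> \<Phi> (A.leaf w K s) 0 \<in> open_arc Z' (code0 w)"
proof -
  define c where "c s = \<Phi> (A.leaf w K s) 0" for s
  have leaf_in: "A.leaf w K s \<in> topspace A.Zbar" if "s \<in> {0<..<1}" for s
    using A.leaf_in[OF w] that by auto
  have cp: "c s \<in> pts Z'" if "s \<in> {0<..<1}" for s
    unfolding c_def using invlim_D(1)[OF \<Phi>_in[OF leaf_in[OF that]]] .
  \<comment> \<open>A point lies in an open arc as soon as its image under \<open>h'\<close> is no
    vertex. This extra step gives the time \<open>K + 1\<close>, exactly when the arc of depth
    \<open>K\<close> reaches the parameter \<open>s\<close> itself.\<close>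
  have hc: "h' (c s) \<notin> verts Z'" if s: "s \<in> {0<..<1}" for s
  proof
    let ?x = "A.leaf w K s"
    assume "h' (c s) \<in> verts Z'"
    then have "\<Phi> (invlim_map h ?x) 0 \<in> verts Z'"
      unfolding comm[OF leaf_in[OF s]] c_def by (simp add: invlim_map_def)
    then have "(h ^^ K) (invlim_map h ?x 0) \<in> verts Z"
      by (rule K[OF A.invlim_map_closed[OF leaf_in[OF s]]])
    then have v: "(h ^^ (K + 1)) (?x 0) \<in> verts Z" by (simp add: invlim_map_def funpow_swap1)
    have s01: "s \<in> {0..1}" using s by auto
    have "(h ^^ (K + 1)) (?x 0) = echar Z (fst (w (int (K + 1)))) s"
      using A.leaf_0_funpow[OF w s01, of "K + 1" K] by simp
    then show False using v A.edge_interior[OF A.word_edge[OF w]] s by auto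
  qed
  have "continuous_map (top_of_set {0<..<1}) A.Zbar (A.leaf w K)"
    by (rule continuous_map_interval_subset[OF A.leaf_cont[OF w]]) auto
  then have "continuous_map (top_of_set {0<..<1}) B.Zbar (\<lambda>s. \<Phi> (A.leaf w K s))"
    using continuous_map_compose[OF _ homeomorphic_imp_continuous_map[OF homeo]] unfolding o_def by blast
  from continuous_map_compose[OF this continuous_map_invlim_coord, of 0]
  have "continuous_map (top_of_set {0<..<1}) (gtop Z') c" unfolding o_def c_def .
  then have conn: "connectedin (gtop Z') (c ` {0<..<1})"
    by (rule connectedin_continuous_map_image) (simp add: connectedin_subtopology)
  have half: "1/2 \<in> {0<..<1::real}" by simp
  obtain I where I: "I \<in> \<B>" "c (1/2) \<in> open_arc Z' I"
    by (rule B.open_arc_exists[OF cp[OF half] hc[OF half]])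
  let ?E = "\<Union>(open_arc Z' ` (\<B> - {I}))"
  have opE: "openin (gtop Z') ?E" using B.openin_open_arc by (intro openin_Union) blast
  have sub: "c ` {0<..<1} \<subseteq> open_arc Z' I \<union> ?E"
  proof
    fix y assume "y \<in> c ` {0<..<1}"
    then obtain s where s: "s \<in> {0<..<1}" "y = c s" by blast
    obtain J where "J \<in> \<B>" "c s \<in> open_arc Z' J" by (rule B.open_arc_exists[OF cp[OF s(1)] hc[OF s(1)]])
    then show "y \<in> open_arc Z' I \<union> ?E" using s(2) by (cases "J = I") blast+
  qed
  have disj: "open_arc Z' I \<inter> ?E \<inter> c ` {0<..<1} = {}"
  proof -
    have "y \<notin> ?E" if "y \<in> open_arc Z' I" for y using B.open_arc_disjoint[OF I(1) _ that] by blast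
    then show ?thesis by blast
  qed
  have meet: "open_arc Z' I \<inter> c ` {0<..<1} \<noteq> {}" using I(2) half by blast
  have "?E \<inter> c ` {0<..<1} = {}"
  proof (rule ccontr)
    assume "?E \<inter> c ` {0<..<1} \<noteq> {}"
    then show False using connectedinD[OF conn B.openin_open_arc[OF I(1)] opE sub disj meet] by blast
  qed
  then have "\<forall>s\<in>{0<..<1}. c s \<in> open_arc Z' I" using sub by blast
  then have "\<exists>I. I \<in> \<B> \<and> (\<forall>s\<in>{0<..<1}. \<Phi> (A.leaf w K s) 0 \<in> open_arc Z' I)" using I(1) unfolding c_def by blast
  then have "code0 w \<in> \<B> \<and> (\<forall>s\<in>{0<..<1}. \<Phi> (A.leaf w K s) 0 \<in> open_arc Z' (code0 w))"
    unfolding code0_def by (rule someI_ex)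
  then show "code0 w \<in> \<B>" "\<And>s. s \<in> {0<..<1} \<Longrightarrow> \<Phi> (A.leaf w K s) 0 \<in> open_arc Z' (code0 w)" by blast+
qed

lemma code0_leaf:
  assumes w: "w \<in> A.words" and s: "s \<in> {0<..<1}"
  shows "\<Phi> (A.leaf w (K + m) s) 0 \<in> open_arc Z' (code0 w)"
proof -
  obtain s' where "s' \<in> {0<..<1}" "A.leaf w (K + m) s = A.leaf w K s'"
    using A.leaf_Suc_subset[OF w, of K m] s by blast
  then show ?thesis using code0(2)[OF w] by simp
qed

definition code :: "(int \<Rightarrow> 'e subinterval) \<Rightarrow> int \<Rightarrow> 'd subinterval" where
  "code w = (\<lambda>i. code0 (shift_by i w))"

lemma code_word:
  assumes w: "w \<in> A.words"
  shows "code w \<in> B.words"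
  unfolding B.words_iff
proof (intro allI conjI)
  fix i
  let ?w = "shift_by i w"
  have w': "?w \<in> A.words" "shift ?w \<in> A.words" using A.shift_by_word[OF w] A.shift_word by blast+
  show I: "code w i \<in> \<B>" unfolding code_def by (rule code0(1)[OF w'(1)])
  have J: "code0 (shift ?w) \<in> \<B>" by (rule code0(1)[OF w'(2)])
  have half: "1/2 \<in> {0<..<1::real}" "1/2 \<in> {0..1::real}" by simp_all
  \<comment> \<open>Depth \<open>K + 1\<close> leaves depth \<open>K\<close> after one shift, so the
    same point reads off two consecutive symbols.\<close>
  let ?x = "A.leaf ?w (K + 1) (1/2)"
  have xin: "?x \<in> topspace A.Zbar" by (rule A.leaf_in[OF w'(1) half(2)])
  have y: "\<Phi> ?x 0 \<in> open_arc Z' (code w i)" unfolding code_def by (rule code0_leaf[OF w'(1) half(1)])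
  have "\<Phi> (A.leaf (shift ?w) K (1/2)) 0 \<in> open_arc Z' (code0 (shift ?w))" by (rule code0(2)[OF w'(2) half(1)])
  then have "h' (\<Phi> ?x 0) \<in> open_arc Z' (code0 (shift ?w))"
    using A.leaf_shift[OF w'(1) half(2), of K] comm[OF xin] by (simp add: invlim_map_def)
  then have "fst (code0 (shift ?w)) = B.tgt (code w i)"
    by (rule B.transition_edge[OF I J y])
  then show "fst (code w (i + 1)) = B.tgt (code w i)"
    unfolding A.shift_shift_by by (simp add: code_def)
qed

text \<open>The additional depth \<open>n\<close> pays for \<open>n\<close> forward steps.
  Coordinate \<open>i\<close> is read by writing the arc as the \<open>i\<close>-th image of an arc
  of the word shifted back by \<open>i\<close>.\<close>

lemma code_leaf:
  assumes w: "w \<in> A.words" and s: "s \<in> {0<..<1}"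
  shows "\<Phi> (A.leaf w (K + n) s) \<in> cylinder Z' h' (code w) n"
proof -
  have s01: "s \<in> {0..1}" using s by auto
  let ?x = "A.leaf w (K + n) s"
  have xin: "?x \<in> topspace A.Zbar" by (rule A.leaf_in[OF w s01])
  have "\<Phi> ?x i \<in> open_arc Z' (code w (- int i)) \<and> (h' ^^ i) (\<Phi> ?x 0) \<in> open_arc Z' (code w (int i))"
    if i: "i \<le> n" for i
  proof
    let ?u = "shift_by (- int i) w"
    have u: "?u \<in> A.words" by (rule A.shift_by_word[OF w])
    let ?v = "A.leaf ?u (K + n + i) s"
    have vin: "?v \<in> topspace A.Zbar" by (rule A.leaf_in[OF u s01])
    have "shift_by (int i) ?u = w" unfolding shift_by_def by simp
    then have "?x = (invlim_map h ^^ i) ?v" using A.leaf_funpow[OF u s01, of i "K + n"] by simp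
    then have "\<Phi> ?x i = (invlim_map h' ^^ i) (\<Phi> ?v) (i + 0)" using comm_funpow[OF vin] by simp
    also have "\<dots> = \<Phi> ?v 0" by (rule invlim_map_funpow_shift)
    also have "\<dots> \<in> open_arc Z' (code0 ?u)" using code0_leaf[OF u s, of "n + i"] by (simp add: add.assoc)
    finally show "\<Phi> ?x i \<in> open_arc Z' (code w (- int i))" unfolding code_def .
  next
    let ?u = "shift_by (int i) w"
    have u: "?u \<in> A.words" by (rule A.shift_by_word[OF w])
    have n: "K + n = (K + (n - i)) + i" using i by simp
    have "(h' ^^ i) (\<Phi> ?x 0) = (invlim_map h' ^^ i) (\<Phi> ?x) 0" by (rule invlim_map_funpow_0[symmetric])
    also have "\<dots> = \<Phi> ((invlim_map h ^^ i) ?x) 0" unfolding comm_funpow[OF xin] ..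
    also have "(invlim_map h ^^ i) ?x = A.leaf ?u (K + (n - i)) s" unfolding n by (rule A.leaf_funpow[OF w s01])
    also have "\<Phi> (A.leaf ?u (K + (n - i)) s) 0 \<in> open_arc Z' (code0 ?u)" by (rule code0_leaf[OF u s])
    finally show "(h' ^^ i) (\<Phi> ?x 0) \<in> open_arc Z' (code w (int i))" unfolding code_def .
  qed
  then show ?thesis unfolding cylinder_def using \<Phi>_in[OF xin] by blast
qed

text \<open>Continuity carries the closure of each arc into the closure of a cylinder of the code,
  and only one point lies in all of these closures.\<close>

lemma code_pt:
  assumes w: "w \<in> A.words"
  shows "\<Phi> (A.pt w) = B.pt (code w)"
proof (rule B.cylinder_closure_unique[OF code_word[OF w]])
  fix n
  have "\<Phi> (A.pt w) \<in> \<Phi> ` (A.Zbar closure_of (A.leaf w (K + n) ` {0<..<1}))"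
    using A.pt_closure[OF w] by (rule imageI)
  also have "\<dots> \<subseteq> B.Zbar closure_of (\<Phi> ` A.leaf w (K + n) ` {0<..<1})"
    by (rule continuous_map_image_closure_subset[OF homeomorphic_imp_continuous_map[OF homeo]])
  also have "\<dots> \<subseteq> B.Zbar closure_of cylinder Z' h' (code w) n"
    by (rule closure_of_mono) (use code_leaf[OF w] in blast)
  finally show "\<Phi> (A.pt w) \<in> B.Zbar closure_of cylinder Z' h' (code w) n" .
qed

text \<open>Disjointness of the open arcs lets a single point of the leaf determine the symbol.
  Being in the right arc is an open condition on that point, and finitely many of its coordinates
  involve finitely many symbols.\<close>

lemma code0_locally_constant:
  assumes w: "w \<in> A.words"
  obtains n :: nat where
    "\<And>u. u \<in> A.words \<Longrightarrow> (\<forall>k\<in>{- int n..int K}. u k = w k) \<Longrightarrow> code0 u = code0 w"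
proof -
  have half: "1/2 \<in> {0<..<1::real}" "1/2 \<in> {0..1::real}" by simp_all
  let ?x = "A.leaf w K (1/2)"
  define U where "U = {x \<in> topspace A.Zbar. \<Phi> x 0 \<in> open_arc Z' (code0 w)}"
  have "continuous_map A.Zbar (gtop Z') (\<lambda>x. \<Phi> x 0)"
    using continuous_map_compose[OF homeomorphic_imp_continuous_map[OF homeo] continuous_map_invlim_coord, of 0]
    unfolding o_def .
  then have U: "openin A.Zbar U"
    unfolding U_def by (rule openin_continuous_map_preimage) (rule B.openin_open_arc[OF code0(1)[OF w]])
  have x: "?x \<in> U" unfolding U_def using A.leaf_in[OF w half(2)] code0(2)[OF w half(1)] by blast
  obtain n where n: "\<And>y. y \<in> topspace A.Zbar \<Longrightarrow> (\<forall>i\<le>n. y i = ?x i) \<Longrightarrow> y \<in> U"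
    by (rule openin_invlim_basic[OF U x]) blast
  show ?thesis
  proof (rule that)
    fix u assume u: "u \<in> A.words" and eq: "\<forall>k\<in>{- int n..int K}. u k = w k"
    have "A.leaf u K (1/2) i = ?x i" if "i \<le> n" for i
      by (rule A.leaf_cong) (use eq that in auto)
    then have "A.leaf u K (1/2) \<in> U" using n[OF A.leaf_in[OF u half(2)]] by blast
    then have "\<Phi> (A.leaf u K (1/2)) 0 \<in> open_arc Z' (code0 w)" unfolding U_def by blast
    then show "code0 u = code0 w"
      using B.open_arc_disjoint[OF code0(1)[OF u] code0(1)[OF w] code0(2)[OF u half(1)]] by blast
  qed
qed

lemma code_cont: "continuous_map (sft Z h \<A>) (sft Z' h' \<B>) code"
proof -
  have "continuous_map (sft Z h \<A>) (discrete_topology \<B>) (\<lambda>w. code w i)" for i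
    unfolding continuous_map_def
  proof (intro conjI allI impI)
    show "(\<lambda>w. code w i) \<in> A.words \<rightarrow> topspace (discrete_topology \<B>)"
      using code_word unfolding B.words_iff by auto
    fix V assume "openin (discrete_topology \<B>) V"
    show "openin (sft Z h \<A>) {w \<in> A.words. code w i \<in> V}"
      unfolding openin_subopen[of _ "{w \<in> A.words. code w i \<in> V}"]
    proof
      fix w assume w: "w \<in> {w \<in> A.words. code w i \<in> V}"
      then have w': "shift_by i w \<in> A.words" using A.shift_by_word by blast
      obtain n :: nat where n: "\<And>u. u \<in> A.words \<Longrightarrow>
        (\<forall>k\<in>{- int n..int K}. u k = shift_by i w k) \<Longrightarrow> code0 u = code0 (shift_by i w)"
        by (rule code0_locally_constant[OF w']) blast
      let ?N = "{u \<in> A.words. \<forall>k\<in>{- int n + i..int K + i}. u k = w k}"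
      have "openin (sft Z h \<A>) ?N" by (rule openin_sft_agree) simp
      moreover have "code u i \<in> V" if u: "u \<in> ?N" for u
      proof -
        have "code0 (shift_by i u) = code0 (shift_by i w)"
          by (rule n) (use u A.shift_by_word in \<open>auto simp: shift_by_def\<close>)
        then show ?thesis using w unfolding code_def by simp
      qed
      ultimately show "\<exists>T. openin (sft Z h \<A>) T \<and> w \<in> T \<and> T \<subseteq> {w \<in> A.words. code w i \<in> V}"
        using w by (intro exI[of _ ?N]) blast
    qed
  qed
  moreover have "code ` A.words \<subseteq> {w. \<forall>k. closed_arc Z' (w (k + 1)) \<subseteq> h' ` closed_arc Z' (w k)}"
  proof (rule image_subsetI)
    fix w assume "w \<in> A.words"
    then have "code w \<in> B.words" by (rule code_word)
    then show "code w \<in> {w. \<forall>k. closed_arc Z' (w (k + 1)) \<subseteq> h' ` closed_arc Z' (w k)}"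
      unfolding sft_def topspace_subtopology by blast
  qed
  ultimately show ?thesis
    unfolding sft_def[of Z'] continuous_map_in_subtopology continuous_map_componentwise_UNIV by blast
qed

lemma code_shift: "code (shift w) = shift (code w)"
  unfolding code_def shift_def shift_by_def by (simp add: algebra_simps)

text \<open>A generic word has a generic image, since by \<open>K\<close> a vertex hit of the image
  point would force one of the original point. The image point then has a single coding. Two
  continuous maps into a Hausdorff space that agree on the dense set of generic words are
  equal.\<close>

lemma lift_unique:
  assumes \<alpha>: "continuous_map (sft Z h \<A>) (sft Z' h' \<B>) \<alpha>" "\<And>w. w \<in> A.words \<Longrightarrow> \<Phi> (A.pt w) = B.pt (\<alpha> w)"
    and \<beta>: "continuous_map (sft Z h \<A>) (sft Z' h' \<B>) \<beta>" "\<And>w. w \<in> A.words \<Longrightarrow> \<Phi> (A.pt w) = B.pt (\<beta> w)"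
    and w: "w \<in> A.words"
  shows "\<alpha> w = \<beta> w"
proof (rule forall_in_closure_of_eq[OF A.generic_closure[OF w] Hausdorff_sft \<alpha>(1) \<beta>(1)])
  fix u assume "u \<in> {u \<in> A.words. A.generic u}"
  then have u: "u \<in> A.words" "A.generic u" by auto
  have xin: "A.pt u \<in> topspace A.Zbar" by (rule A.pt_in[OF u(1)])
  have \<alpha>u: "\<alpha> u \<in> B.words" and \<beta>u: "\<beta> u \<in> B.words"
    using continuous_map_image_subset_topspace[OF \<alpha>(1)] continuous_map_image_subset_topspace[OF \<beta>(1)] u(1) by blast+
  have "B.generic (\<alpha> u)" unfolding B.generic_def
  proof (intro allI notI)
    fix j assume "(h' ^^ j) (B.pt (\<alpha> u) 0) \<in> verts Z'"
    then have "\<Phi> ((invlim_map h ^^ j) (A.pt u)) 0 \<in> verts Z'"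
      unfolding comm_funpow[OF xin] invlim_map_funpow_0 \<alpha>(2)[OF u(1)] .
    then have "(h ^^ K) ((invlim_map h ^^ j) (A.pt u) 0) \<in> verts Z"
      by (rule K[OF A.invlim_map_funpow_closed[OF xin]])
    then have "(h ^^ (K + j)) (A.pt u 0) \<in> verts Z" unfolding invlim_map_funpow_0 by (simp add: funpow_add)
    then show False using u(2) unfolding A.generic_def by blast
  qed
  moreover have "B.pt (\<alpha> u) = B.pt (\<beta> u)" using \<alpha>(2)[OF u(1)] \<beta>(2)[OF u(1)] by simp
  ultimately show "\<alpha> u = \<beta> u" using B.generic_determined[OF \<alpha>u _ \<beta>u] by blast
qed

end

section \<open>Inverting the code: the conjugacy of the shifts and its uniqueness\<close>

theorem markov_pair_conjugacy:
  assumes P: "markov_pair Z h \<A> Z' h' \<B> \<Phi> \<Theta> \<Theta>'" and Q: "markov_pair Z' h' \<B> Z h \<A> \<Psi> \<Theta>' \<Theta>"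
    and inv: "homeomorphic_maps (invlim (gtop Z) h) (invlim (gtop Z') h') \<Phi> \<Psi>"
  shows "\<exists>\<psi>. (conjugacy (sft Z h \<A>) shift (sft Z' h' \<B>) shift \<psi> \<and>
            (\<forall>w\<in>topspace (sft Z h \<A>). \<Phi> (cover_map Z h w) = cover_map Z' h' (\<psi> w))) \<and>
           (\<forall>\<psi>'. conjugacy (sft Z h \<A>) shift (sft Z' h' \<B>) shift \<psi>' \<and>
              (\<forall>w\<in>topspace (sft Z h \<A>). \<Phi> (cover_map Z h w) = cover_map Z' h' (\<psi>' w)) \<longrightarrow>
              (\<forall>w\<in>topspace (sft Z h \<A>). \<psi>' w = \<psi> w))"
proof -
  interpret P: markov_pair Z h \<A> Z' h' \<B> \<Phi> \<Theta> \<Theta>' by (rule P)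
  interpret Q: markov_pair Z' h' \<B> Z h \<A> \<Psi> \<Theta>' \<Theta> by (rule Q)
  have \<Psi>\<Phi>: "\<Psi> (\<Phi> x) = x" if "x \<in> topspace P.A.Zbar" for x
    using inv that unfolding homeomorphic_maps_def by blast
  have \<Phi>\<Psi>: "\<Phi> (\<Psi> y) = y" if "y \<in> topspace P.B.Zbar" for y
    using inv that unfolding homeomorphic_maps_def by blast
  \<comment> \<open>The identity is a conjugacy of the same kind. Both composites of the two codes
    lift it, and so does the identity on words, so \<open>lift_unique\<close> shows that the codes
    are mutually inverse.\<close>
  interpret PP: markov_pair Z h \<A> Z h \<A> "\<lambda>x. x" \<Theta> \<Theta>
    by unfold_locales (use P.\<Theta>_sub P.\<Theta>_verts Q.\<Theta>'_fin Q.\<Theta>'_inv Q.\<Theta>'_verts in \<open>auto simp: homeomorphic_map_id[unfolded id_def]\<close>)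
  interpret QQ: markov_pair Z' h' \<B> Z' h' \<B> "\<lambda>x. x" \<Theta>' \<Theta>'
    by unfold_locales (use Q.\<Theta>_sub Q.\<Theta>_verts P.\<Theta>'_fin P.\<Theta>'_inv P.\<Theta>'_verts in \<open>auto simp: homeomorphic_map_id[unfolded id_def]\<close>)
  have QP: "Q.code (P.code w) = w" if w: "w \<in> P.A.words" for w
  proof (rule PP.lift_unique[OF _ _ _ _ w])
    show "continuous_map (sft Z h \<A>) (sft Z h \<A>) (\<lambda>w. Q.code (P.code w))"
      using continuous_map_compose[OF P.code_cont Q.code_cont] unfolding o_def .
    show "P.A.pt w = P.A.pt (Q.code (P.code w))" if "w \<in> P.A.words" for w
      using Q.code_pt[OF P.code_word[OF that]] P.code_pt[OF that, symmetric] \<Psi>\<Phi>[OF P.A.pt_in[OF that]] by simp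
  qed simp_all
  have PQ: "P.code (Q.code w) = w" if w: "w \<in> P.B.words" for w
  proof (rule QQ.lift_unique[OF _ _ _ _ w])
    show "continuous_map (sft Z' h' \<B>) (sft Z' h' \<B>) (\<lambda>w. P.code (Q.code w))"
      using continuous_map_compose[OF Q.code_cont P.code_cont] unfolding o_def .
    show "P.B.pt w = P.B.pt (P.code (Q.code w))" if "w \<in> P.B.words" for w
      using P.code_pt[OF Q.code_word[OF that]] Q.code_pt[OF that, symmetric] \<Phi>\<Psi>[OF P.B.pt_in[OF that]] by simp
  qed simp_all
  have "homeomorphic_maps (sft Z h \<A>) (sft Z' h' \<B>) P.code Q.code"
    unfolding homeomorphic_maps_def using P.code_cont Q.code_cont QP PQ by blast
  then have conj: "conjugacy (sft Z h \<A>) shift (sft Z' h' \<B>) shift P.code"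
    unfolding conjugacy_def homeomorphic_map_maps using P.code_shift by blast
  have cov: "\<Phi> (cover_map Z h w) = cover_map Z' h' (P.code w)" if "w \<in> P.A.words" for w
    unfolding P.A.cover_map_eq_pt[OF that] P.B.cover_map_eq_pt[OF P.code_word[OF that]] by (rule P.code_pt[OF that])
  have uniq: "\<psi>' w = P.code w"
    if c: "conjugacy (sft Z h \<A>) shift (sft Z' h' \<B>) shift \<psi>'"
      and e: "\<forall>w\<in>P.A.words. \<Phi> (cover_map Z h w) = cover_map Z' h' (\<psi>' w)" and w: "w \<in> P.A.words" for \<psi>' w
  proof (rule P.lift_unique[OF _ _ P.code_cont P.code_pt w])
    show cont: "continuous_map (sft Z h \<A>) (sft Z' h' \<B>) \<psi>'"
      using c homeomorphic_imp_continuous_map unfolding conjugacy_def by blast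
    fix u assume u: "u \<in> P.A.words"
    then have "\<psi>' u \<in> P.B.words" using continuous_map_image_subset_topspace[OF cont] by blast
    then show "\<Phi> (P.A.pt u) = P.B.pt (\<psi>' u)"
      using bspec[OF e u] P.A.cover_map_eq_pt[OF u] P.B.cover_map_eq_pt by simp
  qed
  show ?thesis
  proof (intro exI[of _ P.code] conjI ballI allI impI)
    show "conjugacy (sft Z h \<A>) shift (sft Z' h' \<B>) shift P.code" by (rule conj)
    show "\<Phi> (cover_map Z h w) = cover_map Z' h' (P.code w)" if "w \<in> P.A.words" for w by (rule cov[OF that])
    fix \<psi>' w
    assume "conjugacy (sft Z h \<A>) shift (sft Z' h' \<B>) shift \<psi>' \<and>
      (\<forall>w\<in>P.A.words. \<Phi> (cover_map Z h w) = cover_map Z' h' (\<psi>' w))" and w: "w \<in> P.A.words"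
    then show "\<psi>' w = P.code w" using uniq by blast
  qed
qed

section \<open>The new presentation\<close>

lemma new_graph_simps:
  "verts (new_graph \<O> L) = Vtx ` \<O>" "edges (new_graph \<O> L) = L" "echar (new_graph \<O> L) = edge_point"
  unfolding new_graph_def by simp_all

lemma edge_point_interior: "0 < t \<Longrightarrow> t < 1 \<Longrightarrow> edge_point l t = Inn l t"
  unfolding edge_point_def by simp

lemma rho_edge_point: "t \<in> {0..1} \<Longrightarrow> rho (edge_point l t) = prep l t"
  unfolding edge_point_def by (cases "t = 0"; cases "t = 1") (auto simp: pinit_def pterm_def)

locale path_graph =
  fixes T :: "'a topology" and \<O> :: "'a set" and L :: "'a pathclass set"
  assumes Haus: "Hausdorff_space T" and fin_\<O>: "finite \<O>" and \<O>_sub: "\<O> \<subseteq> topspace T"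
    and fin_L: "finite L" and L_paths: "L \<subseteq> paths_between T \<O>"
    and oriented: "\<And>l m. l \<in> L \<Longrightarrow> m \<in> L \<Longrightarrow> l \<in> {m, prev m} \<Longrightarrow> l = m"
begin

abbreviation "Z \<equiv> new_graph \<O> L"

lemma L_prep:
  assumes "l \<in> L"
  shows "continuous_map (top_of_set {0..1}) T (prep l)" "locally_one_to_one (top_of_set {0..1}) (prep l)"
    "pclass (prep l) = l" "prep l 0 \<in> \<O>" "prep l 1 \<in> \<O>" "\<And>t. 0 < t \<Longrightarrow> t < 1 \<Longrightarrow> prep l t \<notin> \<O>"
proof -
  have l: "l \<in> paths_between T \<O>" using assms L_paths by blast
  show "continuous_map (top_of_set {0..1}) T (prep l)" "locally_one_to_one (top_of_set {0..1}) (prep l)"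
    using prep_paths_between(1)[OF l] unfolding path_map_def pathin_def by blast+
  show "pclass (prep l) = l" "prep l 0 \<in> \<O>" "prep l 1 \<in> \<O>" using prep_paths_between(2-4)[OF l] .
  show "\<And>t. 0 < t \<Longrightarrow> t < 1 \<Longrightarrow> prep l t \<notin> \<O>" using prep_paths_between(5)[OF l] .
qed

definition all_pts :: "('a, 'a pathclass) gpoint set" where
  "all_pts = Vtx ` \<O> \<union> {Inn l t |l t. l \<in> L \<and> 0 < t \<and> t < 1}"

lemma edge_point_all: "l \<in> L \<Longrightarrow> edge_point l t \<in> all_pts"
  unfolding all_pts_def edge_point_def using L_prep(4,5)[of l] by (auto simp: pinit_def pterm_def)

lemma pts_new_graph: "pts Z = all_pts"
proof
  have "new_open \<O> L (pts Z)" using openin_topspace[of "gtop Z"] unfolding openin_new_graph .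
  then show "pts Z \<subseteq> all_pts" unfolding new_open_def all_pts_def by (rule conjunct1)
  have "{t \<in> {0..1}. edge_point l t \<in> all_pts} = {0..1}" if "l \<in> L" for l
    using edge_point_all[OF that] by blast
  then have "new_open \<O> L all_pts" unfolding new_open_def by (auto simp: all_pts_def)
  then have "openin (gtop Z) all_pts" unfolding openin_new_graph .
  then show "all_pts \<subseteq> pts Z" by (rule openin_subset)
qed

lemma edge_point_cont:
  assumes "l \<in> L"
  shows "continuous_map (top_of_set {0..1}) (gtop Z) (edge_point l)"
  unfolding continuous_map_def
proof (intro conjI allI impI)
  show "edge_point l \<in> topspace (top_of_set {0..1}) \<rightarrow> pts Z"
    unfolding pts_new_graph using edge_point_all[OF assms] by blast
  fix U assume "openin (gtop Z) U"
  then have "new_open \<O> L U" unfolding openin_new_graph .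
  then have "openin (top_of_set {0..1}) {t \<in> {0..1}. edge_point l t \<in> U}"
    using assms unfolding new_open_def by blast
  then show "openin (top_of_set {0..1}) {t \<in> topspace (top_of_set {0..1}). edge_point l t \<in> U}" by simp
qed

text \<open>The universal property of the quotient topology: continuity is tested along the
  edges.\<close>

lemma continuous_from_new_graph:
  assumes "\<And>l. l \<in> L \<Longrightarrow> continuous_map (top_of_set {0..1}) S (\<lambda>t. F (edge_point l t))"
    and "\<And>z. z \<in> all_pts \<Longrightarrow> F z \<in> topspace S"
  shows "continuous_map (gtop Z) S F"
  unfolding continuous_map_def
proof (intro conjI allI impI)
  show "F \<in> pts Z \<rightarrow> topspace S" unfolding pts_new_graph using assms(2) by blast
  fix U assume U: "openin S U"
  have "openin (top_of_set {0..1}) {t \<in> {0..1}. edge_point l t \<in> {z \<in> pts Z. F z \<in> U}}" if l: "l \<in> L" for l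
  proof -
    have "openin (top_of_set {0..1}) {t \<in> topspace (top_of_set {0..1}). F (edge_point l t) \<in> U}"
      by (rule openin_continuous_map_preimage[OF assms(1)[OF l] U])
    moreover have "{t \<in> topspace (top_of_set {0..1}). F (edge_point l t) \<in> U} =
      {t \<in> {0..1}. edge_point l t \<in> {z \<in> pts Z. F z \<in> U}}"
      unfolding pts_new_graph using edge_point_all[OF l] by simp
    ultimately show ?thesis by simp
  qed
  moreover have "{z \<in> pts Z. F z \<in> U} \<subseteq> all_pts" unfolding pts_new_graph by blast
  ultimately show "openin (gtop Z) {z \<in> pts Z. F z \<in> U}"
    unfolding openin_new_graph new_open_def all_pts_def by blast
qed

lemma pts_new_graph_cases:
  assumes "z \<in> pts Z"
  obtains (vertex) x where "x \<in> \<O>" "z = Vtx x" | (inner) l t where "l \<in> L" "0 < t" "t < 1" "z = Inn l t"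
  using assms unfolding pts_new_graph all_pts_def by blast

lemma rho_in:
  assumes "z \<in> all_pts"
  shows "rho z \<in> topspace T"
proof -
  have "z \<in> pts Z" using assms unfolding pts_new_graph .
  then show ?thesis
  proof (cases rule: pts_new_graph_cases)
    case (vertex x)
    then show ?thesis using \<O>_sub by auto
  next
    case (inner l t)
    have "prep l \<in> topspace (top_of_set {0..1}) \<rightarrow> topspace T"
      using L_prep(1)[OF inner(1)] unfolding continuous_map_def by blast
    then show ?thesis using inner by (auto simp: Pi_iff)
  qed
qed

lemma rho_cont: "continuous_map (gtop Z) T rho"
proof (rule continuous_from_new_graph[OF _ rho_in])
  fix l assume l: "l \<in> L"
  show "continuous_map (top_of_set {0..1}) T (\<lambda>t. rho (edge_point l t))"
    by (rule continuous_map_eq[OF L_prep(1)[OF l]]) (simp add: rho_edge_point)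
qed

lemma rho_vertex_iff:
  assumes "z \<in> pts Z"
  shows "rho z \<in> \<O> \<longleftrightarrow> z \<in> Vtx ` \<O>"
  using assms
proof (cases rule: pts_new_graph_cases)
  case (inner l t)
  then show ?thesis using L_prep(6)[OF inner(1-3)] by auto
qed auto

lemma openin_inner:
  assumes l: "l \<in> L" and U: "open U" "U \<subseteq> {0<..<1}"
  shows "openin (gtop Z) (Inn l ` U)"
  unfolding openin_new_graph new_open_def
proof (intro conjI ballI)
  show "Inn l ` U \<subseteq> Vtx ` \<O> \<union> {Inn l t |l t. l \<in> L \<and> 0 < t \<and> t < 1}" using assms by auto
  fix l' assume "l' \<in> L"
  have "{t \<in> {0..1}. edge_point l' t \<in> Inn l ` U} = (if l' = l then {0..1} \<inter> U else {})"
    using U(2) by (auto simp: edge_point_def)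
  then show "openin (top_of_set {0..1}) {t \<in> {0..1}. edge_point l' t \<in> Inn l ` U}"
    using U(1) by (simp add: openin_open_Int)
qed

text \<open>Points with different projections are separated downstairs. Distinct points with the
  same projection are both interior to edges, because the points over \<open>\<O>\<close> are the
  vertices and vertices have distinct projections; there the edge topology separates them.\<close>

lemma Hausdorff_new_graph: "Hausdorff_space (gtop Z)"
  unfolding Hausdorff_space_def
proof (intro allI impI)
  fix z z' assume zz: "z \<in> pts Z \<and> z' \<in> pts Z \<and> z \<noteq> z'"
  show "\<exists>U V. openin (gtop Z) U \<and> openin (gtop Z) V \<and> z \<in> U \<and> z' \<in> V \<and> disjnt U V"
  proof (cases "rho z = rho z'")
    case False
    have "rho z \<in> topspace T" "rho z' \<in> topspace T" using rho_in zz unfolding pts_new_graph by blast+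
    then obtain U V where UV: "openin T U" "openin T V" "rho z \<in> U" "rho z' \<in> V" "disjnt U V"
      using Haus False unfolding Hausdorff_space_def by blast
    have "openin (gtop Z) {z \<in> pts Z. rho z \<in> U}" "openin (gtop Z) {z \<in> pts Z. rho z \<in> V}"
      using openin_continuous_map_preimage[OF rho_cont] UV by blast+
    moreover have "disjnt {z \<in> pts Z. rho z \<in> U} {z \<in> pts Z. rho z \<in> V}" using UV(5) unfolding disjnt_def by blast
    ultimately show ?thesis using zz UV by blast
  next
    case True
    have notv: "z \<notin> Vtx ` \<O>"
    proof
      assume v: "z \<in> Vtx ` \<O>"
      then have "rho z' \<in> \<O>" using True rho_vertex_iff zz by metis
      then have "z' \<in> Vtx ` \<O>" using rho_vertex_iff zz by blast
      then show False using v True zz by auto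
    qed
    then have "rho z' \<notin> \<O>" using True rho_vertex_iff zz by metis
    then have notv': "z' \<notin> Vtx ` \<O>" using rho_vertex_iff zz by blast
    obtain l t where l: "l \<in> L" "0 < t" "t < 1" "z = Inn l t"
      using zz notv unfolding pts_new_graph all_pts_def by blast
    obtain l' t' where l': "l' \<in> L" "0 < t'" "t' < 1" "z' = Inn l' t'"
      using zz notv' unfolding pts_new_graph all_pts_def by blast
    show ?thesis
    proof (cases "l = l'")
      case True
      then have "t \<noteq> t'" using zz l l' by auto
      then obtain U V where UV: "open U" "open V" "t \<in> U" "t' \<in> V" "U \<inter> V = {}"
        using hausdorff[of t t'] by blast
      have "openin (gtop Z) (Inn l ` (U \<inter> {0<..<1}))" "openin (gtop Z) (Inn l ` (V \<inter> {0<..<1}))"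
        using UV l by (intro openin_inner; auto)+
      moreover have "disjnt (Inn l ` (U \<inter> {0<..<1})) (Inn l ` (V \<inter> {0<..<1}))"
        using UV(5) unfolding disjnt_def by auto
      moreover have "z \<in> Inn l ` (U \<inter> {0<..<1})" "z' \<in> Inn l ` (V \<inter> {0<..<1})"
        using l l' UV True by auto
      ultimately show ?thesis by blast
    next
      case False
      have "openin (gtop Z) (Inn l ` {0<..<1})" "openin (gtop Z) (Inn l' ` {0<..<1})"
        using l l' by (intro openin_inner; auto)+
      moreover have "disjnt (Inn l ` {0<..<1::real}) (Inn l' ` {0<..<1})" using False unfolding disjnt_def by auto
      moreover have "z \<in> Inn l ` {0<..<1}" "z' \<in> Inn l' ` {0<..<1}" using l l' by auto
      ultimately show ?thesis by blast
    qed
  qed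
qed

lemma digraph_new_graph: "finite_digraph Z"
  unfolding finite_digraph_def new_graph_simps
proof (intro conjI ballI impI)
  show "Hausdorff_space (gtop Z)" by (rule Hausdorff_new_graph)
  show "finite (Vtx ` \<O>)" using fin_\<O> by blast
  show "finite L" by (rule fin_L)
  show "pts Z = Vtx ` \<O> \<union> \<Union> ((\<lambda>e. edge_point e ` {0..1}) ` L)"
  proof
    show "pts Z \<subseteq> Vtx ` \<O> \<union> \<Union> ((\<lambda>e. edge_point e ` {0..1}) ` L)"
    proof
      fix z assume "z \<in> pts Z"
      then show "z \<in> Vtx ` \<O> \<union> \<Union> ((\<lambda>e. edge_point e ` {0..1}) ` L)"
      proof (cases rule: pts_new_graph_cases)
        case (inner l t)
        then have "z = edge_point l t" "t \<in> {0..1}" by (auto simp: edge_point_interior)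
        then show ?thesis using inner(1) by blast
      qed blast
    qed
    show "Vtx ` \<O> \<union> \<Union> ((\<lambda>e. edge_point e ` {0..1}) ` L) \<subseteq> pts Z"
      unfolding pts_new_graph using edge_point_all by (auto simp: all_pts_def)
  qed
next
  fix l assume l: "l \<in> L"
  show "continuous_map (top_of_set {0..1}) (gtop Z) (edge_point l)" by (rule edge_point_cont[OF l])
  show "inj_on (edge_point l) {0<..<1}" by (auto simp: inj_on_def edge_point_interior)
  show "edge_point l 0 \<in> Vtx ` \<O>" "edge_point l 1 \<in> Vtx ` \<O>"
    using L_prep(4,5)[OF l] by (auto simp: edge_point_def pinit_def pterm_def)
  show "edge_point l ` {0<..<1} \<inter> Vtx ` \<O> = {}" by (auto simp: edge_point_interior)
next
  fix l l' assume "l \<in> L" "l' \<in> L" "l \<noteq> l'"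
  then show "edge_point l ` {0<..<1} \<inter> edge_point l' ` {0<..<1} = {}" by (auto simp: edge_point_interior)
qed

end

section \<open>Finiteness of the set of edge paths\<close>

lemma reparamI:
  assumes "continuous_on {0..1} h" "strict_mono_on {0..1} h" "h 0 = 0" "h 1 = 1"
  shows "reparam h"
proof -
  have le: "h s \<le> h t" if "s \<in> {0..1}" "t \<in> {0..1}" "s \<le> t" for s t
    using strict_mono_onD[OF assms(2) that(1,2)] that(3) by (cases "s = t") auto
  have "h ` {0..1} = {0..1}"
  proof
    show "h ` {0..1} \<subseteq> {0..1}"
    proof
      fix y assume "y \<in> h ` {0..1}"
      then obtain t where t: "t \<in> {0..1}" "y = h t" by blast
      then show "y \<in> {0..1}" using le[of 0 t] le[of t 1] assms(3,4) by simp
    qed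
    have "connected (h ` {0..1})" by (rule connected_continuous_image[OF assms(1)]) simp
    moreover have "h 0 \<in> h ` {0..1}" "h 1 \<in> h ` {0..1}" by (rule imageI, simp)+
    ultimately have "{h 0..h 1} \<subseteq> h ` {0..1}" by (intro connected_contains_Icc)
    then show "{0..1} \<subseteq> h ` {0..1}" unfolding assms(3,4) .
  qed
  then show ?thesis unfolding reparam_def using assms by blast
qed

context finite_graph
begin

text \<open>The case \<open>d < c\<close> is allowed and gives the piece traversed backwards, so no
  direction has to be recorded.\<close>

definition segment :: "'e \<Rightarrow> real \<Rightarrow> real \<Rightarrow> real \<Rightarrow> 'a" where
  "segment e c d t = echar G e (c + t * (d - c))"

text \<open>Dividing by the signed difference of the end parameters turns increasing and decreasing
  charts alike into an increasing parameter from 0 to 1.\<close>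

lemma path_piece:
  fixes a b :: real
  assumes ab: "a < b" and \<gamma>: "continuous_map (top_of_set {a..b}) (gtop G) \<gamma>"
    and loc: "locally_one_to_one (top_of_set {a<..<b}) \<gamma>"
    and avoid: "\<And>t. a < t \<Longrightarrow> t < b \<Longrightarrow> \<gamma> t \<notin> verts G"
    and ends: "\<gamma> a \<in> F" "\<gamma> b \<in> F"
  obtains e c d h where "e \<in> edges G" "c \<in> {t \<in> {0..1}. echar G e t \<in> F}" "d \<in> {t \<in> {0..1}. echar G e t \<in> F}"
    "continuous_on {a..b} h" "strict_mono_on {a..b} h" "h a = 0" "h b = 1" "\<forall>t\<in>{a..b}. \<gamma> t = segment e c d (h t)"
proof -
  obtain e \<xi> where x: "e \<in> edges G" "continuous_on {a..b} \<xi>" "inj_on \<xi> {a..b}" "\<xi> ` {a..b} \<subseteq> {0..1}"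
    "\<forall>t\<in>{a..b}. \<gamma> t = echar G e (\<xi> t)" "\<xi> ` {a<..<b} \<subseteq> {0<..<1}"
    by (rule edge_chart[OF ab \<gamma> loc avoid])
  have ends_ab: "a \<in> {a..b}" "b \<in> {a..b}" using ab by auto
  have ne: "\<xi> a \<noteq> \<xi> b" using inj_onD[OF x(3) _ ends_ab] ab by auto
  define h where "h t = (\<xi> t - \<xi> a) / (\<xi> b - \<xi> a)" for t
  have cont: "continuous_on {a..b} h" unfolding h_def using ne by (intro continuous_intros x(2)) auto
  have mono: "strict_mono_on {a..b} h"
  proof -
    consider "strict_mono_on {a..b} \<xi>" | "strict_antimono_on {a..b} \<xi>"
      using x(2,3) injective_eq_monotone_map[of "{a..b}" \<xi>] by (auto simp: is_interval_cc)
    then show ?thesis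
    proof cases
      case 1
      have "\<xi> a < \<xi> b" using strict_mono_onD[OF 1 ends_ab ab] .
      then show ?thesis unfolding h_def
        by (intro strict_mono_onI divide_strict_right_mono) (use strict_mono_onD[OF 1] in auto)
    next
      case 2
      then have lt: "\<xi> t < \<xi> s" if "s \<in> {a..b}" "t \<in> {a..b}" "s < t" for s t
        using that unfolding monotone_on_def by blast
      have "\<xi> b < \<xi> a" using lt[OF ends_ab ab] .
      then show ?thesis unfolding h_def
        by (intro strict_mono_onI divide_strict_right_mono_neg) (use lt in auto)
    qed
  qed
  have eq: "\<gamma> t = segment e (\<xi> a) (\<xi> b) (h t)" if "t \<in> {a..b}" for t
    using x(5) that ne unfolding segment_def h_def by simp
  have "\<xi> a \<in> {t \<in> {0..1}. echar G e t \<in> F}" "\<xi> b \<in> {t \<in> {0..1}. echar G e t \<in> F}"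
  proof -
    have "\<xi> a \<in> {0..1}" "\<xi> b \<in> {0..1}" using x(4) ends_ab by blast+
    moreover have "echar G e (\<xi> a) \<in> F" "echar G e (\<xi> b) \<in> F" using x(5) ends ends_ab by metis+
    ultimately show "\<xi> a \<in> {t \<in> {0..1}. echar G e t \<in> F}" "\<xi> b \<in> {t \<in> {0..1}. echar G e t \<in> F}" by simp_all
  qed
  then show ?thesis using that[OF x(1) _ _ cont mono] eq ne unfolding h_def by simp
qed

definition join_maps :: "(real \<Rightarrow> 'a) \<Rightarrow> (real \<Rightarrow> 'a) \<Rightarrow> real \<Rightarrow> 'a" where
  "join_maps \<gamma> \<delta> t = (if t \<le> 1/2 then \<gamma> (2 * t) else \<delta> (2 * t - 1))"

text \<open>
  Since \<open>F\<close> meets every open edge, a path between points of \<open>F\<close> passes through at most one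
  vertex, so it is determined by at most two segments of edges.
\<close>

lemma finite_paths_between:
  assumes F: "finite F" and meets: "\<And>e. e \<in> edges G \<Longrightarrow> echar G e ` {0<..<1} \<inter> F \<noteq> {}"
  shows "finite (paths_between (gtop G) F)"
proof -
  \<comment> \<open>Each piece ends in \<open>F\<close> or at the vertex passed on the way, which
    leaves finitely many possible end parameters on every edge.\<close>
  let ?F = "F \<union> verts G"
  let ?D = "\<lambda>e. {t \<in> {0..1}. echar G e t \<in> ?F}"
  have finD: "finite (?D e)" if e: "e \<in> edges G" for e
    using F finite_verts
    by (intro finite_path_level_sets[OF edge_cont[OF e] inj_on_imp_locally_one_to_one[OF edge_inj[OF e]]]) blast
  define S where "S = (SIGMA e:edges G. ?D e \<times> ?D e)"
  have finS: "finite S" unfolding S_def using finite_edges finD by blast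
  define sg where "sg p = segment (fst p) (fst (snd p)) (snd (snd p))" for p
  let ?B = "(\<lambda>p. pclass (sg p)) ` S \<union> (\<lambda>(p, q). pclass (join_maps (sg p) (sg q))) ` (S \<times> S)"
  have "paths_between (gtop G) F \<subseteq> ?B"
  proof
    fix l assume l: "l \<in> paths_between (gtop G) F"
    define \<gamma> where "\<gamma> = prep l"
    have pm: "path_map (gtop G) \<gamma>" and cl: "pclass \<gamma> = l" and ends: "\<gamma> 0 \<in> F" "\<gamma> 1 \<in> F"
      and inner: "\<And>t. 0 < t \<Longrightarrow> t < 1 \<Longrightarrow> \<gamma> t \<notin> F"
      unfolding \<gamma>_def using prep_paths_between[OF l] by blast+
    have cont: "continuous_map (top_of_set {0..1}) (gtop G) \<gamma>" and loc: "locally_one_to_one (top_of_set {0..1}) \<gamma>"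
      using pm unfolding path_map_def pathin_def by blast+
    have loc': "locally_one_to_one (top_of_set {a<..<b}) \<gamma>" if "0 \<le> a" "b \<le> 1" for a b
      by (rule locally_one_to_one_subset[OF loc]) (use that in auto)
    have cont': "continuous_map (top_of_set {a..b}) (gtop G) \<gamma>" if "0 \<le> a" "b \<le> 1" for a b
      by (rule continuous_map_interval_subset[OF cont]) (use that in auto)
    have no2: False if st: "0 < s" "s < t" "t < 1" "\<gamma> s \<in> verts G" "\<gamma> t \<in> verts G" for s t
    proof -
      obtain e where e: "e \<in> edges G" "edge_set G e \<subseteq> \<gamma> ` {s..t}"
        by (rule covers_edge[OF cont loc'[of 0 1] st]) auto
      obtain y where y: "y \<in> echar G e ` {0<..<1}" "y \<in> F" using meets[OF e(1)] by blast
      have "echar G e ` {0<..<1} \<subseteq> edge_set G e" by (rule image_mono) auto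
      then obtain r where "r \<in> {s..t}" "y = \<gamma> r" using y(1) e(2) by blast
      then show False using inner[of r] y(2) st by auto
    qed
    show "l \<in> ?B"
    proof (cases "\<exists>\<tau>. 0 < \<tau> \<and> \<tau> < 1 \<and> \<gamma> \<tau> \<in> verts G")
      case False
      obtain e c d h where p: "e \<in> edges G" "c \<in> ?D e" "d \<in> ?D e"
        "continuous_on {0..1} h" "strict_mono_on {0..1} h" "h 0 = 0" "h 1 = 1" "\<forall>t\<in>{0..1}. \<gamma> t = segment e c d (h t)"
        by (rule path_piece[OF zero_less_one cont loc'[of 0 1], of ?F]) (use False ends in auto)
      have "\<gamma> \<in> pclass (sg (e, c, d))"
        by (rule pclassI[OF reparamI[OF p(4-7)]]) (use p(8) in \<open>simp add: sg_def\<close>)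
      then have "l = pclass (sg (e, c, d))" using pclass_eqI cl by blast
      moreover have "(e, c, d) \<in> S" unfolding S_def using p(1-3) by blast
      ultimately show ?thesis by blast
    next
      case True
      then obtain \<tau> where \<tau>: "0 < \<tau>" "\<tau> < 1" "\<gamma> \<tau> \<in> verts G" by blast
      have av: "\<gamma> t \<notin> verts G" if "0 < t" "t < 1" "t \<noteq> \<tau>" for t
        using no2[of t \<tau>] no2[of \<tau> t] that \<tau> by (meson linorder_neqE_linordered_idom)
      obtain e c d h where p: "e \<in> edges G" "c \<in> ?D e" "d \<in> ?D e"
        "continuous_on {0..\<tau>} h" "strict_mono_on {0..\<tau>} h" "h 0 = 0" "h \<tau> = 1" "\<forall>t\<in>{0..\<tau>}. \<gamma> t = segment e c d (h t)"
        by (rule path_piece[OF \<tau>(1) cont'[of 0 \<tau>] loc'[of 0 \<tau>], of ?F]) (use av ends \<tau> in auto)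
      obtain e' c' d' k where q: "e' \<in> edges G" "c' \<in> ?D e'" "d' \<in> ?D e'"
        "continuous_on {\<tau>..1} k" "strict_mono_on {\<tau>..1} k" "k \<tau> = 0" "k 1 = 1" "\<forall>t\<in>{\<tau>..1}. \<gamma> t = segment e' c' d' (k t)"
        by (rule path_piece[OF \<tau>(2) cont'[of \<tau> 1] loc'[of \<tau> 1], of ?F]) (use av ends \<tau> in auto)
      \<comment> \<open>A reparametrization that moves the visit to the vertex from
        \<open>\<tau>\<close> to 1/2, where \<open>join_maps\<close> joins its two halves.\<close>
      define r where "r t = (if t \<le> \<tau> then h t / 2 else (1 + k t) / 2)" for t
      have h_le: "h t < 1" if "0 \<le> t" "t < \<tau>" for t
        using strict_mono_onD[OF p(5), of t \<tau>] that p(7) by auto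
      have k_pos: "0 < k t" if "\<tau> < t" "t \<le> 1" for t
        using strict_mono_onD[OF q(5), of \<tau> t] that q(6) by auto
      have "reparam r"
      proof (rule reparamI)
        have un: "{0..1} = {0..\<tau>} \<union> {\<tau>..1}" using \<tau> by auto
        show "continuous_on {0..1} r"
          unfolding un r_def
          by (intro continuous_on_If continuous_intros p(4) q(4)) (use p(7) q(6) in auto)
        show "strict_mono_on {0..1} r"
        proof (rule strict_mono_onI)
          fix s t :: real assume st: "s \<in> {0..1}" "t \<in> {0..1}" "s < t"
          consider "t \<le> \<tau>" | "s \<le> \<tau>" "\<tau> < t" | "\<tau> < s" by linarith
          then show "r s < r t"
          proof cases
            case 1
            then have "h s < h t" using st by (intro strict_mono_onD[OF p(5)]) auto
            then show ?thesis using 1 st unfolding r_def by simp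
          next
            case 2
            have "h s \<le> 1" using h_le[of s] p(7) 2 st by (cases "s = \<tau>") auto
            then show ?thesis using 2 st k_pos[of t] unfolding r_def by simp
          next
            case 3
            then have "k s < k t" using st by (intro strict_mono_onD[OF q(5)]) auto
            then show ?thesis using 3 st unfolding r_def by simp
          qed
        qed
        show "r 0 = 0" "r 1 = 1" using p(6) q(7) \<tau> unfolding r_def by simp_all
      qed
      moreover have "\<gamma> t = join_maps (sg (e, c, d)) (sg (e', c', d')) (r t)" if t: "t \<in> {0..1}" for t
      proof (cases "t \<le> \<tau>")
        case True
        have "h t \<le> 1" using h_le[of t] p(7) True t by (cases "t = \<tau>") auto
        then show ?thesis using True p(8) t unfolding r_def join_maps_def sg_def by simp
      next
        case False
        have "0 < k t" using k_pos[of t] False t by simp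
        then have "\<not> r t \<le> 1/2" "2 * r t - 1 = k t" using False unfolding r_def by (simp_all add: field_simps)
        then show ?thesis using False q(8) t unfolding join_maps_def sg_def by simp
      qed
      ultimately have "\<gamma> \<in> pclass (join_maps (sg (e, c, d)) (sg (e', c', d')))" by (rule pclassI)
      then have "l = pclass (join_maps (sg (e, c, d)) (sg (e', c', d')))" using pclass_eqI cl by blast
      moreover have "((e, c, d), (e', c', d')) \<in> S \<times> S" unfolding S_def using p(1-3) q(1-3) by blast
      ultimately show ?thesis by (intro UnI2) (rule image_eqI[where x = "((e, c, d), (e', c', d'))"], simp_all)
    qed
  qed
  then show ?thesis by (rule finite_subset) (use finS in blast)
qed

end

section \<open>Every arc of the graph eventually covers the whole graph\<close>

locale expanding_graph = finite_graph X for X :: "('a, 'e, 'm) digraph_scheme" +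
  fixes f :: "'a \<Rightarrow> 'a" and n :: nat
  assumes presentation: "graph_presentation X f" and n_pos: "n > 0"
    and covers: "\<And>e. e \<in> edges X \<Longrightarrow> pts X \<subseteq> (f ^^ n) ` edge_set X e"
begin

lemma f_cont: "continuous_map (gtop X) (gtop X) f" and flat: "flattening X f" and expand: "expansion X f"
  and nonfold: "nonfolding X f" and f_verts: "f ` verts X \<subseteq> verts X"
  using presentation unfolding graph_presentation_def markov_def by simp_all

lemma funpow_cont: "continuous_map (gtop X) (gtop X) (f ^^ m)"
proof (induction m)
  case (Suc m)
  show ?case unfolding funpow.simps by (rule continuous_map_compose[OF Suc f_cont])
qed (simp add: id_def)

lemma funpow_pts: "x \<in> pts X \<Longrightarrow> (f ^^ m) x \<in> pts X"
  using continuous_map_image_subset_topspace[OF funpow_cont[of m]] by blast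

lemma funpow_verts: "x \<in> verts X \<Longrightarrow> (f ^^ m) x \<in> verts X"
  using f_verts by (induction m) auto

lemma edge_path_cont: "e \<in> edges X \<Longrightarrow> continuous_map (top_of_set {0..1}) (gtop X) (\<lambda>t. (f ^^ m) (echar X e t))"
  using continuous_map_compose[OF edge_cont funpow_cont] unfolding o_def .

lemma edge_path_loc:
  assumes e: "e \<in> edges X"
  shows "locally_one_to_one (top_of_set {0<..<1}) (\<lambda>t. (f ^^ m) (echar X e t))"
proof (cases "m = 0")
  case True
  then show ?thesis using inj_on_imp_locally_one_to_one[OF edge_inj[OF e]] by simp
next
  case False
  let ?T = "subtopology (gtop X) (pts X - verts X)"
  have "continuous_map (top_of_set {0<..<1}) (gtop X) (echar X e)"
    by (rule continuous_map_interval_subset[OF edge_cont[OF e]]) auto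
  then have c: "continuous_map (top_of_set {0<..<1}) ?T (echar X e)"
    unfolding continuous_map_in_subtopology using edge_interior[OF e] edge_in_pts[OF e] by auto
  have loc: "locally_one_to_one ?T (f ^^ m)" using nonfold False unfolding nonfolding_def by blast
  show ?thesis unfolding locally_one_to_one_def
  proof
    fix t assume t: "t \<in> topspace (top_of_set {0<..<1::real})"
    then have "echar X e t \<in> topspace ?T" using c unfolding continuous_map_def by blast
    then obtain U where U: "openin ?T U" "echar X e t \<in> U" "inj_on (f ^^ m) U"
      using loc unfolding locally_one_to_one_def by blast
    let ?V = "{t \<in> topspace (top_of_set {0<..<1}). echar X e t \<in> U}"
    have "openin (top_of_set {0<..<1}) ?V" by (rule openin_continuous_map_preimage[OF c U(1)])
    moreover have "inj_on (\<lambda>t. (f ^^ m) (echar X e t)) ?V"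
    proof (rule inj_onI)
      fix x y assume xy: "x \<in> ?V" "y \<in> ?V" "(f ^^ m) (echar X e x) = (f ^^ m) (echar X e y)"
      then have "echar X e x = echar X e y" using inj_onD[OF U(3)] by blast
      then show "x = y" using inj_onD[OF edge_inj[OF e]] xy by simp
    qed
    ultimately show "\<exists>U. openin (top_of_set {0<..<1}) U \<and> t \<in> U \<and> inj_on (\<lambda>t. (f ^^ m) (echar X e t)) U"
      using t U(2) by (intro exI[of _ ?V]) blast
  qed
qed

lemma distance_bounded:
  assumes "Metric_space (pts X) d" "Metric_space.mtopology (pts X) d = gtop X"
  obtains B where "\<And>x y. x \<in> pts X \<Longrightarrow> y \<in> pts X \<Longrightarrow> d x y \<le> B"
proof -
  have "compactin (Metric_space.mtopology (pts X) d) (pts X)"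
    using compact_graph assms(2) unfolding compact_space_def by simp
  then have "Metric_space.mbounded (pts X) d (pts X)" by (rule Metric_space.compactin_imp_mbounded[OF assms(1)])
  then obtain B where "\<forall>x\<in>pts X. \<forall>y\<in>pts X. d x y \<le> B"
    using Metric_space.mbounded_alt[OF assms(1)] by blast
  then show ?thesis using that by blast
qed

text \<open>All images of such an interval would be connected and off the vertices, hence each
  inside one edge. Expansion would then separate the images of its ends beyond the diameter, which
  is finite by compactness.\<close>

lemma no_vertex_free_interval:
  assumes e: "e \<in> edges X" and st: "0 < s" "s < t" "t < 1"
  shows "\<exists>x\<in>{s..t}. \<exists>m. (f ^^ m) (echar X e x) \<in> verts X"
proof (rule ccontr)
  assume "\<not> ?thesis"
  then have av: "(f ^^ m) (echar X e x) \<notin> verts X" if "x \<in> {s..t}" for x m using that by blast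
  obtain d C \<Lambda> where D: "Metric_space (pts X) d \<and> Metric_space.mtopology (pts X) d = gtop X \<and>
        C > 0 \<and> \<Lambda> > (1::real) \<and>
        (\<forall>n>0. \<forall>e\<in>edges X. \<forall>s t. 0 \<le> s \<and> s \<le> t \<and> t \<le> 1 \<and>
           (\<exists>e'\<in>edges X. (f ^^ n) ` echar X e ` {s..t} \<subseteq> edge_set X e') \<longrightarrow>
           d ((f ^^ n) (echar X e s)) ((f ^^ n) (echar X e t))
             \<ge> C * \<Lambda> ^ n * d (echar X e s) (echar X e t))"
    using expand unfolding expansion_def by (elim exE) (rule that)
  note d = D[THEN conjunct1] D[THEN conjunct2, THEN conjunct1]
  note C = D[THEN conjunct2, THEN conjunct2, THEN conjunct1] D[THEN conjunct2, THEN conjunct2, THEN conjunct2, THEN conjunct1]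
  note ex = D[THEN conjunct2, THEN conjunct2, THEN conjunct2, THEN conjunct2]
  obtain B where B: "\<And>x y. x \<in> pts X \<Longrightarrow> y \<in> pts X \<Longrightarrow> d x y \<le> B" by (rule distance_bounded[OF d]) blast
  let ?x = "echar X e s" and ?y = "echar X e t"
  have xy: "?x \<in> pts X" "?y \<in> pts X" using edge_in_pts[OF e] st by auto
  have "?x \<noteq> ?y" using edge_eq(2)[OF e e, of s t] st by auto
  then have "d ?x ?y \<noteq> 0" using Metric_space.zero[OF d(1) xy] by simp
  moreover have "0 \<le> d ?x ?y" using Metric_space.nonneg[OF d(1)] by blast
  ultimately have pos: "0 < d ?x ?y" by simp
  have key: "C * \<Lambda> ^ m * d ?x ?y \<le> B" if m: "m > 0" for m
  proof -
    let ?S = "(\<lambda>t. (f ^^ m) (echar X e t)) ` {s..t}"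
    have "continuous_map (top_of_set {s..t}) (gtop X) (\<lambda>t. (f ^^ m) (echar X e t))"
      by (rule continuous_map_interval_subset[OF edge_path_cont[OF e]]) (use st in auto)
    then have "connectedin (gtop X) ?S"
      by (rule connectedin_continuous_map_image) (simp add: connectedin_subtopology)
    moreover have "?S \<inter> verts X = {}" using av by blast
    moreover have "?S \<noteq> {}" using st by auto
    ultimately obtain e' where e': "e' \<in> edges X" "?S \<subseteq> echar X e' ` {0<..<1}" by (rule connected_in_edge)
    have "echar X e' ` {0<..<1} \<subseteq> edge_set X e'" by (rule image_mono) auto
    then have "(f ^^ m) ` echar X e ` {s..t} \<subseteq> edge_set X e'" using e'(2) by (auto simp: image_image)
    moreover have "0 \<le> s" "s \<le> t" "t \<le> 1" using st by simp_all
    ultimately have "0 \<le> s \<and> s \<le> t \<and> t \<le> 1 \<and>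
      (\<exists>e'\<in>edges X. (f ^^ m) ` echar X e ` {s..t} \<subseteq> edge_set X e')" using e'(1) by blast
    then have "d ((f ^^ m) ?x) ((f ^^ m) ?y) \<ge> C * \<Lambda> ^ m * d ?x ?y"
      by (rule ex[rule_format, OF m e])
    moreover have "d ((f ^^ m) ?x) ((f ^^ m) ?y) \<le> B" by (intro B funpow_pts xy)
    ultimately show ?thesis by linarith
  qed
  obtain m where m: "B / (C * d ?x ?y) < \<Lambda> ^ m" using real_arch_pow[OF C(2)] by blast
  \<comment> \<open>The expansion estimate holds for positive times only, so one more step is taken
    in case \<open>m\<close> is 0.\<close>
  have "\<Lambda> ^ m \<le> \<Lambda> ^ Suc m" using C(2) by simp
  then have "B / (C * d ?x ?y) < \<Lambda> ^ Suc m" using m by linarith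
  then have "B < C * \<Lambda> ^ Suc m * d ?x ?y" using C(1) pos by (simp add: field_simps)
  then show False using key[of "Suc m"] by simp
qed

text \<open>Two disjoint subintervals each contain a point that reaches a vertex. Vertices stay
  vertices, so at a common time both points are there, and the image in between contains an
  edge.\<close>

lemma eventually_covers_edge:
  assumes e: "e \<in> edges X" and st: "0 \<le> s" "s < t" "t \<le> 1"
  obtains m e' where "e' \<in> edges X" "edge_set X e' \<subseteq> (f ^^ m) ` echar X e ` {s..t}"
proof -
  define p where "p i = s + (t - s) * i / 5" for i :: real
  have pp: "s < p 1" "p 1 < p 2" "p 2 < p 3" "p 3 < p 4" "p 4 < t" using st(2) unfolding p_def by (simp_all add: field_simps)
  obtain x m1 where x: "x \<in> {p 1..p 2}" "(f ^^ m1) (echar X e x) \<in> verts X"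
    using no_vertex_free_interval[OF e, of "p 1" "p 2"] pp st by auto
  obtain y m2 where y: "y \<in> {p 3..p 4}" "(f ^^ m2) (echar X e y) \<in> verts X"
    using no_vertex_free_interval[OF e, of "p 3" "p 4"] pp st by auto
  define m where "m = m1 + m2"
  have "(f ^^ m) (echar X e x) \<in> verts X"
    using funpow_verts[OF x(2), of m2] unfolding m_def by (simp add: funpow_add add.commute[of m1])
  moreover have "(f ^^ m) (echar X e y) \<in> verts X"
    using funpow_verts[OF y(2), of m1] unfolding m_def by (simp add: funpow_add)
  moreover have xy: "0 < x" "x < y" "y < 1" using x(1) y(1) pp st by auto
  ultimately obtain e' where e': "e' \<in> edges X" "edge_set X e' \<subseteq> (\<lambda>t. (f ^^ m) (echar X e t)) ` {x..y}"
    using covers_edge[OF edge_path_cont[OF e] edge_path_loc[OF e] xy] by blast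
  have "(\<lambda>t. (f ^^ m) (echar X e t)) ` {x..y} \<subseteq> (\<lambda>t. (f ^^ m) (echar X e t)) ` {s..t}"
    by (rule image_mono) (use x(1) y(1) pp in auto)
  then have "edge_set X e' \<subseteq> (f ^^ m) ` echar X e ` {s..t}" using e'(2) by (auto simp: image_image)
  then show ?thesis using that e'(1) by blast
qed

lemma eventually_onto:
  assumes e: "e \<in> edges X" and st: "0 \<le> s" "s < t" "t \<le> 1"
  obtains m where "pts X \<subseteq> (f ^^ m) ` echar X e ` {s..t}"
proof -
  obtain m e' where m: "e' \<in> edges X" "edge_set X e' \<subseteq> (f ^^ m) ` echar X e ` {s..t}"
    by (rule eventually_covers_edge[OF e st])
  have "pts X \<subseteq> (f ^^ n) ` edge_set X e'" by (rule covers[OF m(1)])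
  also have "\<dots> \<subseteq> (f ^^ n) ` (f ^^ m) ` echar X e ` {s..t}" by (rule image_mono[OF m(2)])
  also have "\<dots> = (f ^^ (n + m)) ` echar X e ` {s..t}" by (simp add: image_image funpow_add)
  finally show ?thesis using that by blast
qed

text \<open>Without edges the graph would be a finite set, and flattening would find a copy of an
  open interval in it.\<close>

lemma edges_nonempty:
  assumes "pts X \<noteq> {}"
  shows "edges X \<noteq> {}"
proof
  assume none: "edges X = {}"
  then have fin: "finite (pts X)" using finite_verts unfolding pts_eq by simp
  obtain x where x: "x \<in> pts X" using assms by blast
  obtain k U \<epsilon> where U: "openin (gtop X) U" "x \<in> U" "\<epsilon> > (0::real)"
    "subtopology (gtop X) ((f ^^ k) ` U) homeomorphic_space top_of_set {-\<epsilon><..<\<epsilon>}"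
    using flat x unfolding flattening_def by blast
  obtain \<theta> where "homeomorphic_map (subtopology (gtop X) ((f ^^ k) ` U)) (top_of_set {-\<epsilon><..<\<epsilon>}) \<theta>"
    using U(4) unfolding homeomorphic_space by blast
  from homeomorphic_imp_surjective_map[OF this]
  have "\<theta> ` topspace (subtopology (gtop X) ((f ^^ k) ` U)) = {-\<epsilon><..<\<epsilon>}" by simp
  moreover have "finite (\<theta> ` topspace (subtopology (gtop X) ((f ^^ k) ` U)))"
    using fin by (intro finite_imageI) simp
  moreover have "infinite {-\<epsilon><..<\<epsilon>}" using U(3) by (simp add: infinite_Ioo)
  ultimately show False by simp
qed

lemma funpow_onto: "pts X \<subseteq> (f ^^ m) ` pts X"
proof (cases "edges X = {}")
  case True
  then show ?thesis using edges_nonempty by blast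
next
  case False
  then obtain e where e: "e \<in> edges X" by blast
  have f_onto: "pts X \<subseteq> f ` pts X"
  proof
    fix x assume "x \<in> pts X"
    then obtain y where y: "y \<in> edge_set X e" "x = (f ^^ n) y" using covers[OF e] by blast
    have yp: "y \<in> pts X" using y(1) e unfolding pts_eq by blast
    obtain k where "n = Suc k" using n_pos by (cases n) auto
    then have "x = f ((f ^^ k) y)" using y(2) by simp
    then show "x \<in> f ` pts X" using funpow_pts[OF yp] by blast
  qed
  show ?thesis
  proof (induction m)
    case (Suc m)
    have "pts X \<subseteq> f ` pts X" by (rule f_onto)
    also have "\<dots> \<subseteq> f ` (f ^^ m) ` pts X" by (rule image_mono[OF Suc])
    also have "\<dots> = (f ^^ Suc m) ` pts X" by (simp add: image_comp)
    finally show ?case .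
  qed simp
qed

lemma onto_mono:
  assumes "pts X \<subseteq> (f ^^ m) ` S" "m \<le> m'"
  shows "pts X \<subseteq> (f ^^ m') ` S"
proof -
  have "pts X \<subseteq> (f ^^ (m' - m)) ` pts X" by (rule funpow_onto)
  also have "\<dots> \<subseteq> (f ^^ (m' - m)) ` (f ^^ m) ` S" by (rule image_mono[OF assms(1)])
  also have "\<dots> = (f ^^ m') ` S" using assms(2) by (simp add: image_comp flip: funpow_add)
  finally show ?thesis .
qed

end

section \<open>The new presentation as a graph with a Markov map\<close>

locale new_presentation_data = expanding_graph X f n for X :: "('a, 'e, 'm) digraph_scheme" and f n +
  fixes \<O> :: "'a set" and N :: nat and L :: "'a pathclass set"
    and h :: "('a, 'a pathclass) gpoint \<Rightarrow> ('a, 'a pathclass) gpoint"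
  assumes fin_\<O>: "finite \<O>" and \<O>_sub: "\<O> \<subseteq> pts X" and \<O>_inv: "f ` \<O> \<subseteq> \<O>" and \<O>_ne: "\<O> \<noteq> {}"
    and meets: "\<And>e. e \<in> edges X \<Longrightarrow> echar X e ` {0<..<1} \<inter> preimg (gtop X) f N \<O> \<noteq> {}"
    and edge_paths: "new_edge_paths X f \<O> N L" and induced: "induced_map f \<O> L h"
begin

lemma finite_preimg: "finite (preimg (gtop X) f N \<O>)"
proof -
  have "finite {t \<in> {0..1}. (f ^^ N) (echar X e t) \<in> \<O>}" if e: "e \<in> edges X" for e
    by (rule finite_path_level_sets[OF edge_path_cont[OF e] edge_path_loc[OF e] fin_\<O>])
  then have "finite (verts X \<union> (\<Union>e\<in>edges X. echar X e ` {t \<in> {0..1}. (f ^^ N) (echar X e t) \<in> \<O>}))"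
    using finite_verts finite_edges by blast
  moreover have "preimg (gtop X) f N \<O> \<subseteq>
    verts X \<union> (\<Union>e\<in>edges X. echar X e ` {t \<in> {0..1}. (f ^^ N) (echar X e t) \<in> \<O>})"
    unfolding preimg_def pts_eq by blast
  ultimately show ?thesis by (rule rev_finite_subset)
qed

lemma L_facts:
  shows "finite L" "L \<subseteq> paths_between (gtop X) \<O>"
    "\<And>l m. l \<in> L \<Longrightarrow> m \<in> L \<Longrightarrow> l \<in> {m, prev m} \<Longrightarrow> l = m"
proof -
  let ?I = "{I \<in> paths_between (gtop X) (preimg (gtop X) f N \<O>). pimage (f ^^ N) I \<in> paths_between (gtop X) \<O>}"
  obtain Ior where Ior: "orientation_of ?I Ior" "orientation_of (pimage (f ^^ N) ` Ior) L"
    using edge_paths unfolding new_edge_paths_def by blast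
  note sub = Ior(1)[unfolded orientation_of_def, THEN conjunct1] Ior(2)[unfolded orientation_of_def, THEN conjunct1]
  note uniq = Ior(2)[unfolded orientation_of_def, THEN conjunct2]
  have "finite (paths_between (gtop X) (preimg (gtop X) f N \<O>))"
    by (rule finite_paths_between[OF finite_preimg meets])
  then have "finite ?I" by (rule finite_subset[rotated]) (rule Collect_subset)
  then have "finite Ior" by (rule finite_subset[OF sub(1)])
  then show "finite L" by (rule finite_surj[OF _ sub(2)])
  show "L \<subseteq> paths_between (gtop X) \<O>"
  proof
    fix l assume "l \<in> L"
    then obtain J where "J \<in> Ior" "l = pimage (f ^^ N) J" using sub(2) by blast
    then show "l \<in> paths_between (gtop X) \<O>" using subsetD[OF sub(1), of J] by simp
  qed
  fix l m assume lm: "l \<in> L" "m \<in> L" "l \<in> {m, prev m}"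
  have U: "\<exists>!k. k \<in> {m, prev m} \<and> k \<in> L" by (rule bspec[OF uniq subsetD[OF sub(2) lm(2)]])
  have "m \<in> {m, prev m} \<and> m \<in> L" using lm(2) by simp
  from the1_equality[OF U this] have "(THE k. k \<in> {m, prev m} \<and> k \<in> L) = m" .
  moreover have "l \<in> {m, prev m} \<and> l \<in> L" using lm(1,3) by (rule conjI[rotated])
  from the1_equality[OF U this] have "(THE k. k \<in> {m, prev m} \<and> k \<in> L) = l" .
  ultimately show "l = m" by simp
qed

sublocale N: path_graph "gtop X" \<O> L
  by unfold_locales (use Hausdorff fin_\<O> \<O>_sub L_facts in auto)

text \<open>Under a high iterate an edge visits \<open>\<O>\<close> at two different parameters. The
  stretch between two consecutive visits, looked at \<open>N\<close> steps earlier, is a path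
  between points of the preimage of \<open>\<O>\<close> whose image is a path between points of
  \<open>\<O>\<close>.\<close>

lemma L_nonempty: "L \<noteq> {}"
proof -
  have "pts X \<noteq> {}" using \<O>_ne \<O>_sub by blast
  then obtain e where e: "e \<in> edges X" using edges_nonempty by blast
  obtain m1 where m1: "pts X \<subseteq> (f ^^ m1) ` echar X e ` {1/5..2/5}" by (rule eventually_onto[OF e, of "1/5" "2/5"]) auto
  obtain m2 where m2: "pts X \<subseteq> (f ^^ m2) ` echar X e ` {3/5..4/5}" by (rule eventually_onto[OF e, of "3/5" "4/5"]) auto
  \<comment> \<open>Large enough that both subintervals cover the whole graph at time
    \<open>N + M\<close>.\<close>
  define M where "M = Suc (m1 + m2)"
  obtain o1 where o1: "o1 \<in> \<O>" using \<O>_ne by blast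
  define \<gamma> where "\<gamma> t = (f ^^ (N + M)) (echar X e t)" for t
  have "pts X \<subseteq> (f ^^ (N + M)) ` echar X e ` {1/5..2/5}" by (rule onto_mono[OF m1]) (simp add: M_def)
  then have "o1 \<in> \<gamma> ` {1/5..2/5}" using o1 \<O>_sub unfolding \<gamma>_def[abs_def] by (auto simp: image_image)
  then obtain t1 where t1: "t1 \<in> {1/5..2/5}" "\<gamma> t1 \<in> \<O>" using o1 by blast
  have "pts X \<subseteq> (f ^^ (N + M)) ` echar X e ` {3/5..4/5}" by (rule onto_mono[OF m2]) (simp add: M_def)
  then have "o1 \<in> \<gamma> ` {3/5..4/5}" using o1 \<O>_sub unfolding \<gamma>_def[abs_def] by (auto simp: image_image)
  then obtain t2 where t2: "t2 \<in> {3/5..4/5}" "\<gamma> t2 \<in> \<O>" using o1 by blast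
  have loc: "locally_one_to_one (top_of_set {0<..<1}) \<gamma>" unfolding \<gamma>_def by (rule edge_path_loc[OF e])
  let ?H = "{t \<in> {t1..t2}. \<gamma> t \<in> \<O>} - {t1}"
  have finH: "finite ?H"
  proof -
    have "{t1..t2} \<subseteq> {0<..<1}" using t1(1) t2(1) by auto
    then have "finite {t \<in> {t1..t2}. \<gamma> t \<in> \<O>}" by (intro finite_level_sets[OF loc] fin_\<O>) auto
    then show ?thesis by blast
  qed
  have t2H: "t2 \<in> ?H" using t1 t2 by auto
  define t where "t = Min ?H"
  have tH: "t \<in> ?H" unfolding t_def using Min_in[OF finH] t2H by blast
  have tmin: "t \<le> x" if "x \<in> ?H" for x unfolding t_def using Min_le[OF finH that] .
  define s where "s = t1"
  have st: "0 < s" "s < t" "t < 1" "\<gamma> s \<in> \<O>" "\<gamma> t \<in> \<O>" using tH t1 t2(1) unfolding s_def by auto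
  have gap: "\<gamma> x \<notin> \<O>" if "s < x" "x < t" for x
    using tmin[of x] that tH unfolding s_def by auto
  define u where "u r = s + r * (t - s)" for r :: real
  have u_open: "u r \<in> {s<..<t}" if "0 < r" "r < 1" for r
  proof -
    have "r * (t - s) < 1 * (t - s)" using that st by (intro mult_strict_right_mono) auto
    moreover have "0 < r * (t - s)" using that st by simp
    ultimately show ?thesis unfolding u_def by auto
  qed
  have u01: "u 0 = s" "u 1 = t" unfolding u_def by simp_all
  have u_in: "u r \<in> {0<..<1}" if "r \<in> {0..1}" for r
    using u_open[of r] u01 st that by (cases "r = 0"; cases "r = 1") auto
  have u_cont: "continuous_on {0..1} u" unfolding u_def by (intro continuous_intros)
  have u_inj: "inj_on u {0..1}" unfolding u_def inj_on_def using st(2) by auto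
  \<comment> \<open>The stretch is stopped at time \<open>M\<close>, so that the remaining
    \<open>N\<close> steps are those of the construction of \<open>L\<close>.\<close>
  define \<delta> where "\<delta> r = (f ^^ M) (echar X e (u r))" for r
  have pm: "path_map (gtop X) (\<lambda>r. (f ^^ k) (echar X e (u r)))" for k
    unfolding path_map_def pathin_def
  proof
    have "continuous_map (top_of_set {0..1}) (top_of_set {0..1}) u"
      unfolding continuous_map_in_subtopology using u_cont u_in by (auto simp: less_imp_le)
    from continuous_map_compose[OF this edge_path_cont[OF e, of k]]
    show "continuous_map (top_of_set {0..1}) (gtop X) (\<lambda>r. (f ^^ k) (echar X e (u r)))" unfolding o_def .
    show "locally_one_to_one (top_of_set {0..1}) (\<lambda>r. (f ^^ k) (echar X e (u r)))"
      by (rule locally_one_to_one_compose_inj[OF edge_path_loc[OF e, of k] u_cont _ u_inj]) (use u_in in auto)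
  qed
  have N\<delta>: "(f ^^ N) (\<delta> r) = \<gamma> (u r)" for r unfolding \<delta>_def \<gamma>_def by (simp add: funpow_add)
  have "\<delta> r \<in> pts X" if "r \<in> {0..1}" for r
    unfolding \<delta>_def using u_in[OF that] by (intro funpow_pts edge_in_pts[OF e]) auto
  then have pre: "\<delta> r \<in> preimg (gtop X) f N \<O> \<longleftrightarrow> \<gamma> (u r) \<in> \<O>" if "r \<in> {0..1}" for r
    using that unfolding preimg_def N\<delta>[symmetric] by blast
  have I1: "pclass \<delta> \<in> paths_between (gtop X) (preimg (gtop X) f N \<O>)"
  proof (rule pclass_paths_between)
    show "path_map (gtop X) \<delta>" unfolding \<delta>_def by (rule pm)
    show "\<delta> 0 \<in> preimg (gtop X) f N \<O>" "\<delta> 1 \<in> preimg (gtop X) f N \<O>" using pre u01 st by simp_all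
    show "\<delta> r \<notin> preimg (gtop X) f N \<O>" if "0 < r" "r < 1" for r
      using pre[of r] gap[of "u r"] u_open[OF that] that by simp
  qed
  have "pclass ((f ^^ N) \<circ> \<delta>) \<in> paths_between (gtop X) \<O>"
  proof (rule pclass_paths_between)
    have "(f ^^ N) \<circ> \<delta> = (\<lambda>r. (f ^^ (N + M)) (echar X e (u r)))" unfolding \<delta>_def o_def by (simp add: funpow_add)
    then show "path_map (gtop X) ((f ^^ N) \<circ> \<delta>)" using pm[of "N + M"] by simp
    show "((f ^^ N) \<circ> \<delta>) 0 \<in> \<O>" "((f ^^ N) \<circ> \<delta>) 1 \<in> \<O>" using N\<delta> u01 st by simp_all
    show "((f ^^ N) \<circ> \<delta>) r \<notin> \<O>" if "0 < r" "r < 1" for r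
      using N\<delta>[of r] gap[of "u r"] u_open[OF that] by simp
  qed
  then have "pimage (f ^^ N) (pclass \<delta>) \<in> paths_between (gtop X) \<O>" unfolding pimage_pclass .
  then have I: "pclass \<delta> \<in> {I \<in> paths_between (gtop X) (preimg (gtop X) f N \<O>). pimage (f ^^ N) I \<in> paths_between (gtop X) \<O>}"
    using I1 by simp
  obtain Ior where Ior: "orientation_of {I \<in> paths_between (gtop X) (preimg (gtop X) f N \<O>).
    pimage (f ^^ N) I \<in> paths_between (gtop X) \<O>} Ior" "orientation_of (pimage (f ^^ N) ` Ior) L"
    using edge_paths unfolding new_edge_paths_def by blast
  obtain J where "J \<in> Ior"
    using ex1_implies_ex[OF bspec[OF Ior(1)[unfolded orientation_of_def, THEN conjunct2] I]] by blast
  then have "pimage (f ^^ N) J \<in> pimage (f ^^ N) ` Ior" by (rule imageI)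
  from ex1_implies_ex[OF bspec[OF Ior(2)[unfolded orientation_of_def, THEN conjunct2] this]]
  show ?thesis by blast
qed

lemma h_cont: "continuous_map (gtop N.Z) (gtop N.Z) h"
  and rho_h: "z \<in> pts N.Z \<Longrightarrow> rho (h z) = f (rho z)"
  using induced unfolding induced_map_def by blast+

lemma h_pts: "z \<in> pts N.Z \<Longrightarrow> h z \<in> pts N.Z"
  using continuous_map_image_subset_topspace[OF h_cont] by blast

lemma h_funpow_pts: "z \<in> pts N.Z \<Longrightarrow> (h ^^ m) z \<in> pts N.Z"
  by (induction m) (simp_all add: h_pts)

lemma rho_funpow: "z \<in> pts N.Z \<Longrightarrow> rho ((h ^^ m) z) = (f ^^ m) (rho z)"
  by (induction m) (simp_all add: rho_h h_funpow_pts)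

lemma h_vertex: "v \<in> Vtx ` \<O> \<Longrightarrow> h v \<in> Vtx ` \<O>"
proof -
  assume v: "v \<in> Vtx ` \<O>"
  then have vp: "v \<in> pts N.Z" unfolding N.pts_new_graph N.all_pts_def by blast
  have "rho (h v) \<in> \<O>" using rho_h[OF vp] N.rho_vertex_iff[OF vp] v \<O>_inv by auto
  then show ?thesis using N.rho_vertex_iff[OF h_pts[OF vp]] by blast
qed

text \<open>Finitely many visits to vertices leave a stretch without any, where an edge chart
  applies. This carries eventual covering over from edges to the paths in \<open>L\<close>.\<close>

lemma path_contains_segment:
  assumes l: "l \<in> L" and st: "0 \<le> s" "s < t" "t \<le> 1"
  obtains e c d where "e \<in> edges X" "0 \<le> c" "c < d" "d \<le> 1" "echar X e ` {c..d} \<subseteq> prep l ` {s<..<t}"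
proof -
  have cont: "continuous_map (top_of_set {0..1}) (gtop X) (prep l)" and loc: "locally_one_to_one (top_of_set {0..1}) (prep l)"
    using N.L_prep[OF l] by blast+
  have sub: "{s..t} \<subseteq> {0..1}" using st by auto
  have fin: "finite {r \<in> {s..t}. prep l r \<in> verts X}"
    by (rule finite_level_sets[OF loc _ sub finite_verts]) simp
  then obtain b where b: "s < b" "b < t" "\<forall>r\<in>{s<..b}. prep l r \<notin> verts X"
  proof -
    let ?H = "{r \<in> {s..t}. prep l r \<in> verts X} - {s} \<union> {t}"
    have H: "finite ?H" "?H \<noteq> {}" using fin by auto
    define m where "m = Min ?H"
    have m: "m \<in> ?H" unfolding m_def by (rule Min_in[OF H])
    have mm: "m \<le> x" if "x \<in> ?H" for x unfolding m_def by (rule Min_le[OF H(1) that])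
    have "s < m" "m \<le> t" using m mm[of t] st by auto
    moreover have "prep l r \<notin> verts X" if "s < r" "r < m" for r
      using mm[of r] that \<open>m \<le> t\<close> by auto
    ultimately show ?thesis using that[of "(s + m) / 2"] by auto
  qed
  define a where "a = (s + b) / 2"
  have ab: "s < a" "a < b" using b unfolding a_def by auto
  obtain e \<xi> where x: "e \<in> edges X" "continuous_on {a..b} \<xi>" "inj_on \<xi> {a..b}" "\<xi> ` {a..b} \<subseteq> {0..1}"
    "\<forall>t\<in>{a..b}. prep l t = echar X e (\<xi> t)" "\<xi> ` {a<..<b} \<subseteq> {0<..<1}"
  proof (rule edge_chart[OF ab(2)])
    show "continuous_map (top_of_set {a..b}) (gtop X) (prep l)"
      by (rule continuous_map_interval_subset[OF cont]) (use ab b st in auto)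
    show "locally_one_to_one (top_of_set {a<..<b}) (prep l)"
      by (rule locally_one_to_one_subset[OF loc]) (use ab b st in auto)
    show "prep l r \<notin> verts X" if "a < r" "r < b" for r using b(3) that ab by simp
  qed
  obtain c d where cd: "\<xi> ` {a..b} = {c..d}" "c \<le> d"
    using continuous_image_closed_interval[OF less_imp_le[OF ab(2)] x(2)] by blast
  have "\<xi> a \<in> {c..d}" "\<xi> b \<in> {c..d}" "\<xi> a \<noteq> \<xi> b"
  proof -
    show "\<xi> a \<in> {c..d}" "\<xi> b \<in> {c..d}" unfolding cd(1)[symmetric] using ab by simp_all
    show "\<xi> a \<noteq> \<xi> b" using inj_onD[OF x(3), of a b] ab by auto
  qed
  then have "c < d" using cd(2) by (cases "c = d") auto
  have "{c..d} \<subseteq> {0..1}" using x(4) unfolding cd(1) .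
  then have "0 \<le> c" "d \<le> 1" using cd(2) by auto
  moreover have "echar X e ` {c..d} \<subseteq> prep l ` {s<..<t}"
  proof
    fix y assume "y \<in> echar X e ` {c..d}"
    then obtain r where r: "r \<in> {a..b}" "y = echar X e (\<xi> r)" unfolding cd(1)[symmetric] by blast
    then have "y = prep l r" using x(5) by simp
    then show "y \<in> prep l ` {s<..<t}" by (rule image_eqI) (use r(1) ab b in auto)
  qed
  ultimately show ?thesis using that[OF x(1) _ \<open>c < d\<close>] by blast
qed

text \<open>The projected subarc eventually covers the graph and in particular reaches a point of
  \<open>\<O>\<close>; the points over \<open>\<O>\<close> are exactly the vertices of the new
  graph.\<close>

lemma escape:
  assumes l: "l \<in> L" and st: "0 \<le> s" "s < t" "t \<le> 1"
  shows "\<exists>r m. s < r \<and> r < t \<and> (h ^^ m) (edge_point l r) \<in> Vtx ` \<O>"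
proof -
  obtain e c d where e: "e \<in> edges X" "0 \<le> c" "c < d" "d \<le> 1" "echar X e ` {c..d} \<subseteq> prep l ` {s<..<t}"
    by (rule path_contains_segment[OF l st])
  obtain m where m: "pts X \<subseteq> (f ^^ m) ` echar X e ` {c..d}" by (rule eventually_onto[OF e(1-4)])
  obtain x where x: "x \<in> \<O>" using \<O>_ne by blast
  have "x \<in> (f ^^ m) ` prep l ` {s<..<t}"
    by (rule subsetD[OF subset_trans[OF m image_mono[OF e(5)]] subsetD[OF \<O>_sub x]])
  then obtain r where r: "r \<in> {s<..<t}" "x = (f ^^ m) (prep l r)" by (elim imageE) simp
  have r01: "r \<in> {0..1}" using r(1) st by auto
  have z: "edge_point l r \<in> pts N.Z" unfolding N.pts_new_graph by (rule N.edge_point_all[OF l])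
  have "rho ((h ^^ m) (edge_point l r)) = x"
    unfolding rho_funpow[OF z] rho_edge_point[OF r01] using r(2) by simp
  then have "(h ^^ m) (edge_point l r) \<in> Vtx ` \<O>" using N.rho_vertex_iff[OF h_funpow_pts[OF z]] x by blast
  then show ?thesis using r(1) by auto
qed

text \<open>One edge path already suffices: its iterates eventually cover the graph, and they are
  projections of iterates under \<open>h\<close>.\<close>

lemma rho_onto: "rho ` pts N.Z = pts X"
proof
  show "rho ` pts N.Z \<subseteq> pts X" using N.rho_in unfolding N.pts_new_graph by blast
  obtain l where l: "l \<in> L" using L_nonempty by blast
  obtain e c d where e: "e \<in> edges X" "0 \<le> c" "c < d" "d \<le> 1" "echar X e ` {c..d} \<subseteq> prep l ` {0<..<1}"
    by (rule path_contains_segment[OF l, of 0 1]) auto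
  obtain m where m: "pts X \<subseteq> (f ^^ m) ` echar X e ` {c..d}" by (rule eventually_onto[OF e(1-4)])
  show "pts X \<subseteq> rho ` pts N.Z"
  proof
    fix x assume "x \<in> pts X"
    then have "x \<in> (f ^^ m) ` prep l ` {0<..<1}" by (rule subsetD[OF subset_trans[OF m image_mono[OF e(5)]]])
    then obtain r where r: "r \<in> {0<..<1}" "x = (f ^^ m) (prep l r)" by (elim imageE) simp
    have r01: "r \<in> {0..1}" using r(1) by auto
    have z: "edge_point l r \<in> pts N.Z" unfolding N.pts_new_graph by (rule N.edge_point_all[OF l])
    have "x = rho ((h ^^ m) (edge_point l r))" unfolding rho_funpow[OF z] rho_edge_point[OF r01] by (rule r(2))
    then show "x \<in> rho ` pts N.Z" using h_funpow_pts[OF z] by blast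
  qed
qed

lemma markov_system:
  assumes "markov_partition N.Z h \<A>"
  shows "markov_system N.Z h \<A>"
proof
  show "finite_digraph N.Z" by (rule N.digraph_new_graph)
  show "continuous_map (gtop N.Z) (gtop N.Z) h" by (rule h_cont)
  show "h v \<in> verts N.Z" if "v \<in> verts N.Z" for v using h_vertex that unfolding new_graph_simps .
  show "markov_partition N.Z h \<A>" by (rule assms)
  show "\<exists>r m. s < r \<and> r < t \<and> (h ^^ m) (echar N.Z e r) \<in> verts N.Z"
    if "e \<in> edges N.Z" "0 \<le> s" "s < t" "t \<le> 1" for e s t
    using escape[of e s t] that unfolding new_graph_simps by blast
qed

end

section \<open>The projection of the new presentation is a conjugacy\<close>

lemma compact_invlim:
  assumes T: "compact_space T" "Hausdorff_space T" and f: "continuous_map T T f"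
  shows "compact_space (invlim T f)"
proof -
  let ?P = "product_topology (\<lambda>_::nat. T) UNIV"
  have coord: "continuous_map ?P T (\<lambda>x. x i)" for i
    by (rule continuous_map_product_projection) simp
  have "closedin ?P (topspace ?P \<inter> (\<Inter>i. {x \<in> topspace ?P. f (x (Suc i)) = x i}))"
  proof (intro closedin_Int closedin_topspace closedin_Inter)
    fix S assume "S \<in> range (\<lambda>i. {x \<in> topspace ?P. f (x (Suc i)) = x i})"
    then obtain i where S: "S = {x \<in> topspace ?P. f (x (Suc i)) = x i}" by blast
    have "continuous_map ?P T (\<lambda>x. f (x (Suc i)))"
      using continuous_map_compose[OF coord f] unfolding o_def .
    then show "closedin ?P S" unfolding S by (rule closedin_continuous_maps_eq[OF T(2) _ coord])
  qed simp
  moreover have "topspace ?P \<inter> (\<Inter>i. {x \<in> topspace ?P. f (x (Suc i)) = x i}) =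
    topspace ?P \<inter> {x. \<forall>i. f (x (Suc i)) = x i}" by blast
  ultimately have "closedin ?P (topspace ?P \<inter> {x. \<forall>i. f (x (Suc i)) = x i})" by simp
  moreover have "compact_space ?P" using T(1) by (simp add: compact_space_product_topology)
  ultimately have "compactin ?P (topspace ?P \<inter> {x. \<forall>i. f (x (Suc i)) = x i})"
    by (intro closedin_compact_space)
  then have "compact_space (subtopology ?P (topspace ?P \<inter> {x. \<forall>i. f (x (Suc i)) = x i}))"
    by (rule compact_space_subtopology)
  then show ?thesis unfolding invlim_def subtopology_restrict .
qed

lemma Hausdorff_invlim: "Hausdorff_space T \<Longrightarrow> Hausdorff_space (invlim T f)"
  unfolding invlim_def by (intro Hausdorff_space_subtopology) (simp add: Hausdorff_space_product_topology)

lemma invlim_drop: "x \<in> topspace (invlim T f) \<Longrightarrow> (\<lambda>k. x (i + k)) \<in> topspace (invlim T f)"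
  unfolding topspace_invlim by simp

context markov_system
begin

text \<open>Vertices are mapped to vertices, so no earlier coordinate is a vertex either. Each
  earlier coordinate then lies in the interior of exactly one arc.\<close>

lemma backward_word:
  assumes z: "z \<in> topspace Zbar" and z0: "z 0 \<notin> verts Z"
  obtains w s where "s \<in> {0<..<1}" "z 0 = echar Z (fst (w 0)) s" "fst (w 0) \<in> edges Z"
    "\<forall>i. adm w (- int i) i" "\<forall>i. z i = echar Z (fst (w (- int i))) (comp_br w (- int i) i s)"
proof -
  have zp: "z i \<in> pts Z" and zh: "h (z (Suc i)) = z i" for i using invlim_D[OF z] by blast+
  have zv: "z i \<notin> verts Z" for i
  proof
    assume "z i \<in> verts Z"
    then have "(h ^^ i) (z i) \<in> verts Z" by (rule h_funpow_verts)
    then show False using invlim_funpow[OF z, of i 0] z0 by simp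
  qed
  obtain e s where e: "e \<in> edges Z" "0 < s" "s < 1" "z 0 = echar Z e s" by (rule pts_cases[OF zp z0])
  have "\<exists>I. I \<in> \<A> \<and> z (Suc i) \<in> open_arc Z I" for i
    using open_arc_exists[OF zp, of "Suc i"] zh zv by metis
  then obtain A where A: "\<And>i. A i \<in> \<A>" "\<And>i. z (Suc i) \<in> open_arc Z (A i)" by metis
  \<comment> \<open>Only the past is prescribed. At time 0 the edge alone matters, and the symbols
    at later times are placeholders.\<close>
  define w where "w k = (if 0 \<le> k then (e, 0, 0) else A (nat (- k - 1)))" for k :: int
  have wS: "w (- int (Suc i)) = A i" for i unfolding w_def by (simp add: nat_diff_distrib')
  have w0: "w 0 = (e, 0, 0)" unfolding w_def by simp
  have tr: "fst (w (- int i)) = tgt (A i)" for i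
  proof (cases i)
    case 0
    obtain s' where s': "s' \<in> {0<..<1}" "h (z (Suc 0)) = echar Z (tgt (A 0)) s'" by (rule open_arc_image[OF A])
    then have "echar Z e s = echar Z (tgt (A 0)) s'" using zh[of 0] e(4) by simp
    then show ?thesis using edge_eq(1)[OF e(1) branch(1)[OF A(1)] e(2,3), of s' 0] s'(1) 0 w0 by simp
  next
    case (Suc j)
    have "h (z (Suc i)) \<in> open_arc Z (A j)" unfolding zh Suc by (rule A(2))
    then have "fst (A j) = tgt (A i)" by (rule transition_edge[OF A(1) A(1) A(2)])
    then show ?thesis unfolding Suc wS .
  qed
  have adm: "adm w (- int i) i" for i
  proof (induction i)
    case (Suc i)
    have "- int (Suc i) + 1 = - int i" by simp
    then show ?case unfolding adm_Suc using Suc tr[of i] A(1)[of i] wS[of i] by simp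
  qed (simp add: adm_def)
  have s: "s \<in> {0<..<1}" using e by simp
  have coord: "z i = echar Z (fst (w (- int i))) (comp_br w (- int i) i s)" for i
  proof (induction i)
    case 0
    then show ?case using e(4) w0 by simp
  next
    case (Suc i)
    obtain t where t: "t \<in> {lo (A i)<..<hi (A i)}" "z (Suc i) = echar Z (fst (A i)) t"
      using A(2)[of i] unfolding open_arc_eq by blast
    then obtain s' where s': "s' \<in> {0<..<1}" "t = br (A i) s'" using branch_open(1)[OF A(1)] by blast
    have "h (z (Suc i)) = echar Z (tgt (A i)) s'" using branch(6)[OF A(1), of s'] s' t(2) by simp
    then have eq: "echar Z (tgt (A i)) s' = echar Z (tgt (A i)) (comp_br w (- int i) i s)"
      using Suc tr[of i] zh[of i] by simp
    have "comp_br w (- int i) i s \<in> {0<..<1}" by (rule comp_br_mem_open[OF adm s])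
    then have "s' = comp_br w (- int i) i s"
      using edge_eq(2)[OF branch(1)[OF A(1)] branch(1)[OF A(1)] _ _ _ _ eq] s'(1) by simp
    moreover have "- int (Suc i) + 1 = - int i" by simp
    ultimately show ?case using t(2) s'(2) wS[of i] by simp
  qed
  show ?thesis
    by (rule that[OF s]) (use e w0 adm coord in auto)
qed

end

section \<open>Surjectivity and injectivity of \<open>rho_bar\<close>\<close>

locale new_presentation_markov = new_presentation_data X f n \<O> N L h
  for X :: "('a, 'e, 'm) digraph_scheme" and f n \<O> N L h +
  fixes \<A> :: "'a pathclass subinterval set"
  assumes mpart: "markov_partition (new_graph \<O> L) h \<A>"
begin

sublocale M: markov_system "new_graph \<O> L" h \<A>
  by (rule markov_system[OF mpart])

abbreviation Xbar :: "(nat \<Rightarrow> 'a) topology" where "Xbar \<equiv> invlim (gtop X) f"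

lemma rho_bar_in:
  assumes z: "z \<in> topspace M.Zbar"
  shows "rho_bar z \<in> topspace Xbar"
proof -
  have "z i \<in> pts N.Z" "h (z (Suc i)) = z i" for i using invlim_D[OF z] by blast+
  then show ?thesis
    unfolding topspace_invlim rho_bar_def using rho_h[symmetric] N.rho_in N.pts_new_graph by simp
qed

lemma rho_bar_cont: "continuous_map M.Zbar Xbar rho_bar"
proof (rule continuous_map_into_invlim[OF _ rho_bar_in])
  fix i
  show "continuous_map M.Zbar (gtop X) (\<lambda>z. rho_bar z i)"
    unfolding rho_bar_def using continuous_map_compose[OF continuous_map_invlim_coord N.rho_cont] unfolding o_def .
qed

lemma rho_bar_comm:
  assumes z: "z \<in> topspace M.Zbar"
  shows "rho_bar (invlim_map h z) = invlim_map f (rho_bar z)"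
proof
  fix i
  show "rho_bar (invlim_map h z) i = invlim_map f (rho_bar z) i"
    using rho_h[OF invlim_D(1)[OF z, of 0]] unfolding rho_bar_def invlim_map_def by (cases i) simp_all
qed

text \<open>Surjectivity of \<open>rho\<close> lifts single coordinates, and these lifts need not be
  compatible. Compactness of the product selects a compatible sequence.\<close>

lemma rho_bar_onto:
  assumes x: "x \<in> topspace Xbar"
  shows "x \<in> rho_bar ` topspace M.Zbar"
proof -
  let ?P = "product_topology (\<lambda>_::nat. gtop N.Z) UNIV"
  have coord: "continuous_map ?P (gtop N.Z) (\<lambda>z. z i)" for i
    by (rule continuous_map_product_projection) simp
  have topP: "z \<in> topspace ?P \<longleftrightarrow> (\<forall>i. z i \<in> pts N.Z)" for z by (simp add: PiE_UNIV_domain Pi_iff)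
  \<comment> \<open>Only the projection at \<open>m\<close> is prescribed. Compatibility below
    \<open>m\<close> then determines the earlier projections, which is why the sets
    decrease.\<close>
  define C where "C m = {z \<in> topspace ?P. (\<forall>i<m. h (z (Suc i)) = z i) \<and> rho (z m) = x m}" for m
  have xp: "x i \<in> pts X" "f (x (Suc i)) = x i" for i using invlim_D[OF x] by blast+
  have "\<Inter>(range C) \<noteq> {}"
  proof (rule compact_space_imp_nest)
    show "compact_space ?P" using M.compact_graph by (simp add: compact_space_product_topology)
    show "closedin ?P (C m)" for m
    proof -
      have "closedin ?P {z \<in> topspace ?P. rho (z m) \<in> {x m}}"
      proof (rule closedin_continuous_map_preimage)
        show "continuous_map ?P (gtop X) (\<lambda>z. rho (z m))"
          using continuous_map_compose[OF coord N.rho_cont, of m] unfolding o_def .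
        show "closedin (gtop X) {x m}" by (rule closedin_finite) (use xp(1) in simp_all)
      qed
      moreover have cl: "closedin ?P {z \<in> topspace ?P. h (z (Suc i)) = z i}" for i
        using continuous_map_compose[OF coord h_cont, of "Suc i"] unfolding o_def
        by (rule closedin_continuous_maps_eq[OF M.Hausdorff _ coord])
      then have "closedin ?P (topspace ?P \<inter> (\<Inter>i\<in>{..<m}. {z \<in> topspace ?P. h (z (Suc i)) = z i}))"
      proof (cases "m = 0")
        case False
        then have "closedin ?P (\<Inter>((\<lambda>i. {z \<in> topspace ?P. h (z (Suc i)) = z i}) ` {..<m}))"
          by (intro closedin_Inter) (use cl in auto)
        then show ?thesis by (intro closedin_Int closedin_topspace)
      next
        case True
        then show ?thesis using closedin_topspace[of ?P] by simp
      qed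
      ultimately have "closedin ?P ((topspace ?P \<inter> (\<Inter>i\<in>{..<m}. {z \<in> topspace ?P. h (z (Suc i)) = z i})) \<inter>
        {z \<in> topspace ?P. rho (z m) \<in> {x m}})" by (rule closedin_Int[rotated])
      moreover have "(topspace ?P \<inter> (\<Inter>i\<in>{..<m}. {z \<in> topspace ?P. h (z (Suc i)) = z i})) \<inter>
        {z \<in> topspace ?P. rho (z m) \<in> {x m}} = C m" unfolding C_def by auto
      ultimately show ?thesis by simp
    qed
    show "C m \<noteq> {}" for m
    proof -
      have "x m \<in> rho ` pts N.Z" unfolding rho_onto by (rule xp(1))
      then obtain y where y: "y \<in> pts N.Z" "x m = rho y" by blast
      \<comment> \<open>The coordinates beyond \<open>m\<close> are unconstrained in
        \<open>C m\<close>, so any point may stand there.\<close>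
      define z where "z i = (if i \<le> m then (h ^^ (m - i)) y else y)" for i
      have "z \<in> topspace ?P" unfolding topP z_def using y(1) h_funpow_pts by simp
      moreover have "h (z (Suc i)) = z i" if "i < m" for i
      proof -
        have "m - i = Suc (m - Suc i)" using that by simp
        then show ?thesis unfolding z_def using that by simp
      qed
      moreover have "rho (z m) = x m" unfolding z_def using y(2) by simp
      ultimately have "z \<in> C m" unfolding C_def by blast
      then show ?thesis by blast
    qed
    show "decseq C"
    proof (rule decseq_SucI, rule subsetI)
      fix m z assume z: "z \<in> C (Suc m)"
      then have zp: "z (Suc m) \<in> pts N.Z" unfolding C_def topP by blast
      have "rho (z m) = rho (h (z (Suc m)))" using z unfolding C_def by simp
      also have "\<dots> = x m" using rho_h[OF zp] z xp(2)[of m] unfolding C_def by simp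
      finally show "z \<in> C m" using z unfolding C_def by simp
    qed
  qed
  then obtain z where z: "\<And>m. z \<in> C m" by blast
  have "z i \<in> pts N.Z" for i using z[of 0] unfolding C_def topP by blast
  moreover have "h (z (Suc i)) = z i" for i using z[of "Suc i"] unfolding C_def by blast
  moreover have "rho (z i) = x i" for i using z[of i] unfolding C_def by blast
  ultimately have "z \<in> topspace M.Zbar" "rho_bar z = x" unfolding topspace_invlim rho_bar_def by auto
  then show ?thesis by blast
qed

text \<open>A Lebesgue number on the compact set of parameter pairs at which two edge paths meet. It
  provides a single flattening neighbourhood for short pieces of both paths.\<close>

lemma common_neighborhood:
  assumes \<U>: "\<forall>x\<in>pts X. \<exists>U. openin (gtop X) U \<and> x \<in> U \<and> P U"
  shows "\<exists>\<delta>>0. \<forall>l\<in>L. \<forall>l'\<in>L. \<forall>t\<in>{0..1}. \<forall>t'\<in>{0..1}. prep l t = prep l' t' \<longrightarrow>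
    (\<exists>U. P U \<and> (\<forall>r\<in>{0..1}. \<bar>r - t\<bar> < \<delta> \<longrightarrow> prep l r \<in> U) \<and> (\<forall>r\<in>{0..1}. \<bar>r - t'\<bar> < \<delta> \<longrightarrow> prep l' r \<in> U))"
proof -
  let ?Q = "\<lambda>p \<delta>. \<forall>t\<in>{0..1}. \<forall>t'\<in>{0..1}. prep (fst p) t = prep (snd p) t' \<longrightarrow>
    (\<exists>U. P U \<and> (\<forall>r\<in>{0..1}. \<bar>r - t\<bar> < \<delta> \<longrightarrow> prep (fst p) r \<in> U) \<and> (\<forall>r\<in>{0..1}. \<bar>r - t'\<bar> < \<delta> \<longrightarrow> prep (snd p) r \<in> U))"
  have one: "\<exists>\<delta>>0. ?Q p \<delta>" if p: "p \<in> L \<times> L" for p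
  proof -
    obtain l l' where ll: "p = (l, l')" "l \<in> L" "l' \<in> L" using p by blast
    let ?sq = "{0..1} \<times> {0..1} :: (real \<times> real) set"
    \<comment> \<open>Clamping the parameters to the unit interval makes the edge paths continuous
      on the whole plane, so that ordinary open sets and balls can be used.\<close>
    define cl where "cl r = max 0 (min 1 r)" for r :: real
    have cl_id: "cl r = r" if "r \<in> {0..1}" for r using that unfolding cl_def by auto
    have cl_cont: "continuous_map euclidean (top_of_set {0..1}) (\<lambda>q::real \<times> real. cl (pr q))"
      if "continuous_on UNIV pr" for pr
      unfolding continuous_map_in_subtopology cl_def using that by (auto intro!: continuous_intros)
    note pl = N.L_prep(1)[OF ll(2)] and pl' = N.L_prep(1)[OF ll(3)]
    have c1: "continuous_map euclidean (gtop X) (\<lambda>q::real \<times> real. prep l (cl (fst q)))"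
      using continuous_map_compose[OF cl_cont[OF continuous_on_fst[OF continuous_on_id]] pl] unfolding o_def .
    have c2: "continuous_map euclidean (gtop X) (\<lambda>q::real \<times> real. prep l' (cl (snd q)))"
      using continuous_map_compose[OF cl_cont[OF continuous_on_snd[OF continuous_on_id]] pl'] unfolding o_def .
    have "closedin euclidean {q \<in> topspace euclidean. prep l (cl (fst q)) = prep l' (cl (snd q))}"
      by (rule closedin_continuous_maps_eq[OF Hausdorff c1 c2])
    then have "closed {q::real \<times> real. prep l (cl (fst q)) = prep l' (cl (snd q))}" by simp
    then have S: "compact (?sq \<inter> {q. prep l (cl (fst q)) = prep l' (cl (snd q))})"
      by (intro compact_Int_closed compact_Times) auto
    let ?G = "\<lambda>U. {q::real \<times> real. prep l (cl (fst q)) \<in> U \<and> prep l' (cl (snd q)) \<in> U}"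
    let ?\<G> = "?G ` {U. openin (gtop X) U \<and> P U}"
    have opn: "open G" if G: "G \<in> ?\<G>" for G
    proof -
      obtain U where U: "openin (gtop X) U" "G = ?G U" using G by blast
      have "open {q::real \<times> real. prep l (cl (fst q)) \<in> U}" "open {q::real \<times> real. prep l' (cl (snd q)) \<in> U}"
        using openin_continuous_map_preimage[OF c1 U(1)] openin_continuous_map_preimage[OF c2 U(1)] by simp_all
      then have "open ({q::real \<times> real. prep l (cl (fst q)) \<in> U} \<inter> {q. prep l' (cl (snd q)) \<in> U})" by (rule open_Int)
      then show ?thesis unfolding U(2) by (simp add: Collect_conj_eq)
    qed
    have cov: "?sq \<inter> {q. prep l (cl (fst q)) = prep l' (cl (snd q))} \<subseteq> \<Union>?\<G>"
    proof
      fix q assume q: "q \<in> ?sq \<inter> {q. prep l (cl (fst q)) = prep l' (cl (snd q))}"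
      have "cl (fst q) \<in> {0..1}" unfolding cl_def by auto
      then have "prep l (cl (fst q)) \<in> pts X" using pl unfolding continuous_map_def by auto
      then obtain U where "openin (gtop X) U" "prep l (cl (fst q)) \<in> U" "P U" using \<U> by blast
      then show "q \<in> \<Union>?\<G>" using q by auto
    qed
    have "\<exists>\<epsilon>>0. \<forall>q\<in>?sq \<inter> {q. prep l (cl (fst q)) = prep l' (cl (snd q))}. \<exists>G\<in>?\<G>. ball q \<epsilon> \<subseteq> G"
    proof (rule Heine_Borel_lemma[OF S cov opn])
      fix \<epsilon> :: real
      assume e: "0 < \<epsilon>" "\<And>q. q \<in> ?sq \<inter> {q. prep l (cl (fst q)) = prep l' (cl (snd q))} \<Longrightarrow> \<exists>G\<in>?\<G>. ball q \<epsilon> \<subseteq> G"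
      show ?thesis
      proof (intro exI[of _ \<epsilon>] conjI ballI e(1))
        fix q assume "q \<in> ?sq \<inter> {q. prep l (cl (fst q)) = prep l' (cl (snd q))}"
        then show "\<exists>G\<in>?\<G>. ball q \<epsilon> \<subseteq> G" by (rule e(2))
      qed
    qed
    then obtain \<epsilon> where \<epsilon>: "0 < \<epsilon>"
      "\<forall>q\<in>?sq \<inter> {q. prep l (cl (fst q)) = prep l' (cl (snd q))}. \<exists>G\<in>?\<G>. ball q \<epsilon> \<subseteq> G"
      by (elim exE conjE)
    have "?Q p \<epsilon>"
    proof (intro ballI impI)
      fix t t' :: real assume t: "t \<in> {0..1}" "t' \<in> {0..1}" and eq: "prep (fst p) t = prep (snd p) t'"
      then have "(t, t') \<in> ?sq \<inter> {q. prep l (cl (fst q)) = prep l' (cl (snd q))}" using ll(1) cl_id by simp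
      from bspec[OF \<epsilon>(2) this] obtain U where U: "P U" "ball (t, t') \<epsilon> \<subseteq> ?G U" by blast
      have "prep l r \<in> U" if "r \<in> {0..1}" "\<bar>r - t\<bar> < \<epsilon>" for r
      proof -
        have "(r, t') \<in> ball (t, t') \<epsilon>" using that(2) by (simp add: dist_Pair_Pair dist_real_def abs_minus_commute)
        then have "prep l (cl r) \<in> U" using U(2) by auto
        then show ?thesis using cl_id[OF that(1)] by simp
      qed
      moreover have "prep l' r \<in> U" if "r \<in> {0..1}" "\<bar>r - t'\<bar> < \<epsilon>" for r
      proof -
        have "(t, r) \<in> ball (t, t') \<epsilon>" using that(2) by (simp add: dist_Pair_Pair dist_real_def abs_minus_commute)
        then have "prep l' (cl r) \<in> U" using U(2) by auto
        then show ?thesis using cl_id[OF that(1)] by simp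
      qed
      ultimately show "\<exists>U. P U \<and> (\<forall>r\<in>{0..1}. \<bar>r - t\<bar> < \<epsilon> \<longrightarrow> prep (fst p) r \<in> U) \<and>
        (\<forall>r\<in>{0..1}. \<bar>r - t'\<bar> < \<epsilon> \<longrightarrow> prep (snd p) r \<in> U)" using U(1) ll(1) by (intro exI[of _ U]) simp
    qed
    then show ?thesis using \<epsilon>(1) by blast
  qed
  have "\<exists>\<delta>>0. \<forall>p\<in>L \<times> L. ?Q p \<delta>"
  proof (rule uniform_radius[OF _ one])
    show "finite (L \<times> L)" using L_facts(1) by blast
    fix p d d' assume Q: "?Q p d" and d': "d' \<le> (d::real)"
    show "?Q p d'"
    proof (intro ballI impI)
      fix t t' :: real assume t: "t \<in> {0..1}" "t' \<in> {0..1}" "prep (fst p) t = prep (snd p) t'"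
      obtain U where U: "P U" "\<forall>r\<in>{0..1}. \<bar>r - t\<bar> < d \<longrightarrow> prep (fst p) r \<in> U"
        "\<forall>r\<in>{0..1}. \<bar>r - t'\<bar> < d \<longrightarrow> prep (snd p) r \<in> U"
        using Q[rule_format, OF t] by (elim exE conjE)
      have "\<forall>r\<in>{0..1}. \<bar>r - t\<bar> < d' \<longrightarrow> prep (fst p) r \<in> U" "\<forall>r\<in>{0..1}. \<bar>r - t'\<bar> < d' \<longrightarrow> prep (snd p) r \<in> U"
        using U(2,3) d' by simp_all
      then show "\<exists>U. P U \<and> (\<forall>r\<in>{0..1}. \<bar>r - t\<bar> < d' \<longrightarrow> prep (fst p) r \<in> U) \<and>
        (\<forall>r\<in>{0..1}. \<bar>r - t'\<bar> < d' \<longrightarrow> prep (snd p) r \<in> U)" using U(1) by blast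
    qed
  qed
  then obtain \<delta> where \<delta>: "\<delta> > 0" "\<forall>p\<in>L \<times> L. ?Q p \<delta>" by (elim exE conjE)
  show ?thesis
  proof (intro exI[of _ \<delta>] conjI \<delta>(1) ballI)
    fix l l' and t t' :: real assume "l \<in> L" "l' \<in> L" "t \<in> {0..1}" "t' \<in> {0..1}"
    then show "prep l t = prep l' t' \<longrightarrow> (\<exists>U. P U \<and> (\<forall>r\<in>{0..1}. \<bar>r - t\<bar> < \<delta> \<longrightarrow> prep l r \<in> U) \<and>
      (\<forall>r\<in>{0..1}. \<bar>r - t'\<bar> < \<delta> \<longrightarrow> prep l' r \<in> U))"
      using bspec[OF \<delta>(2), of "(l, l')"] by simp
  qed
qed

text \<open>After \<open>k\<close> steps the short piece lies in a set homeomorphic to a real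
  interval. There it is an edge path reparametrized by an inverse branch, hence locally injective,
  and a locally injective real function on an interval is injective. The edge path itself may cross
  itself in the graph; the further \<open>i - k\<close> steps recover it.\<close>

lemma flattened_lift:
  fixes \<epsilon> :: real
  assumes adm: "M.adm w (- int i) i" and edge: "fst (w 0) \<in> L" and k: "1 \<le> k" "k < i"
    and U: "\<And>s. s \<in> {0..1} \<Longrightarrow> prep (fst (w (- int i))) (M.comp_br w (- int i) i s) \<in> U"
    and \<theta>: "homeomorphic_map (subtopology (gtop X) ((f ^^ k) ` U)) (top_of_set {-\<epsilon><..<\<epsilon>}) \<theta>"
  obtains A where "\<And>s. s \<in> {0..1} \<Longrightarrow> A s = (f ^^ k) (prep (fst (w (- int i))) (M.comp_br w (- int i) i s))"
    "\<And>s. s \<in> {0..1} \<Longrightarrow> A s \<in> topspace (subtopology (gtop X) ((f ^^ k) ` U))"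
    "continuous_on {0..1} (\<lambda>s. \<theta> (A s))" "inj_on (\<lambda>s. \<theta> (A s)) {0..1}"
    "\<And>s. s \<in> {0..1} \<Longrightarrow> (f ^^ (i - k)) (A s) = prep (fst (w 0)) s"
proof -
  let ?T = "subtopology (gtop X) ((f ^^ k) ` U)"
  define A where "A s = (f ^^ k) (prep (fst (w (- int i))) (M.comp_br w (- int i) i s))" for s
  obtain i' where i': "i = Suc i'" using k by (cases i) auto
  have e_i: "fst (w (- int i)) \<in> L" using M.adm_edge[of w "- int i" i'] adm unfolding i' new_graph_simps by blast
  have iter: "(f ^^ m) (prep (fst (w (- int i))) (M.comp_br w (- int i) i s)) =
    prep (fst (w (- int i + int m))) (M.comp_br w (- int i + int m) (i - m) s)"
    if m: "m \<le> i" and s: "s \<in> {0..1}" for m s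
  proof -
    have im: "i = m + (i - m)" using m by simp
    have adm': "M.adm w (- int i) (m + (i - m))" using adm im by simp
    have c: "M.comp_br w (- int i) i s \<in> {0..1}" by (rule M.comp_br_mem[OF adm s])
    have c': "M.comp_br w (- int i + int m) (i - m) s \<in> {0..1}" by (rule M.comp_br_mem[OF M.adm_drop[OF adm'] s])
    have z: "edge_point (fst (w (- int i))) (M.comp_br w (- int i) i s) \<in> pts N.Z"
      unfolding N.pts_new_graph by (rule N.edge_point_all[OF e_i])
    have H: "(h ^^ m) (edge_point (fst (w (- int i))) (M.comp_br w (- int i) i s)) =
      edge_point (fst (w (- int i + int m))) (M.comp_br w (- int i + int m) (i - m) s)"
      using M.funpow_comp_br[OF adm' s] im unfolding new_graph_simps by simp
    have "(f ^^ m) (prep (fst (w (- int i))) (M.comp_br w (- int i) i s)) =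
      (f ^^ m) (rho (edge_point (fst (w (- int i))) (M.comp_br w (- int i) i s)))"
      unfolding rho_edge_point[OF c] ..
    also have "\<dots> = rho ((h ^^ m) (edge_point (fst (w (- int i))) (M.comp_br w (- int i) i s)))"
      by (rule rho_funpow[OF z, symmetric])
    also have "\<dots> = rho (edge_point (fst (w (- int i + int m))) (M.comp_br w (- int i + int m) (i - m) s))"
      unfolding H ..
    also have "\<dots> = prep (fst (w (- int i + int m))) (M.comp_br w (- int i + int m) (i - m) s)"
      by (rule rho_edge_point[OF c'])
    finally show ?thesis .
  qed
  have A_in: "A s \<in> topspace ?T" if s: "s \<in> {0..1}" for s
  proof -
    have "prep (fst (w (- int i))) (M.comp_br w (- int i) i s) \<in> pts X"
      using N.L_prep(1)[OF e_i] M.comp_br_mem[OF adm s] unfolding continuous_map_def by auto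
    then show ?thesis unfolding A_def using U[OF s] funpow_pts by simp
  qed
  have cb: "continuous_map (top_of_set {0..1}) (top_of_set {0..1}) (M.comp_br w j m)" if "M.adm w j m" for j m
  proof -
    have "M.comp_br w j m \<in> topspace (top_of_set {0..1}) \<rightarrow> {0..1}" using M.comp_br_mem[OF that] by simp
    moreover have "continuous_map (top_of_set {0..1}) euclideanreal (M.comp_br w j m)"
      using M.comp_br_cont[OF that] by (simp only: continuous_map_iff_continuous)
    ultimately show ?thesis unfolding continuous_map_in_subtopology by blast
  qed
  have "continuous_map (top_of_set {0..1}) (gtop X) A"
    unfolding A_def using continuous_map_compose[OF continuous_map_compose[OF cb[OF adm] N.L_prep(1)[OF e_i]] funpow_cont, of k]
    unfolding o_def .
  then have "continuous_map (top_of_set {0..1}) ?T A"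
    unfolding continuous_map_in_subtopology using A_in by auto
  from continuous_map_compose[OF this homeomorphic_imp_continuous_map[OF \<theta>]]
  have "continuous_map (top_of_set {0..1}) (top_of_set {-\<epsilon><..<\<epsilon>}) (\<lambda>s. \<theta> (A s))" unfolding o_def .
  then have cont: "continuous_on {0..1} (\<lambda>s. \<theta> (A s))"
    unfolding continuous_map_in_subtopology by (simp only: continuous_map_iff_continuous)
  have ki: "k \<le> i" using k by simp
  have adm_k: "M.adm w (- int i + int k) (i - k)"
    by (rule M.adm_drop) (use adm ki in simp)
  have e_k: "fst (w (- int i + int k)) \<in> L"
  proof -
    obtain q where "i - k = Suc q" using k by (cases "i - k") auto
    then show ?thesis using M.adm_edge[of w "- int i + int k" q] adm_k unfolding new_graph_simps by simp
  qed
  have locA: "locally_one_to_one (top_of_set {0..1}) A"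
  proof (rule locally_one_to_one_compose_inj[OF N.L_prep(2)[OF e_k] M.comp_br_cont[OF adm_k] _ M.comp_br_inj[OF adm_k]])
    show "M.comp_br w (- int i + int k) (i - k) ` {0..1} \<subseteq> {0..1}" using M.comp_br_mem[OF adm_k] by blast
    show "A s = prep (fst (w (- int i + int k))) (M.comp_br w (- int i + int k) (i - k) s)" if "s \<in> {0..1}" for s
      unfolding A_def by (rule iter[OF ki that])
  qed
  have locu: "locally_one_to_one (top_of_set {0..1}) (\<lambda>s. \<theta> (A s))"
    unfolding locally_one_to_one_def
  proof
    fix x assume "x \<in> topspace (top_of_set {0..1::real})"
    then obtain V where V: "openin (top_of_set {0..1}) V" "x \<in> V" "inj_on A V"
      using locA unfolding locally_one_to_one_def by blast
    have sub: "V \<subseteq> {0..1}" using V(1) openin_imp_subset by blast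
    have "inj_on (\<lambda>s. \<theta> (A s)) V"
    proof (rule inj_onI)
      fix p q assume pq: "p \<in> V" "q \<in> V" "\<theta> (A p) = \<theta> (A q)"
      then have "A p = A q"
        using inj_onD[OF homeomorphic_imp_injective_map[OF \<theta>]] A_in sub by blast
      then show "p = q" using inj_onD[OF V(3)] pq by blast
    qed
    then show "\<exists>V. openin (top_of_set {0..1}) V \<and> x \<in> V \<and> inj_on (\<lambda>s. \<theta> (A s)) V" using V by blast
  qed
  have inj: "inj_on (\<lambda>s. \<theta> (A s)) {0..1}"
    by (rule locally_injective_imp_injective[OF is_interval_cc cont locu])
  have "(f ^^ (i - k)) (A s) = prep (fst (w 0)) s" if s: "s \<in> {0..1}" for s
  proof -
    have "(f ^^ (i - k)) (A s) = (f ^^ i) (prep (fst (w (- int i))) (M.comp_br w (- int i) i s))"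
      unfolding A_def using ki by (metis funpow_add le_add_diff_inverse2 o_apply)
    also have "\<dots> = prep (fst (w 0)) s" using iter[OF order_refl s] by simp
    finally show ?thesis .
  qed
  then show ?thesis using that[of A] A_in cont inj unfolding A_def by blast
qed

text \<open>
  Long backward branches through \<open>z i\<close> and \<open>z' i\<close> project into one flattening neighbourhood, so
  their images lie in a common arc.  The preimages of \<open>\<O>\<close> cut the same piece out of this arc,
  whence the edges containing \<open>z 0\<close> and \<open>z' 0\<close> project to the same path.
\<close>

lemma rho_bar_inj_0:
  assumes z: "z \<in> topspace M.Zbar" and z': "z' \<in> topspace M.Zbar" and eq: "rho_bar z = rho_bar z'"
  shows "z 0 = z' 0"
proof -
  have zp: "z 0 \<in> pts N.Z" "z' 0 \<in> pts N.Z" using invlim_D(1)[OF z] invlim_D(1)[OF z'] by blast+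
  have rho_eq: "rho (z i) = rho (z' i)" for i using fun_cong[OF eq, of i] unfolding rho_bar_def .
  have vv: "z 0 \<in> Vtx ` \<O> \<longleftrightarrow> z' 0 \<in> Vtx ` \<O>"
    using N.rho_vertex_iff[OF zp(1)] N.rho_vertex_iff[OF zp(2)] rho_eq[of 0] by simp
  show ?thesis
  proof (cases "z 0 \<in> Vtx ` \<O>")
    case True
    then have "z' 0 \<in> Vtx ` \<O>" using vv by blast
    then show ?thesis using True rho_eq[of 0] by auto
  next
    case False
    then have z0: "z 0 \<notin> verts N.Z" "z' 0 \<notin> verts N.Z" using vv unfolding new_graph_simps by blast+
    obtain w s0 where w: "s0 \<in> {0<..<1}" "z 0 = echar N.Z (fst (w 0)) s0" "fst (w 0) \<in> edges N.Z"
      "\<forall>i. M.adm w (- int i) i" "\<forall>i. z i = echar N.Z (fst (w (- int i))) (M.comp_br w (- int i) i s0)"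
      by (rule M.backward_word[OF z z0(1)])
    obtain w' t0 where w': "t0 \<in> {0<..<1}" "z' 0 = echar N.Z (fst (w' 0)) t0" "fst (w' 0) \<in> edges N.Z"
      "\<forall>i. M.adm w' (- int i) i" "\<forall>i. z' i = echar N.Z (fst (w' (- int i))) (M.comp_br w' (- int i) i t0)"
      by (rule M.backward_word[OF z' z0(2)])
    have s01: "s0 \<in> {0..1}" "t0 \<in> {0..1}" using w(1) w'(1) by auto
    obtain k where k: "1 \<le> k" "\<forall>x\<in>pts X. \<exists>U. openin (gtop X) U \<and> x \<in> U \<and> (\<exists>\<epsilon>>0. subtopology (gtop X) ((f ^^ k) ` U)
           homeomorphic_space top_of_set {-\<epsilon><..<\<epsilon>::real})"
      using flat unfolding flattening_def by (elim exE conjE)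
    define P where "P U \<longleftrightarrow> (\<exists>\<epsilon>>0. subtopology (gtop X) ((f ^^ k) ` U) homeomorphic_space top_of_set {-\<epsilon><..<\<epsilon>::real})" for U
    have "\<forall>x\<in>pts X. \<exists>U. openin (gtop X) U \<and> x \<in> U \<and> P U"
      unfolding P_def by (rule k(2))
    from common_neighborhood[where P = P, OF this] obtain \<delta> where \<delta>: "\<delta> > 0"
      "\<forall>l\<in>L. \<forall>l'\<in>L. \<forall>t\<in>{0..1}. \<forall>t'\<in>{0..1}. prep l t = prep l' t' \<longrightarrow>
        (\<exists>U. P U \<and> (\<forall>r\<in>{0..1}. \<bar>r - t\<bar> < \<delta> \<longrightarrow> prep l r \<in> U) \<and> (\<forall>r\<in>{0..1}. \<bar>r - t'\<bar> < \<delta> \<longrightarrow> prep l' r \<in> U))"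
      by (elim exE conjE)
    obtain M where M: "\<forall>w i n x y. M \<le> n \<longrightarrow> M.adm w i n \<longrightarrow> x \<in> M.comp_br w i n ` {0..1} \<longrightarrow>
      y \<in> M.comp_br w i n ` {0..1} \<longrightarrow> y - x < \<delta>" using M.uniform_shrink[OF \<delta>(1)] by (elim exE)
    \<comment> \<open>Order at least \<open>M\<close> makes the branches shorter than
      \<open>\<delta>\<close>; order above \<open>k\<close> leaves a branch to work with after the
      flattening steps.\<close>
    define i where "i = M + k + 1"
    have i: "M \<le> i" "k < i" unfolding i_def by simp_all
    let ?l = "fst (w (- int i))" and ?l' = "fst (w' (- int i))"
    let ?T = "M.comp_br w (- int i) i" and ?T' = "M.comp_br w' (- int i) i"
    have adm: "M.adm w (- int i) i" and adm': "M.adm w' (- int i) i" using w(4) w'(4) by blast+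
    have "\<exists>j. i = Suc j" unfolding i_def by simp
    then have lL: "?l \<in> L" "?l' \<in> L"
      using M.adm_edge[of w "- int i"] M.adm_edge[of w' "- int i"] adm adm' unfolding new_graph_simps by auto
    have T01: "?T s0 \<in> {0..1}" "?T' t0 \<in> {0..1}" using M.comp_br_mem[OF adm s01(1)] M.comp_br_mem[OF adm' s01(2)] .
    have "prep ?l (?T s0) = rho (z i)"
      unfolding spec[OF w(5), of i] new_graph_simps rho_edge_point[OF T01(1)] ..
    also have "\<dots> = prep ?l' (?T' t0)"
      unfolding rho_eq spec[OF w'(5), of i] new_graph_simps rho_edge_point[OF T01(2)] ..
    finally have "prep ?l (?T s0) = prep ?l' (?T' t0)" .
    from \<delta>(2)[rule_format, OF lL T01 this] obtain U where U: "P U"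
      "\<forall>r\<in>{0..1}. \<bar>r - ?T s0\<bar> < \<delta> \<longrightarrow> prep ?l r \<in> U" "\<forall>r\<in>{0..1}. \<bar>r - ?T' t0\<bar> < \<delta> \<longrightarrow> prep ?l' r \<in> U"
      by (elim exE conjE)
    have small: "\<bar>M.comp_br v (- int i) i s - M.comp_br v (- int i) i t\<bar> < \<delta>"
      if v: "M.adm v (- int i) i" and st: "s \<in> {0..1}" "t \<in> {0..1}" for v s t
      using M[rule_format, OF i(1) v imageI[OF st(1)] imageI[OF st(2)]]
        M[rule_format, OF i(1) v imageI[OF st(2)] imageI[OF st(1)]] by linarith
    have TU: "prep ?l (?T s) \<in> U" if "s \<in> {0..1}" for s
      using U(2) M.comp_br_mem[OF adm that] small[OF adm that s01(1)] by blast
    have TU': "prep ?l' (?T' s) \<in> U" if "s \<in> {0..1}" for s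
      using U(3) M.comp_br_mem[OF adm' that] small[OF adm' that s01(2)] by blast
    obtain \<epsilon> \<theta> where \<theta>: "homeomorphic_map (subtopology (gtop X) ((f ^^ k) ` U)) (top_of_set {-\<epsilon><..<\<epsilon>::real}) \<theta>"
      using U(1) unfolding P_def homeomorphic_space by blast
    let ?S = "topspace (subtopology (gtop X) ((f ^^ k) ` U))"
    have w0L: "fst (w 0) \<in> L" "fst (w' 0) \<in> L" using w(3) w'(3) unfolding new_graph_simps .
    obtain A where A: "\<And>s. s \<in> {0..1} \<Longrightarrow> A s = (f ^^ k) (prep ?l (?T s))" "\<And>s. s \<in> {0..1} \<Longrightarrow> A s \<in> ?S"
      "continuous_on {0..1} (\<lambda>s. \<theta> (A s))" "inj_on (\<lambda>s. \<theta> (A s)) {0..1}"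
      "\<And>s. s \<in> {0..1} \<Longrightarrow> (f ^^ (i - k)) (A s) = prep (fst (w 0)) s"
      using flattened_lift[OF adm w0L(1) k(1) i(2) TU \<theta>] by blast
    obtain A' where A': "\<And>s. s \<in> {0..1} \<Longrightarrow> A' s = (f ^^ k) (prep ?l' (?T' s))" "\<And>s. s \<in> {0..1} \<Longrightarrow> A' s \<in> ?S"
      "continuous_on {0..1} (\<lambda>s. \<theta> (A' s))" "inj_on (\<lambda>s. \<theta> (A' s)) {0..1}"
      "\<And>s. s \<in> {0..1} \<Longrightarrow> (f ^^ (i - k)) (A' s) = prep (fst (w' 0)) s"
      using flattened_lift[OF adm' w0L(2) k(1) i(2) TU' \<theta>] by blast
    let ?u = "\<lambda>s. \<theta> (A s)" and ?v = "\<lambda>s. \<theta> (A' s)"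
    have link: "prep (fst (w 0)) s = prep (fst (w' 0)) t" if "s \<in> {0..1}" "t \<in> {0..1}" "?u s = ?v t" for s t
    proof -
      have "A s = A' t"
        by (rule inj_onD[OF homeomorphic_imp_injective_map[OF \<theta>] that(3) A(2)[OF that(1)] A'(2)[OF that(2)]])
      then show ?thesis using A(5)[OF that(1)] A'(5)[OF that(2)] by simp
    qed
    have "A s0 = A' t0" using A(1)[OF s01(1)] A'(1)[OF s01(2)] \<open>prep ?l (?T s0) = prep ?l' (?T' t0)\<close> by simp
    then have u0: "?u s0 = ?v t0" by simp
    obtain c d where cd: "?u ` {0..1} = {c..d}" using continuous_image_closed_interval[OF zero_le_one A(3)] by blast
    obtain c' d' where cd': "?v ` {0..1} = {c'..d'}" using continuous_image_closed_interval[OF zero_le_one A'(3)] by blast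
    note ends = injective_interval_image[OF zero_less_one A(3,4) cd]
    note ends' = injective_interval_image[OF zero_less_one A'(3,4) cd']
    note Lw = N.L_prep(4-6)[OF w0L(1)] and Lw' = N.L_prep(4-6)[OF w0L(2)]
    \<comment> \<open>An end of one arc strictly inside the other would put a point of
      \<open>\<O>\<close> into the interior of an edge path.\<close>
    have no1: "r \<notin> {c', d'}" if r: "r \<in> {c<..<d}" for r
    proof
      assume "r \<in> {c', d'}"
      then obtain t where t: "t \<in> {0,1}" "r = ?v t" unfolding ends'(1)[symmetric] by blast
      obtain s where s: "s \<in> {0<..<1}" "r = ?u s" using r unfolding ends(2)[symmetric] by blast
      have "prep (fst (w 0)) s = prep (fst (w' 0)) t" using s t by (intro link) auto
      then show False using Lw(3)[of s] Lw' s(1) t(1) by auto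
    qed
    have no2: "r \<notin> {c, d}" if r: "r \<in> {c'<..<d'}" for r
    proof
      assume "r \<in> {c, d}"
      then obtain s where s: "s \<in> {0,1}" "r = ?u s" unfolding ends(1)[symmetric] by blast
      obtain t where t: "t \<in> {0<..<1}" "r = ?v t" using r unfolding ends'(2)[symmetric] by blast
      have "prep (fst (w 0)) s = prep (fst (w' 0)) t" using s t by (intro link) auto
      then show False using Lw'(3)[of t] Lw t(1) s(1) by auto
    qed
    have r0: "?u s0 \<in> {c<..<d}" "?u s0 \<in> {c'<..<d'}"
    proof -
      show "?u s0 \<in> {c<..<d}" unfolding ends(2)[symmetric] by (rule imageI[OF w(1)])
      show "?u s0 \<in> {c'<..<d'}" unfolding u0 ends'(2)[symmetric] by (rule imageI[OF w'(1)])
    qed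
    have "\<not> c < c'" "\<not> d' < d" "\<not> c' < c" "\<not> d < d'"
      using no1[of c'] no1[of d'] no2[of c] no2[of d] r0 by auto
    then have "c = c'" "d = d'" by linarith+
    then have same: "?u ` {0..1} = ?v ` {0..1}" using cd cd' by simp
    \<comment> \<open>The change of parameter between the two edge paths, read through the common
      real arc.\<close>
    define \<xi> where "\<xi> s = inv_into {0..1} ?v (?u s)" for s
    have \<xi>: "\<xi> s \<in> {0..1}" "?v (\<xi> s) = ?u s" if "s \<in> {0..1}" for s
    proof -
      have "?u s \<in> ?v ` {0..1}" unfolding same[symmetric] using that by blast
      then show "\<xi> s \<in> {0..1}" "?v (\<xi> s) = ?u s"
        unfolding \<xi>_def using inv_into_into[of "?u s" ?v] f_inv_into_f[of "?u s" ?v] by blast+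
    qed
    have "continuous_on (?v ` {0..1}) (inv_into {0..1} ?v)"
    proof (rule continuous_on_inv[OF A'(3)])
      show "\<forall>t\<in>{0..1}. inv_into {0..1} ?v (?v t) = t" by (intro ballI inv_into_f_f[OF A'(4)])
    qed simp
    then have \<xi>_cont: "continuous_on {0..1} \<xi>"
      unfolding \<xi>_def by (rule continuous_on_compose2[OF _ A(3)]) (simp add: same)
    have \<xi>_inj: "inj_on \<xi> {0..1}"
    proof (rule inj_onI)
      fix p q :: real assume pq: "p \<in> {0..1}" "q \<in> {0..1}" "\<xi> p = \<xi> q"
      then have "?u p = ?u q" using \<xi>(2)[OF pq(1)] \<xi>(2)[OF pq(2)] by simp
      then show "p = q" using inj_onD[OF A(4)] pq by blast
    qed
    have \<xi>_v: "\<xi> s = t" if "s \<in> {0..1}" "t \<in> {0..1}" "?u s = ?v t" for s t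
      by (rule inj_onD[OF A'(4) _ \<xi>(1)[OF that(1)] that(2)]) (use \<xi>(2)[OF that(1)] that(3) in simp)
    have \<xi>_onto: "\<xi> ` {0..1} = {0..1}"
    proof
      show "\<xi> ` {0..1} \<subseteq> {0..1}" using \<xi>(1) by blast
      show "{0..1} \<subseteq> \<xi> ` {0..1}"
      proof
        fix t :: real assume t: "t \<in> {0..1}"
        then have "?v t \<in> ?u ` {0..1}" unfolding same by (rule imageI)
        then obtain s where "s \<in> {0..1}" "?v t = ?u s" by (rule imageE)
        then show "t \<in> \<xi> ` {0..1}" using \<xi>_v[of s t] t by (intro image_eqI[of _ _ s]) simp_all
      qed
    qed
    have param: "prep (fst (w 0)) s = prep (fst (w' 0)) (\<xi> s)" if "s \<in> {0..1}" for s
      by (rule link[OF that \<xi>(1)[OF that]]) (use \<xi>(2)[OF that] in simp)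
    have "pclass (prep (fst (w 0))) \<in> {pclass (prep (fst (w' 0))), prev (pclass (prep (fst (w' 0))))}"
      by (rule pclass_eq_up_to_direction[OF \<xi>_cont \<xi>_inj \<xi>_onto]) (rule param)
    then have ll: "fst (w 0) = fst (w' 0)"
      unfolding N.L_prep(3)[OF w0L(1)] N.L_prep(3)[OF w0L(2)] by (rule L_facts(3)[OF w0L])
    \<comment> \<open>The path now coincides with its own reparametrization by \<open>\<xi>\<close>;
      rigidity excludes a nontrivial \<open>\<xi>\<close>, so the two points also have the same
      parameter.\<close>
    have "\<xi> s0 = s0"
      by (rule locally_injective_rigid[OF N.L_prep(2)[OF w0L(1)] \<xi>_cont _ _ s01(1)])
        (use \<xi>_onto param ll in simp_all)
    then have "s0 = t0" using \<xi>_v[OF s01 u0] by simp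
    then show ?thesis using w(2) w'(2) ll by simp
  qed
qed

lemma rho_bar_inj: "inj_on rho_bar (topspace M.Zbar)"
proof (rule inj_onI, rule ext)
  fix z z' i assume z: "z \<in> topspace M.Zbar" "z' \<in> topspace M.Zbar" and eq: "rho_bar z = rho_bar z'"
  have "rho_bar (\<lambda>k. z (i + k)) = rho_bar (\<lambda>k. z' (i + k))"
  proof
    fix k
    show "rho_bar (\<lambda>k. z (i + k)) k = rho_bar (\<lambda>k. z' (i + k)) k"
      using fun_cong[OF eq, of "i + k"] unfolding rho_bar_def .
  qed
  from rho_bar_inj_0[OF invlim_drop[OF z(1)] invlim_drop[OF z(2)] this]
  show "z i = z' i" by simp
qed

lemma rho_bar_homeomorphic: "homeomorphic_map M.Zbar Xbar rho_bar"
proof (rule continuous_imp_homeomorphic_map)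
  show "continuous_map M.Zbar Xbar rho_bar" by (rule rho_bar_cont)
  show "compact_space M.Zbar" by (rule compact_invlim[OF M.compact_graph M.Hausdorff h_cont])
  show "Hausdorff_space Xbar" by (rule Hausdorff_invlim[OF Hausdorff])
  show "rho_bar ` topspace M.Zbar = topspace Xbar" using rho_bar_in rho_bar_onto by blast
  show "inj_on rho_bar (topspace M.Zbar)" by (rule rho_bar_inj)
qed

end

section \<open>Conjugate systems and periodic orbits\<close>

lemma periodic_orbits_finite:
  assumes A: "finite_union_of_periodic_orbits T s A"
  shows "finite A" "\<And>x. x \<in> A \<Longrightarrow> s x \<in> A" "s ` topspace T \<subseteq> topspace T \<Longrightarrow> A \<subseteq> topspace T"
proof -
  obtain B where B: "finite B" "B \<subseteq> topspace T" "\<forall>x\<in>B. \<exists>n>0. (s ^^ n) x = x"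
    "A = (\<Union>x\<in>B. range (\<lambda>n. (s ^^ n) x))"
    using A unfolding finite_union_of_periodic_orbits_def by (elim exE conjE)
  have "finite (range (\<lambda>n. (s ^^ n) x))" if x: "x \<in> B" for x
  proof -
    obtain p where p: "p > 0" "(s ^^ p) x = x" using bspec[OF B(3) x] by (elim exE conjE)
    have "range (\<lambda>n. (s ^^ n) x) \<subseteq> (\<lambda>n. (s ^^ n) x) ` {..<p}"
    proof
      fix y assume "y \<in> range (\<lambda>n. (s ^^ n) x)"
      then obtain n where "y = (s ^^ n) x" by blast
      then have "y = (s ^^ (n mod p)) x" using funpow_mod_eq[OF p(2)] by simp
      then show "y \<in> (\<lambda>n. (s ^^ n) x) ` {..<p}" using p(1) by auto
    qed
    then show ?thesis by (rule finite_subset) simp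
  qed
  then show "finite A" unfolding B(4) using B(1) by (intro finite_UN_I) simp_all
  show "s x \<in> A" if x: "x \<in> A" for x
  proof -
    obtain y n where y: "y \<in> B" "x = (s ^^ n) y" using x unfolding B(4) by (elim UN_E rangeE)
    then have "s x = (s ^^ Suc n) y" by simp
    then have "s x \<in> range (\<lambda>n. (s ^^ n) y)" by (rule range_eqI)
    then show ?thesis unfolding B(4) by (rule UN_I[OF y(1)])
  qed
  show "A \<subseteq> topspace T" if sub: "s ` topspace T \<subseteq> topspace T"
  proof
    fix x assume "x \<in> A"
    then obtain y n where y: "y \<in> B" "x = (s ^^ n) y" unfolding B(4) by (elim UN_E rangeE)
    have "(s ^^ n) y \<in> topspace T" using y(1) B(2) sub by (induction n) auto
    then show "x \<in> topspace T" using y(2) by simp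
  qed
qed

text \<open>The instance of \<open>\<Theta>\<close> in \<open>markov_pair\<close>: the periodic
  orbits seen in the inverse limit of the new graph.\<close>

definition orbit_lifts ::
  "(nat \<Rightarrow> 'a) set \<Rightarrow> 'a pathclass set \<Rightarrow> (('a, 'a pathclass) gpoint \<Rightarrow> ('a, 'a pathclass) gpoint)
     \<Rightarrow> (nat \<Rightarrow> ('a, 'a pathclass) gpoint) set" where
  "orbit_lifts \<O>bar L h = {z \<in> topspace (invlim (gtop (new_graph (proj0 ` \<O>bar) L)) h). rho_bar z \<in> \<O>bar}"

locale orbit_presentation = new_presentation_markov X f n "proj0 ` \<O>bar" N L h \<A>
  for X :: "('a, 'e) digraph" and f n and \<O>bar :: "(nat \<Rightarrow> 'a) set" and N L h \<A> +
  assumes \<O>bar_sub: "\<O>bar \<subseteq> topspace Xbar" and \<O>bar_fin: "finite \<O>bar"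
    and \<O>bar_inv: "\<And>x. x \<in> \<O>bar \<Longrightarrow> invlim_map f x \<in> \<O>bar"
begin

abbreviation "lifts \<equiv> orbit_lifts \<O>bar L h"

lemma orbit_lifts:
  shows "lifts \<subseteq> topspace M.Zbar" "rho_bar ` lifts = \<O>bar" "finite lifts"
    "\<And>z. z \<in> lifts \<Longrightarrow> z 0 \<in> verts N.Z" "\<And>z. z \<in> lifts \<Longrightarrow> invlim_map h z \<in> lifts"
    "verts N.Z \<subseteq> (\<lambda>z. z 0) ` lifts"
proof -
  show sub: "lifts \<subseteq> topspace M.Zbar" unfolding orbit_lifts_def by blast
  show img: "rho_bar ` lifts = \<O>bar"
    unfolding orbit_lifts_def using rho_bar_onto \<O>bar_sub by blast
  show "finite lifts"
    by (rule finite_imageD[OF _ inj_on_subset[OF rho_bar_inj sub]]) (simp add: img \<O>bar_fin)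
  show v: "z 0 \<in> verts N.Z" if z: "z \<in> lifts" for z
  proof -
    have "rho (z 0) = proj0 (rho_bar z)" unfolding proj0_def rho_bar_def ..
    then have "rho (z 0) \<in> proj0 ` \<O>bar" using z unfolding orbit_lifts_def by blast
    then show ?thesis
      using N.rho_vertex_iff[OF invlim_D(1)[of z]] z unfolding orbit_lifts_def new_graph_simps by blast
  qed
  show "invlim_map h z \<in> lifts" if z: "z \<in> lifts" for z
    using z M.invlim_map_closed rho_bar_comm \<O>bar_inv unfolding orbit_lifts_def by auto
  show "verts N.Z \<subseteq> (\<lambda>z. z 0) ` lifts"
  proof
    fix y assume "y \<in> verts N.Z"
    \<comment> \<open>Every vertex comes from the zeroth coordinate of a point of
      \<open>\<O>bar\<close>, and the lift of that point starts over the same point of the graph,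
      hence at this vertex.\<close>
    then obtain x where x: "x \<in> \<O>bar" "y = Vtx (proj0 x)" unfolding new_graph_simps by blast
    then obtain z where z: "z \<in> lifts" "x = rho_bar z" using img by blast
    have "z 0 \<in> verts N.Z" by (rule v[OF z(1)])
    then obtain a where a: "z 0 = Vtx a" unfolding new_graph_simps by blast
    have "proj0 x = a" unfolding z(2) proj0_def rho_bar_def a by simp
    then show "y \<in> (\<lambda>z. z 0) ` lifts" using x(2) a z(1) by (intro image_eqI[of _ _ z]) simp_all
  qed
qed

end

lemma lifted_markov_pair:
  assumes P: "orbit_presentation X f n \<O>bar N L h \<A>" and Q: "orbit_presentation Y g m \<O>bar' N' L' h' \<B>"
    and \<phi>: "homeomorphic_map (invlim (gtop X) f) (invlim (gtop Y) g) \<phi>"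
    and comm: "\<And>x. x \<in> topspace (invlim (gtop X) f) \<Longrightarrow> \<phi> (invlim_map f x) = invlim_map g (\<phi> x)"
    and img: "\<O>bar' = \<phi> ` \<O>bar"
    and R: "homeomorphic_maps (invlim (gtop (new_graph (proj0 ` \<O>bar') L')) h') (invlim (gtop Y) g) rho_bar R"
  shows "markov_pair (new_graph (proj0 ` \<O>bar) L) h \<A> (new_graph (proj0 ` \<O>bar') L') h' \<B> (\<lambda>z. R (\<phi> (rho_bar z)))
    (orbit_lifts \<O>bar L h) (orbit_lifts \<O>bar' L' h')"
proof -
  interpret P: orbit_presentation X f n \<O>bar N L h \<A> by (rule P)
  interpret Q: orbit_presentation Y g m \<O>bar' N' L' h' \<B> by (rule Q)
  have Rrho: "R (rho_bar z) = z" if "z \<in> topspace Q.M.Zbar" for z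
    using R that unfolding homeomorphic_maps_def by blast
  have rhoR: "rho_bar (R y) = y" and R_in: "R y \<in> topspace Q.M.Zbar" if "y \<in> topspace Q.Xbar" for y
    using R that unfolding homeomorphic_maps_def continuous_map_def by auto
  have \<phi>_in: "\<phi> x \<in> topspace Q.Xbar" if "x \<in> topspace P.Xbar" for x
    using homeomorphic_imp_surjective_map[OF \<phi>] that by blast
  have "homeomorphic_map Q.Xbar Q.M.Zbar R" using R homeomorphic_maps_map by blast
  from homeomorphic_map_compose[OF homeomorphic_map_compose[OF P.rho_bar_homeomorphic \<phi>] this]
  have homeo: "homeomorphic_map P.M.Zbar Q.M.Zbar (\<lambda>z. R (\<phi> (rho_bar z)))" unfolding o_def .
  have com: "R (\<phi> (rho_bar (invlim_map h z))) = invlim_map h' (R (\<phi> (rho_bar z)))" if z: "z \<in> topspace P.M.Zbar" for z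
  proof -
    let ?y = "\<phi> (rho_bar z)"
    have y: "?y \<in> topspace Q.Xbar" by (intro \<phi>_in P.rho_bar_in z)
    have "R (\<phi> (rho_bar (invlim_map h z))) = R (invlim_map g ?y)"
      unfolding P.rho_bar_comm[OF z] comm[OF P.rho_bar_in[OF z]] ..
    also have "invlim_map g ?y = invlim_map g (rho_bar (R ?y))" unfolding rhoR[OF y] ..
    also have "\<dots> = rho_bar (invlim_map h' (R ?y))" by (rule Q.rho_bar_comm[OF R_in[OF y], symmetric])
    also have "R \<dots> = invlim_map h' (R ?y)" by (rule Rrho[OF Q.M.invlim_map_closed[OF R_in[OF y]]])
    finally show ?thesis .
  qed
  have lifts: "(\<lambda>z. R (\<phi> (rho_bar z))) ` P.lifts = Q.lifts"
  proof -
    have "(\<lambda>z. R (\<phi> (rho_bar z))) ` P.lifts = R ` \<phi> ` rho_bar ` P.lifts" by (simp add: image_image)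
    also have "\<dots> = R ` \<O>bar'" unfolding P.orbit_lifts(2) img ..
    also have "\<dots> = R ` rho_bar ` Q.lifts" unfolding Q.orbit_lifts(2) ..
    also have "\<dots> = Q.lifts" using Rrho Q.orbit_lifts(1) by (force simp: image_image)
    finally show ?thesis .
  qed
  show ?thesis
  proof unfold_locales
    show "homeomorphic_map P.M.Zbar Q.M.Zbar (\<lambda>z. R (\<phi> (rho_bar z)))" by (rule homeo)
    show "R (\<phi> (rho_bar (invlim_map h z))) = invlim_map h' (R (\<phi> (rho_bar z)))" if "z \<in> topspace P.M.Zbar" for z
      by (rule com[OF that])
    show "P.lifts \<subseteq> topspace P.M.Zbar" by (rule P.orbit_lifts(1))
    show "z 0 \<in> verts P.N.Z" if "z \<in> P.lifts" for z by (rule P.orbit_lifts(4)[OF that])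
    show "(\<lambda>z. R (\<phi> (rho_bar z))) ` P.lifts = Q.lifts" by (rule lifts)
    show "finite Q.lifts" by (rule Q.orbit_lifts(3))
    show "invlim_map h' z \<in> Q.lifts" if "z \<in> Q.lifts" for z by (rule Q.orbit_lifts(5)[OF that])
    show "verts Q.N.Z \<subseteq> (\<lambda>z. z 0) ` Q.lifts" by (rule Q.orbit_lifts(6))
  qed
qed

theorem conjugate_orbit_presentations:
  assumes P: "orbit_presentation X f n \<O>bar N L h \<A>" and Q: "orbit_presentation Y g m \<O>bar' N' L' h' \<B>"
    and conj: "conjugacy (invlim (gtop X) f) (invlim_map f) (invlim (gtop Y) g) (invlim_map g) \<phi>"
    and img: "\<O>bar' = \<phi> ` \<O>bar" and XO: "XO = new_graph (proj0 ` \<O>bar) L" and YO: "YO = new_graph (proj0 ` \<O>bar') L'"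
  shows "\<exists>\<psi>. (conjugacy (sft XO h \<A>) shift (sft YO h' \<B>) shift \<psi> \<and>
              (\<forall>w\<in>topspace (sft XO h \<A>).
                 \<phi> (rho_bar (cover_map XO h w)) = rho_bar (cover_map YO h' (\<psi> w)))) \<and>
             (\<forall>\<psi>'. conjugacy (sft XO h \<A>) shift (sft YO h' \<B>) shift \<psi>' \<and>
                (\<forall>w\<in>topspace (sft XO h \<A>).
                   \<phi> (rho_bar (cover_map XO h w)) = rho_bar (cover_map YO h' (\<psi>' w))) \<longrightarrow>
                (\<forall>w\<in>topspace (sft XO h \<A>). \<psi>' w = \<psi> w))"
proof -
  interpret P: orbit_presentation X f n \<O>bar N L h \<A> by (rule P)
  interpret Q: orbit_presentation Y g m \<O>bar' N' L' h' \<B> by (rule Q)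
  obtain \<phi>i where \<phi>: "homeomorphic_maps P.Xbar Q.Xbar \<phi> \<phi>i"
    using conj unfolding conjugacy_def homeomorphic_map_maps by blast
  have hm: "homeomorphic_map P.Xbar Q.Xbar \<phi>" "homeomorphic_map Q.Xbar P.Xbar \<phi>i"
    using \<phi> homeomorphic_maps_map by blast+
  have inv1: "\<phi>i (\<phi> x) = x" if "x \<in> topspace P.Xbar" for x using \<phi> that unfolding homeomorphic_maps_def by blast
  have inv2: "\<phi> (\<phi>i y) = y" and \<phi>i_in: "\<phi>i y \<in> topspace P.Xbar" if "y \<in> topspace Q.Xbar" for y
    using \<phi> that unfolding homeomorphic_maps_def continuous_map_def by auto
  have \<phi>_in: "\<phi> x \<in> topspace Q.Xbar" if "x \<in> topspace P.Xbar" for x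
    using homeomorphic_imp_surjective_map[OF hm(1)] that by blast
  have comm: "\<phi> (invlim_map f x) = invlim_map g (\<phi> x)" if "x \<in> topspace P.Xbar" for x
    using conj that unfolding conjugacy_def by blast
  have fX: "f ` pts X \<subseteq> pts X" using continuous_map_image_subset_topspace[OF P.f_cont] .
  have comm_i: "\<phi>i (invlim_map g y) = invlim_map f (\<phi>i y)" if y: "y \<in> topspace Q.Xbar" for y
  proof -
    have "\<phi> (invlim_map f (\<phi>i y)) = invlim_map g y" unfolding comm[OF \<phi>i_in[OF y]] inv2[OF y] ..
    then show ?thesis using inv1[OF invlim_map_in[OF fX \<phi>i_in[OF y]]] by simp
  qed
  have img_i: "\<O>bar = \<phi>i ` \<O>bar'"
    unfolding img image_image using inv1 P.\<O>bar_sub by force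
  obtain R where R: "homeomorphic_maps P.M.Zbar P.Xbar rho_bar R"
    using P.rho_bar_homeomorphic unfolding homeomorphic_map_maps by blast
  obtain R' where R': "homeomorphic_maps Q.M.Zbar Q.Xbar rho_bar R'"
    using Q.rho_bar_homeomorphic unfolding homeomorphic_map_maps by blast
  define \<Phi> where "\<Phi> = (\<lambda>z. R' (\<phi> (rho_bar z)))"
  define \<Psi> where "\<Psi> = (\<lambda>z. R (\<phi>i (rho_bar z)))"
  have pair: "markov_pair XO h \<A> YO h' \<B> \<Phi> P.lifts Q.lifts"
    unfolding \<Phi>_def XO YO by (rule lifted_markov_pair[OF P Q hm(1) comm img R'])
  have pair': "markov_pair YO h' \<B> XO h \<A> \<Psi> Q.lifts P.lifts"
    unfolding \<Psi>_def XO YO by (rule lifted_markov_pair[OF Q P hm(2) comm_i img_i R])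
  have "homeomorphic_maps Q.Xbar Q.M.Zbar R' rho_bar" by (rule homeomorphic_maps_sym[THEN iffD1, OF R'])
  from homeomorphic_maps_compose[OF conjI[OF homeomorphic_maps_compose[OF conjI[OF R \<phi>]] this]]
  have maps: "homeomorphic_maps (invlim (gtop XO) h) (invlim (gtop YO) h') \<Phi> \<Psi>"
    unfolding \<Phi>_def \<Psi>_def XO YO o_def .
  have rhoR': "rho_bar (R' y) = y" if "y \<in> topspace Q.Xbar" for y
    using R' that unfolding homeomorphic_maps_def by blast
  have R'rho: "R' (rho_bar z) = z" if "z \<in> topspace Q.M.Zbar" for z
    using R' that unfolding homeomorphic_maps_def by blast
  \<comment> \<open>Since \<open>rho_bar\<close> is bijective, the equation upstairs for
    \<open>\<Phi>\<close> and the one downstairs for \<open>\<phi>\<close> are equivalent; existence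
    and uniqueness both transfer.\<close>
  have equiv: "\<Phi> (cover_map XO h w) = cover_map YO h' u \<longleftrightarrow>
      \<phi> (rho_bar (cover_map XO h w)) = rho_bar (cover_map YO h' u)"
    if w: "w \<in> topspace (sft XO h \<A>)" and u: "u \<in> topspace (sft YO h' \<B>)" for w u
  proof -
    have z: "cover_map XO h w \<in> topspace P.M.Zbar"
      using P.M.pt_in P.M.cover_map_eq_pt w unfolding XO by simp
    have z': "cover_map YO h' u \<in> topspace Q.M.Zbar"
      using Q.M.pt_in Q.M.cover_map_eq_pt u unfolding YO by simp
    have "\<phi> (rho_bar (cover_map XO h w)) \<in> topspace Q.Xbar" by (intro \<phi>_in P.rho_bar_in z)
    from rhoR'[OF this] R'rho[OF z'] show ?thesis unfolding \<Phi>_def by metis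
  qed
  have conj_in: "\<psi> w \<in> topspace (sft YO h' \<B>)"
    if "conjugacy (sft XO h \<A>) shift (sft YO h' \<B>) shift \<psi>" "w \<in> topspace (sft XO h \<A>)" for \<psi> w
    using that homeomorphic_imp_surjective_map unfolding conjugacy_def by blast
  have equiv': "(\<forall>w\<in>topspace (sft XO h \<A>). \<Phi> (cover_map XO h w) = cover_map YO h' (\<psi> w)) \<longleftrightarrow>
      (\<forall>w\<in>topspace (sft XO h \<A>). \<phi> (rho_bar (cover_map XO h w)) = rho_bar (cover_map YO h' (\<psi> w)))"
    if "conjugacy (sft XO h \<A>) shift (sft YO h' \<B>) shift \<psi>" for \<psi>
    using equiv[OF _ conj_in[OF that]] by simp
  obtain \<psi> where \<psi>: "conjugacy (sft XO h \<A>) shift (sft YO h' \<B>) shift \<psi>"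
    "\<forall>w\<in>topspace (sft XO h \<A>). \<Phi> (cover_map XO h w) = cover_map YO h' (\<psi> w)"
    "\<forall>\<psi>'. conjugacy (sft XO h \<A>) shift (sft YO h' \<B>) shift \<psi>' \<and>
      (\<forall>w\<in>topspace (sft XO h \<A>). \<Phi> (cover_map XO h w) = cover_map YO h' (\<psi>' w)) \<longrightarrow>
      (\<forall>w\<in>topspace (sft XO h \<A>). \<psi>' w = \<psi> w)"
    using markov_pair_conjugacy[OF pair pair' maps] by (elim exE conjE)
  show ?thesis
  proof (intro exI[of _ \<psi>] conjI allI impI)
    show "conjugacy (sft XO h \<A>) shift (sft YO h' \<B>) shift \<psi>" by (rule \<psi>(1))
    show "\<forall>w\<in>topspace (sft XO h \<A>). \<phi> (rho_bar (cover_map XO h w)) = rho_bar (cover_map YO h' (\<psi> w))"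
      using \<psi>(2) unfolding equiv'[OF \<psi>(1)] .
    fix \<psi>'
    assume a: "conjugacy (sft XO h \<A>) shift (sft YO h' \<B>) shift \<psi>' \<and>
      (\<forall>w\<in>topspace (sft XO h \<A>). \<phi> (rho_bar (cover_map XO h w)) = rho_bar (cover_map YO h' (\<psi>' w)))"
    then have "\<forall>w\<in>topspace (sft XO h \<A>). \<Phi> (cover_map XO h w) = cover_map YO h' (\<psi>' w)"
      using equiv'[OF conjunct1[OF a]] by blast
    then show "\<forall>w\<in>topspace (sft XO h \<A>). \<psi>' w = \<psi> w" using \<psi>(3) a by blast
  qed
qed

text \<open>The degenerate case of an empty union of periodic orbits, which is separated off because
  the covering arguments start from a point of \<open>\<O>\<close>.\<close>

lemma new_edge_paths_empty:
  assumes "new_edge_paths G f {} N L"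
  shows "L = {}"
proof -
  have none: "paths_between T {} = {}" for T :: "'a topology" unfolding paths_between_def by simp
  have "preimg (gtop G) f N {} = {}" unfolding preimg_def by simp
  then obtain Ior where Ior: "orientation_of {} Ior" "orientation_of (pimage (f ^^ N) ` Ior) L"
    using assms none unfolding new_edge_paths_def by auto
  have "Ior = {}" using Ior(1) unfolding orientation_of_def by simp
  then show ?thesis using Ior(2) unfolding orientation_of_def by simp
qed

lemma sft_empty:
  assumes "markov_partition (new_graph \<O> {}) h \<A>"
  shows "topspace (sft (new_graph \<O> {}) h \<A>) = {}"
proof -
  have "\<A> = {}" using assms unfolding markov_partition_def new_graph_simps by auto
  then show ?thesis unfolding sft_def by (auto simp: PiE_UNIV_domain)
qed

lemma orbit_presentation_exists:
  fixes X :: "('a, 'e) digraph"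
  assumes X: "graph_presentation X f"
    and orb: "finite_union_of_periodic_orbits (invlim (gtop X) f) (invlim_map f) \<O>bar" and ne: "\<O>bar \<noteq> {}"
    and np: "admissible_level X f (proj0 ` \<O>bar) n N" "new_edge_paths X f (proj0 ` \<O>bar) N L"
      "induced_map f (proj0 ` \<O>bar) L h"
    and mp: "markov_partition (new_graph (proj0 ` \<O>bar) L) h \<A>"
  shows "orbit_presentation X f n \<O>bar N L h \<A>"
proof -
  have "continuous_map (gtop X) (gtop X) f" using X unfolding graph_presentation_def by (elim conjE)
  then have fX: "f ` pts X \<subseteq> pts X" by (rule continuous_map_image_subset_topspace)
  have closed: "invlim_map f ` topspace (invlim (gtop X) f) \<subseteq> topspace (invlim (gtop X) f)"
    using invlim_map_in[OF fX] by blast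
  note O = periodic_orbits_finite(1,2)[OF orb] periodic_orbits_finite(3)[OF orb closed]
  have fin: "finite (proj0 ` \<O>bar)" using O(1) by blast
  have sub: "proj0 ` \<O>bar \<subseteq> pts X" using O(3) invlim_D(1) unfolding proj0_def by blast
  have inv: "f ` proj0 ` \<O>bar \<subseteq> proj0 ` \<O>bar"
  proof
    fix y assume "y \<in> f ` proj0 ` \<O>bar"
    then obtain x where x: "x \<in> \<O>bar" "y = f (x 0)" unfolding proj0_def by blast
    have "y = proj0 (invlim_map f x)" unfolding x(2) proj0_def invlim_map_def by simp
    then show "y \<in> proj0 ` \<O>bar" using O(2)[OF x(1)] by blast
  qed
  note al = np(1)[unfolded admissible_level_def]
  have n: "n > 0" using al by (rule conjunct1)
  have cov: "\<forall>e\<in>edges X. pts X \<subseteq> (f ^^ n) ` edge_set X e" using al by (elim conjE)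
  have meets: "\<forall>e\<in>edges X. echar X e ` {0<..<1} \<inter> preimg (gtop X) f N (proj0 ` \<O>bar) \<noteq> {}" using al by (elim conjE)
  have "finite_digraph X" using X unfolding graph_presentation_def by (rule conjunct1)
  show ?thesis
  proof unfold_locales
    show "finite_digraph X" by fact
    show "graph_presentation X f" by (rule X)
    show "0 < n" by (rule n)
    show "pts X \<subseteq> (f ^^ n) ` edge_set X e" if "e \<in> edges X" for e using cov that by (rule bspec)
    show "finite (proj0 ` \<O>bar)" by (rule fin)
    show "proj0 ` \<O>bar \<subseteq> pts X" by (rule sub)
    show "f ` proj0 ` \<O>bar \<subseteq> proj0 ` \<O>bar" by (rule inv)
    show "proj0 ` \<O>bar \<noteq> {}" using ne by blast
    show "echar X e ` {0<..<1} \<inter> preimg (gtop X) f N (proj0 ` \<O>bar) \<noteq> {}" if "e \<in> edges X" for e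
      using meets that by (rule bspec)
    show "new_edge_paths X f (proj0 ` \<O>bar) N L" by (rule np(2))
    show "induced_map f (proj0 ` \<O>bar) L h" by (rule np(3))
    show "markov_partition (new_graph (proj0 ` \<O>bar) L) h \<A>" by (rule mp)
    show "\<O>bar \<subseteq> topspace (invlim (gtop X) f)" by (rule O(3))
    show "finite \<O>bar" by (rule O(1))
    show "invlim_map f x \<in> \<O>bar" if "x \<in> \<O>bar" for x by (rule O(2)[OF that])
  qed
qed

lemma periodic_orbits_image:
  assumes conj: "conjugacy S s T t \<phi>" and orb: "finite_union_of_periodic_orbits S s A"
    and sub: "s ` topspace S \<subseteq> topspace S"
  shows "finite_union_of_periodic_orbits T t (\<phi> ` A)"
proof -
  obtain B where B: "finite B" "B \<subseteq> topspace S" "\<forall>x\<in>B. \<exists>n>0. (s ^^ n) x = x"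
    "A = (\<Union>x\<in>B. range (\<lambda>n. (s ^^ n) x))"
    using orb unfolding finite_union_of_periodic_orbits_def by (elim exE conjE)
  have \<phi>: "homeomorphic_map S T \<phi>" and comm: "\<forall>x\<in>topspace S. \<phi> (s x) = t (\<phi> x)"
    using conj unfolding conjugacy_def by blast+
  have iter: "(s ^^ n) x \<in> topspace S \<and> \<phi> ((s ^^ n) x) = (t ^^ n) (\<phi> x)" if "x \<in> B" for x n
    using that B(2) sub comm by (induction n) auto
  have "\<phi> ` A = (\<Union>y\<in>\<phi> ` B. range (\<lambda>n. (t ^^ n) y))"
    unfolding B(4) image_UN image_image using iter by (intro SUP_cong) auto
  moreover have "\<forall>y\<in>\<phi> ` B. \<exists>n>0. (t ^^ n) y = y"
  proof (intro ballI)
    fix y assume "y \<in> \<phi> ` B"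
    then obtain x where x: "x \<in> B" "y = \<phi> x" by blast
    then obtain n where n: "n > 0" "(s ^^ n) x = x" using B(3) by blast
    have "(t ^^ n) y = y" using conjunct2[OF iter[OF x(1), of n]] unfolding n(2) x(2) by simp
    then show "\<exists>n>0. (t ^^ n) y = y" using n(1) by blast
  qed
  moreover have "\<phi> ` B \<subseteq> topspace T" using B(2) homeomorphic_imp_surjective_map[OF \<phi>] by blast
  ultimately show ?thesis unfolding finite_union_of_periodic_orbits_def using B(1) by blast
qed

theorem theorem5p2:
  fixes X :: "('a, 'e) digraph" and f :: "'a \<Rightarrow> 'a"
    and Y :: "('b, 'd) digraph" and g :: "'b \<Rightarrow> 'b"
    and \<phi> :: "(nat \<Rightarrow> 'a) \<Rightarrow> nat \<Rightarrow> 'b"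
    and \<O>bar :: "(nat \<Rightarrow> 'a) set" and \<O>bar' :: "(nat \<Rightarrow> 'b) set"
    and \<O> :: "'a set" and \<O>' :: "'b set"
    and XO :: "(('a, 'a pathclass) gpoint, 'a pathclass) digraph"
    and YO :: "(('b, 'b pathclass) gpoint, 'b pathclass) digraph"
    and fO :: "('a, 'a pathclass) gpoint \<Rightarrow> ('a, 'a pathclass) gpoint"
    and gO :: "('b, 'b pathclass) gpoint \<Rightarrow> ('b, 'b pathclass) gpoint"
    and \<A> :: "'a pathclass subinterval set" and \<A>' :: "'b pathclass subinterval set"
  assumes "graph_presentation X f" and "graph_presentation Y g"
    and "conjugacy (invlim (gtop X) f) (invlim_map f) (invlim (gtop Y) g) (invlim_map g) \<phi>"
    and "finite_union_of_periodic_orbits (invlim (gtop X) f) (invlim_map f) \<O>bar"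
    and "\<O>bar' = \<phi> ` \<O>bar"
    and "\<O> = proj0 ` \<O>bar" and "\<O>' = proj0 ` \<O>bar'"
    and "new_presentation X f \<O> XO fO" and "new_presentation Y g \<O>' YO gO"
    and "markov_partition XO fO \<A>" and "markov_partition YO gO \<A>'"
  shows "\<exists>\<psi>. (conjugacy (sft XO fO \<A>) shift (sft YO gO \<A>') shift \<psi> \<and>
              (\<forall>w\<in>topspace (sft XO fO \<A>).
                 \<phi> (rho_bar (cover_map XO fO w)) = rho_bar (cover_map YO gO (\<psi> w)))) \<and>
             (\<forall>\<psi>'. conjugacy (sft XO fO \<A>) shift (sft YO gO \<A>') shift \<psi>' \<and>
                (\<forall>w\<in>topspace (sft XO fO \<A>).
                   \<phi> (rho_bar (cover_map XO fO w)) = rho_bar (cover_map YO gO (\<psi>' w))) \<longrightarrow>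
                (\<forall>w\<in>topspace (sft XO fO \<A>). \<psi>' w = \<psi> w))"
proof -
  obtain n N L where P: "admissible_level X f \<O> n N" "new_edge_paths X f \<O> N L" "XO = new_graph \<O> L" "induced_map f \<O> L fO"
    using assms(8) unfolding new_presentation_def by (elim exE conjE)
  obtain m N' L' where Q: "admissible_level Y g \<O>' m N'" "new_edge_paths Y g \<O>' N' L'" "YO = new_graph \<O>' L'"
    "induced_map g \<O>' L' gO"
    using assms(9) unfolding new_presentation_def by (elim exE conjE)
  show ?thesis
  proof (cases "\<O>bar = {}")
    case True
    have e: "\<O> = {}" "\<O>' = {}" unfolding assms(5-7) True by simp_all
    have "L = {}" by (rule new_edge_paths_empty[OF P(2)[unfolded e]])
    then have XO: "topspace (sft XO fO \<A>) = {}" using sft_empty assms(10) unfolding P(3) by blast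
    have "L' = {}" by (rule new_edge_paths_empty[OF Q(2)[unfolded e]])
    then have YO: "topspace (sft YO gO \<A>') = {}" using sft_empty assms(11) unfolding Q(3) by blast
    \<comment> \<open>Both shift spaces are empty, so an arbitrary function is a conjugacy.\<close>
    have "conjugacy (sft XO fO \<A>) shift (sft YO gO \<A>') shift (\<lambda>_ _. undefined)"
      unfolding conjugacy_def homeomorphic_map_maps homeomorphic_maps_def continuous_map_def XO YO by simp
    then show ?thesis unfolding XO by (intro exI conjI) simp_all
  next
    case False
    have "continuous_map (gtop X) (gtop X) f" using assms(1) unfolding graph_presentation_def by (elim conjE)
    then have fX: "f ` pts X \<subseteq> pts X" by (rule continuous_map_image_subset_topspace)
    have "invlim_map f ` topspace (invlim (gtop X) f) \<subseteq> topspace (invlim (gtop X) f)"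
      by (rule image_subsetI) (rule invlim_map_in[OF fX])
    then have orb': "finite_union_of_periodic_orbits (invlim (gtop Y) g) (invlim_map g) \<O>bar'"
      unfolding assms(5) by (rule periodic_orbits_image[OF assms(3,4)])
    have ne': "\<O>bar' \<noteq> {}" unfolding assms(5) using False by simp
    have PP: "orbit_presentation X f n \<O>bar N L fO \<A>"
      by (rule orbit_presentation_exists[OF assms(1,4) False P(1,2,4)[unfolded assms(6)]])
        (rule assms(10)[unfolded P(3) assms(6)])
    have QQ: "orbit_presentation Y g m \<O>bar' N' L' gO \<A>'"
      by (rule orbit_presentation_exists[OF assms(2) orb' ne' Q(1,2,4)[unfolded assms(7)]])
        (rule assms(11)[unfolded Q(3) assms(7)])
    show ?thesis
      by (rule conjugate_orbit_presentations[OF PP QQ assms(3,5) P(3)[unfolded assms(6)] Q(3)[unfolded assms(7)]])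
  qed
qed

end
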